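(* Let $G$ be a locally compact abelian group, $\mathcal{H}$ a Hilbert space, $\pi:G\to\mathcal{U}(\mathcal{H})$ a strongly continuous unitary representation and $\mu\in\mathrm{M}(G)$. The following are equivalent: (i) $\Gamma_\pi(\mu)$ is positive. (ii) $\Gamma_\pi(\mu)$ is completely positive. (iii) The function $(\sigma,\tau)\mapsto\hat\mu(\sigma\tau^{-1})$ is positive definite on $E_\pi\times E_\pi$.
   Context: $\mathcal{U}(\mathcal{H})$ is the unitary group of $\mathcal{B}(\mathcal{H})$. $\mathrm{M}(G)$ is the space of bounded complex regular Borel measures on $G$. $\widehat{G}$ is the dual group of $G$. For $\mu\in\mathrm{M}(G)$ and $\sigma\in\widehat{G}$, $\hat\mu(\sigma)=\int_G\sigma(s)\,d\mu(s)$ (no conjugate or inverse), and $\hat f(\sigma)=\int_G f(s)\sigma(s)\,ds$ for $f\in\mathrm{L}^1(G)$. $\Gamma_\pi(\mu)$ is the normal completely bounded map on $\mathcal{B}(\mathcal{H})$ given by $\Gamma_\pi(\mu)x=\int_G\pi(s)x\pi(s)^*\,d\mu(s)$ (weak* convergent integral) for $x\in\mathcal{B}(\mathcal{H})$; positivity and complete positivity refer to this map. $\mathrm{C}^*_\pi$ is the norm closure in $\mathcal{B}(\mathcal{H})$ of $\{\pi_1(f)=\int_G f(s)\pi(s)\,ds:f\in\mathrm{L}^1(G)\}$. $E_\pi$ is the spectrum (character space) of the commutative C*-algebra $\mathrm{C}^*_\pi$, regarded as a closed subset of $\widehat{G}$: $\sigma\in E_\pi$ corresponds to the character of $\mathrm{C}^*_\pi$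 with $\pi_1(f)\mapsto\hat f(\sigma)$. A function $u:E\times E\to\mathbb{C}$ is positive definite if for every finite collection $x_1,\dots,x_n\in E$ the matrix $[u(x_i,x_j)]$ is of positive type (positive semidefinite). *)

theory Defs
  imports "HOL-Analysis.Analysis"
begin

section \<open>Complex Hilbert spaces and bounded operators\<close>

text \<open>The inner product is linear in the first argument and conjugate-linear in the second.\<close>

class complex_hilbert = banach +
  fixes scaleC :: "complex \<Rightarrow> 'a \<Rightarrow> 'a"  (infixr \<open>*\<^sub>C\<close> 75)
    and cinner :: "'a \<Rightarrow> 'a \<Rightarrow> complex"
  assumes scaleC_of_real: "of_real r *\<^sub>C x = r *\<^sub>R x"
    and scaleC_add_right: "c *\<^sub>C (x + y) = c *\<^sub>C x + c *\<^sub>C y"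
    and scaleC_add_left: "(c + d) *\<^sub>C x = c *\<^sub>C x + d *\<^sub>C x"
    and scaleC_scaleC: "c *\<^sub>C d *\<^sub>C x = (c * d) *\<^sub>C x"
    and cinner_add_left: "cinner (x + y) z = cinner x z + cinner y z"
    and cinner_scaleC_left: "cinner (c *\<^sub>C x) y = c * cinner x y"
    and cinner_commute: "cinner x y = cnj (cinner y x)"
    and cinner_self: "cinner x x = of_real ((norm x)\<^sup>2)"

lemma norm_scaleC: "norm (c *\<^sub>C x) = cmod c * norm (x :: 'h::complex_hilbert)"
proof -
  have "complex_of_real ((norm (c *\<^sub>C x))\<^sup>2) = c * cnj c * cinner x x"
    by (metis (no_types, lifting) cinner_self cinner_scaleC_left cinner_commute
        complex_cnj_mult mult.assoc)
  also have "\<dots> = complex_of_real ((cmod c * norm x)\<^sup>2)"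
    by (simp only: cinner_self flip: complex_norm_square)
       (simp add: power_mult_distrib)
  finally have "(norm (c *\<^sub>C x))\<^sup>2 = (cmod c * norm x)\<^sup>2"
    using of_real_eq_iff by blast
  then show ?thesis by simp
qed

lemma bounded_linear_scaleC: "bounded_linear (\<lambda>x :: 'h::complex_hilbert. c *\<^sub>C x)"
proof (rule bounded_linear_intro[where K = "cmod c"])
  show "c *\<^sub>C (r *\<^sub>R x) = r *\<^sub>R (c *\<^sub>C x)" for r and x :: 'h
    by (simp add: scaleC_scaleC mult.commute flip: scaleC_of_real)
qed (simp_all add: scaleC_add_right norm_scaleC mult.commute)

text \<open>The type \<^typ>\<open>'h \<Rightarrow>\<^sub>L 'h\<close> consists of the bounded real-linear operators with the operator
  norm; \<open>BH\<close> is the norm-closed subalgebra of the complex-linear ones.\<close>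

definition BH :: "('h::complex_hilbert \<Rightarrow>\<^sub>L 'h) set" where
  "BH = {T. \<forall>c x. blinfun_apply T (c *\<^sub>C x) = c *\<^sub>C blinfun_apply T x}"

lift_definition scaleC_op :: "complex \<Rightarrow> ('h::complex_hilbert \<Rightarrow>\<^sub>L 'h) \<Rightarrow> ('h \<Rightarrow>\<^sub>L 'h)"
  is "\<lambda>c T x. c *\<^sub>C T x"
  by (rule bounded_linear_compose[OF bounded_linear_scaleC])

definition is_adj :: "('h::complex_hilbert \<Rightarrow>\<^sub>L 'h) \<Rightarrow> ('h \<Rightarrow>\<^sub>L 'h) \<Rightarrow> bool" where
  "is_adj S T \<longleftrightarrow>
     (\<forall>x y. cinner (blinfun_apply T x) y = cinner x (blinfun_apply S y))"

definition op_adj :: "('h::complex_hilbert \<Rightarrow>\<^sub>L 'h) \<Rightarrow> ('h \<Rightarrow>\<^sub>L 'h)" where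
  "op_adj T = (THE S. S \<in> BH \<and> is_adj S T)"

definition unitary_op :: "('h::complex_hilbert \<Rightarrow>\<^sub>L 'h) \<Rightarrow> bool" where
  "unitary_op U \<longleftrightarrow> U \<in> BH \<and>
     (\<exists>V \<in> BH. is_adj V U \<and> V o\<^sub>L U = id_blinfun \<and> U o\<^sub>L V = id_blinfun)"

definition positive_op :: "('h::complex_hilbert \<Rightarrow>\<^sub>L 'h) \<Rightarrow> bool" where
  "positive_op T \<longleftrightarrow> T \<in> BH \<and> (\<forall>\<xi>. cinner (blinfun_apply T \<xi>) \<xi> \<in> \<real>\<^sub>\<ge>\<^sub>0)"

text \<open>The \<open>n \<times> n\<close> matrix \<open>(X i j)\<^bsub>i,j<n\<^esub>\<close> of operators, seen as an operator on the
  \<open>n\<close>-fold direct sum of the Hilbert space, is positive.\<close>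

definition positive_op_matrix :: "nat \<Rightarrow> (nat \<Rightarrow> nat \<Rightarrow> ('h::complex_hilbert \<Rightarrow>\<^sub>L 'h)) \<Rightarrow> bool" where
  "positive_op_matrix n X \<longleftrightarrow>
     (\<forall>i<n. \<forall>j<n. X i j \<in> BH) \<and>
     (\<forall>\<xi> :: nat \<Rightarrow> 'h. (\<Sum>i<n. \<Sum>j<n. cinner (blinfun_apply (X i j) (\<xi> j)) (\<xi> i)) \<in> \<real>\<^sub>\<ge>\<^sub>0)"

definition positive_map :: "(('h::complex_hilbert \<Rightarrow>\<^sub>L 'h) \<Rightarrow> ('h \<Rightarrow>\<^sub>L 'h)) \<Rightarrow> bool" where
  "positive_map \<Phi> \<longleftrightarrow> (\<forall>x. positive_op x \<longrightarrow> positive_op (\<Phi> x))"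

definition completely_positive_map ::
    "(('h::complex_hilbert \<Rightarrow>\<^sub>L 'h) \<Rightarrow> ('h \<Rightarrow>\<^sub>L 'h)) \<Rightarrow> bool" where
  "completely_positive_map \<Phi> \<longleftrightarrow>
     (\<forall>n X. positive_op_matrix n X \<longrightarrow> positive_op_matrix n (\<lambda>i j. \<Phi> (X i j)))"

text \<open>The normal (weak* continuous) functionals on \<open>B(H)\<close>, i.e. its predual: functionals
  \<open>T \<mapsto> \<Sum>\<^sub>n \<langle>T \<xi>\<^sub>n, \<eta>\<^sub>n\<rangle>\<close> with square-summable sequences of vectors.\<close>

definition normal_functionals :: "(('h::complex_hilbert \<Rightarrow>\<^sub>L 'h) \<Rightarrow> complex) set" where
  "normal_functionals =
     {(\<lambda>T. \<Sum>n. cinner (blinfun_apply T (\<xi> n)) (\<eta> n)) | \<xi> \<eta> :: nat \<Rightarrow> 'h.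
        summable (\<lambda>n. (norm (\<xi> n))\<^sup>2) \<and> summable (\<lambda>n. (norm (\<eta> n))\<^sup>2)}"

text \<open>Weak* convergent integral of an operator-valued function, with respect to the scalar
  integral \<open>I\<close>.\<close>

definition weak_star_integral ::
    "(('g \<Rightarrow> complex) \<Rightarrow> complex) \<Rightarrow> ('g \<Rightarrow> ('h::complex_hilbert \<Rightarrow>\<^sub>L 'h)) \<Rightarrow> ('h \<Rightarrow>\<^sub>L 'h)" where
  "weak_star_integral I F =
     (THE T. T \<in> BH \<and> (\<forall>\<omega> \<in> normal_functionals. \<omega> T = I (\<lambda>s. \<omega> (F s))))"


section \<open>Complex measures\<close>

text \<open>Complex Borel measures are represented as set functions; only their values on Borel sets
  are relevant.\<close>

definition total_variation :: "('g::topological_space set \<Rightarrow> complex) \<Rightarrow> 'g set \<Rightarrow> ennreal" where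
  "total_variation \<mu> A =
     (SUP P \<in> {P. finite P \<and> P \<subseteq> sets borel \<and> partition_on A P}. \<Sum>B\<in>P. ennreal (cmod (\<mu> B)))"

definition M_space :: "('g::topological_space set \<Rightarrow> complex) set" where
  "M_space = {\<mu>.
     (\<forall>A :: nat \<Rightarrow> 'g set. range A \<subseteq> sets borel \<and> disjoint_family A \<longrightarrow>
        (\<lambda>n. \<mu> (A n)) sums \<mu> (\<Union>n. A n)) \<and>
     total_variation \<mu> UNIV < \<infinity> \<and>
     (\<forall>A \<in> sets borel.
        total_variation \<mu> A = (INF U \<in> {U. open U \<and> A \<subseteq> U}. total_variation \<mu> U) \<and>
        total_variation \<mu> A = (SUP K \<in> {K. compact K \<and> K \<in> sets borel \<and> K \<subseteq> A}. total_variation \<mu> K))}"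

text \<open>The positive part \<open>\<nu>\<^sup>+(A) = sup {\<nu>(B) | B \<subseteq> A}\<close> of the Jordan decomposition of a
  real Borel measure; the negative part is that of \<open>-\<nu>\<close>.  Note that \<^const>\<open>ennreal\<close> maps
  negative numbers to \<open>0\<close>, the value contributed by \<open>B = {}\<close>.\<close>

definition jordan_pos :: "('g::topological_space set \<Rightarrow> real) \<Rightarrow> 'g measure" where
  "jordan_pos \<nu> = measure_of UNIV (sets borel)
     (\<lambda>A. SUP B \<in> {B \<in> sets borel. B \<subseteq> A}. ennreal (\<nu> B))"

definition cm_integral :: "('g::topological_space set \<Rightarrow> complex) \<Rightarrow> ('g \<Rightarrow> complex) \<Rightarrow> complex" where
  "cm_integral \<mu> f =
     ((\<integral>s. f s \<partial>jordan_pos (\<lambda>A. Re (\<mu> A))) - (\<integral>s. f s \<partial>jordan_pos (\<lambda>A. - Re (\<mu> A)))) +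
     \<i> * ((\<integral>s. f s \<partial>jordan_pos (\<lambda>A. Im (\<mu> A))) - (\<integral>s. f s \<partial>jordan_pos (\<lambda>A. - Im (\<mu> A))))"


section \<open>Abelian groups, duals and representations\<close>

text \<open>Abelian groups are written additively; their characters and representations take values in
  multiplicative groups.\<close>

definition haar_measure :: "'g::{topological_ab_group_add, t2_space} measure \<Rightarrow> bool" where
  "haar_measure m \<longleftrightarrow>
     sets m = sets borel \<and>
     emeasure m UNIV \<noteq> 0 \<and>
     (\<forall>s. \<forall>A \<in> sets borel. emeasure m ((\<lambda>t. s + t) ` A) = emeasure m A) \<and>
     (\<forall>K. compact K \<longrightarrow> emeasure m K < \<infinity>) \<and>
     (\<forall>A \<in> sets borel. emeasure m A = (INF U \<in> {U. open U \<and> A \<subseteq> U}. emeasure m U)) \<and>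
     (\<forall>U. open U \<longrightarrow> emeasure m U = (SUP K \<in> {K. compact K \<and> K \<subseteq> U}. emeasure m K))"

definition dual_group :: "('g::topological_ab_group_add \<Rightarrow> complex) set" where
  "dual_group = {\<sigma>. continuous_on UNIV \<sigma> \<and> (\<forall>s. cmod (\<sigma> s) = 1) \<and>
     (\<forall>s t. \<sigma> (s + t) = \<sigma> s * \<sigma> t)}"

definition unitary_rep ::
    "('g::topological_ab_group_add \<Rightarrow> ('h::complex_hilbert \<Rightarrow>\<^sub>L 'h)) \<Rightarrow> bool" where
  "unitary_rep \<pi> \<longleftrightarrow>
     (\<forall>s. unitary_op (\<pi> s)) \<and>
     (\<forall>s t. \<pi> (s + t) = \<pi> s o\<^sub>L \<pi> t) \<and>
     (\<forall>\<xi>. continuous_on UNIV (\<lambda>s. blinfun_apply (\<pi> s) \<xi>))"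

definition Gamma_rep ::
    "('g::topological_ab_group_add \<Rightarrow> ('h::complex_hilbert \<Rightarrow>\<^sub>L 'h)) \<Rightarrow> ('g set \<Rightarrow> complex)
       \<Rightarrow> ('h \<Rightarrow>\<^sub>L 'h) \<Rightarrow> ('h \<Rightarrow>\<^sub>L 'h)" where
  "Gamma_rep \<pi> \<mu> x = weak_star_integral (cm_integral \<mu>) (\<lambda>s. \<pi> s o\<^sub>L x o\<^sub>L op_adj (\<pi> s))"

definition measure_transform :: "('g::topological_space set \<Rightarrow> complex) \<Rightarrow> ('g \<Rightarrow> complex) \<Rightarrow> complex" where
  "measure_transform \<mu> \<sigma> = cm_integral \<mu> \<sigma>"

definition L1_transform :: "'g measure \<Rightarrow> ('g \<Rightarrow> complex) \<Rightarrow> ('g \<Rightarrow> complex) \<Rightarrow> complex" where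
  "L1_transform m f \<sigma> = (\<integral>s. f s * \<sigma> s \<partial>m)"

definition pi1 ::
    "'g measure \<Rightarrow> ('g \<Rightarrow> ('h::complex_hilbert \<Rightarrow>\<^sub>L 'h)) \<Rightarrow> ('g \<Rightarrow> complex) \<Rightarrow> ('h \<Rightarrow>\<^sub>L 'h)" where
  "pi1 m \<pi> f = weak_star_integral (integral\<^sup>L m) (\<lambda>s. scaleC_op (f s) (\<pi> s))"

definition Cstar_pi ::
    "'g measure \<Rightarrow> ('g \<Rightarrow> ('h::complex_hilbert \<Rightarrow>\<^sub>L 'h)) \<Rightarrow> ('h \<Rightarrow>\<^sub>L 'h) set" where
  "Cstar_pi m \<pi> = closure {pi1 m \<pi> f | f :: 'g \<Rightarrow> complex. integrable m f}"

definition is_character ::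
    "('h::complex_hilbert \<Rightarrow>\<^sub>L 'h) set \<Rightarrow> (('h \<Rightarrow>\<^sub>L 'h) \<Rightarrow> complex) \<Rightarrow> bool" where
  "is_character A \<phi> \<longleftrightarrow>
     (\<forall>x\<in>A. \<forall>y\<in>A. \<phi> (x + y) = \<phi> x + \<phi> y) \<and>
     (\<forall>c. \<forall>x\<in>A. \<phi> (scaleC_op c x) = c * \<phi> x) \<and>
     (\<forall>x\<in>A. \<forall>y\<in>A. \<phi> (x o\<^sub>L y) = \<phi> x * \<phi> y) \<and>
     (\<exists>x\<in>A. \<phi> x \<noteq> 0)"

text \<open>The character space of the algebra \<^const>\<open>Cstar_pi\<close>, realised inside the dual group.\<close>

definition E_pi ::
    "'g::topological_ab_group_add measure \<Rightarrow> ('g \<Rightarrow> ('h::complex_hilbert \<Rightarrow>\<^sub>L 'h))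
       \<Rightarrow> ('g \<Rightarrow> complex) set" where
  "E_pi m \<pi> = {\<sigma> \<in> dual_group. \<exists>\<phi>. is_character (Cstar_pi m \<pi>) \<phi> \<and>
     (\<forall>f. integrable m f \<longrightarrow> \<phi> (pi1 m \<pi> f) = L1_transform m f \<sigma>)}"

definition positive_definite_on :: "'e set \<Rightarrow> ('e \<Rightarrow> 'e \<Rightarrow> complex) \<Rightarrow> bool" where
  "positive_definite_on E u \<longleftrightarrow>
     (\<forall>n (x :: nat \<Rightarrow> 'e) (c :: nat \<Rightarrow> complex). (\<forall>i<n. x i \<in> E) \<longrightarrow>
        (\<Sum>i<n. \<Sum>j<n. u (x i) (x j) * c j * cnj (c i)) \<in> \<real>\<^sub>\<ge>\<^sub>0)"

end

theory Submission
  imports Defs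
begin

text \<open>The spectrum of \<open>C*\<^sub>\<pi>\<close> is the set of approximate eigencharacters: those \<open>\<sigma>\<close> for which,
  uniformly on every compact set, \<open>\<pi>(s) \<eta>\<close> is close to \<open>\<sigma>(s) \<eta>\<close> for some unit vector \<open>\<eta>\<close>.  Such vectors
  for different characters are almost orthogonal, so evaluating \<open>\<Gamma>\<^sub>\<pi>(\<mu>)\<close> on the rank-one operator
  of a combination of them recovers the quadratic form of \<open>(\<sigma>, \<tau>) \<mapsto> \<mu>^(\<sigma> \<tau>\<inverse>)\<close>; hence positivity implies
  positive definiteness.

  Conversely, Zorn's lemma decomposes the Hilbert space into mutually orthogonal invariant subspaces
  on each of which \<open>\<pi>\<close> is, up to a given error and on a given compact set, multiplication by a point of
  the spectrum.  These subspaces are cut out by absolute values of self-adjoint operators in the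
  bicommutant of \<open>\<pi>\<close>.  Thus \<open>\<pi>(s) \<xi>\<close> is approximated by finite sums of \<open>\<sigma>(s) v\<^sub>\<sigma>\<close>, and the quadratic form of
  the amplified map becomes, in the limit, the sum of the entries of a Schur product of two positive matrices.\<close>

section \<open>Hilbert space geometry\<close>

text \<open>The spectrum may be purely continuous, so \<pi> need not have a single eigenvector; both
  implications work with approximations on compact sets. Tightness of \<mu> makes this enough: the
  compact set K is chosen from \<mu> and the error alone, and off K only a bound valid on all of G
  counts. That is why approximants carry two estimates, one on K and one global.
  \<open>is_character\<close> asks for an algebraic homomorphism only, neither continuous nor
  compatible with adjoints. It is linked with vectors by contradiction: without approximate
  eigenvectors, a sum b of squares would be bounded below, and b x = a could be solved inside the
  algebra although the character kills the left side and not a. In the other direction \<pi> is only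
  strongly continuous, so a pointwise limit of approximate eigenvalues could be a discontinuous
  homomorphism. Passing to a subspace on which some \<open>pi1 m \<pi> f\<close> is bounded below
  restores norm continuity there.\<close>

lemma scaleC_zero_left [simp]: "0 *\<^sub>C x = (0 :: 'h::complex_hilbert)"
  using scaleC_of_real[of 0 x] by simp

lemma scaleC_zero_right [simp]: "c *\<^sub>C (0 :: 'h::complex_hilbert) = 0"
  using scaleC_add_right[of c 0 0] by simp

lemma scaleC_one [simp]: "1 *\<^sub>C x = (x :: 'h::complex_hilbert)"
  using scaleC_of_real[of 1 x] by simp

lemma scaleC_minus_left: "(- c) *\<^sub>C x = - (c *\<^sub>C (x :: 'h::complex_hilbert))"
  using scaleC_add_left[of "- c" c x] by (simp add: eq_neg_iff_add_eq_0)

lemma scaleC_minus_right: "c *\<^sub>C (- x) = - (c *\<^sub>C (x :: 'h::complex_hilbert))"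
  using scaleC_add_right[of c "- x" x] by (simp add: eq_neg_iff_add_eq_0)

lemma scaleC_diff_right: "c *\<^sub>C (x - y) = c *\<^sub>C x - c *\<^sub>C (y :: 'h::complex_hilbert)"
  using scaleC_add_right[of c x "- y"] by (simp add: scaleC_minus_right)

lemma scaleC_diff_left: "(c - d) *\<^sub>C x = c *\<^sub>C x - d *\<^sub>C (x :: 'h::complex_hilbert)"
  using scaleC_add_left[of c "- d" x] by (simp add: scaleC_minus_left)

lemma scaleC_sum_right: "c *\<^sub>C (\<Sum>i\<in>A. f i) = (\<Sum>i\<in>A. c *\<^sub>C (f i :: 'h::complex_hilbert))"
  by (induction A rule: infinite_finite_induct) (simp_all add: scaleC_add_right)

lemma cinner_add_right: "cinner x (y + z) = cinner x y + cinner x (z :: 'h::complex_hilbert)"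
  by (metis cinner_add_left cinner_commute complex_cnj_add)

lemma cinner_scaleC_right: "cinner x (c *\<^sub>C y) = cnj c * cinner x (y :: 'h::complex_hilbert)"
  by (metis cinner_scaleC_left cinner_commute complex_cnj_mult)

lemma cinner_zero_left [simp]: "cinner 0 (y :: 'h::complex_hilbert) = 0"
  using cinner_add_left[of 0 0 y] by simp

lemma cinner_zero_right [simp]: "cinner (y :: 'h::complex_hilbert) 0 = 0"
  using cinner_add_right[of y 0 0] by simp

lemma cinner_minus_left: "cinner (- x) y = - cinner x (y :: 'h::complex_hilbert)"
  using cinner_add_left[of "- x" x y] by (simp add: eq_neg_iff_add_eq_0)

lemma cinner_minus_right: "cinner x (- y) = - cinner x (y :: 'h::complex_hilbert)"
  using cinner_add_right[of x "- y" y] by (simp add: eq_neg_iff_add_eq_0)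

lemma cinner_diff_left: "cinner (x - y) z = cinner x z - cinner y (z :: 'h::complex_hilbert)"
  using cinner_add_left[of x "- y" z] by (simp add: cinner_minus_left)

lemma cinner_diff_right: "cinner x (y - z) = cinner x y - cinner x (z :: 'h::complex_hilbert)"
  using cinner_add_right[of x y "- z"] by (simp add: cinner_minus_right)

lemma cinner_scaleR_left: "cinner (r *\<^sub>R x) y = of_real r * cinner x (y :: 'h::complex_hilbert)"
  by (simp add: cinner_scaleC_left flip: scaleC_of_real)

lemma cinner_scaleR_right: "cinner x (r *\<^sub>R y) = of_real r * cinner x (y :: 'h::complex_hilbert)"
  by (simp add: cinner_scaleC_right flip: scaleC_of_real)

lemma cinner_sum_left: "cinner (\<Sum>i\<in>A. f i) y = (\<Sum>i\<in>A. cinner (f i) (y :: 'h::complex_hilbert))"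
  by (induction A rule: infinite_finite_induct) (simp_all add: cinner_add_left)

lemma cinner_sum_right: "cinner y (\<Sum>i\<in>A. f i) = (\<Sum>i\<in>A. cinner (y :: 'h::complex_hilbert) (f i))"
  by (induction A rule: infinite_finite_induct) (simp_all add: cinner_add_right)

lemmas cinner_simps = cinner_add_left cinner_add_right cinner_diff_left cinner_diff_right
  cinner_scaleC_left cinner_scaleC_right cinner_minus_left cinner_minus_right
  cinner_scaleR_left cinner_scaleR_right

lemma norm_add_sq:
  "(norm (x + y))\<^sup>2 = (norm x)\<^sup>2 + 2 * Re (cinner x y) + (norm (y :: 'h::complex_hilbert))\<^sup>2"
proof -
  have "of_real ((norm (x + y))\<^sup>2) = cinner x x + cinner x y + cnj (cinner x y) + cinner y y"
    unfolding cinner_self[symmetric] by (simp add: cinner_simps flip: cinner_commute)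
  also have "\<dots> = of_real ((norm x)\<^sup>2 + 2 * Re (cinner x y) + (norm y)\<^sup>2)"
    by (simp add: cinner_self complex_eq_iff)
  finally show ?thesis using of_real_eq_iff by blast
qed

lemma norm_diff_sq:
  "(norm (x - y))\<^sup>2 = (norm x)\<^sup>2 - 2 * Re (cinner x y) + (norm (y :: 'h::complex_hilbert))\<^sup>2"
  using norm_add_sq[of x "- y"] by (simp add: cinner_minus_right)

text \<open>Cauchy-Schwarz, from the non-negative squared distance between x and its component
  \<open>c *\<^sub>C y\<close> along y.\<close>

lemma cmod_cinner_le: "cmod (cinner x y) \<le> norm x * norm (y :: 'h::complex_hilbert)"
proof (cases "y = 0")
  case False
  define c where "c = cinner x y / of_real ((norm y)\<^sup>2)"
  have "cinner x (c *\<^sub>C y) = of_real ((cmod (cinner x y))\<^sup>2 / (norm y)\<^sup>2)"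
    using complex_norm_square[of "cinner x y"]
    by (simp add: cinner_scaleC_right c_def mult.commute)
  moreover have "cmod c = cmod (cinner x y) / (norm y)\<^sup>2"
    unfolding c_def norm_divide norm_of_real by simp
  then have "(norm (c *\<^sub>C y))\<^sup>2 = (cmod (cinner x y))\<^sup>2 / (norm y)\<^sup>2"
    using False by (simp add: norm_scaleC power_mult_distrib field_simps power2_eq_square)
  ultimately have "0 \<le> (norm x)\<^sup>2 - (cmod (cinner x y))\<^sup>2 / (norm y)\<^sup>2"
    using norm_diff_sq[of x "c *\<^sub>C y"] zero_le_power2[of "norm (x - c *\<^sub>C y)"] by simp
  then have "(cmod (cinner x y))\<^sup>2 \<le> (norm x * norm y)\<^sup>2"
    using False by (simp add: field_simps power_mult_distrib)
  then show ?thesis by (rule power2_le_imp_le) simp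
qed simp

text \<open>Testing x against itself. Many vectors and operators here are known only through inner
  products, and this turns such information into norm bounds.\<close>

lemma norm_le_if_cinner_le:
  fixes x :: "'h::complex_hilbert"
  assumes "\<And>y. cmod (cinner x y) \<le> B * norm y" and "0 \<le> B"
  shows "norm x \<le> B"
proof (cases "x = 0")
  case False
  have "norm x * norm x \<le> B * norm x"
    using assms(1)[of x] by (simp add: cinner_self norm_power power2_eq_square norm_mult)
  then show ?thesis using False by simp
qed (use assms in simp)

lemma cinner_ext:
  fixes x :: "'h::complex_hilbert"
  assumes "\<And>z. cinner x z = cinner y z"
  shows "x = y"
  using norm_le_if_cinner_le[of "x - y" 0] assms by (simp add: cinner_diff_left)

lemma tendsto_cinner:
  fixes f g :: "'a \<Rightarrow> 'h::complex_hilbert"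
  assumes "(f \<longlongrightarrow> x) F" "(g \<longlongrightarrow> y) F"
  shows "((\<lambda>s. cinner (f s) (g s)) \<longlongrightarrow> cinner x y) F"
proof -
  have "bounded_bilinear (cinner :: 'h \<Rightarrow> 'h \<Rightarrow> complex)"
    by standard (auto simp: cinner_simps scaleR_conv_of_real intro!: exI[of _ 1] cmod_cinner_le)
  from bounded_bilinear.tendsto[OF this assms] show ?thesis .
qed

lemma continuous_on_cinner:
  fixes f g :: "'a::topological_space \<Rightarrow> 'h::complex_hilbert"
  assumes "continuous_on S f" "continuous_on S g"
  shows "continuous_on S (\<lambda>s. cinner (f s) (g s))"
  using assms unfolding continuous_on_def by (auto intro: tendsto_cinner)

section \<open>Complex subspaces, orthogonal projection and the Riesz theorem\<close>

definition csubspace :: "'h::complex_hilbert set \<Rightarrow> bool" where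
  "csubspace W \<longleftrightarrow> 0 \<in> W \<and> (\<forall>x\<in>W. \<forall>y\<in>W. x + y \<in> W) \<and> (\<forall>c. \<forall>x\<in>W. c *\<^sub>C x \<in> W)"

lemma csubspaceD:
  assumes "csubspace W"
  shows "0 \<in> W" "x \<in> W \<Longrightarrow> y \<in> W \<Longrightarrow> x + y \<in> W" "x \<in> W \<Longrightarrow> c *\<^sub>C x \<in> W"
    "x \<in> W \<Longrightarrow> y \<in> W \<Longrightarrow> x - y \<in> W" "x \<in> W \<Longrightarrow> r *\<^sub>R x \<in> W"
proof -
  have *: "- y \<in> W" if "y \<in> W" for y
    using assms that scaleC_minus_left[of 1 y] unfolding csubspace_def by (metis scaleC_one)
  show "0 \<in> W" "x \<in> W \<Longrightarrow> y \<in> W \<Longrightarrow> x + y \<in> W" "x \<in> W \<Longrightarrow> c *\<^sub>C x \<in> W"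
    using assms by (auto simp: csubspace_def)
  show "x \<in> W \<Longrightarrow> y \<in> W \<Longrightarrow> x - y \<in> W"
    using assms * unfolding csubspace_def diff_conv_add_uminus by blast
  show "x \<in> W \<Longrightarrow> r *\<^sub>R x \<in> W"
    using assms unfolding csubspace_def by (metis scaleC_of_real)
qed

lemma csubspace_closure:
  assumes "csubspace W"
  shows "csubspace (closure W)"
proof -
  have "x + y \<in> closure W" if xy: "x \<in> closure W" "y \<in> closure W" for x y
  proof -
    obtain f g where f: "\<forall>n. f n \<in> W" "f \<longlonglongrightarrow> x" and g: "\<forall>n. g n \<in> W" "g \<longlonglongrightarrow> y"
      using xy unfolding closure_sequential by blast
    have "(\<lambda>n. f n + g n) \<longlonglongrightarrow> x + y" using f(2) g(2) by (rule tendsto_add)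
    moreover have "\<forall>n. f n + g n \<in> W" using f g csubspaceD(2)[OF assms] by blast
    ultimately show ?thesis unfolding closure_sequential by (intro exI[of _ "\<lambda>n. f n + g n"]) blast
  qed
  moreover have "c *\<^sub>C x \<in> closure W" if x: "x \<in> closure W" for x c
  proof -
    obtain f where f: "\<forall>n. f n \<in> W" "f \<longlonglongrightarrow> x"
      using x unfolding closure_sequential by blast
    have "(\<lambda>n. c *\<^sub>C f n) \<longlonglongrightarrow> c *\<^sub>C x"
      by (rule bounded_linear.tendsto[OF bounded_linear_scaleC f(2)])
    moreover have "\<forall>n. c *\<^sub>C f n \<in> W" using f csubspaceD(3)[OF assms] by blast
    ultimately show ?thesis unfolding closure_sequential by (intro exI[of _ "\<lambda>n. c *\<^sub>C f n"]) blast
  qed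
  moreover have "0 \<in> closure W" using csubspaceD(1)[OF assms] closure_subset by blast
  ultimately show ?thesis by (auto simp: csubspace_def)
qed

text \<open>The distance from x to W is attained: the parallelogram law makes a minimising sequence
  Cauchy, because the midpoint of two of its members again lies in W. Orthogonality is the
  first-order condition at the minimiser.\<close>

theorem orthogonal_projection_exists:
  fixes x :: "'h::complex_hilbert"
  assumes "closed W" and W: "csubspace W"
  obtains p where "p \<in> W" "\<And>w. w \<in> W \<Longrightarrow> cinner (x - p) w = 0"
proof -
  define I where "I = (INF w\<in>W. (norm (x - w))\<^sup>2)"
  have bdd: "bdd_below ((\<lambda>w. (norm (x - w))\<^sup>2) ` W)" by (rule bdd_belowI[of _ 0]) auto
  have lower: "I \<le> (norm (x - w))\<^sup>2" if "w \<in> W" for w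
    unfolding I_def by (rule cINF_lower[OF bdd that])
  have "\<exists>w\<in>W. (norm (x - w))\<^sup>2 < I + 1 / real (Suc n)" for n
  proof -
    have "(INF w\<in>W. (norm (x - w))\<^sup>2) < I + 1 / real (Suc n)" by (simp add: I_def)
    then show ?thesis using csubspaceD(1)[OF W] bdd by (subst (asm) cINF_less_iff) auto
  qed
  then obtain w where w: "\<And>n. w n \<in> W" "\<And>n. (norm (x - w n))\<^sup>2 < I + 1 / real (Suc n)"
    by metis
  have close: "(norm (w m - w n))\<^sup>2 \<le> 2 * (1 / real (Suc m) + 1 / real (Suc n))" for m n
  proof -
    let ?a = "x - w m" and ?b = "x - w n"
    have "(norm (?a + ?b))\<^sup>2 + (norm (?a - ?b))\<^sup>2 = 2 * (norm ?a)\<^sup>2 + 2 * (norm ?b)\<^sup>2"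
      by (simp only: norm_add_sq norm_diff_sq) simp
    moreover have "?a + ?b = 2 *\<^sub>R (x - (1/2) *\<^sub>R (w m + w n))"
      by (simp add: algebra_simps scaleR_2)
    moreover have "I \<le> (norm (x - (1/2) *\<^sub>R (w m + w n)))\<^sup>2"
      by (rule lower) (intro csubspaceD[OF W] w)
    ultimately show ?thesis
      using w(2)[of m] w(2)[of n] by (simp add: power_mult_distrib norm_minus_commute)
  qed
  have "Cauchy w"
  proof (rule CauchyI)
    fix e :: real assume "0 < e"
    obtain N where "4 / e\<^sup>2 < real N" using reals_Archimedean2 by blast
    then have N: "4 / e\<^sup>2 < real (Suc N)" by simp
    have "norm (w m - w n) < e" if "N \<le> m" "N \<le> n" for m n
    proof -
      have "1 / real (Suc m) \<le> 1 / real (Suc N)" "1 / real (Suc n) \<le> 1 / real (Suc N)"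
        using that by (auto simp: field_simps)
      then have "(norm (w m - w n))\<^sup>2 \<le> 4 / real (Suc N)" using close[of m n] by simp
      also have "\<dots> < e\<^sup>2" using N \<open>0 < e\<close> by (simp add: field_simps)
      finally show ?thesis using \<open>0 < e\<close> by (simp add: power2_less_imp_less)
    qed
    then show "\<exists>M. \<forall>m\<ge>M. \<forall>n\<ge>M. norm (w m - w n) < e" by blast
  qed
  then obtain p where p: "w \<longlonglongrightarrow> p" using Cauchy_convergent convergent_def by blast
  have "p \<in> W" using closed_sequentially[OF \<open>closed W\<close>] w(1) p by blast
  have "(\<lambda>n. (norm (x - w n))\<^sup>2) \<longlonglongrightarrow> (norm (x - p))\<^sup>2" by (intro tendsto_intros p)
  moreover have "(\<lambda>n. I + 1 / real (Suc n)) \<longlonglongrightarrow> I + 0"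
    by (intro tendsto_intros LIMSEQ_Suc lim_inverse_n'[unfolded inverse_eq_divide])
  ultimately have "(norm (x - p))\<^sup>2 \<le> I"
    using w(2) by (intro LIMSEQ_le[where X = "\<lambda>n. (norm (x - w n))\<^sup>2"]) (auto intro: less_imp_le)
  have "cinner (x - p) v = 0" if "v \<in> W" for v
  proof -
    \<comment> \<open>Moving p by \<open>of_real t * z\<close> times v changes the squared distance
      by |z|^2 t (t |v|^2 - 2). This t keeps the bracket negative, also when v = 0.\<close>
    define z t where "z = cinner (x - p) v" and "t = 1 / ((norm v)\<^sup>2 + 1)"
    have "t > 0" "t * (norm v)\<^sup>2 < 2" by (auto simp: t_def field_simps add_pos_nonneg add_nonneg_pos)
    have "(norm (x - p))\<^sup>2 \<le> (norm (x - p - (of_real t * z) *\<^sub>C v))\<^sup>2"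
      using \<open>(norm (x - p))\<^sup>2 \<le> I\<close> lower[of "p + (of_real t * z) *\<^sub>C v"] 
        csubspaceD(2)[OF W \<open>p \<in> W\<close> csubspaceD(3)[OF W that]]
      unfolding diff_diff_eq by (meson order_trans)
    also have "\<dots> = (norm (x - p))\<^sup>2 - 2 * (t * (cmod z)\<^sup>2) + (t * cmod z * norm v)\<^sup>2"
      using \<open>t > 0\<close> cmod_power2[of z]
      by (simp add: power2_eq_square[of "Re z"] power2_eq_square[of "Im z"] norm_diff_sq[of "x - p"] cinner_scaleC_right z_def[symmetric] norm_scaleC
          norm_mult mult.assoc mult.commute[of "cnj z"] flip: of_real_power)
    finally have "0 \<le> t * ((cmod z)\<^sup>2 * (t * (norm v)\<^sup>2 - 2))"
      by (simp add: power_mult_distrib algebra_simps power2_eq_square)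
    then have "0 \<le> (cmod z)\<^sup>2 * (t * (norm v)\<^sup>2 - 2)"
      using \<open>t > 0\<close> by (simp add: zero_le_mult_iff)
    then have "(cmod z)\<^sup>2 \<le> 0" using \<open>t * (norm v)\<^sup>2 < 2\<close>
      by (smt (verit) mult_pos_neg zero_le_power2)
    then show ?thesis by (simp add: z_def)
  qed
  with \<open>p \<in> W\<close> that show thesis by blast
qed

text \<open>The orthogonal complement of the kernel is one-dimensional; e spans it, and y is e
  rescaled so that both sides agree on e.\<close>

theorem riesz_representation:
  fixes f :: "'h::complex_hilbert \<Rightarrow> complex"
  assumes f: "bounded_linear f" and fC: "\<And>c x. f (c *\<^sub>C x) = c * f x"
  obtains y where "\<And>x. f x = cinner x y"
proof (cases "\<forall>x. f x = 0")
  case True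
  then show thesis using that[of 0] by simp
next
  case False
  interpret bounded_linear f by fact
  obtain x0 where x0: "f x0 \<noteq> 0" using False by blast
  define W where "W = {x. f x = 0}"
  have "closed W" unfolding W_def
    by (intro closed_Collect_eq continuous_intros continuous_on continuous_on_id continuous_on_const)
  moreover have "csubspace W" by (auto simp: csubspace_def W_def add fC zero)
  ultimately obtain p where p: "p \<in> W" "\<And>w. w \<in> W \<Longrightarrow> cinner (x0 - p) w = 0"
    using orthogonal_projection_exists by blast
  define e where "e = x0 - p"
  have fe: "f e = f x0" using p(1) by (simp add: e_def diff W_def)
  then have "e \<noteq> 0" using x0 zero by auto
  define y where "y = cnj (f e / of_real ((norm e)\<^sup>2)) *\<^sub>C e"
  have "f x = cinner x y" for x
  proof -
    have "x - (f x / f e) *\<^sub>C e \<in> W" using fe x0 by (simp add: W_def diff fC)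
    then have "cnj (cinner e (x - (f x / f e) *\<^sub>C e)) = 0" using p(2) by (simp add: e_def)
    then have "cinner x e = f x / f e * of_real ((norm e)\<^sup>2)"
      by (simp flip: cinner_commute add: cinner_simps cinner_self)
    then show ?thesis using \<open>e \<noteq> 0\<close> fe x0 by (simp add: y_def cinner_scaleC_right)
  qed
  then show thesis using that by blast
qed

subsection \<open>Bounded operators\<close>

lemma BH_D: "T \<in> BH \<Longrightarrow> T (c *\<^sub>C x) = c *\<^sub>C T x"
  by (simp add: BH_def)

lemma BH_zero [simp]: "0 \<in> BH"
  and BH_id [simp]: "id_blinfun \<in> BH"
  and BH_add: "S \<in> BH \<Longrightarrow> T \<in> BH \<Longrightarrow> S + T \<in> BH"
  and BH_diff: "S \<in> BH \<Longrightarrow> T \<in> BH \<Longrightarrow> S - T \<in> BH"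
  and BH_compose: "S \<in> BH \<Longrightarrow> T \<in> BH \<Longrightarrow> S o\<^sub>L T \<in> BH"
  and BH_scaleC: "S \<in> BH \<Longrightarrow> scaleC_op c S \<in> BH"
  and BH_scaleR: "S \<in> BH \<Longrightarrow> r *\<^sub>R S \<in> BH"
  by (auto simp: BH_def blinfun.add_left blinfun.diff_left scaleC_add_right scaleC_diff_right
      scaleC_op.rep_eq scaleC_scaleC mult.commute blinfun.scaleR_left simp flip: scaleC_of_real)

lemma closed_BH: "closed (BH :: ('h::complex_hilbert \<Rightarrow>\<^sub>L 'h) set)"
proof -
  have eq: "BH = (\<Inter>c. \<Inter>x. {T :: 'h \<Rightarrow>\<^sub>L 'h. T (c *\<^sub>C x) = c *\<^sub>C T x})" by (auto simp: BH_def)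
  moreover have "closed {T :: 'h \<Rightarrow>\<^sub>L 'h. T (c *\<^sub>C x) = c *\<^sub>C T x}" for c x
    by (intro closed_Collect_eq continuous_intros
        bounded_linear.continuous_on[OF bounded_linear_scaleC])
  ultimately show ?thesis unfolding eq by (intro closed_INT ballI)
qed

lemma blinfun_ext_cinner:
  fixes S T :: "'h::complex_hilbert \<Rightarrow>\<^sub>L 'h"
  assumes "\<And>x y. cinner (S x) y = cinner (T x) y"
  shows "S = T"
  by (rule blinfun_eqI, rule cinner_ext, rule assms)

text \<open>Riesz applied in the second variable, after conjugation to make the form linear there.
  Integrals, adjoints, projections and rank-one operators are all produced from their forms in this
  way.\<close>

theorem sesquilinear_form_operator:
  fixes b :: "'h::complex_hilbert \<Rightarrow> 'h \<Rightarrow> complex"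
  assumes add1: "\<And>x y z. b (x + y) z = b x z + b y z"
    and sc1: "\<And>c x z. b (c *\<^sub>C x) z = c * b x z"
    and add2: "\<And>x y z. b x (y + z) = b x y + b x z"
    and sc2: "\<And>c x z. b x (c *\<^sub>C z) = cnj c * b x z"
    and bound: "\<And>x y. cmod (b x y) \<le> M * norm x * norm y"
  obtains T where "T \<in> BH" "\<And>x y. cinner (T x) y = b x y"
proof -
  have scR1: "b (r *\<^sub>R x) z = of_real r * b x z" and scR2: "b x (r *\<^sub>R z) = of_real r * b x z" for r x z
    using sc1[of "of_real r"] sc2[of x "of_real r"] by (simp_all add: scaleC_of_real)
  have "\<exists>t. \<forall>y. cnj (b x y) = cinner y t" for x
  proof -
    have "bounded_linear (\<lambda>y. cnj (b x y))"
      by (rule bounded_linear_intro[where K = "M * norm x"])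
        (simp_all add: add2 scR2 scaleR_conv_of_real bound mult.commute mult.left_commute,
          metis bound mult.commute mult.left_commute)
    then obtain t where "\<And>y. cnj (b x y) = cinner y t"
      by (rule riesz_representation) (simp add: sc2, blast)
    then show ?thesis by blast
  qed
  then obtain t where t: "\<And>x y. cnj (b x y) = cinner y (t x)" by metis
  have t': "cinner (t x) y = b x y" for x y
    by (metis t cinner_commute complex_cnj_cnj)
  \<comment> \<open>The sign of M is unknown, while \<open>norm_le_if_cinner_le\<close> asks for a
    non-negative bound; hence the absolute value.\<close>
  have M: "norm (t x) \<le> norm x * \<bar>M\<bar>" for x
  proof (rule norm_le_if_cinner_le)
    fix y show "cmod (cinner (t x) y) \<le> norm x * \<bar>M\<bar> * norm y"
      using bound[of x y] mult_right_mono[OF abs_ge_self[of M], of "norm x * norm y"]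
      by (simp add: t' mult_ac)
  qed simp
  have "bounded_linear t"
    by (rule bounded_linear_intro[OF _ _ M]) (rule cinner_ext; simp add: t' cinner_simps add1 scR1)+
  then have T: "blinfun_apply (Blinfun t) = t" by (simp add: bounded_linear_Blinfun_apply)
  have "Blinfun t \<in> BH"
    unfolding BH_def mem_Collect_eq T
    by (intro allI, rule cinner_ext) (simp add: t' sc1 cinner_scaleC_left)
  then show thesis using that[of "Blinfun t"] by (simp add: T t')
qed

lemma is_adjD: "is_adj S T \<Longrightarrow> cinner (T x) y = cinner x (S y)"
  by (simp add: is_adj_def)

lemma is_adj_sym: "is_adj S T \<Longrightarrow> is_adj T S"
  unfolding is_adj_def by (metis cinner_commute)

lemma is_adj_unique: "is_adj S T \<Longrightarrow> is_adj S' T \<Longrightarrow> S = S'"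
  using blinfun_ext_cinner is_adj_sym unfolding is_adj_def by (metis (no_types, lifting))

text \<open>Adjoints are handled through the relation \<open>is_adj\<close>; this is the bridge to
  the definite description in \<open>op_adj\<close>.\<close>

lemma op_adj_eq: "S \<in> BH \<Longrightarrow> is_adj S T \<Longrightarrow> op_adj T = S"
  unfolding op_adj_def by (rule the_equality) (auto intro: is_adj_unique)

lemma is_adj_add: "is_adj S T \<Longrightarrow> is_adj S' T' \<Longrightarrow> is_adj (S + S') (T + T')"
  and is_adj_diff: "is_adj S T \<Longrightarrow> is_adj S' T' \<Longrightarrow> is_adj (S - S') (T - T')"
  and is_adj_compose: "is_adj S T \<Longrightarrow> is_adj S' T' \<Longrightarrow> is_adj (S' o\<^sub>L S) (T o\<^sub>L T')"
  and is_adj_scaleC: "is_adj S T \<Longrightarrow> is_adj (scaleC_op (cnj c) S) (scaleC_op c T)"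
  and is_adj_scaleR: "is_adj S T \<Longrightarrow> is_adj (r *\<^sub>R S) (r *\<^sub>R T)"
  and is_adj_id: "is_adj id_blinfun (id_blinfun :: 'h::complex_hilbert \<Rightarrow>\<^sub>L 'h)"
  by (simp_all add: is_adj_def blinfun.add_left blinfun.diff_left cinner_simps scaleC_op.rep_eq
      blinfun.scaleR_left)

section \<open>Absolute value of a self-adjoint operator\<close>

lemma compose_add_left: "(S + T) o\<^sub>L U = (S o\<^sub>L U) + (T o\<^sub>L U)"
  and compose_add_right: "U o\<^sub>L (S + T) = (U o\<^sub>L S) + (U o\<^sub>L T)"
  and compose_diff_left: "(S - T) o\<^sub>L U = (S o\<^sub>L U) - (T o\<^sub>L U)"
  and compose_diff_right: "U o\<^sub>L (S - T) = (U o\<^sub>L S) - (U o\<^sub>L T)"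
  and compose_scaleR_left: "(r *\<^sub>R S) o\<^sub>L U = r *\<^sub>R (S o\<^sub>L U)"
  and compose_scaleR_right: "U o\<^sub>L (r *\<^sub>R S) = r *\<^sub>R (U o\<^sub>L S)"
  by (rule blinfun_eqI; simp add: blinfun.add_left blinfun.diff_left blinfun.scaleR_left
      blinfun.add_right blinfun.diff_right blinfun.scaleR_right)+

lemma compose_id_left [simp]: "id_blinfun o\<^sub>L U = U"
  and compose_id_right [simp]: "U o\<^sub>L id_blinfun = U"
  by (rule blinfun_eqI; simp)+

lemma compose_assoc: "(S o\<^sub>L T) o\<^sub>L U = S o\<^sub>L (T o\<^sub>L U)"
  by (rule blinfun_eqI) simp

lemmas compose_simps = compose_add_left compose_add_right compose_diff_left compose_diff_right
  compose_scaleR_left compose_scaleR_right compose_assoc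

lemma tendsto_compose:
  assumes "(S \<longlongrightarrow> S') F" "(T \<longlongrightarrow> T') F"
  shows "((\<lambda>n. S n o\<^sub>L T n) \<longlongrightarrow> S' o\<^sub>L T') F"
  using bounded_bilinear.tendsto[OF bounded_bilinear_blinfun_compose assms] .

section \<open>Commuting operators and the square-root iteration\<close>

definition commutes :: "('a::real_normed_vector \<Rightarrow>\<^sub>L 'a) \<Rightarrow> ('a \<Rightarrow>\<^sub>L 'a) \<Rightarrow> bool" where
  "commutes S T \<longleftrightarrow> S o\<^sub>L T = T o\<^sub>L S"

lemma commutes_sym: "commutes S T \<Longrightarrow> commutes T S"
  by (simp add: commutes_def)

lemma commutesD: "commutes S T \<Longrightarrow> S (T x) = T (S x)"
  unfolding commutes_def by (metis blinfun_apply_blinfun_compose)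

lemma commutesI: "(\<And>x. blinfun_apply S (blinfun_apply T x) = T (S x)) \<Longrightarrow> commutes S T"
  unfolding commutes_def by (rule blinfun_eqI) simp

lemma commutes_add: "commutes S T \<Longrightarrow> commutes S T' \<Longrightarrow> commutes S (T + T')"
  and commutes_diff: "commutes S T \<Longrightarrow> commutes S T' \<Longrightarrow> commutes S (T - T')"
  and commutes_scaleR: "commutes S T \<Longrightarrow> commutes S (r *\<^sub>R T)"
  and commutes_id: "commutes S id_blinfun"
  by (simp_all add: commutes_def compose_simps)

lemma commutes_compose: "commutes S T \<Longrightarrow> commutes S T' \<Longrightarrow> commutes S (T o\<^sub>L T')"
  unfolding commutes_def by (metis compose_assoc)

lemma commutes_limit:
  assumes "\<And>n. commutes S (T n)" "T \<longlonglongrightarrow> T'"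
  shows "commutes S T'"
  using LIMSEQ_unique[OF tendsto_compose[OF tendsto_const[of S] assms(2)]]
    tendsto_compose[OF assms(2) tendsto_const[of S]] assms(1)
  by (simp add: commutes_def)

text \<open>A fixed point Y satisfies (1 - Y)^2 = 1 - X, so the limit yields a square root 1 - Y of
  1 - X that commutes with whatever commutes with X.\<close>

fun sqrt_iter :: "('a::real_normed_vector \<Rightarrow>\<^sub>L 'a) \<Rightarrow> nat \<Rightarrow> ('a \<Rightarrow>\<^sub>L 'a)" where
  "sqrt_iter X 0 = 0"
| "sqrt_iter X (Suc n) = (1/2) *\<^sub>R (X + (sqrt_iter X n o\<^sub>L sqrt_iter X n))"

text \<open>The same iteration at the scalar X = 1. It increases and stays below or at 1, and it
  majorises the operator iteration.\<close>

fun sqrt_iter_real :: "nat \<Rightarrow> real" where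
  "sqrt_iter_real 0 = 0"
| "sqrt_iter_real (Suc n) = (1 + (sqrt_iter_real n)\<^sup>2) / 2"

lemma sqrt_iter_real_bounds: "0 \<le> sqrt_iter_real n \<and> sqrt_iter_real n \<le> 1"
  by (induction n) (auto simp: power_le_one)

lemma sqrt_iter_real_convergent: "convergent sqrt_iter_real"
proof (rule Bseq_mono_convergent)
  show "Bseq sqrt_iter_real"
    using sqrt_iter_real_bounds by (intro BseqI'[of _ 1]) auto
  have "sqrt_iter_real n \<le> sqrt_iter_real (Suc n)" for n
    using zero_le_power2[of "sqrt_iter_real n - 1"] by (simp add: power2_eq_square algebra_simps)
  then show "\<forall>m n. m \<le> n \<longrightarrow> sqrt_iter_real m \<le> sqrt_iter_real n"
    using lift_Suc_mono_le by blast
qed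

lemma sqrt_iter_commutes: "commutes S X \<Longrightarrow> commutes S (sqrt_iter X n)"
  by (induction n) (auto simp: commutes_def[of S 0] intro!: commutes_add commutes_scaleR commutes_compose)

lemma norm_sqrt_iter:
  assumes "norm X \<le> 1"
  shows "norm (sqrt_iter X n) \<le> sqrt_iter_real n"
proof (induction n)
  case (Suc n)
  have "norm (sqrt_iter X n o\<^sub>L sqrt_iter X n) \<le> (sqrt_iter_real n)\<^sup>2"
    using norm_blinfun_compose[of "sqrt_iter X n" "sqrt_iter X n"] Suc
    by (smt (verit) mult_mono norm_ge_zero power2_eq_square)
  then show ?case
    using norm_triangle_ineq[of X "sqrt_iter X n o\<^sub>L sqrt_iter X n"] assms by simp
qed simp

text \<open>The iterates are polynomials in \<open>X\<close> with non-negative coefficients, as are their increments;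
  hence the scalar iteration at \<open>X = 1\<close> dominates them.\<close>

lemma norm_sqrt_iter_Suc_diff:
  assumes "norm X \<le> 1"
  shows "norm (sqrt_iter X (Suc n) - sqrt_iter X n) \<le> sqrt_iter_real (Suc n) - sqrt_iter_real n"
proof (induction n)
  case 0
  show ?case using assms by simp
next
  case (Suc n)
  let ?Y = "sqrt_iter X" and ?y = sqrt_iter_real
  \<comment> \<open>Two iterates commute, so the difference of their squares factors as sum times
    difference.\<close>
  have "commutes (?Y (Suc n)) (?Y n)"
    by (intro sqrt_iter_commutes commutes_sym[OF sqrt_iter_commutes]) (simp add: commutes_def)
  then have "?Y (Suc (Suc n)) - ?Y (Suc n) = (1/2) *\<^sub>R ((?Y (Suc n) + ?Y n) o\<^sub>L (?Y (Suc n) - ?Y n))"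
    unfolding commutes_def sqrt_iter.simps(2)[of X "Suc n"]
    by (subst (3) sqrt_iter.simps(2))
      (simp only: compose_add_left compose_diff_right scaleR_diff_right scaleR_add_right, simp)
  also have "norm \<dots> \<le> (1/2) * (norm (?Y (Suc n) + ?Y n) * norm (?Y (Suc n) - ?Y n))"
    using norm_blinfun_compose[of "?Y (Suc n) + ?Y n" "?Y (Suc n) - ?Y n"]
    by (simp del: sqrt_iter.simps)
  also have "\<dots> \<le> (1/2) * ((?y (Suc n) + ?y n) * (?y (Suc n) - ?y n))"
    using norm_sqrt_iter[OF assms, of n] norm_sqrt_iter[OF assms, of "Suc n"] Suc
      norm_triangle_ineq[of "?Y (Suc n)" "?Y n"] sqrt_iter_real_bounds[of n] sqrt_iter_real_bounds[of "Suc n"]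
    by (intro mult_left_mono mult_mono) (auto simp del: sqrt_iter.simps sqrt_iter_real.simps)
  also have "\<dots> = ?y (Suc (Suc n)) - ?y (Suc n)"
  proof -
    have "?y (Suc (Suc n)) - ?y (Suc n) = (1 + (?y (Suc n))\<^sup>2) / 2 - (1 + (?y n)\<^sup>2) / 2"
      by simp
    then show ?thesis by (simp add: power2_eq_square field_simps del: sqrt_iter_real.simps)
  qed
  finally show ?case .
qed

text \<open>The increments are dominated by those of the convergent scalar iteration, so telescoping
  gives the Cauchy property in norm.\<close>

lemma sqrt_iter_convergent:
  fixes X :: "'a::banach \<Rightarrow>\<^sub>L 'a"
  assumes "norm X \<le> 1"
  shows "convergent (sqrt_iter X)"
proof -
  have diff: "norm (sqrt_iter X (n + k) - sqrt_iter X n) \<le> sqrt_iter_real (n + k) - sqrt_iter_real n" for n k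
  proof (induction k)
    case (Suc k)
    then show ?case
      using norm_sqrt_iter_Suc_diff[OF assms, of "n + k"]
        norm_triangle_ineq[of "sqrt_iter X (Suc (n + k)) - sqrt_iter X (n + k)" "sqrt_iter X (n + k) - sqrt_iter X n"]
      by (simp del: sqrt_iter.simps sqrt_iter_real.simps)
  qed simp
  have "Cauchy (sqrt_iter X)"
    unfolding Cauchy_altdef
  proof (intro allI impI)
    fix e :: real assume "0 < e"
    then obtain M where M: "\<And>m n. M \<le> m \<Longrightarrow> M \<le> n \<Longrightarrow> dist (sqrt_iter_real m) (sqrt_iter_real n) < e"
      using convergent_Cauchy[OF sqrt_iter_real_convergent] unfolding Cauchy_def by meson
    have "dist (sqrt_iter X m) (sqrt_iter X n) < e" if "M \<le> m" "m < n" for m n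
      using diff[of m "n - m"] M[of n m] that by (simp add: dist_real_def dist_norm norm_minus_commute)
    then show "\<exists>M. \<forall>m\<ge>M. \<forall>n>m. dist (sqrt_iter X m) (sqrt_iter X n) < e" by blast
  qed
  then show ?thesis by (simp add: Cauchy_convergent_iff)
qed

lemma is_adj_limit:
  assumes "\<And>n. is_adj (S n) (T n)" "S \<longlonglongrightarrow> S'" "T \<longlonglongrightarrow> T'"
  shows "is_adj S' T'"
  unfolding is_adj_def
proof (intro allI)
  fix x y
  have "(\<lambda>n. cinner (T n x) y) \<longlonglongrightarrow> cinner (T' x) y"
    and "(\<lambda>n. cinner (T n x) y) \<longlonglongrightarrow> cinner x (S' y)"
    by (intro tendsto_cinner tendsto_const blinfun.tendsto assms)
      (simp only: is_adjD[OF assms(1)], intro tendsto_cinner tendsto_const blinfun.tendsto assms)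
  then show "cinner (T' x) y = cinner x (S' y)" by (rule LIMSEQ_unique)
qed

text \<open>With r the norm of B and X = 1 - B^2 / r^2, the iteration gives Y with (1 - Y)^2 = B^2 /
  r^2, and C = r (1 - Y). The last property is what later places C in the bicommutant of a
  representation.\<close>

theorem selfadjoint_absolute_value:
  fixes B :: "'h::complex_hilbert \<Rightarrow>\<^sub>L 'h"
  assumes B: "B \<in> BH" "is_adj B B"
  obtains C where "C \<in> BH" "is_adj C C" "C o\<^sub>L C = B o\<^sub>L B"
    "\<And>x. 0 \<le> Re (cinner (C x) x)" "\<And>S. commutes S B \<Longrightarrow> commutes S C"
proof (cases "B = 0")
  case True
  show thesis by (rule that[of 0]) (auto simp: True is_adj_def)
next
  case False
  define r where "r = norm B"
  have "r > 0" using False by (simp add: r_def)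
  define X where "X = id_blinfun - (1 / r\<^sup>2) *\<^sub>R (B o\<^sub>L B)"
  have X: "X \<in> BH" "is_adj X X"
    unfolding X_def by (intro BH_diff BH_id BH_scaleR BH_compose B is_adj_diff is_adj_id is_adj_scaleR is_adj_compose)+
  have "norm X \<le> 1"
  proof (rule norm_blinfun_bound)
    fix x
    let ?t = "1 / r\<^sup>2"
    \<comment> \<open>Self-adjointness turns the cross term into |B x|^2, and |B (B x)| \<le> r |B
      x| lets it absorb the last term.\<close>
    have eq: "(norm (X x))\<^sup>2 = (norm x)\<^sup>2 - 2 * ?t * (norm (B x))\<^sup>2 + ?t\<^sup>2 * (norm (B (B x)))\<^sup>2"
      using is_adjD[OF B(2), of x "B x"]
      by (simp add: X_def blinfun.diff_left blinfun.scaleR_left norm_diff_sq cinner_scaleR_right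
          cinner_self power_mult_distrib power_divide flip: is_adjD[OF B(2), of x "B x"] of_real_power)
    have "?t\<^sup>2 * (norm (B (B x)))\<^sup>2 \<le> ?t\<^sup>2 * (r * norm (B x))\<^sup>2"
      unfolding r_def by (intro mult_left_mono power_mono norm_blinfun) auto
    also have "\<dots> = ?t * (norm (B x))\<^sup>2"
      using \<open>r > 0\<close> by (simp add: power2_eq_square field_simps)
    finally have "(norm (X x))\<^sup>2 \<le> (norm x)\<^sup>2 - ?t * (norm (B x))\<^sup>2" using eq by simp
    moreover have "0 \<le> ?t * (norm (B x))\<^sup>2" by simp
    ultimately have "(norm (X x))\<^sup>2 \<le> (norm x)\<^sup>2" by linarith
    then show "norm (X x) \<le> 1 * norm x" using power2_le_imp_le[of "norm (X x)" "norm x"] by simp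
  qed simp
  then obtain Y where Y: "sqrt_iter X \<longlonglongrightarrow> Y"
    using sqrt_iter_convergent convergent_def by blast
  have iter: "sqrt_iter X n \<in> BH \<and> is_adj (sqrt_iter X n) (sqrt_iter X n)" for n
    by (induction n) (auto simp: is_adj_def[of 0] intro!: BH_scaleR BH_add BH_compose X is_adj_scaleR is_adj_add is_adj_compose)
  have "Y \<in> BH" using closed_sequentially[OF closed_BH] iter Y by blast
  have "is_adj Y Y" using is_adj_limit[OF _ Y Y] iter by blast
  have "norm Y \<le> 1"
    by (rule LIMSEQ_le_const2[OF tendsto_norm[OF Y]])
      (meson norm_sqrt_iter[OF \<open>norm X \<le> 1\<close>] sqrt_iter_real_bounds order_trans)
  have "(\<lambda>n. sqrt_iter X (Suc n)) \<longlonglongrightarrow> (1/2) *\<^sub>R (X + (Y o\<^sub>L Y))"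
    unfolding sqrt_iter.simps by (intro tendsto_intros tendsto_compose Y)
  then have fixpt: "Y = (1/2) *\<^sub>R (X + (Y o\<^sub>L Y))"
    using LIMSEQ_unique[OF LIMSEQ_Suc[OF Y]] by blast
  have "2 *\<^sub>R Y = X + (Y o\<^sub>L Y)" by (subst fixpt) simp
  then have YY: "Y o\<^sub>L Y = 2 *\<^sub>R Y - X" by simp
  have comm: "commutes S Y" if "commutes S B" for S
  proof (rule commutes_limit[OF sqrt_iter_commutes Y])
    show "commutes S X"
      unfolding X_def by (intro commutes_diff commutes_id commutes_scaleR commutes_compose that)
  qed
  define C where "C = r *\<^sub>R (id_blinfun - Y)"
  have "C o\<^sub>L C = r\<^sup>2 *\<^sub>R ((id_blinfun - Y) o\<^sub>L (id_blinfun - Y))"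
    by (simp add: C_def compose_scaleR_left compose_scaleR_right power2_eq_square)
  also have "(id_blinfun - Y) o\<^sub>L (id_blinfun - Y) = id_blinfun - X"
    by (simp add: compose_diff_left compose_diff_right YY scaleR_2)
  also have "r\<^sup>2 *\<^sub>R (id_blinfun - X) = B o\<^sub>L B"
    using \<open>r > 0\<close> by (simp add: X_def)
  finally have "C o\<^sub>L C = B o\<^sub>L B" .
  moreover have "0 \<le> Re (cinner (C x) x)" for x
  proof -
    \<comment> \<open>Positivity of C amounts to Re <Y x, x> \<le> |x|^2, which follows from the
      norm of Y being at most 1.\<close>
    have "Re (cinner (Y x) x) \<le> norm (Y x) * norm x"
      by (rule order_trans[OF complex_Re_le_cmod cmod_cinner_le])
    also have "\<dots> \<le> norm x * norm x"
      using norm_blinfun[of Y x] mult_right_mono[OF \<open>norm Y \<le> 1\<close> norm_ge_zero[of x]]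
      by (intro mult_right_mono) auto
    finally show ?thesis
      using \<open>r > 0\<close>
      by (simp add: C_def blinfun.scaleR_left blinfun.diff_left cinner_simps cinner_self power2_eq_square)
  qed
  moreover have "C \<in> BH" unfolding C_def by (intro BH_scaleR BH_diff BH_id \<open>Y \<in> BH\<close>)
  moreover have "is_adj C C"
    unfolding C_def by (intro is_adj_scaleR is_adj_diff is_adj_id \<open>is_adj Y Y\<close>)
  moreover have "commutes S C" if "commutes S B" for S
    unfolding C_def by (intro commutes_scaleR commutes_diff commutes_id comm that)
  ultimately show thesis using that by blast
qed

section \<open>Weak integrals of operator-valued functions\<close>

lemma norm_integral_le:
  fixes f :: "'s \<Rightarrow> 'b::{banach,second_countable_topology}"
  assumes "f \<in> borel_measurable M" "integrable M g" "\<And>s. s \<in> space M \<Longrightarrow> norm (f s) \<le> g s"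
  shows "integrable M f" "norm (integral\<^sup>L M f) \<le> integral\<^sup>L M g"
proof -
  show int: "integrable M f"
    by (rule Bochner_Integration.integrable_bound[OF assms(2,1)], rule AE_I2) (use assms(3) in force)
  have "norm (integral\<^sup>L M f) \<le> (\<integral>s. norm (f s) \<partial>M)" by (rule integral_norm_bound)
  also have "\<dots> \<le> integral\<^sup>L M g"
    by (rule integral_mono[OF integrable_norm[OF int] assms(2,3)])
  finally show "norm (integral\<^sup>L M f) \<le> integral\<^sup>L M g" .
qed

lemma cmod_cinner_blinfun_le:
  "cmod (cinner (blinfun_apply T x) y) \<le> norm T * (norm x * norm (y :: 'h::complex_hilbert))"
proof -
  have "cmod (cinner (T x) y) \<le> norm (T x) * norm y" by (rule cmod_cinner_le)
  also have "\<dots> \<le> norm T * norm x * norm y" by (intro mult_right_mono norm_blinfun) simp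
  finally show ?thesis by (simp add: mult.assoc)
qed

lemma summable_norm_mult:
  fixes \<xi> \<eta> :: "nat \<Rightarrow> 'h::real_normed_vector"
  assumes "summable (\<lambda>n. (norm (\<xi> n))\<^sup>2)" "summable (\<lambda>n. (norm (\<eta> n))\<^sup>2)"
  shows "summable (\<lambda>n. norm (\<xi> n) * norm (\<eta> n))"
proof (rule summable_comparison_test'[OF summable_add[OF assms]])
  fix n
  show "norm (norm (\<xi> n) * norm (\<eta> n)) \<le> (norm (\<xi> n))\<^sup>2 + (norm (\<eta> n))\<^sup>2"
    using sum_squares_bound[of "norm (\<xi> n)" "norm (\<eta> n)"]
      mult_nonneg_nonneg[OF norm_ge_zero[of "\<xi> n"] norm_ge_zero[of "\<eta> n"]]
    unfolding real_norm_def abs_mult abs_norm_cancel by linarith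
qed

lemma summable_cinner_blinfun:
  fixes \<xi> \<eta> :: "nat \<Rightarrow> 'h::complex_hilbert"
  assumes "summable (\<lambda>n. (norm (\<xi> n))\<^sup>2)" "summable (\<lambda>n. (norm (\<eta> n))\<^sup>2)"
  shows "summable (\<lambda>n. norm (cinner (blinfun_apply T (\<xi> n)) (\<eta> n)))"
  by (rule summable_comparison_test'[OF summable_mult[OF summable_norm_mult[OF assms], of "norm T"]])
    (simp add: cmod_cinner_blinfun_le)

lemma normal_functional_linear:
  assumes "\<omega> \<in> normal_functionals"
  shows "\<omega> (S + T) = \<omega> S + \<omega> T" "\<omega> (S - T) = \<omega> S - \<omega> T" "\<omega> (scaleC_op c T) = c * \<omega> T"
proof -
  obtain \<xi> \<eta> :: "nat \<Rightarrow> 'a" where \<omega>: "\<omega> = (\<lambda>T. \<Sum>n. cinner (blinfun_apply T (\<xi> n)) (\<eta> n))"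
    and "summable (\<lambda>n. (norm (\<xi> n))\<^sup>2)" "summable (\<lambda>n. (norm (\<eta> n))\<^sup>2)"
    using assms unfolding normal_functionals_def by blast
  then have s: "summable (\<lambda>n. cinner (blinfun_apply T (\<xi> n)) (\<eta> n))" for T
    by (intro summable_norm_cancel[OF summable_cinner_blinfun])
  show "\<omega> (S + T) = \<omega> S + \<omega> T" "\<omega> (S - T) = \<omega> S - \<omega> T" "\<omega> (scaleC_op c T) = c * \<omega> T"
    using suminf_add[OF s[of S] s[of T]] suminf_diff[OF s[of S] s[of T]] suminf_mult[OF s[of T], of c]
    by (simp_all add: \<omega> blinfun.add_left blinfun.diff_left scaleC_op.rep_eq cinner_simps)
qed

lemma vector_functional_normal: "(\<lambda>T. cinner (blinfun_apply T \<xi>) \<eta>) \<in> normal_functionals"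
proof -
  define x y where "x n = (if n = 0 then \<xi> else 0)" and "y n = (if n = 0 then \<eta> else 0)" for n :: nat
  have x: "x 0 = \<xi>" "y 0 = \<eta>" "\<And>n. n \<noteq> 0 \<Longrightarrow> x n = 0" "\<And>n. n \<noteq> 0 \<Longrightarrow> y n = 0" by (simp_all add: x_def y_def)
  have eq: "cinner (blinfun_apply T \<xi>) \<eta> = (\<Sum>n. cinner (blinfun_apply T (x n)) (y n))" for T
    using suminf_finite[of "{0}" "\<lambda>n. cinner (blinfun_apply T (x n)) (y n)"] x by simp
  have "summable (\<lambda>n. (norm (x n))\<^sup>2)" "summable (\<lambda>n. (norm (y n))\<^sup>2)"
    using summable_finite[of "{0}" "\<lambda>n. (norm (x n))\<^sup>2"] summable_finite[of "{0}" "\<lambda>n. (norm (y n))\<^sup>2"] x by simp_all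
  then show ?thesis
    unfolding normal_functionals_def mem_Collect_eq
    by (intro exI[of _ x] exI[of _ y] conjI ext eq)
qed

text \<open>Vector functionals are normal and separate operators, so the description behind
  \<open>weak_star_integral\<close> has at most one solution. I stays arbitrary in order to cover
  Haar integrals and complex measures alike.\<close>

lemma weak_star_integral_eq:
  assumes "T \<in> BH" "\<And>\<omega>. \<omega> \<in> normal_functionals \<Longrightarrow> \<omega> T = I (\<lambda>s. \<omega> (F s))"
  shows "weak_star_integral I F = T"
  unfolding weak_star_integral_def
proof (rule the_equality)
  show "T \<in> BH \<and> (\<forall>\<omega>\<in>normal_functionals. \<omega> T = I (\<lambda>s. \<omega> (F s)))"
    by (intro conjI ballI assms)
  fix S assume S: "S \<in> BH \<and> (\<forall>\<omega>\<in>normal_functionals. \<omega> S = I (\<lambda>s. \<omega> (F s)))"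
  show "S = T"
  proof (rule blinfun_ext_cinner)
    fix x y
    have "cinner (S x) y = I (\<lambda>s. cinner (F s x) y)"
      by (rule bspec[OF conjunct2[OF S] vector_functional_normal])
    also have "\<dots> = cinner (T x) y"
      by (rule assms(2)[OF vector_functional_normal, symmetric])
    finally show "cinner (S x) y = cinner (T x) y" .
  qed
qed

text \<open>The form of T is integrated directly. Passing from vector functionals to normal ones
  exchanges a series with an integral; this is allowed because the integrals of the absolute values
  are dominated by \<open>?G\<close> times the product of two square-summable sequences.\<close>

theorem weak_integral_exists:
  fixes F :: "'s \<Rightarrow> ('h::complex_hilbert \<Rightarrow>\<^sub>L 'h)"
  assumes BH: "\<And>s. F s \<in> BH"
    and meas: "\<And>\<xi> \<eta>. (\<lambda>s. cinner (F s \<xi>) \<eta>) \<in> borel_measurable M"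
    and g: "integrable M g" and bound: "\<And>s. norm (F s) \<le> g s"
  obtains T where "T \<in> BH" "\<And>\<omega>. \<omega> \<in> normal_functionals \<Longrightarrow> \<omega> T = (\<integral>s. \<omega> (F s) \<partial>M)"
    "\<And>\<omega>. \<omega> \<in> normal_functionals \<Longrightarrow> integrable M (\<lambda>s. \<omega> (F s))"
proof -
  let ?b = "\<lambda>\<xi> \<eta>. \<integral>s. cinner (F s \<xi>) \<eta> \<partial>M" and ?G = "integral\<^sup>L M g"
  have le: "cmod (cinner (F s \<xi>) \<eta>) \<le> g s * (norm \<xi> * norm \<eta>)" for s \<xi> \<eta>
    using cmod_cinner_blinfun_le[of "F s" \<xi> \<eta>] mult_right_mono[OF bound[of s], of "norm \<xi> * norm \<eta>"]
    by simp
  have gi: "integrable M (\<lambda>s. g s * c)" for c using g by simp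
  note int = norm_integral_le(1)[OF meas gi le]
  have b_le: "cmod (?b \<xi> \<eta>) \<le> ?G * norm \<xi> * norm \<eta>" for \<xi> \<eta>
    using norm_integral_le(2)[OF meas gi le, of \<xi> \<eta>] by (simp add: mult.assoc)
  have abs_le: "(\<integral>s. cmod (cinner (F s \<xi>) \<eta>) \<partial>M) \<le> ?G * (norm \<xi> * norm \<eta>)" for \<xi> \<eta>
    using integral_mono[OF integrable_norm[OF int] gi le, of \<xi> \<eta>] by simp
  obtain T where T: "T \<in> BH" "\<And>\<xi> \<eta>. cinner (T \<xi>) \<eta> = ?b \<xi> \<eta>"
  proof (rule sesquilinear_form_operator[of ?b ?G])
    fix x y z :: 'h and c
    show "?b (x + y) z = ?b x z + ?b y z"
      by (simp only: blinfun.add_right cinner_add_left Bochner_Integration.integral_add[OF int int])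
    show "?b x (y + z) = ?b x y + ?b x z"
      by (simp only: cinner_add_right Bochner_Integration.integral_add[OF int int])
    show "?b (c *\<^sub>C x) z = c * ?b x z"
      by (simp only: BH_D[OF BH] cinner_scaleC_left integral_mult_right_zero)
    show "?b x (c *\<^sub>C z) = cnj c * ?b x z"
      by (simp only: cinner_scaleC_right integral_mult_right_zero)
  qed (use b_le in blast)+
  have "\<omega> T = (\<integral>s. \<omega> (F s) \<partial>M) \<and> integrable M (\<lambda>s. \<omega> (F s))"
    if normal: "\<omega> \<in> normal_functionals" for \<omega>
  proof -
    obtain \<xi> \<eta> :: "nat \<Rightarrow> 'h" where \<omega>: "\<omega> = (\<lambda>T. \<Sum>n. cinner (blinfun_apply T (\<xi> n)) (\<eta> n))"
      and sq: "summable (\<lambda>n. (norm (\<xi> n))\<^sup>2)" "summable (\<lambda>n. (norm (\<eta> n))\<^sup>2)"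
      using normal unfolding normal_functionals_def by blast
    have summable: "summable (\<lambda>n. \<integral>s. norm (cinner (F s (\<xi> n)) (\<eta> n)) \<partial>M)"
      by (rule summable_comparison_test'[OF summable_mult[OF summable_norm_mult[OF sq], of ?G]])
        (simp add: abs_le)
    note * = int summable_cinner_blinfun[OF sq, THEN AE_I2] summable
    show ?thesis
      unfolding \<omega> T(2) using integral_suminf[OF *] integrable_suminf[OF *] by simp
  qed
  with T(1) that show thesis by blast
qed

section \<open>Integration against complex measures\<close>

lemma M_space_sums:
  assumes "\<mu> \<in> M_space" "\<And>n. A n \<in> sets borel" "disjoint_family A"
  shows "(\<lambda>n. \<mu> (A n)) sums \<mu> (\<Union>n. A n)"
proof -
  have "range A \<subseteq> sets borel \<and> disjoint_family A" using assms(2,3) by auto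
  then show ?thesis using assms(1) unfolding M_space_def mem_Collect_eq by blast
qed

lemma M_space_empty:
  assumes "\<mu> \<in> M_space"
  shows "\<mu> {} = 0"
proof -
  have "(\<lambda>n::nat. \<mu> {}) sums \<mu> {}"
    using M_space_sums[OF assms, of "\<lambda>_. {}"] by (auto simp: disjoint_family_on_def)
  then have "(\<lambda>n::nat. \<mu> {}) \<longlonglongrightarrow> 0" by (intro summable_LIMSEQ_zero sums_summable)
  then show ?thesis by (simp add: LIMSEQ_const_iff)
qed

text \<open>B and its complement in A form a partition of A; the empty set has to be removed, since
  partition blocks are non-empty.\<close>

lemma cmod_le_total_variation:
  assumes "\<mu> \<in> M_space" "A \<in> sets borel" "B \<in> sets borel" "B \<subseteq> A"
  shows "ennreal (cmod (\<mu> B)) \<le> total_variation \<mu> A"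
proof -
  let ?P = "{B, A - B} - {{}}"
  have "partition_on A ?P" using assms(4) by (auto simp: partition_on_def disjoint_def)
  then have "(\<Sum>B\<in>?P. ennreal (cmod (\<mu> B))) \<le> total_variation \<mu> A"
    unfolding total_variation_def using assms by (intro SUP_upper) auto
  moreover have "ennreal (cmod (\<mu> B)) \<le> (\<Sum>B\<in>?P. ennreal (cmod (\<mu> B)))"
  proof (cases "B = {}")
    case False
    then show ?thesis by (intro member_le_sum) auto
  qed (simp add: M_space_empty[OF assms(1)])
  ultimately show ?thesis by (rule order_trans[rotated])
qed

lemma SUP_add_SUP_le_ennreal:
  fixes c :: ennreal
  assumes "I \<noteq> {}" "J \<noteq> {}" "\<And>i j. i \<in> I \<Longrightarrow> j \<in> J \<Longrightarrow> f i + g j \<le> c"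
  shows "(SUP i\<in>I. f i) + (SUP j\<in>J. g j) \<le> c"
  unfolding ennreal_SUP_add_left[OF assms(1), symmetric]
  by (rule SUP_least, subst ennreal_SUP_add_right[OF assms(2)], rule SUP_least, rule assms(3))

text \<open>Partitions of the two sets combine into one of the union. Applied to a compact set and
  its complement, this turns inner regularity into smallness of the complement.\<close>

lemma total_variation_superadditive:
  assumes "A \<in> sets borel" "B \<in> sets borel" "A \<inter> B = {}"
  shows "total_variation \<mu> A + total_variation \<mu> B \<le> total_variation \<mu> (A \<union> B)"
proof -
  let ?S = "\<lambda>A. {P. finite P \<and> P \<subseteq> sets borel \<and> partition_on A P}"
  let ?v = "\<lambda>P. \<Sum>B\<in>P. ennreal (cmod (\<mu> B))"
  have ne: "?S A \<noteq> {}" if "A \<in> sets borel" for A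
  proof -
    have "{A} - {{}} \<in> ?S A" using that by (auto simp: partition_on_def disjoint_def)
    then show ?thesis by blast
  qed
  have "?v P + ?v Q \<le> total_variation \<mu> (A \<union> B)" if P: "P \<in> ?S A" and Q: "Q \<in> ?S B" for P Q
  proof -
    have PQ: "partition_on A P" "partition_on B Q" using P Q by simp_all
    \<comment> \<open>The families share no block, as blocks are non-empty and lie in disjoint sets;
      the two sums therefore add up to the sum over the union.\<close>
    have "P \<inter> Q = {}"
    proof (rule equals0I)
      fix C assume C: "C \<in> P \<inter> Q"
      then have "C \<subseteq> A \<inter> B" "C \<noteq> {}"
        using partition_onD1[OF PQ(1)] partition_onD1[OF PQ(2)] partition_onD3[OF PQ(1)] by auto
      then show False using assms(3) by simp
    qed
    then have eq: "?v P + ?v Q = ?v (P \<union> Q)" using P Q by (intro sum.union_disjoint[symmetric]) auto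
    have "disjoint (P \<union> Q)"
      using partition_onD1[OF PQ(1)] partition_onD1[OF PQ(2)] partition_onD2[OF PQ(1)]
        partition_onD2[OF PQ(2)] assms(3) by (intro disjoint_union) auto
    then have "partition_on (A \<union> B) (P \<union> Q)"
      using PQ by (auto simp: partition_on_def)
    then have "P \<union> Q \<in> ?S (A \<union> B)"
      using P Q by simp
    then show ?thesis
      unfolding total_variation_def eq by (rule SUP_upper)
  qed
  then show ?thesis
    unfolding total_variation_def[of \<mu> A] total_variation_def[of \<mu> B]
    by (intro SUP_add_SUP_le_ennreal ne assms(1,2))
qed

text \<open>Inner regularity of the whole space provides K; superadditivity then bounds the
  variation off K, after cancelling the variation of K.\<close>

lemma total_variation_tight:
  assumes "\<mu> \<in> M_space" "0 < e"
  obtains K where "compact K" "K \<in> sets borel" "total_variation \<mu> (- K) < ennreal e"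
proof -
  let ?V = "total_variation \<mu> UNIV"
  have fin: "?V < \<infinity>" and
    inner: "?V = (SUP K \<in> {K. compact K \<and> K \<in> sets borel \<and> K \<subseteq> UNIV}. total_variation \<mu> K)"
    using assms(1) unfolding M_space_def mem_Collect_eq by (blast, metis (no_types) sets.top space_borel)
  have "\<exists>K. compact K \<and> K \<in> sets borel \<and> ?V < total_variation \<mu> K + ennreal e"
  proof (rule ccontr)
    assume "\<not> ?thesis"
    then have *: "total_variation \<mu> K + ennreal e \<le> ?V" if "compact K" "K \<in> sets borel" for K
      using that by (meson not_le)
    \<comment> \<open>Taking the supremum over K would give V + e \<le> V, which is impossible for
      finite V.\<close>
    have "?V + ennreal e = (SUP K \<in> {K. compact K \<and> K \<in> sets borel \<and> K \<subseteq> UNIV}. total_variation \<mu> K + ennreal e)"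
      by (subst inner, subst ennreal_SUP_add_left) auto
    also have "\<dots> \<le> ?V" by (rule SUP_least) (use * in auto)
    finally show False using fin assms(2)
      by (metis add.right_neutral ennreal_add_left_cancel_le ennreal_eq_0_iff infinity_ennreal_def
          le_zero_eq less_irrefl not_le)
  qed
  then obtain K where K: "compact K" "K \<in> sets borel" "?V < total_variation \<mu> K + ennreal e" by blast
  have "total_variation \<mu> K + total_variation \<mu> (- K) \<le> ?V"
    using total_variation_superadditive[of K "- K" \<mu>] K(2) by (simp add: Compl_partition)
  from le_less_trans[OF this K(3)]
  have "total_variation \<mu> K + total_variation \<mu> (- K) < total_variation \<mu> K + ennreal e" .
  then have "total_variation \<mu> (- K) < ennreal e" by (simp add: ennreal_add_left_cancel_less)
  with K that show thesis by blast
qed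

text \<open>Only an inequality, because \<open>ennreal\<close> truncates negative numbers to
  0.\<close>

lemma ennreal_add_le: "ennreal (a + b) \<le> ennreal a + ennreal b"
  unfolding ennreal_plus_if by (rule ennreal_leI) auto

lemma ennreal_sum_le: "ennreal (\<Sum>i\<in>A. f i) \<le> (\<Sum>i\<in>A. ennreal (f i))"
proof (induction A rule: infinite_finite_induct)
  case (insert a A)
  have "ennreal (sum f (insert a A)) \<le> ennreal (f a) + ennreal (sum f A)"
    unfolding sum.insert[OF insert(1,2)] by (rule ennreal_add_le)
  also have "\<dots> \<le> ennreal (f a) + (\<Sum>i\<in>A. ennreal (f i))"
    using insert by (intro add_left_mono)
  finally show ?case unfolding sum.insert[OF insert(1,2)] .
qed simp_all

section \<open>Jordan parts of complex measures\<close>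

lemma sets_jordan_pos [simp, measurable_cong]: "sets (jordan_pos \<nu>) = sets borel"
  using sets.sets_measure_of_eq[of borel] unfolding jordan_pos_def space_borel .

lemma space_jordan_pos [simp]: "space (jordan_pos \<nu>) = UNIV"
  using sets_eq_imp_space_eq[OF sets_jordan_pos] unfolding space_borel .

text \<open>\<open>measure_of\<close> returns the given set function only once that function is
  known to be countably additive. Superadditivity joins competitors C and D of disjoint sets;
  countable subadditivity cuts a competitor B along the sets \<open>A n\<close>.\<close>

lemma emeasure_jordan_pos:
  fixes \<nu> :: "'g::topological_space set \<Rightarrow> real"
  assumes sums: "\<And>A. (\<And>n::nat. A n \<in> sets borel) \<Longrightarrow> disjoint_family A \<Longrightarrow> (\<lambda>n. \<nu> (A n)) sums \<nu> (\<Union>n. A n)"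
    and empty: "\<nu> {} = 0" and A: "A \<in> sets borel"
  shows "emeasure (jordan_pos \<nu>) A = (SUP B \<in> {B \<in> sets borel. B \<subseteq> A}. ennreal (\<nu> B))"
proof -
  define p where "p A = (SUP B \<in> {B \<in> sets borel. B \<subseteq> A}. ennreal (\<nu> B))" for A
  have union: "\<nu> (B \<union> C) = \<nu> B + \<nu> C" if BC: "B \<in> sets borel" "C \<in> sets borel" "B \<inter> C = {}" for B C
  proof -
    let ?f = "\<lambda>n::nat. if n = 0 then B else if n = 1 then C else {}"
    have "(\<lambda>n. \<nu> (?f n)) sums \<nu> (\<Union>n. ?f n)"
      using BC by (intro sums) (auto simp: disjoint_family_on_def)
    moreover have "(\<Union>n. ?f n) = B \<union> C" by (auto split: if_splits)
    moreover have "(\<lambda>n. \<nu> (?f n)) sums (\<Sum>n\<in>{0,1}. \<nu> (?f n))"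
      by (rule sums_finite) (auto simp: empty)
    ultimately show ?thesis using sums_unique2 by fastforce
  qed
  have super: "p A + p B \<le> p (A \<union> B)" if "A \<inter> B = {}" for A B
  proof -
    have "ennreal (\<nu> C) + ennreal (\<nu> D) \<le> p (A \<union> B)"
      if CD: "C \<in> {C \<in> sets borel. C \<subseteq> A}" "D \<in> {D \<in> sets borel. D \<subseteq> B}" for C D
    proof -
      have upper: "ennreal (\<nu> E) \<le> p (A \<union> B)" if "E \<in> sets borel" "E \<subseteq> A \<union> B" for E
        unfolding p_def using that by (intro SUP_upper) auto
      have "\<nu> (C \<union> D) = \<nu> C + \<nu> D" using CD \<open>A \<inter> B = {}\<close> by (intro union) auto
      moreover have "ennreal (\<nu> C) \<le> p (A \<union> B)" "ennreal (\<nu> D) \<le> p (A \<union> B)"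
        "ennreal (\<nu> (C \<union> D)) \<le> p (A \<union> B)"
        using CD by (intro upper; blast intro: sets.Un)+
      \<comment> \<open>C \<union> D is the competitor when both values are non-negative. A negative
        value is truncated to 0, and then the other set alone suffices.\<close>
      ultimately show ?thesis
        by (cases "0 \<le> \<nu> C"; cases "0 \<le> \<nu> D") (simp_all only: ennreal_plus_if if_True if_False simp_thms)
    qed
    then show ?thesis
      unfolding p_def[of A] p_def[of B] by (intro SUP_add_SUP_le_ennreal) auto
  qed
  have "countably_additive (sets borel) p"
  proof (rule countably_additiveI)
    fix A :: "nat \<Rightarrow> 'g set"
    assume A: "range A \<subseteq> sets borel" "disjoint_family A"
    show "(\<Sum>n. p (A n)) = p (\<Union>n. A n)"
    proof (rule antisym)
      have "(\<Sum>n<N. p (A n)) \<le> p (\<Union>n<N. A n)" for N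
      proof (induction N)
        case (Suc N)
        have "(\<Union>n<N. A n) \<inter> A N = {}"
          using A(2) unfolding disjoint_family_on_def by (auto dest: less_imp_neq)
        have "(\<Sum>n<Suc N. p (A n)) = (\<Sum>n<N. p (A n)) + p (A N)" by simp
        also have "\<dots> \<le> p (\<Union>n<N. A n) + p (A N)" by (rule add_right_mono[OF Suc])
        also have "\<dots> \<le> p ((\<Union>n<N. A n) \<union> A N)" by (rule super) fact
        also have "(\<Union>n<N. A n) \<union> A N = (\<Union>n<Suc N. A n)" by (auto simp: lessThan_Suc)
        finally show ?case .
      qed simp
      also have "p (\<Union>n<N. A n) \<le> p (\<Union>n. A n)" for N
        unfolding p_def by (rule SUP_subset_mono) auto
      finally show "(\<Sum>n. p (A n)) \<le> p (\<Union>n. A n)" by (simp add: suminf_eq_SUP SUP_least)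
      show "p (\<Union>n. A n) \<le> (\<Sum>n. p (A n))"
        unfolding p_def[of "\<Union>n. A n"]
      proof (rule SUP_least)
        fix B assume B: "B \<in> {B \<in> sets borel. B \<subseteq> (\<Union>n. A n)}"
        have "(\<lambda>n. \<nu> (B \<inter> A n)) sums \<nu> (\<Union>n. B \<inter> A n)"
          using A B by (intro sums) (auto simp: disjoint_family_on_def)
        moreover have "(\<Union>n. B \<inter> A n) = B" using B by auto
        ultimately have "(\<lambda>N. ennreal (\<Sum>n<N. \<nu> (B \<inter> A n))) \<longlonglongrightarrow> ennreal (\<nu> B)"
          by (intro tendsto_ennrealI) (simp add: sums_def)
        moreover have "ennreal (\<Sum>n<N. \<nu> (B \<inter> A n)) \<le> (\<Sum>n. p (A n))" for N
        proof -
          have "ennreal (\<Sum>n<N. \<nu> (B \<inter> A n)) \<le> (\<Sum>n<N. ennreal (\<nu> (B \<inter> A n)))"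
            by (rule ennreal_sum_le)
          also have "\<dots> \<le> (\<Sum>n<N. p (A n))"
            unfolding p_def using A B by (intro sum_mono SUP_upper) auto
          also have "\<dots> \<le> (\<Sum>n. p (A n))" by (rule sum_le_suminf) auto
          finally show ?thesis .
        qed
        ultimately show "ennreal (\<nu> B) \<le> (\<Sum>n. p (A n))"
          by (intro LIMSEQ_le_const2) auto
      qed
    qed
  qed
  moreover have "positive (sets borel) p" by (simp add: positive_def p_def empty Collect_conv_if)
  ultimately have "emeasure (jordan_pos \<nu>) A = p A"
    using A by (intro emeasure_measure_of[of "jordan_pos \<nu>" UNIV "sets borel" p])
      (simp_all only: sets_jordan_pos Pow_UNIV subset_UNIV, simp only: jordan_pos_def p_def[abs_def])
  then show ?thesis by (simp add: p_def)
qed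

text \<open>A list, so that the four summands of \<open>cm_integral\<close> are addressed by an
  index and treated uniformly; the order is that of the summands.\<close>

definition jordan_parts :: "('g::topological_space set \<Rightarrow> complex) \<Rightarrow> 'g measure list" where
  "jordan_parts \<mu> = map jordan_pos [\<lambda>A. Re (\<mu> A), \<lambda>A. - Re (\<mu> A), \<lambda>A. Im (\<mu> A), \<lambda>A. - Im (\<mu> A)]"

lemma sets_jordan_parts: "M \<in> set (jordan_parts \<mu>) \<Longrightarrow> sets M = sets borel"
  by (auto simp: jordan_parts_def)

lemma emeasure_jordan_parts_le:
  assumes \<mu>: "\<mu> \<in> M_space" and M: "M \<in> set (jordan_parts \<mu>)" and A: "A \<in> sets borel"
  shows "emeasure M A \<le> total_variation \<mu> A"
proof -
  obtain \<nu> where \<nu>: "M = jordan_pos \<nu>"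
    "\<nu> \<in> {\<lambda>A. Re (\<mu> A), \<lambda>A. - Re (\<mu> A), \<lambda>A. Im (\<mu> A), \<lambda>A. - Im (\<mu> A)}"
    using M by (auto simp: jordan_parts_def)
  have "(\<lambda>n. \<nu> (A n)) sums \<nu> (\<Union>n. A n)"
    if "\<And>n::nat. A n \<in> sets borel" "disjoint_family A" for A
    using M_space_sums[OF \<mu> that] \<nu>(2) by (auto intro: sums_Re sums_Im sums_minus)
  moreover have "\<nu> {} = 0" using \<nu>(2) M_space_empty[OF \<mu>] by auto
  ultimately have "emeasure M A = (SUP B \<in> {B \<in> sets borel. B \<subseteq> A}. ennreal (\<nu> B))"
    unfolding \<nu>(1) using A by (rule emeasure_jordan_pos)
  also have "\<dots> \<le> total_variation \<mu> A"
  proof (rule SUP_least)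
    fix B assume B: "B \<in> {B \<in> sets borel. B \<subseteq> A}"
    have "\<nu> B \<le> cmod (\<mu> B)"
      using \<nu>(2) abs_Re_le_cmod[of "\<mu> B"] abs_Im_le_cmod[of "\<mu> B"] by auto
    then show "ennreal (\<nu> B) \<le> total_variation \<mu> A"
      using cmod_le_total_variation[OF \<mu> A, of B] B by (auto intro: order_trans ennreal_leI)
  qed
  finally show ?thesis .
qed

lemma finite_measure_jordan_parts:
  assumes "\<mu> \<in> M_space" "M \<in> set (jordan_parts \<mu>)"
  shows "finite_measure M"
proof (rule finite_measureI)
  have "total_variation \<mu> UNIV < \<infinity>" using assms(1) unfolding M_space_def mem_Collect_eq by blast
  then show "emeasure M (space M) \<noteq> \<infinity>"
    using emeasure_jordan_parts_le[OF assms, of UNIV] sets_eq_imp_space_eq[OF sets_jordan_parts[OF assms(2)]]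
    by (auto simp: top.extremum_strict dest: le_less_trans)
qed

text \<open>Integrands on which \<open>cm_integral\<close> is additive: all four parts are finite
  measures, so each of them integrates every such function.\<close>

definition bounded_borel :: "('g::topological_space \<Rightarrow> complex) set" where
  "bounded_borel = {f \<in> borel_measurable borel. \<exists>b. \<forall>s. cmod (f s) \<le> b}"

lemma bounded_borelI:
  "f \<in> borel_measurable borel \<Longrightarrow> (\<And>s. cmod (f s) \<le> b) \<Longrightarrow> f \<in> bounded_borel"
  by (auto simp: bounded_borel_def)

lemma integrable_jordan_parts:
  assumes "\<mu> \<in> M_space" "M \<in> set (jordan_parts \<mu>)" "f \<in> bounded_borel"
  shows "integrable M f"
proof -
  obtain b where b: "\<And>s. cmod (f s) \<le> b" and [measurable]: "f \<in> borel_measurable borel"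
    using assms(3) unfolding bounded_borel_def by blast
  have [measurable_cong]: "sets M = sets borel" by (rule sets_jordan_parts[OF assms(2)])
  show ?thesis
    by (rule finite_measure.integrable_const_bound[OF finite_measure_jordan_parts[OF assms(1,2)], of _ b])
      (use b in auto)
qed

lemma bounded_borel_add:
  assumes "f \<in> bounded_borel" "g \<in> bounded_borel" shows "(\<lambda>s. f s + g s) \<in> bounded_borel"
proof -
  obtain b c where "\<And>s. cmod (f s) \<le> b" "\<And>s. cmod (g s) \<le> c"
    using assms unfolding bounded_borel_def by blast
  then have "cmod (f s + g s) \<le> b + c" for s by (meson norm_triangle_mono)
  with assms show ?thesis unfolding bounded_borel_def by (blast intro: borel_measurable_add)
qed

lemma bounded_borel_mult:
  assumes "f \<in> bounded_borel" "g \<in> bounded_borel" shows "(\<lambda>s. f s * g s) \<in> bounded_borel"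
proof -
  obtain b c where "\<And>s. cmod (f s) \<le> b" "\<And>s. cmod (g s) \<le> c"
    using assms unfolding bounded_borel_def by blast
  then have "cmod (f s * g s) \<le> b * c" for s
    by (simp add: norm_mult) (meson mult_mono norm_ge_zero order_trans)
  with assms show ?thesis unfolding bounded_borel_def by (blast intro: borel_measurable_times)
qed

lemma bounded_borel_const: "(\<lambda>s. c) \<in> bounded_borel"
  by (rule bounded_borelI[of _ "cmod c"]) auto

lemma bounded_borel_diff:
  assumes "f \<in> bounded_borel" "g \<in> bounded_borel" shows "(\<lambda>s. f s - g s) \<in> bounded_borel"
  using bounded_borel_add[OF assms(1) bounded_borel_mult[OF bounded_borel_const[of "-1"] assms(2)]] by simp

lemma bounded_borel_sum:
  assumes "\<And>i. i \<in> A \<Longrightarrow> f i \<in> bounded_borel" shows "(\<lambda>s. \<Sum>i\<in>A. f i s) \<in> bounded_borel"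
  using assms by (induction A rule: infinite_finite_induct) (auto intro: bounded_borel_add bounded_borel_const)

lemma cm_integral_parts:
  "cm_integral \<mu> f = (integral\<^sup>L (jordan_parts \<mu> ! 0) f - integral\<^sup>L (jordan_parts \<mu> ! 1) f) +
     \<i> * (integral\<^sup>L (jordan_parts \<mu> ! 2) f - integral\<^sup>L (jordan_parts \<mu> ! 3) f)"
  by (simp add: cm_integral_def jordan_parts_def numeral_2_eq_2 numeral_3_eq_3)

lemma jordan_parts_nth_mem: "k < 4 \<Longrightarrow> jordan_parts \<mu> ! k \<in> set (jordan_parts \<mu>)"
  by (rule nth_mem) (simp add: jordan_parts_def)

context
  fixes \<mu> :: "'g::topological_space set \<Rightarrow> complex"
  assumes \<mu>: "\<mu> \<in> M_space"
begin

lemma cm_integral_add: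
  "f \<in> bounded_borel \<Longrightarrow> g \<in> bounded_borel \<Longrightarrow>
    cm_integral \<mu> (\<lambda>s. f s + g s) = cm_integral \<mu> f + cm_integral \<mu> g"
  by (simp add: cm_integral_parts Bochner_Integration.integral_add integrable_jordan_parts[OF \<mu> jordan_parts_nth_mem] algebra_simps)

lemma cm_integral_cmult: "cm_integral \<mu> (\<lambda>s. c * f s) = c * cm_integral \<mu> f"
  by (simp add: cm_integral_parts algebra_simps)

lemma cm_integral_diff:
  "f \<in> bounded_borel \<Longrightarrow> g \<in> bounded_borel \<Longrightarrow>
    cm_integral \<mu> (\<lambda>s. f s - g s) = cm_integral \<mu> f - cm_integral \<mu> g"
  by (simp add: cm_integral_parts Bochner_Integration.integral_diff integrable_jordan_parts[OF \<mu> jordan_parts_nth_mem] algebra_simps)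

lemma cm_integral_sum:
  "(\<And>i. i \<in> A \<Longrightarrow> f i \<in> bounded_borel) \<Longrightarrow>
    cm_integral \<mu> (\<lambda>s. \<Sum>i\<in>A. f i s) = (\<Sum>i\<in>A. cm_integral \<mu> (f i))"
proof (induction A rule: infinite_finite_induct)
  case (insert a A)
  then show ?case by (simp add: cm_integral_add bounded_borel_sum)
qed (simp_all add: cm_integral_parts)

text \<open>V depends on \<mu> alone and K on \<mu> and e alone, so K can be fixed before the
  function is constructed. Every later estimate of \<open>cm_integral\<close> goes through this
  bound: a controls f on K, while off K only the global bound b enters, with weight e.\<close>

theorem cm_integral_tight_bound:
  obtains V where "0 \<le> V"
    "\<And>e. 0 < e \<Longrightarrow> \<exists>K. compact K \<and> (\<forall>f a b. f \<in> borel_measurable borel \<longrightarrow> 0 \<le> a \<longrightarrow>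
       (\<forall>s\<in>K. cmod (f s) \<le> a) \<longrightarrow> (\<forall>s. cmod (f s) \<le> b) \<longrightarrow> cmod (cm_integral \<mu> f) \<le> V * a + e * b)"
proof -
  let ?J = "jordan_parts \<mu>"
  define V where "V = (\<Sum>k<4. measure (?J ! k) UNIV)"
  have "\<exists>K. compact K \<and> (\<forall>f a b. f \<in> borel_measurable borel \<longrightarrow> 0 \<le> a \<longrightarrow>
       (\<forall>s\<in>K. cmod (f s) \<le> a) \<longrightarrow> (\<forall>s. cmod (f s) \<le> b) \<longrightarrow> cmod (cm_integral \<mu> f) \<le> V * a + e * b)"
    if "0 < e" for e
  proof -
    \<comment> \<open>The four Jordan parts share the error.\<close>
    have "0 < e / 4" using that by simp
    then obtain K where K: "compact K" "K \<in> sets borel" "total_variation \<mu> (- K) < ennreal (e/4)"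
      by (rule total_variation_tight[OF \<mu>])
    have "cmod (cm_integral \<mu> f) \<le> V * a + e * b"
      if f: "f \<in> borel_measurable borel" "0 \<le> a" "\<forall>s\<in>K. cmod (f s) \<le> a" "\<forall>s. cmod (f s) \<le> b" for f a b
    proof -
      have "0 \<le> b" using f(4) norm_ge_zero order_trans by blast
      have part: "cmod (integral\<^sup>L (?J ! k) f) \<le> measure (?J ! k) UNIV * a + (e/4) * b" if "k < 4" for k
      proof -
        let ?M = "?J ! k"
        note mem = jordan_parts_nth_mem[OF that, of \<mu>]
        have [measurable_cong]: "sets ?M = sets borel" by (rule sets_jordan_parts[OF mem])
        interpret finite_measure ?M by (rule finite_measure_jordan_parts[OF \<mu> mem])
        have [simp]: "space ?M = UNIV" using sets_eq_imp_space_eq[OF sets_jordan_parts[OF mem]] by simp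
        have [measurable]: "- K \<in> sets borel" "f \<in> borel_measurable borel" using K f by auto
        have "emeasure ?M (- K) < ennreal (e/4)"
              using le_less_trans[OF emeasure_jordan_parts_le[OF \<mu> mem, of "- K"] K(3)] by simp
        then have "measure ?M (- K) \<le> e/4"
          using \<open>0 < e\<close> by (simp add: emeasure_eq_measure ennreal_less_iff)
        have ind: "integrable ?M (\<lambda>s. indicat_real (- K) s)"
          by (rule integrable_const_bound[of _ 1]) (auto split: split_indicator)
        have int: "integrable ?M (\<lambda>s. a + b * indicat_real (- K) s)"
          by (intro Bochner_Integration.integrable_add integrable_const integrable_mult_right ind)
        have "f \<in> borel_measurable ?M" by measurable
        moreover have "cmod (f s) \<le> a + b * indicat_real (- K) s" for s
          using f \<open>0 \<le> b\<close> by (auto split: split_indicator intro: add_increasing)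
        ultimately have "cmod (integral\<^sup>L ?M f) \<le> (\<integral>s. a + b * indicat_real (- K) s \<partial>?M)"
          by (rule norm_integral_le(2)[OF _ int])
        also have "\<dots> = measure ?M UNIV * a + measure ?M (- K) * b"
          using ind by (subst Bochner_Integration.integral_add) (auto simp: mult.commute)
        also have "\<dots> \<le> measure ?M UNIV * a + (e/4) * b"
          using mult_right_mono[OF \<open>measure ?M (- K) \<le> e/4\<close> \<open>0 \<le> b\<close>] by simp
        finally show ?thesis .
      qed
      have "cmod (cm_integral \<mu> f) \<le> cmod (integral\<^sup>L (?J ! 0) f) + cmod (integral\<^sup>L (?J ! 1) f)
          + (cmod (integral\<^sup>L (?J ! 2) f) + cmod (integral\<^sup>L (?J ! 3) f))"
        unfolding cm_integral_parts
        by (rule order_trans[OF norm_triangle_ineq add_mono])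
          (simp_all add: norm_mult norm_triangle_ineq4)
      also have "\<dots> \<le> V * a + e * b"
        using part[of 0] part[of 1] part[of 2] part[of 3]
        by (simp add: V_def eval_nat_numeral algebra_simps)
      finally show ?thesis .
    qed
    with K(1) show ?thesis by blast
  qed
  moreover have "0 \<le> V" by (simp add: V_def sum_nonneg)
  ultimately show thesis using that by blast
qed

text \<open>The weak integrals against the four finite Jordan parts exist separately and are
  combined as in \<open>cm_integral\<close>.\<close>

lemma cm_weak_integral:
  fixes F :: "'g \<Rightarrow> ('h::complex_hilbert \<Rightarrow>\<^sub>L 'h)"
  assumes BH: "\<And>s. F s \<in> BH"
    and meas: "\<And>\<xi> \<eta>. (\<lambda>s. cinner (F s \<xi>) \<eta>) \<in> borel_measurable borel"
    and bound: "\<And>s. norm (F s) \<le> b"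
  shows "weak_star_integral (cm_integral \<mu>) F \<in> BH"
    "cinner (weak_star_integral (cm_integral \<mu>) F \<xi>) \<eta> = cm_integral \<mu> (\<lambda>s. cinner (F s \<xi>) \<eta>)"
proof -
  let ?J = "jordan_parts \<mu>"
  have "\<exists>T \<in> BH. \<forall>\<omega>\<in>normal_functionals. \<omega> T = (\<integral>s. \<omega> (F s) \<partial>(?J ! k))" if "k < 4" for k
  proof -
    note mem = jordan_parts_nth_mem[OF that, of \<mu>]
    have [measurable_cong]: "sets (?J ! k) = sets borel" by (rule sets_jordan_parts[OF mem])
    interpret finite_measure "?J ! k" by (rule finite_measure_jordan_parts[OF \<mu> mem])
    show ?thesis
    proof (rule weak_integral_exists[of F "?J ! k" "\<lambda>_. b"])
      show "(\<lambda>s. cinner (F s \<xi>) \<eta>) \<in> borel_measurable (?J ! k)" for \<xi> \<eta>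
        using meas[of \<xi> \<eta>] by measurable
    qed (use BH bound in auto)
  qed
  then obtain T where T: "\<And>k. k < 4 \<Longrightarrow> T k \<in> BH"
    "\<And>k \<omega>. k < 4 \<Longrightarrow> \<omega> \<in> normal_functionals \<Longrightarrow> \<omega> (T k) = (\<integral>s. \<omega> (F s) \<partial>(?J ! k))"
    by metis
  define S where "S = (T 0 - T 1) + scaleC_op \<i> (T 2 - T 3)"
  have "S \<in> BH" unfolding S_def by (intro BH_add BH_diff BH_scaleC T) auto
  have S: "\<omega> S = cm_integral \<mu> (\<lambda>s. \<omega> (F s))" if "\<omega> \<in> normal_functionals" for \<omega>
    by (simp add: S_def normal_functional_linear[OF that] T(2)[OF _ that] cm_integral_parts)
  have "weak_star_integral (cm_integral \<mu>) F = S"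
    by (rule weak_star_integral_eq[where F = F and I = "cm_integral \<mu>"]) (fact, rule S)
  moreover have "cinner (S \<xi>) \<eta> = cm_integral \<mu> (\<lambda>s. cinner (F s \<xi>) \<eta>)"
    by (rule S[OF vector_functional_normal])
  ultimately show "weak_star_integral (cm_integral \<mu>) F \<in> BH"
    "cinner (weak_star_integral (cm_integral \<mu>) F \<xi>) \<eta> = cm_integral \<mu> (\<lambda>s. cinner (F s \<xi>) \<eta>)"
    using \<open>S \<in> BH\<close> by simp_all
qed

end

section \<open>Haar measure\<close>

locale haar =
  fixes m :: "'g::{topological_ab_group_add, t2_space} measure"
  assumes haar: "haar_measure m"
begin

lemma sets_m [measurable_cong]: "sets m = sets borel"
  using haar by (simp add: haar_measure_def)

lemma space_m [simp]: "space m = UNIV"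
  using sets_eq_imp_space_eq[OF sets_m] unfolding space_borel .

lemma borel_measurable_m: "borel_measurable m = borel_measurable borel"
  by (rule measurable_cong_sets[OF sets_m refl])

lemma compact_finite: "compact K \<Longrightarrow> emeasure m K < \<infinity>"
  using haar by (simp add: haar_measure_def)

lemma compact_sets: "compact K \<Longrightarrow> K \<in> sets m"
  using sets_m compact_imp_closed borel_closed by blast

lemma outer_open:
  assumes "A \<in> sets borel" "emeasure m A < \<infinity>" "0 < e"
  obtains U where "open U" "A \<subseteq> U" "emeasure m U < emeasure m A + ennreal e"
proof -
  have eq: "emeasure m A = (INF U \<in> {U. open U \<and> A \<subseteq> U}. emeasure m U)"
    using haar assms(1) unfolding haar_measure_def by blast
  have "emeasure m A < emeasure m A + ennreal e"
    using assms(2,3) ennreal_add_left_cancel_less[of "emeasure m A" 0 "ennreal e"] by simp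
  then have "(INF U \<in> {U. open U \<and> A \<subseteq> U}. emeasure m U) < emeasure m A + ennreal e"
    using eq by simp
  then show thesis using that unfolding INF_less_iff by blast
qed

lemma inner_compact_open:
  assumes "open U" "a < emeasure m U"
  obtains K where "compact K" "K \<subseteq> U" "a < emeasure m K"
proof -
  have "emeasure m U = (SUP K \<in> {K. compact K \<and> K \<subseteq> U}. emeasure m K)"
    using haar assms(1) unfolding haar_measure_def by blast
  then have "a < (SUP K \<in> {K. compact K \<and> K \<subseteq> U}. emeasure m K)" using assms(2) by simp
  then show thesis using that unfolding less_SUP_iff by blast
qed

lemma emeasure_diff_less:
  assumes "A \<in> sets borel" "B \<in> sets borel" "A \<subseteq> B" "emeasure m B < emeasure m A + e"
  shows "emeasure m (B - A) < e"
proof -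
  have "emeasure m A + emeasure m (B - A) = emeasure m B"
    using assms by (subst plus_emeasure) (auto simp: sets_m Un_absorb1)
  with assms(4) have "emeasure m A + emeasure m (B - A) < emeasure m A + e" by simp
  then show ?thesis by (simp add: ennreal_add_left_cancel_less)
qed

text \<open>Haar measure is inner regular on open sets by definition. For A of finite measure take
  an open U around A, a compact K in U and an open V around U - A, each up to e/3. Then K - V is
  compact, lies in A, and misses at most the part of A in U - K or in V.\<close>

lemma inner_compact:
  assumes A: "A \<in> sets borel" "emeasure m A < \<infinity>" and "0 < e"
  obtains C where "compact C" "C \<subseteq> A" "emeasure m (A - C) \<le> ennreal e"
proof -
  let ?e = "e / 3"
  have e: "0 < ?e" using assms by simp
  obtain U where U: "open U" "A \<subseteq> U" "emeasure m U < emeasure m A + ennreal ?e"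
    by (rule outer_open[OF A e])
  have UA: "emeasure m (U - A) < ennreal ?e"
    using U A by (intro emeasure_diff_less) auto
  have Ufin: "emeasure m U < \<infinity>"
    using U(3) A(2) by (metis ennreal_add_less_top ennreal_less_top infinity_ennreal_def order_less_trans)
  obtain K where K: "compact K" "K \<subseteq> U" "emeasure m U < emeasure m K + ennreal ?e"
  \<comment> \<open>Subtraction in \<open>ennreal\<close> truncates; if U has measure below e/3, the
    empty set already serves.\<close>
  proof (cases "emeasure m U < ennreal ?e")
    case True
    then show thesis using that[of "{}"] by simp
  next
    case False
    have "emeasure m U \<noteq> 0" using False e by (metis ennreal_0 ennreal_less_zero_iff)
    have "emeasure m U - ennreal ?e < emeasure m U"
      using e Ufin \<open>emeasure m U \<noteq> 0\<close>
      by (intro ennreal_between(1)) (auto simp: zero_less_iff_neq_zero)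
    then obtain K where K: "compact K" "K \<subseteq> U" "emeasure m U - ennreal ?e < emeasure m K"
      by (rule inner_compact_open[OF U(1)])
    have "emeasure m U = (emeasure m U - ennreal ?e) + ennreal ?e"
      using False by (simp add: diff_add_cancel_ennreal)
    also have "\<dots> < emeasure m K + ennreal ?e"
      using K(3) by (metis add.commute ennreal_add_left_cancel_less ennreal_neq_top infinity_ennreal_def)
    finally show thesis using K that by blast
  qed
  have UK: "emeasure m (U - K) < ennreal ?e"
    using U K compact_sets by (intro emeasure_diff_less) (auto simp: sets_m)
  have "emeasure m (U - A) < \<infinity>" using UA by (metis ennreal_less_top infinity_ennreal_def order_less_trans)
  then obtain V where V: "open V" "U - A \<subseteq> V" "emeasure m V < emeasure m (U - A) + ennreal ?e"
    using outer_open[of "U - A" ?e] A U(1) e by auto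
  have "emeasure m (A - (K - V)) \<le> emeasure m ((U - K) \<union> V)"
    using U K V A compact_sets by (intro emeasure_mono) (auto simp: sets_m intro!: sets.Un sets.Diff)
  also have "\<dots> \<le> emeasure m (U - K) + emeasure m V"
    using U K V compact_sets by (intro emeasure_subadditive) (auto simp: sets_m intro!: sets.Diff)
  also have "\<dots> \<le> ennreal ?e + (ennreal ?e + ennreal ?e)"
    by (rule add_mono[OF less_imp_le[OF UK] order_trans[OF less_imp_le[OF V(3)] add_right_mono[OF less_imp_le[OF UA]]]])
  also have "\<dots> = ennreal e" using e by (simp flip: ennreal_plus)
  finally have "emeasure m (A - (K - V)) \<le> ennreal e" .
  moreover have "compact (K - V)" "K - V \<subseteq> A" using K V by (auto intro: compact_diff)
  ultimately show thesis using that by blast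
qed

section \<open>Translations, and approximation in L1 from compact sets\<close>

lemma emeasure_translate: "A \<in> sets borel \<Longrightarrow> emeasure m ((\<lambda>t. s + t) ` A) = emeasure m A"
  using haar by (simp add: haar_measure_def)

lemma measurable_translate [measurable]: "(\<lambda>t. t - s) \<in> borel_measurable (borel :: 'g measure)"
  by (intro borel_measurable_continuous_onI continuous_intros)

lemma distr_translate: "distr m m (\<lambda>t. t - s) = m"
proof (rule measure_eqI)
  fix A assume "A \<in> sets (distr m m (\<lambda>t. t - s))"
  then have A: "A \<in> sets borel" by (simp add: sets_m)
  have "(\<lambda>t. t - s) -` A = (\<lambda>t. s + t) ` A"
    by (auto simp: image_iff algebra_simps intro!: bexI[of _ "x - s" for x])
  then show "emeasure (distr m m (\<lambda>t. t - s)) A = emeasure m A"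
    using A emeasure_translate[OF A, of s]
    by (subst emeasure_distr) (simp_all add: sets_m measurable_cong_sets[OF sets_m sets_m])
qed simp

lemma translate_measurable_m: "(\<lambda>t. t - s) \<in> measurable m m"
  by (simp add: measurable_cong_sets[OF sets_m sets_m])

lemma integral_translate:
  fixes f :: "'g \<Rightarrow> 'b::{banach,second_countable_topology}"
  assumes "f \<in> borel_measurable m"
  shows "(\<integral>t. f (t - s) \<partial>m) = integral\<^sup>L m f"
  using integral_distr[OF translate_measurable_m assms, of s] distr_translate[of s] by simp

lemma integrable_translate:
  fixes f :: "'g \<Rightarrow> 'b::{banach,second_countable_topology}"
  assumes "integrable m f"
  shows "integrable m (\<lambda>t. f (t - s))"
  using integrable_distr_eq[OF translate_measurable_m borel_measurable_integrable[OF assms], of s]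
    distr_translate[of s] assms by simp

lemma integrable_indicator_compact: "compact C \<Longrightarrow> integrable m (\<lambda>t. indicator C t *\<^sub>R (c::complex))"
  using compact_sets compact_finite by (intro integrable_scaleR_left integrable_real_indicator) auto

text \<open>Indicators of compact sets replace those of measurable sets, by inner regularity, and
  one limit step in the L1 seminorm replaces dominated pointwise limits. Properties stated up to an
  error pass through that step.\<close>

lemma integrable_compact_induct [consumes 1, case_names base add lim]:
  fixes f :: "'g \<Rightarrow> complex"
  assumes f: "integrable m f"
    and base: "\<And>C c. compact C \<Longrightarrow> P (\<lambda>t. indicator C t *\<^sub>R c)"
    and add: "\<And>f g. integrable m f \<Longrightarrow> P f \<Longrightarrow> integrable m g \<Longrightarrow> P g \<Longrightarrow> P (\<lambda>x. f x + g x)"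
    and lim: "\<And>f. integrable m f \<Longrightarrow> (\<And>e. 0 < e \<Longrightarrow> \<exists>g. integrable m g \<and> P g \<and> (\<integral>t. cmod (f t - g t) \<partial>m) \<le> e) \<Longrightarrow> P f"
  shows "P f"
  using f
proof (induct rule: integrable_induct)
  case (base A c)
  show ?case
  proof (rule lim)
    show "integrable m (\<lambda>x. indicator A x *\<^sub>R c)"
      using base by (intro integrable_scaleR_left integrable_real_indicator)
    fix e :: real assume "0 < e"
    \<comment> \<open>The summand 1 avoids division by zero for c = 0.\<close>
    then have "0 < e / (cmod c + 1)" by (simp add: add_nonneg_pos)
    then obtain C where C: "compact C" "C \<subseteq> A" "emeasure m (A - C) \<le> ennreal (e / (cmod c + 1))"
      using inner_compact[of A] base by (auto simp: sets_m)
    have "measure m (A - C) \<le> e / (cmod c + 1)"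
      using C(3) \<open>0 < e / (cmod c + 1)\<close> by (simp add: measure_def enn2real_leI)
    have "(\<integral>t. cmod (indicator A t *\<^sub>R c - indicator C t *\<^sub>R c) \<partial>m) = (\<integral>t. cmod c * indicat_real (A - C) t \<partial>m)"
      using C(2) by (intro Bochner_Integration.integral_cong) (auto split: split_indicator)
    also have "\<dots> = cmod c * measure m (A - C)" by simp
    also have "\<dots> \<le> (cmod c + 1) * (e / (cmod c + 1))"
      using \<open>measure m (A - C) \<le> e / (cmod c + 1)\<close> \<open>0 < e\<close> by (intro mult_mono) auto
    also have "\<dots> = e" using norm_ge_zero[of c] by (simp add: add_nonneg_pos less_imp_neq[symmetric])
    finally have "(\<integral>t. cmod (indicator A t *\<^sub>R c - indicator C t *\<^sub>R c) \<partial>m) \<le> e" .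
    with C(1) show "\<exists>g. integrable m g \<and> P g \<and> (\<integral>t. cmod (indicator A t *\<^sub>R c - g t) \<partial>m) \<le> e"
      using integrable_indicator_compact[OF C(1), of c] assms(2)[OF C(1), of c] by blast
  qed
next
  case (add f g)
  then show ?case by (intro assms(3))
next
  case (lim f s)
  note [measurable] = borel_measurable_integrable[OF lim(1)] borel_measurable_integrable[OF lim(5)]
  \<comment> \<open>The approximants satisfy |s i| \<le> 2 |f|, so 3 |f| dominates the
    differences.\<close>
  have "(\<lambda>i. \<integral>t. cmod (f t - s i t) \<partial>m) \<longlonglongrightarrow> (\<integral>t. 0 \<partial>m)"
  proof (rule integral_dominated_convergence[where w = "\<lambda>t. 3 * cmod (f t)"])
    show "AE t in m. (\<lambda>i. cmod (f t - s i t)) \<longlonglongrightarrow> 0"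
    proof (rule AE_I2)
      fix t assume "t \<in> space m"
      then have "(\<lambda>i. cmod (f t - s i t)) \<longlonglongrightarrow> cmod (f t - f t)"
        by (intro tendsto_intros lim(3))
      then show "(\<lambda>i. cmod (f t - s i t)) \<longlonglongrightarrow> 0" by simp
    qed
    show "AE t in m. norm (cmod (f t - s i t)) \<le> 3 * cmod (f t)" for i
    proof (rule AE_I2)
      fix t assume "t \<in> space m"
      then show "norm (cmod (f t - s i t)) \<le> 3 * cmod (f t)"
        using lim(4)[of t i] norm_triangle_ineq4[of "f t" "s i t"] by simp
    qed
  qed (use lim(5) in auto)
  then have conv: "(\<lambda>i. \<integral>t. cmod (f t - s i t) \<partial>m) \<longlonglongrightarrow> 0" by simp
  show ?case
  proof (rule assms(4)[OF lim(5)])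
    fix e :: real assume "0 < e"
    then have "\<forall>\<^sub>F i in sequentially. (\<integral>t. cmod (f t - s i t) \<partial>m) < e"
      by (rule order_tendstoD(2)[OF conv])
    then obtain i where "(\<integral>t. cmod (f t - s i t) \<partial>m) < e"
      using eventually_happens'[OF sequentially_bot] by blast
    then show "\<exists>g. integrable m g \<and> P g \<and> (\<integral>t. cmod (f t - g t) \<partial>m) \<le> e"
      using lim(1,2) less_imp_le by blast
  qed
qed

text \<open>Immediate for the indicator of a compact set; sums take the union of two compact sets,
  limits inherit the one of an approximant. It cuts integrals down to a compact set even when the
  group is not sigma-compact.\<close>

lemma L1_tail:
  fixes f :: "'g \<Rightarrow> complex"
  assumes "integrable m f"
  shows "\<forall>e>0. \<exists>K. compact K \<and> (\<integral>t. cmod (f t) * indicator (- K) t \<partial>m) \<le> e"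
  using assms
proof (induct rule: integrable_compact_induct)
  case (base C c)
  have "(\<integral>t. cmod (indicator C t *\<^sub>R c) * indicator (- C) t \<partial>m) = (\<integral>t. 0 \<partial>m)"
    by (intro Bochner_Integration.integral_cong) (auto split: split_indicator)
  then show ?case using base by (intro allI impI exI[of _ C]) simp
next
  case (add f g)
  show ?case
  proof (intro allI impI)
    fix e :: real assume "0 < e"
    then have e: "0 < e/2" by simp
    obtain K where K: "compact K" "(\<integral>t. cmod (f t) * indicator (- K) t \<partial>m) \<le> e/2" using add(2) e by blast
    obtain L where L: "compact L" "(\<integral>t. cmod (g t) * indicator (- L) t \<partial>m) \<le> e/2" using add(4) e by blast
    have meas: "- K \<in> sets m" "- L \<in> sets m" "- (K \<union> L) \<in> sets m"
      using compact_sets K(1) L(1) by (auto simp: sets_m intro!: sets.compl_sets[of _ borel, simplified])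
    have int: "integrable m (\<lambda>t. cmod (h t) * indicator B t)" if "integrable m h" "B \<in> sets m"
      for h :: "'g \<Rightarrow> complex" and B
      using integrable_real_mult_indicator[OF that(2) integrable_norm[OF that(1)]] .
    have "(\<integral>t. cmod (f t + g t) * indicator (- (K \<union> L)) t \<partial>m)
        \<le> (\<integral>t. cmod (f t) * indicator (- K) t + cmod (g t) * indicator (- L) t \<partial>m)"
      by (intro integral_mono int meas Bochner_Integration.integrable_add add)
        (auto split: split_indicator intro: norm_triangle_ineq)
    also have "\<dots> \<le> e/2 + e/2"
      using K(2) L(2) by (subst Bochner_Integration.integral_add) (auto intro: int meas add)
    finally show "\<exists>K. compact K \<and> (\<integral>t. cmod (f t + g t) * indicator (- K) t \<partial>m) \<le> e"
      using compact_Un[OF K(1) L(1)] by (intro exI[of _ "K \<union> L"]) simp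
  qed
next
  case (lim f)
  show ?case
  proof (intro allI impI)
    fix e :: real assume "0 < e"
    then have e: "0 < e/2" by simp
    obtain g where g: "integrable m g" "\<forall>e>0. \<exists>K. compact K \<and> (\<integral>t. cmod (g t) * indicator (- K) t \<partial>m) \<le> e"
      "(\<integral>t. cmod (f t - g t) \<partial>m) \<le> e/2" using lim(2)[OF e] by blast
    obtain K where K: "compact K" "(\<integral>t. cmod (g t) * indicator (- K) t \<partial>m) \<le> e/2" using g(2) e by blast
    have meas: "- K \<in> sets m"
      using compact_sets K(1) by (auto simp: sets_m intro!: sets.compl_sets[of _ borel, simplified])
    have int: "integrable m (\<lambda>t. cmod (h t) * indicator (- K) t)" if "integrable m h"
      for h :: "'g \<Rightarrow> complex"
      using integrable_real_mult_indicator[OF meas integrable_norm[OF that]] .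
    have "(\<integral>t. cmod (f t) * indicator (- K) t \<partial>m)
        \<le> (\<integral>t. cmod (f t - g t) + cmod (g t) * indicator (- K) t \<partial>m)"
      by (intro integral_mono int Bochner_Integration.integrable_add integrable_norm Bochner_Integration.integrable_diff lim g)
        (use norm_triangle_sub[of "f t" "g t" for t] in \<open>auto split: split_indicator simp: add.commute\<close>)
    also have "\<dots> \<le> e/2 + e/2"
      using K(2) g(1,3) lim(1) by (subst Bochner_Integration.integral_add) (auto intro: int)
    finally show "\<exists>K. compact K \<and> (\<integral>t. cmod (f t) * indicator (- K) t \<partial>m) \<le> e"
      using K(1) by (intro exI[of _ K]) simp
  qed
qed

text \<open>For compact C, an open Q around C of almost the same measure and the tube lemma give a
  neighbourhood U of 0 with U + C inside Q; a translate of C by an element of U then differs little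
  from C.\<close>

lemma L1_translation_continuous:
  fixes f :: "'g \<Rightarrow> complex"
  assumes "integrable m f"
  shows "\<forall>e>0. \<exists>U. open U \<and> 0 \<in> U \<and> (\<forall>s\<in>U. (\<integral>t. cmod (f (t - s) - f t) \<partial>m) \<le> e)"
  using assms
proof (induct rule: integrable_compact_induct)
  case (base C c)
  show ?case
  proof (intro allI impI)
    fix e :: real assume "0 < e"
    define d where "d = e / (2 * (cmod c + 1))"
    have c: "0 < cmod c + 1" using norm_ge_zero[of c] by linarith
    have "0 < d" unfolding d_def by (intro divide_pos_pos mult_pos_pos c \<open>0 < e\<close>) simp
    obtain Q where Q: "open Q" "C \<subseteq> Q" "emeasure m Q < emeasure m C + ennreal d"
      by (rule outer_open[OF compact_sets[OF base, unfolded sets_m] compact_finite[OF base] \<open>0 < d\<close>])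
    have QC: "emeasure m (Q - C) < ennreal d"
      using Q compact_sets[OF base] by (intro emeasure_diff_less) (auto simp: sets_m)
    then have "measure m (Q - C) \<le> d"
      using \<open>0 < d\<close> by (simp add: measure_def enn2real_leI less_imp_le)
    have QC_sets: "Q - C \<in> sets m" using Q(1) compact_sets[OF base] by (auto simp: sets_m)
    have "open ((\<lambda>(s,t). s + t) -` Q :: ('g \<times> 'g) set)"
      using Q(1) by (intro open_vimage) (auto simp: case_prod_unfold intro!: continuous_intros)
    moreover have "{0} \<times> C \<subseteq> (\<lambda>(s,t). s + t) -` Q" using Q(2) by auto
    ultimately obtain U W where U: "0 \<in> U" "open U" "C \<subseteq> W" "U \<times> W \<subseteq> (\<lambda>(s,t). s + t) -` Q"
      using tube_lemma_right[of euclidean euclidean "(\<lambda>(s,t). s + t) -` Q :: ('g \<times> 'g) set" C 0] base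
      by (auto simp flip: open_openin)
    have "(\<integral>t. cmod (indicator C (t - s) *\<^sub>R c - indicator C t *\<^sub>R c) \<partial>m) \<le> e" if "s \<in> U" for s
    proof -
      let ?i = "indicat_real C"
      have i: "integrable m ?i" using compact_sets[OF base] compact_finite[OF base] by (intro integrable_real_indicator)
      have i': "integrable m (\<lambda>t. ?i (t - s))" by (rule integrable_translate[OF i])
      have iQ: "integrable m (indicat_real (Q - C))"
        using QC_sets QC by (intro integrable_real_indicator) (auto simp: top.not_eq_extremum intro: less_trans)
      have eq: "(\<integral>t. ?i (t - s) \<partial>m) = (\<integral>t. ?i t \<partial>m)"
        by (rule integral_translate[OF borel_measurable_integrable[OF i]])
      \<comment> \<open>The subtracted bracket integrates to 0 by translation invariance, so only
        twice the measure of Q - C remains.\<close>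
      have pw: "\<bar>?i (t - s) - ?i t\<bar> \<le> 2 * indicat_real (Q - C) t - (?i (t - s) - ?i t)" for t
      proof -
        have "t \<in> Q" if "t - s \<in> C" using U(3,4) \<open>s \<in> U\<close> that by fastforce
        then show ?thesis by (auto simp: indicator_def)
      qed
      have "(\<integral>t. cmod (?i (t - s) *\<^sub>R c - ?i t *\<^sub>R c) \<partial>m) = (\<integral>t. cmod c * \<bar>?i (t - s) - ?i t\<bar> \<partial>m)"
        by (simp add: norm_mult mult.commute flip: scaleR_diff_left)
      also have "\<dots> = cmod c * (\<integral>t. \<bar>?i (t - s) - ?i t\<bar> \<partial>m)" by simp
      finally have 1: "(\<integral>t. cmod (?i (t - s) *\<^sub>R c - ?i t *\<^sub>R c) \<partial>m)
          = cmod c * (\<integral>t. \<bar>?i (t - s) - ?i t\<bar> \<partial>m)" .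
      have "(\<integral>t. \<bar>?i (t - s) - ?i t\<bar> \<partial>m) \<le> (\<integral>t. 2 * indicat_real (Q - C) t - (?i (t - s) - ?i t) \<partial>m)"
        by (rule integral_mono[OF _ _ pw])
          (intro integrable_abs Bochner_Integration.integrable_diff i i' iQ integrable_mult_right)+
      also have "\<dots> = 2 * measure m (Q - C)"
        using i i' iQ eq by simp
      finally have 2: "(\<integral>t. \<bar>?i (t - s) - ?i t\<bar> \<partial>m) \<le> 2 * d"
        using \<open>measure m (Q - C) \<le> d\<close> by linarith
      have "cmod c * (\<integral>t. \<bar>?i (t - s) - ?i t\<bar> \<partial>m) \<le> (cmod c + 1) * (2 * d)"
        by (rule mult_mono[OF _ 2]) auto
      also have "\<dots> = e"
      proof -
        have "x * (2 * (e / (2 * x))) = e" if "0 < x" for x :: real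
          using that by simp
        from this[OF c] show ?thesis unfolding d_def .
      qed
      finally show ?thesis using 1 by simp
    qed
    with U show "\<exists>U. open U \<and> 0 \<in> U \<and> (\<forall>s\<in>U. (\<integral>t. cmod (indicator C (t - s) *\<^sub>R c - indicator C t *\<^sub>R c) \<partial>m) \<le> e)"
      by blast
  qed
next
  case (add f g)
  show ?case
  proof (intro allI impI)
    fix e :: real assume "0 < e"
    then have e: "0 < e/2" by simp
    obtain U where U: "open U" "0 \<in> U" "\<forall>s\<in>U. (\<integral>t. cmod (f (t - s) - f t) \<partial>m) \<le> e/2" using add(2) e by blast
    obtain V where V: "open V" "0 \<in> V" "\<forall>s\<in>V. (\<integral>t. cmod (g (t - s) - g t) \<partial>m) \<le> e/2" using add(4) e by blast
    have "(\<integral>t. cmod (f (t - s) + g (t - s) - (f t + g t)) \<partial>m) \<le> e" if "s \<in> U \<inter> V" for s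
    proof -
      have int: "integrable m (\<lambda>t. cmod (h (t - s) - h t))" if "integrable m h" for h :: "'g \<Rightarrow> complex"
        by (intro integrable_norm Bochner_Integration.integrable_diff integrable_translate that)
      have "(\<integral>t. cmod (f (t - s) + g (t - s) - (f t + g t)) \<partial>m)
          \<le> (\<integral>t. cmod (f (t - s) - f t) + cmod (g (t - s) - g t) \<partial>m)"
        using add by (intro integral_mono int[of "\<lambda>t. f t + g t"] Bochner_Integration.integrable_add int)
          (auto simp: norm_diff_triangle_ineq)
      also have "\<dots> = (\<integral>t. cmod (f (t - s) - f t) \<partial>m) + (\<integral>t. cmod (g (t - s) - g t) \<partial>m)"
        by (rule Bochner_Integration.integral_add[OF int[OF add(1)] int[OF add(3)]])
      also have "\<dots> \<le> e/2 + e/2" using U(3) V(3) that by (intro add_mono) auto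
      finally show ?thesis by simp
    qed
    then show "\<exists>U. open U \<and> 0 \<in> U \<and> (\<forall>s\<in>U. (\<integral>t. cmod (f (t - s) + g (t - s) - (f t + g t)) \<partial>m) \<le> e)"
      using U V by (intro exI[of _ "U \<inter> V"]) auto
  qed
next
  case (lim f)
  show ?case
  proof (intro allI impI)
    fix e :: real assume "0 < e"
    then have e: "0 < e/3" by simp
    obtain g where g: "integrable m g"
      "\<forall>e>0. \<exists>U. open U \<and> 0 \<in> U \<and> (\<forall>s\<in>U. (\<integral>t. cmod (g (t - s) - g t) \<partial>m) \<le> e)"
      "(\<integral>t. cmod (f t - g t) \<partial>m) \<le> e/3" using lim(2)[OF e] by blast
    obtain U where U: "open U" "0 \<in> U" "\<forall>s\<in>U. (\<integral>t. cmod (g (t - s) - g t) \<partial>m) \<le> e/3"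
      using g(2) e by blast
    have "(\<integral>t. cmod (f (t - s) - f t) \<partial>m) \<le> e" if "s \<in> U" for s
    proof -
      have fg: "integrable m (\<lambda>t. cmod (f t - g t))"
        by (intro integrable_norm Bochner_Integration.integrable_diff lim g)
      have fg': "integrable m (\<lambda>t. cmod (f (t - s) - g (t - s)))" by (rule integrable_translate[OF fg])
      have int: "integrable m (\<lambda>t. cmod (h (t - s) - h t))" if "integrable m h" for h :: "'g \<Rightarrow> complex"
        by (intro integrable_norm Bochner_Integration.integrable_diff integrable_translate that)
      have "(\<integral>t. cmod (f (t - s) - f t) \<partial>m)
          \<le> (\<integral>t. cmod (f (t - s) - g (t - s)) + (cmod (g (t - s) - g t) + cmod (f t - g t)) \<partial>m)"
      proof (rule integral_mono[OF int[OF lim(1)]])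
        show "integrable m (\<lambda>t. cmod (f (t - s) - g (t - s)) + (cmod (g (t - s) - g t) + cmod (f t - g t)))"
          by (intro Bochner_Integration.integrable_add fg fg' int g)
        show "cmod (f (t - s) - f t) \<le> cmod (f (t - s) - g (t - s)) + (cmod (g (t - s) - g t) + cmod (f t - g t))" for t
          using norm_triangle_ineq[of "f (t - s) - g (t - s)" "g (t - s) - f t"]
            norm_triangle_ineq[of "g (t - s) - g t" "g t - f t"] by (simp add: norm_minus_commute)
      qed
      also have "\<dots> = (\<integral>t. cmod (f (t - s) - g (t - s)) \<partial>m) + ((\<integral>t. cmod (g (t - s) - g t) \<partial>m) + (\<integral>t. cmod (f t - g t) \<partial>m))"
        using fg fg' int[OF g(1)] by simp
      also have "(\<integral>t. cmod (f (t - s) - g (t - s)) \<partial>m) = (\<integral>t. cmod (f t - g t) \<partial>m)"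
        by (rule integral_translate[OF borel_measurable_integrable[OF fg]])
      also have "(\<integral>t. cmod (f t - g t) \<partial>m) + ((\<integral>t. cmod (g (t - s) - g t) \<partial>m) + (\<integral>t. cmod (f t - g t) \<partial>m))
          \<le> e/3 + (e/3 + e/3)" using U(3) g(3) that by (intro add_mono) auto
      finally show ?thesis by simp
    qed
    with U show "\<exists>U. open U \<and> 0 \<in> U \<and> (\<forall>s\<in>U. (\<integral>t. cmod (f (t - s) - f t) \<partial>m) \<le> e)" by blast
  qed
qed

lemma compact_positive_measure:
  obtains C where "compact C" "0 < emeasure m C"
proof -
  have "0 < emeasure m UNIV" using haar unfolding haar_measure_def zero_less_iff_neq_zero by blast
  then show thesis using inner_compact_open[of UNIV 0] that by auto
qed

text \<open>Finitely many translates of V cover a compact set of positive measure; one of the pieces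
  has positive measure and is moved back into V.\<close>

lemma small_set_positive_measure:
  assumes V: "open V" "0 \<in> V"
  obtains D where "D \<in> sets borel" "D \<subseteq> V" "0 < emeasure m D" "emeasure m D < \<infinity>"
proof -
  obtain C where C: "compact C" "0 < emeasure m C" by (rule compact_positive_measure)
  let ?V = "\<lambda>s. (\<lambda>t. t - s) -` V"
  have open_V: "open (?V s)" for s
    using V(1) by (intro open_vimage continuous_intros)
  have "C \<subseteq> (\<Union>s\<in>C. ?V s)" using V(2) by auto
  then obtain F where F: "F \<subseteq> C" "finite F" "C \<subseteq> (\<Union>s\<in>F. ?V s)"
    using compactE_image[OF C(1), of C ?V] open_V by blast
  have sets: "C \<inter> ?V s \<in> sets m" for s
    using compact_sets[OF C(1)] open_V by (auto simp: sets_m)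
  have "emeasure m C \<le> emeasure m (\<Union>s\<in>F. C \<inter> ?V s)"
  proof (rule emeasure_mono)
    show "C \<subseteq> (\<Union>s\<in>F. C \<inter> ?V s)" using F(3) by blast
    show "(\<Union>s\<in>F. C \<inter> ?V s) \<in> sets m" by (rule sets.finite_UN[OF F(2) sets])
  qed
  also have "\<dots> \<le> (\<Sum>s\<in>F. emeasure m (C \<inter> ?V s))"
    using F(2) sets by (intro emeasure_subadditive_finite) auto
  finally have "(\<Sum>s\<in>F. emeasure m (C \<inter> ?V s)) \<noteq> 0" using C(2) by auto
  then obtain s where s: "emeasure m (C \<inter> ?V s) \<noteq> 0" by (meson sum.neutral)
  define D where "D = (\<lambda>t. - s + t) ` (C \<inter> ?V s)"
  have D: "D = (\<lambda>t. t - (- s)) -` (C \<inter> ?V s)"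
    by (auto simp: D_def image_iff algebra_simps intro!: bexI[of _ "x + s" for x])
  have "D \<in> sets borel"
    unfolding D using measurable_sets[OF measurable_translate, of "C \<inter> ?V s" "- s"] sets by (simp add: sets_m)
  moreover have "D \<subseteq> V" by (auto simp: D)
  moreover have eq: "emeasure m D = emeasure m (C \<inter> ?V s)"
    unfolding D_def using sets by (intro emeasure_translate) (simp add: sets_m)
  moreover have "emeasure m (C \<inter> ?V s) \<le> emeasure m C"
    using compact_sets[OF C(1)] by (intro emeasure_mono) auto
  ultimately show thesis
    using that[of D] s compact_finite[OF C(1)] by (auto simp: zero_less_iff_neq_zero intro: le_less_trans)
qed

end

section \<open>Unitary representations and their operator algebras\<close>

lemma norm_blinfun_le_cinner:
  fixes T :: "'h::complex_hilbert \<Rightarrow>\<^sub>L 'h"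
  assumes "0 \<le> B" "\<And>\<xi> \<eta>. cmod (cinner (T \<xi>) \<eta>) \<le> B * (norm \<xi> * norm \<eta>)"
  shows "norm T \<le> B"
proof (rule norm_blinfun_bound[OF assms(1)])
  show "norm (T \<xi>) \<le> B * norm \<xi>" for \<xi>
    using assms by (intro norm_le_if_cinner_le) (auto simp: mult.assoc)
qed

section \<open>Weak integrals inside closed spaces of operators\<close>

definition op_subspace :: "('h::complex_hilbert \<Rightarrow>\<^sub>L 'h) set \<Rightarrow> bool" where
  "op_subspace A \<longleftrightarrow> 0 \<in> A \<and> (\<forall>x\<in>A. \<forall>y\<in>A. x + y \<in> A) \<and> (\<forall>c. \<forall>x\<in>A. scaleC_op c x \<in> A)"

context haar
begin

text \<open>A Riemann sum for the integral over B: the part of B where \<Phi> is e-close to one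
  value \<open>\<Phi> s\<close> contributes that value times the integral of f. Splitting this part
  off leaves a smaller set covered by the remaining points, which is why B is generalised in the
  induction.\<close>

lemma op_integral_partition:
  fixes f :: "'g \<Rightarrow> complex" and \<Phi> :: "'g \<Rightarrow> ('h::complex_hilbert \<Rightarrow>\<^sub>L 'h)"
  assumes f: "integrable m f" and "finite F" and A: "op_subspace A" "\<And>s. \<Phi> s \<in> A"
    and cont: "continuous_on UNIV \<Phi>" and bound: "\<And>s. norm (\<Phi> s) \<le> b" and "0 < e"
    and B: "B \<in> sets borel" "B \<subseteq> (\<Union>s\<in>F. {t. norm (\<Phi> t - \<Phi> s) < e})"
  shows "\<exists>y\<in>A. \<forall>\<xi> \<eta>. cmod ((LINT t:B|m. f t * cinner (\<Phi> t \<xi>) \<eta>) - cinner (y \<xi>) \<eta>)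
     \<le> e * (LINT t:B|m. cmod (f t)) * (norm \<xi> * norm \<eta>)"
  using \<open>finite F\<close> B
proof (induct F arbitrary: B rule: finite_induct)
  case empty
  then have "B = {}" by simp
  then show ?case using A(1) by (intro bexI[of _ 0]) (auto simp: op_subspace_def set_lebesgue_integral_def)
next
  case (insert s F)
  define V where "V = {t. norm (\<Phi> t - \<Phi> s) < e}"
  have "open V" unfolding V_def
    by (intro open_Collect_less continuous_intros cont)
  have B1: "B \<inter> V \<in> sets borel" and B2: "B - V \<in> sets borel" using insert(4) \<open>open V\<close> by auto
  have "B - V \<subseteq> (\<Union>s\<in>F. {t. norm (\<Phi> t - \<Phi> s) < e})" using insert(5) by (auto simp: V_def)
  from insert(3)[OF B2 this] obtain y where y: "y \<in> A"
    "\<And>\<xi> \<eta>. cmod ((LINT t:B-V|m. f t * cinner (\<Phi> t \<xi>) \<eta>) - cinner (y \<xi>) \<eta>)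
      \<le> e * (LINT t:B-V|m. cmod (f t)) * (norm \<xi> * norm \<eta>)" by blast
  have int: "integrable m (\<lambda>t. f t * cinner (\<Phi> t \<xi>) \<eta>)" for \<xi> \<eta>
  proof (rule norm_integral_le(1)[where g = "\<lambda>t. cmod (f t) * (b * (norm \<xi> * norm \<eta>))"])
    have "continuous_on UNIV (\<lambda>t. cinner (\<Phi> t \<xi>) \<eta>)"
      by (intro continuous_on_cinner continuous_intros cont)
    then have "(\<lambda>t. cinner (\<Phi> t \<xi>) \<eta>) \<in> borel_measurable m"
      unfolding borel_measurable_m by (rule borel_measurable_continuous_onI)
    then show "(\<lambda>t. f t * cinner (\<Phi> t \<xi>) \<eta>) \<in> borel_measurable m"
      using borel_measurable_integrable[OF f] by measurable
    show "integrable m (\<lambda>t. cmod (f t) * (b * (norm \<xi> * norm \<eta>)))"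
      using f by simp
    show "cmod (f t * cinner (\<Phi> t \<xi>) \<eta>) \<le> cmod (f t) * (b * (norm \<xi> * norm \<eta>))" for t
      unfolding norm_mult using cmod_cinner_blinfun_le[of "\<Phi> t" \<xi> \<eta>] mult_right_mono[OF bound[of t], of "norm \<xi> * norm \<eta>"]
      by (intro mult_left_mono) auto
  qed
  have set_int: "set_integrable m C g" if "integrable m g" "C \<in> sets borel"
    for g :: "'g \<Rightarrow> 'b::{banach,second_countable_topology}" and C
    unfolding set_integrable_def
    by (rule integrable_mult_indicator[OF _ that(1)]) (use that(2) in \<open>simp add: sets_m\<close>)
  define z where "z = scaleC_op (LINT t:B\<inter>V|m. f t) (\<Phi> s)"
  have z: "cmod ((LINT t:B\<inter>V|m. f t * cinner (\<Phi> t \<xi>) \<eta>) - cinner (z \<xi>) \<eta>)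
      \<le> e * (LINT t:B\<inter>V|m. cmod (f t)) * (norm \<xi> * norm \<eta>)" for \<xi> \<eta>
  proof -
    let ?d = "\<lambda>t. f t * cinner (\<Phi> t \<xi>) \<eta> - f t * cinner (\<Phi> s \<xi>) \<eta>"
    have "cinner (z \<xi>) \<eta> = (LINT t:B\<inter>V|m. f t * cinner (\<Phi> s \<xi>) \<eta>)"
      by (simp add: z_def scaleC_op.rep_eq cinner_scaleC_left)
    then have "(LINT t:B\<inter>V|m. f t * cinner (\<Phi> t \<xi>) \<eta>) - cinner (z \<xi>) \<eta> = (LINT t:B\<inter>V|m. ?d t)"
      using int f by (simp add: set_integral_diff set_int[OF _ B1])
    also have "cmod \<dots> \<le> (\<integral>t. indicator (B \<inter> V) t *\<^sub>R cmod (f t) * (e * (norm \<xi> * norm \<eta>)) \<partial>m)"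
      unfolding set_lebesgue_integral_def
    proof (rule norm_integral_le(2))
      show "(\<lambda>t. indicator (B \<inter> V) t *\<^sub>R ?d t) \<in> borel_measurable m"
        using set_int[OF Bochner_Integration.integrable_diff[OF int], of "\<lambda>t. f t * cinner (\<Phi> s \<xi>) \<eta>" "B \<inter> V" \<xi> \<eta>] f B1
        unfolding set_integrable_def by auto
      show "integrable m (\<lambda>t. indicator (B \<inter> V) t *\<^sub>R cmod (f t) * (e * (norm \<xi> * norm \<eta>)))"
        using set_int[OF integrable_norm[OF f] B1] unfolding set_integrable_def by simp
      fix t
      show "norm (indicator (B \<inter> V) t *\<^sub>R ?d t) \<le> indicator (B \<inter> V) t *\<^sub>R cmod (f t) * (e * (norm \<xi> * norm \<eta>))"
      proof (cases "t \<in> B \<inter> V")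
        case True
        have "?d t = f t * cinner ((\<Phi> t - \<Phi> s) \<xi>) \<eta>"
          by (simp add: blinfun.diff_left cinner_diff_left right_diff_distrib)
        moreover have "cmod (cinner ((\<Phi> t - \<Phi> s) \<xi>) \<eta>) \<le> e * (norm \<xi> * norm \<eta>)"
          using True order_trans[OF cmod_cinner_blinfun_le mult_right_mono, of "\<Phi> t - \<Phi> s" e \<xi> \<eta>]
          by (simp add: V_def)
        ultimately show ?thesis using True by (simp add: norm_mult mult_left_mono)
      qed simp
    qed
    also have "\<dots> = e * (LINT t:B\<inter>V|m. cmod (f t)) * (norm \<xi> * norm \<eta>)"
      unfolding integral_mult_left_zero set_lebesgue_integral_def by (simp add: mult_ac)
    finally show ?thesis .
  qed
  have split: "(LINT t:B|m. g t) = (LINT t:B\<inter>V|m. g t) + (LINT t:B-V|m. g t)"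
    if "integrable m g" for g :: "'g \<Rightarrow> 'b::{banach,second_countable_topology}"
    using set_integral_Un[OF _ set_int[OF that B1] set_int[OF that B2]] by (simp add: Int_Diff_Un Int_Diff_disjoint)
  have "cmod ((LINT t:B|m. f t * cinner (\<Phi> t \<xi>) \<eta>) - cinner ((z + y) \<xi>) \<eta>)
     \<le> e * (LINT t:B|m. cmod (f t)) * (norm \<xi> * norm \<eta>)" for \<xi> \<eta>
  proof -
    have "(LINT t:B|m. f t * cinner (\<Phi> t \<xi>) \<eta>) - cinner ((z + y) \<xi>) \<eta>
      = ((LINT t:B\<inter>V|m. f t * cinner (\<Phi> t \<xi>) \<eta>) - cinner (z \<xi>) \<eta>)
        + ((LINT t:B-V|m. f t * cinner (\<Phi> t \<xi>) \<eta>) - cinner (y \<xi>) \<eta>)"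
      unfolding split[OF int] by (simp add: blinfun.add_left cinner_add_left)
    also have "cmod \<dots> \<le> e * (LINT t:B\<inter>V|m. cmod (f t)) * (norm \<xi> * norm \<eta>)
        + e * (LINT t:B-V|m. cmod (f t)) * (norm \<xi> * norm \<eta>)"
      by (rule order_trans[OF norm_triangle_ineq add_mono[OF z y(2)]])
    also have "\<dots> = e * (LINT t:B|m. cmod (f t)) * (norm \<xi> * norm \<eta>)"
      unfolding split[OF integrable_norm[OF f]] by (simp add: algebra_simps)
    finally show ?thesis .
  qed
  moreover have "z + y \<in> A" using A y(1) by (simp add: op_subspace_def z_def)
  ultimately show ?case by blast
qed

text \<open>Up to a small tail f lives on a compact K, which finitely many sets with almost constant
  \<Phi> cover. The Riemann sum over K lies in A and is close to T in norm. Products inside the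
  algebra generated by \<pi> are obtained from this.\<close>

lemma op_integral_mem:
  fixes f :: "'g \<Rightarrow> complex" and \<Phi> :: "'g \<Rightarrow> ('h::complex_hilbert \<Rightarrow>\<^sub>L 'h)"
    and T :: "'h \<Rightarrow>\<^sub>L 'h"
  assumes f: "integrable m f" and A: "op_subspace A" "closed A" "\<And>s. \<Phi> s \<in> A"
    and cont: "continuous_on UNIV \<Phi>" and bound: "\<And>s. norm (\<Phi> s) \<le> b"
    and T: "\<And>\<xi> \<eta>. cinner (T \<xi>) \<eta> = (\<integral>t. f t * cinner (\<Phi> t \<xi>) \<eta> \<partial>m)"
  shows "T \<in> A"
proof -
  have "0 \<le> b" using bound[of 0] norm_ge_zero order_trans by blast
  have "\<exists>y\<in>A. dist y T < e" if "0 < e" for e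
  proof -
    define N where "N = (\<integral>t. cmod (f t) \<partial>m)"
    have "0 \<le> N" by (simp add: N_def)
    have cancel: "e / (3 * x) * (x * c) = e/3 * c" if "0 < x" for x c :: real
      using that by simp
    \<comment> \<open>The sum over K and the tail contribute e/3 each, which leaves the strict
      inequality 2e/3 < e.\<close>
    have e1: "0 < e / (3 * (N + 1))" using \<open>0 < e\<close> \<open>0 \<le> N\<close> by simp
    have e2: "0 < e / (3 * (b + 1))" using \<open>0 < e\<close> \<open>0 \<le> b\<close> by simp
    obtain K where K: "compact K" "(\<integral>t. cmod (f t) * indicator (- K) t \<partial>m) \<le> e / (3 * (b + 1))"
      using L1_tail[OF f] e2 by blast
    let ?V = "\<lambda>s. {t. norm (\<Phi> t - \<Phi> s) < e / (3 * (N + 1))}"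
    have "open (?V s)" for s by (intro open_Collect_less continuous_intros cont)
    moreover have "K \<subseteq> (\<Union>s\<in>K. ?V s)" using e1 by auto
    ultimately obtain F where F: "F \<subseteq> K" "finite F" "K \<subseteq> (\<Union>s\<in>F. ?V s)"
      using compactE_image[OF K(1), of K ?V] by blast
    have Ks: "K \<in> sets borel" using compact_sets[OF K(1)] by (simp add: sets_m)
    then have Ks': "- K \<in> sets m" unfolding sets_m by (rule borel_comp)
    from op_integral_partition[OF f F(2) A(1,3) cont bound e1 Ks F(3)]
    obtain y where y: "y \<in> A"
      "\<And>\<xi> \<eta>. cmod ((LINT t:K|m. f t * cinner (\<Phi> t \<xi>) \<eta>) - cinner (y \<xi>) \<eta>)
        \<le> e / (3 * (N + 1)) * (LINT t:K|m. cmod (f t)) * (norm \<xi> * norm \<eta>)" by blast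
    have "norm (T - y) \<le> e/3 + e/3"
    proof (rule norm_blinfun_le_cinner)
      fix \<xi> \<eta>
      let ?g = "\<lambda>t. f t * cinner (\<Phi> t \<xi>) \<eta>"
      have le: "cmod (?g t) \<le> cmod (f t) * (b * (norm \<xi> * norm \<eta>))" for t
        unfolding norm_mult using cmod_cinner_blinfun_le[of "\<Phi> t" \<xi> \<eta>] mult_right_mono[OF bound[of t], of "norm \<xi> * norm \<eta>"]
        by (intro mult_left_mono) auto
      have int: "integrable m ?g"
      proof (rule norm_integral_le(1)[OF _ _ le])
        have "continuous_on UNIV (\<lambda>t. cinner (\<Phi> t \<xi>) \<eta>)"
          by (intro continuous_on_cinner continuous_intros cont)
        then have "(\<lambda>t. cinner (\<Phi> t \<xi>) \<eta>) \<in> borel_measurable m"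
          unfolding borel_measurable_m by (rule borel_measurable_continuous_onI)
        then show "?g \<in> borel_measurable m"
          using borel_measurable_integrable[OF f] by measurable
      qed (use f in simp)
      have i: "integrable m (\<lambda>t. indicator C t *\<^sub>R h t)" if "integrable m h" "C \<in> sets m"
        for h :: "'g \<Rightarrow> 'b::{banach,second_countable_topology}" and C
        using that integrable_mult_indicator by blast
      have Km: "K \<in> sets m" using Ks by (simp add: sets_m)
      have "(\<integral>t. ?g t \<partial>m) = (\<integral>t. indicator K t *\<^sub>R ?g t + indicator (- K) t *\<^sub>R ?g t \<partial>m)"
        by (rule Bochner_Integration.integral_cong) (auto split: split_indicator)
      also have "\<dots> = (LINT t:K|m. ?g t) + (LINT t:-K|m. ?g t)"
        unfolding set_lebesgue_integral_def
        by (rule Bochner_Integration.integral_add[OF i[OF int Km] i[OF int Ks']])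
      finally have split: "cinner ((T - y) \<xi>) \<eta> = ((LINT t:K|m. ?g t) - cinner (y \<xi>) \<eta>) + (LINT t:-K|m. ?g t)"
        by (simp add: blinfun.diff_left cinner_diff_left T)
      have "(LINT t:K|m. cmod (f t)) \<le> N"
        unfolding set_lebesgue_integral_def N_def
        by (intro integral_mono i integrable_norm f Km) (auto split: split_indicator)
      then have "e / (3 * (N + 1)) * (LINT t:K|m. cmod (f t)) \<le> e / (3 * (N + 1)) * (N + 1)"
        using e1 by (intro mult_left_mono) auto
      also have "\<dots> = e/3" using cancel[of "N + 1" 1] \<open>0 \<le> N\<close> unfolding mult_1_right by linarith
      finally have 1: "cmod ((LINT t:K|m. ?g t) - cinner (y \<xi>) \<eta>) \<le> e/3 * (norm \<xi> * norm \<eta>)"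
        by (intro order_trans[OF y(2)] mult_right_mono) auto
      have "cmod (LINT t:-K|m. ?g t) \<le> (\<integral>t. cmod (f t) * indicator (- K) t * (b * (norm \<xi> * norm \<eta>)) \<partial>m)"
        unfolding set_lebesgue_integral_def
      proof (rule norm_integral_le(2))
        show "(\<lambda>t. indicator (- K) t *\<^sub>R ?g t) \<in> borel_measurable m"
          by (rule borel_measurable_integrable[OF i[OF int Ks']])
        show "integrable m (\<lambda>t. cmod (f t) * indicator (- K) t * (b * (norm \<xi> * norm \<eta>)))"
          using i[OF integrable_norm[OF f] Ks'] by (simp add: mult.commute)
        show "norm (indicator (- K) t *\<^sub>R ?g t) \<le> cmod (f t) * indicator (- K) t * (b * (norm \<xi> * norm \<eta>))" for t
          using le[of t] by (auto split: split_indicator)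
      qed
      also have "\<dots> = (\<integral>t. cmod (f t) * indicator (- K) t \<partial>m) * (b * (norm \<xi> * norm \<eta>))"
        by (rule integral_mult_left_zero)
      also have "\<dots> \<le> e / (3 * (b + 1)) * ((b + 1) * (norm \<xi> * norm \<eta>))"
        using K(2) e2 \<open>0 \<le> b\<close> by (intro mult_mono mult_right_mono mult_nonneg_nonneg) auto
      also have "\<dots> = e/3 * (norm \<xi> * norm \<eta>)" using \<open>0 \<le> b\<close> by (intro cancel) simp
      finally have 2: "cmod (LINT t:-K|m. ?g t) \<le> e/3 * (norm \<xi> * norm \<eta>)" .
      show "cmod (cinner ((T - y) \<xi>) \<eta>) \<le> (e/3 + e/3) * (norm \<xi> * norm \<eta>)"
        unfolding split distrib_right by (rule order_trans[OF norm_triangle_ineq add_mono[OF 1 2]])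
    qed (use \<open>0 < e\<close> in simp)
    then have "dist y T < e" using \<open>0 < e\<close> by (simp add: dist_norm norm_minus_commute)
    with y(1) show ?thesis by blast
  qed
  then show ?thesis using A(2) closed_approachable by blast
qed

end

section \<open>Unitary representations\<close>

locale urep =
  fixes \<pi> :: "'g::{topological_ab_group_add, t2_space} \<Rightarrow> ('h::complex_hilbert \<Rightarrow>\<^sub>L 'h)"
  assumes rep: "unitary_rep \<pi>"
begin

lemma rep_BH: "\<pi> s \<in> BH"
  using rep by (simp add: unitary_rep_def unitary_op_def)

lemma rep_add: "\<pi> (s + t) = \<pi> s o\<^sub>L \<pi> t"
  using rep by (simp add: unitary_rep_def)

lemma rep_add_apply: "\<pi> (s + t) \<xi> = \<pi> s (\<pi> t \<xi>)"
  by (simp add: rep_add)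

lemma rep_continuous: "continuous_on UNIV (\<lambda>s. \<pi> s \<xi>)"
  using rep by (simp add: unitary_rep_def)

lemma rep_inverse: obtains V where "is_adj V (\<pi> s)" "V o\<^sub>L \<pi> s = id_blinfun"
  using rep unfolding unitary_rep_def unitary_op_def by blast

text \<open>\<open>\<pi> 0\<close> is idempotent and has a left inverse.\<close>

lemma rep_zero: "\<pi> 0 = id_blinfun"
proof -
  obtain V where V: "V o\<^sub>L \<pi> 0 = id_blinfun" by (rule rep_inverse)
  have "\<pi> 0 = (V o\<^sub>L \<pi> 0) o\<^sub>L \<pi> 0" by (simp add: V)
  also have "\<dots> = V o\<^sub>L \<pi> (0 + 0)" unfolding rep_add compose_assoc ..
  finally show ?thesis by (simp add: V)
qed

lemma rep_minus_apply [simp]: "\<pi> (- s) (\<pi> s \<xi>) = \<xi>" "\<pi> s (\<pi> (- s) \<xi>) = \<xi>"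
  using rep_add_apply[of "- s" s \<xi>] rep_add_apply[of s "- s" \<xi>] by (simp_all add: rep_zero)

lemma rep_adj: "is_adj (\<pi> (- s)) (\<pi> s)"
proof -
  obtain V where V: "is_adj V (\<pi> s)" "V o\<^sub>L \<pi> s = id_blinfun" by (rule rep_inverse)
  have "\<pi> (- s) = (V o\<^sub>L \<pi> s) o\<^sub>L \<pi> (- s)" by (simp add: V)
  also have "\<dots> = V o\<^sub>L \<pi> (s + - s)" unfolding rep_add compose_assoc ..
  finally show ?thesis using V(1) by (simp add: rep_zero)
qed

lemma cinner_rep: "cinner (\<pi> s \<xi>) \<eta> = cinner \<xi> (\<pi> (- s) \<eta>)"
  by (rule is_adjD[OF rep_adj])

lemma op_adj_rep: "op_adj (\<pi> s) = \<pi> (- s)"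
  by (rule op_adj_eq[OF rep_BH rep_adj])

lemma norm_rep [simp]: "norm (\<pi> s \<xi>) = norm \<xi>"
proof -
  have "complex_of_real ((norm (\<pi> s \<xi>))\<^sup>2) = of_real ((norm \<xi>)\<^sup>2)"
    unfolding cinner_self[symmetric] cinner_rep by simp
  then have "(norm (\<pi> s \<xi>))\<^sup>2 = (norm \<xi>)\<^sup>2" using of_real_eq_iff by blast
  then show ?thesis by simp
qed

lemma rep_commutes: "commutes (\<pi> s) (\<pi> t)"
  unfolding commutes_def by (metis rep_add add.commute)

lemma norm_rep_compose: "norm (\<pi> s o\<^sub>L x) = norm x"
proof (rule antisym)
  show "norm (\<pi> s o\<^sub>L x) \<le> norm x" by (rule norm_blinfun_bound) (auto intro: norm_blinfun)
  show "norm x \<le> norm (\<pi> s o\<^sub>L x)"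
  proof (rule norm_blinfun_bound)
    show "norm (x \<xi>) \<le> norm (\<pi> s o\<^sub>L x) * norm \<xi>" for \<xi>
      using norm_blinfun[of "\<pi> s o\<^sub>L x" \<xi>] by simp
  qed simp
qed

lemma rep_coefficient_continuous: "continuous_on UNIV (\<lambda>s. cinner (\<pi> s \<xi>) \<eta>)"
  by (intro continuous_on_cinner rep_continuous continuous_intros)

lemma rep_minus_continuous: "continuous_on UNIV (\<lambda>s. \<pi> (- s) \<xi>)"
  by (rule continuous_on_compose2[OF rep_continuous]) (auto intro: continuous_intros)

end

section \<open>Integrated operators and the algebra they generate\<close>

locale haar_rep = haar m + urep \<pi>
  for m :: "'g::{topological_ab_group_add, t2_space} measure"
    and \<pi> :: "'g \<Rightarrow> ('h::complex_hilbert \<Rightarrow>\<^sub>L 'h)"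
begin

lemma rep_integrable:
  assumes "integrable m f"
  shows "integrable m (\<lambda>s. f s * cinner (\<pi> s \<xi>) \<eta>)"
proof (rule norm_integral_le(1)[where g = "\<lambda>s. cmod (f s) * (norm \<xi> * norm \<eta>)"])
  have "(\<lambda>s. cinner (\<pi> s \<xi>) \<eta>) \<in> borel_measurable m"
    unfolding borel_measurable_m by (rule borel_measurable_continuous_onI[OF rep_coefficient_continuous])
  then show "(\<lambda>s. f s * cinner (\<pi> s \<xi>) \<eta>) \<in> borel_measurable m"
    using borel_measurable_integrable[OF assms] by measurable
  show "cmod (f s * cinner (\<pi> s \<xi>) \<eta>) \<le> cmod (f s) * (norm \<xi> * norm \<eta>)" for s
    using cmod_cinner_le[of "\<pi> s \<xi>" \<eta>] by (simp add: norm_mult mult_left_mono)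
qed (use assms in simp)

lemma pi1:
  assumes f: "integrable m f"
  shows pi1_BH: "pi1 m \<pi> f \<in> BH"
    and cinner_pi1: "cinner (pi1 m \<pi> f \<xi>) \<eta> = (\<integral>s. f s * cinner (\<pi> s \<xi>) \<eta> \<partial>m)"
proof -
  obtain T where T: "T \<in> BH"
    "\<And>\<omega>. \<omega> \<in> normal_functionals \<Longrightarrow> \<omega> T = (\<integral>s. \<omega> (scaleC_op (f s) (\<pi> s)) \<partial>m)"
  proof (rule weak_integral_exists[of "\<lambda>s. scaleC_op (f s) (\<pi> s)" m "\<lambda>s. cmod (f s)"])
    show "(\<lambda>s. cinner (scaleC_op (f s) (\<pi> s) \<xi>) \<eta>) \<in> borel_measurable m" for \<xi> \<eta>
      using borel_measurable_integrable[OF rep_integrable[OF f]]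
      by (simp add: scaleC_op.rep_eq cinner_scaleC_left)
    show "norm (scaleC_op (f s) (\<pi> s)) \<le> cmod (f s)" for s
      by (rule norm_blinfun_bound) (auto simp: scaleC_op.rep_eq norm_scaleC)
  qed (use f BH_scaleC[OF rep_BH] in auto)
  have eq: "pi1 m \<pi> f = T"
    unfolding pi1_def by (rule weak_star_integral_eq[where F = "\<lambda>s. scaleC_op (f s) (\<pi> s)" and I = "integral\<^sup>L m"]) (fact, rule T)
  show "pi1 m \<pi> f \<in> BH" using eq T(1) by simp
  show "cinner (pi1 m \<pi> f \<xi>) \<eta> = (\<integral>s. f s * cinner (\<pi> s \<xi>) \<eta> \<partial>m)"
    using T(2)[OF vector_functional_normal[of \<xi> \<eta>]] eq by (simp add: scaleC_op.rep_eq cinner_scaleC_left)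
qed

lemma pi1_add:
  assumes "integrable m f" "integrable m g"
  shows "pi1 m \<pi> (\<lambda>s. f s + g s) = pi1 m \<pi> f + pi1 m \<pi> g"
  by (rule blinfun_ext_cinner)
    (simp add: cinner_pi1 assms blinfun.add_left cinner_add_left rep_integrable distrib_right)

lemma pi1_cmult:
  assumes "integrable m f"
  shows "pi1 m \<pi> (\<lambda>s. c * f s) = scaleC_op c (pi1 m \<pi> f)"
  by (rule blinfun_ext_cinner)
    (simp add: cinner_pi1 assms scaleC_op.rep_eq cinner_scaleC_left mult.assoc)

lemma norm_pi1_diff:
  assumes "integrable m f" "integrable m g"
  shows "norm (pi1 m \<pi> f - pi1 m \<pi> g) \<le> (\<integral>s. cmod (f s - g s) \<partial>m)"
proof (rule norm_blinfun_le_cinner)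
  fix \<xi> \<eta>
  have "cinner ((pi1 m \<pi> f - pi1 m \<pi> g) \<xi>) \<eta> = (\<integral>s. (f s - g s) * cinner (\<pi> s \<xi>) \<eta> \<partial>m)"
    by (simp add: cinner_pi1 assms blinfun.diff_left cinner_diff_left rep_integrable left_diff_distrib)
  also have "cmod \<dots> \<le> (\<integral>s. cmod (f s - g s) * (norm \<xi> * norm \<eta>) \<partial>m)"
  proof (rule norm_integral_le(2))
    show "(\<lambda>s. (f s - g s) * cinner (\<pi> s \<xi>) \<eta>) \<in> borel_measurable m"
      by (rule borel_measurable_integrable[OF rep_integrable]) (use assms in simp)
    show "cmod ((f s - g s) * cinner (\<pi> s \<xi>) \<eta>) \<le> cmod (f s - g s) * (norm \<xi> * norm \<eta>)" for s
      using cmod_cinner_le[of "\<pi> s \<xi>" \<eta>] by (simp add: norm_mult mult_left_mono)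
  qed (use assms in simp)
  finally show "cmod (cinner ((pi1 m \<pi> f - pi1 m \<pi> g) \<xi>) \<eta>) \<le> (\<integral>s. cmod (f s - g s) \<partial>m) * (norm \<xi> * norm \<eta>)"
    by simp
qed simp

lemma rep_pi1:
  assumes f: "integrable m f"
  shows "\<pi> s o\<^sub>L pi1 m \<pi> f = pi1 m \<pi> (\<lambda>t. f (t - s))"
proof (rule blinfun_ext_cinner)
  fix \<xi> \<eta>
  have "cinner ((\<pi> s o\<^sub>L pi1 m \<pi> f) \<xi>) \<eta> = (\<integral>t. f t * cinner (\<pi> t \<xi>) (\<pi> (- s) \<eta>) \<partial>m)"
    by (simp add: cinner_rep[of s] cinner_pi1[OF f])
  also have "\<dots> = (\<integral>t. f (t - s) * cinner (\<pi> (t - s) \<xi>) (\<pi> (- s) \<eta>) \<partial>m)"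
    by (rule integral_translate[OF borel_measurable_integrable[OF rep_integrable[OF f]], symmetric])
  also have "\<dots> = (\<integral>t. f (t - s) * cinner (\<pi> t \<xi>) \<eta> \<partial>m)"
    by (simp add: cinner_rep[of s, symmetric] rep_add_apply[symmetric])
  also have "\<dots> = cinner (pi1 m \<pi> (\<lambda>t. f (t - s)) \<xi>) \<eta>"
    by (rule cinner_pi1[OF integrable_translate[OF f], symmetric])
  finally show "cinner ((\<pi> s o\<^sub>L pi1 m \<pi> f) \<xi>) \<eta> = cinner (pi1 m \<pi> (\<lambda>t. f (t - s)) \<xi>) \<eta>" .
qed

text \<open>The adjoint is kept as an integral over \<open>\<pi> (- s)\<close>, the shape in which
  \<open>A_adjoint_compose\<close> feeds it to \<open>op_integral_mem\<close>.\<close>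

lemma pi1_adjoint:
  assumes f: "integrable m f"
  obtains T where "T \<in> BH" "is_adj T (pi1 m \<pi> f)"
    "\<And>\<xi> \<eta>. cinner (T \<xi>) \<eta> = (\<integral>s. cnj (f s) * cinner (\<pi> (- s) \<xi>) \<eta> \<partial>m)"
proof -
  let ?b = "\<lambda>\<xi> \<eta>. cnj (cinner (pi1 m \<pi> f \<eta>) \<xi>)"
  obtain T where T: "T \<in> BH" "\<And>\<xi> \<eta>. cinner (T \<xi>) \<eta> = ?b \<xi> \<eta>"
  proof (rule sesquilinear_form_operator[of ?b "norm (pi1 m \<pi> f)"])
    show "cmod (?b \<xi> \<eta>) \<le> norm (pi1 m \<pi> f) * norm \<xi> * norm \<eta>" for \<xi> \<eta>
      using cmod_cinner_blinfun_le[of "pi1 m \<pi> f" \<eta> \<xi>] by (simp add: mult_ac)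
  qed (simp_all add: blinfun.add_right cinner_simps BH_D[OF pi1_BH[OF f]])
  have "is_adj T (pi1 m \<pi> f)"
    unfolding is_adj_def using T(2) cinner_commute by (metis complex_cnj_cnj)
  moreover have "cinner (T \<xi>) \<eta> = (\<integral>s. cnj (f s) * cinner (\<pi> (- s) \<xi>) \<eta> \<partial>m)" for \<xi> \<eta>
  proof -
    have "cinner (T \<xi>) \<eta> = (\<integral>s. cnj (f s * cinner (\<pi> s \<eta>) \<xi>) \<partial>m)"
      unfolding T(2) cinner_pi1[OF f] by (rule Bochner_Integration.integral_cnj[symmetric])
    also have "\<dots> = (\<integral>s. cnj (f s) * cinner (\<pi> (- s) \<xi>) \<eta> \<partial>m)"
      by (simp add: cinner_rep flip: cinner_commute)
    finally show ?thesis .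
  qed
  ultimately show thesis using that T(1) by blast
qed

text \<open>Only inner products of \<open>pi1 m \<pi> f\<close> are known, so S is carried across
  the weak integral by means of its adjoint.\<close>

lemma pi1_commutes:
  assumes f: "integrable m f" and S: "is_adj S' S" "\<And>t. commutes S (\<pi> t)"
  shows "commutes S (pi1 m \<pi> f)"
proof (rule commutesI, rule cinner_ext)
  fix \<xi> \<eta>
  have "cinner (S (pi1 m \<pi> f \<xi>)) \<eta> = (\<integral>s. f s * cinner (\<pi> s \<xi>) (S' \<eta>) \<partial>m)"
    by (simp add: is_adjD[OF S(1)] cinner_pi1[OF f])
  also have "\<dots> = cinner (pi1 m \<pi> f (S \<xi>)) \<eta>"
    by (simp add: is_adjD[OF S(1), symmetric] commutesD[OF S(2)] cinner_pi1[OF f])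
  finally show "cinner (S (pi1 m \<pi> f \<xi>)) \<eta> = cinner (pi1 m \<pi> f (S \<xi>)) \<eta>" .
qed

abbreviation "\<A> \<equiv> Cstar_pi m \<pi>"

lemma pi1_mem: "integrable m f \<Longrightarrow> pi1 m \<pi> f \<in> \<A>"
  unfolding Cstar_pi_def by (rule subsetD[OF closure_subset], rule CollectI, rule exI[of _ f]) simp

lemma closed_A: "closed \<A>"
  by (simp add: Cstar_pi_def)

lemma A_induct [consumes 1, case_names pi1 lim]:
  assumes "x \<in> \<A>" and "\<And>f. integrable m f \<Longrightarrow> P (pi1 m \<pi> f)"
    and "\<And>y z. (\<And>n::nat. y n \<in> \<A>) \<Longrightarrow> (\<And>n. P (y n)) \<Longrightarrow> y \<longlonglongrightarrow> z \<Longrightarrow> P z"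
  shows "P x"
proof -
  obtain y where y: "\<And>n. y n \<in> {pi1 m \<pi> f | f. integrable m f}" "y \<longlonglongrightarrow> x"
    using assms(1) unfolding Cstar_pi_def closure_sequential by blast
  have "y n \<in> \<A> \<and> P (y n)" for n
  proof -
    obtain f where "y n = pi1 m \<pi> f" "integrable m f" using y(1)[of n] unfolding mem_Collect_eq by (elim exE conjE)
    then show ?thesis using pi1_mem assms(2) by simp
  qed
  then show ?thesis using assms(3) y(2) by blast
qed

lemma A_BH: "x \<in> \<A> \<Longrightarrow> x \<in> BH"
proof (induct rule: A_induct)
  case (lim y z)
  then show ?case using closed_sequentially[OF closed_BH] by blast
qed (rule pi1_BH)

lemma scaleC_op_bounded_linear: "bounded_linear (scaleC_op c :: ('h \<Rightarrow>\<^sub>L 'h) \<Rightarrow> _)"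
proof (rule bounded_linear_intro[where K = "cmod c"])
  show "norm (scaleC_op c T) \<le> norm T * cmod c" for T :: "'h \<Rightarrow>\<^sub>L 'h"
    by (rule norm_blinfun_bound)
      (auto simp: scaleC_op.rep_eq norm_scaleC mult.commute[of _ "cmod c"] mult.assoc intro!: mult_left_mono norm_blinfun)
qed (auto intro!: blinfun_eqI simp: scaleC_op.rep_eq blinfun.add_left blinfun.scaleR_left scaleC_add_right
    scaleC_scaleC mult.commute simp flip: scaleC_of_real)

lemma A_add:
  assumes "x \<in> \<A>" "y \<in> \<A>" shows "x + y \<in> \<A>"
proof -
  have 1: "pi1 m \<pi> f + y \<in> \<A>" if f: "integrable m f" for f
    using assms(2)
  proof (induct rule: A_induct)
    case (pi1 g)
    then show ?case using pi1_mem[of "\<lambda>s. f s + g s"] f by (simp add: pi1_add)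
  next
    case (lim u v)
    then show ?case using closed_sequentially[OF closed_A, of "\<lambda>n. pi1 m \<pi> f + u n"]
      by (simp add: tendsto_add)
  qed
  show ?thesis using assms(1)
  proof (induct rule: A_induct)
    case (lim u v)
    then show ?case using closed_sequentially[OF closed_A, of "\<lambda>n. u n + y"]
      by (simp add: tendsto_add)
  qed (rule 1)
qed

lemma A_scaleC:
  assumes "x \<in> \<A>" shows "scaleC_op c x \<in> \<A>"
  using assms
proof (induct rule: A_induct)
  case (pi1 f)
  then show ?case using pi1_mem[of "\<lambda>s. c * f s"] by (simp add: pi1_cmult)
next
  case (lim u v)
  then show ?case using closed_sequentially[OF closed_A, of "\<lambda>n. scaleC_op c (u n)"]
    by (simp add: bounded_linear.tendsto[OF scaleC_op_bounded_linear])
qed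

lemma op_subspace_A: "op_subspace \<A>"
proof -
  have "scaleC_op 0 (pi1 m \<pi> (\<lambda>_. 0)) = 0" by (rule blinfun_eqI) (simp add: scaleC_op.rep_eq)
  then have "0 \<in> \<A>" using A_scaleC[OF pi1_mem, of "\<lambda>_. 0" 0] by simp
  then show ?thesis by (simp add: op_subspace_def A_add A_scaleC)
qed

lemma A_diff: "x \<in> \<A> \<Longrightarrow> y \<in> \<A> \<Longrightarrow> x - y \<in> \<A>"
proof -
  assume xy: "x \<in> \<A>" "y \<in> \<A>"
  have "scaleC_op (-1) y = - y" by (rule blinfun_eqI) (simp add: scaleC_op.rep_eq blinfun.minus_left scaleC_minus_left)
  then show "x - y \<in> \<A>" using A_add[OF xy(1) A_scaleC[OF xy(2), of "-1"]] by simp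
qed

lemma A_rep: "x \<in> \<A> \<Longrightarrow> \<pi> s o\<^sub>L x \<in> \<A>"
proof (induct rule: A_induct)
  case (pi1 f)
  then show ?case using pi1_mem[OF integrable_translate] by (simp add: rep_pi1)
next
  case (lim u v)
  then show ?case using closed_sequentially[OF closed_A, of "\<lambda>n. \<pi> s o\<^sub>L u n"]
    by (simp add: tendsto_compose)
qed

text \<open>\<pi> itself is only strongly continuous, but becomes norm continuous after
  multiplication by an element of the algebra. For \<open>pi1 m \<pi> f\<close> this is continuity
  of translation in L1; limits cost e/3 three times.\<close>

lemma A_rep_near_zero:
  assumes "x \<in> \<A>"
  shows "\<forall>e>0. \<exists>U. open U \<and> 0 \<in> U \<and> (\<forall>s\<in>U. norm ((\<pi> s o\<^sub>L x) - x) \<le> e)"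
  using assms
proof (induct rule: A_induct)
  case (pi1 f)
  show ?case
  proof (intro allI impI)
    fix e :: real assume "0 < e"
    from L1_translation_continuous[OF pi1, rule_format, OF this]
    obtain U where U: "open U" "0 \<in> U" "\<forall>s\<in>U. (\<integral>t. cmod (f (t - s) - f t) \<partial>m) \<le> e"
      by (elim exE conjE)
    have "norm ((\<pi> s o\<^sub>L pi1 m \<pi> f) - pi1 m \<pi> f) \<le> e" if "s \<in> U" for s
      using norm_pi1_diff[OF integrable_translate[OF pi1] pi1, of s] bspec[OF U(3) that]
      by (simp add: rep_pi1[OF pi1])
    with U show "\<exists>U. open U \<and> 0 \<in> U \<and> (\<forall>s\<in>U. norm ((\<pi> s o\<^sub>L pi1 m \<pi> f) - pi1 m \<pi> f) \<le> e)" by blast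
  qed
next
  case (lim y z)
  show ?case
  proof (intro allI impI)
    fix e :: real assume "0 < e"
    then have e: "0 < e/3" by simp
    then obtain n where n: "norm (y n - z) < e/3"
      using lim(3) unfolding LIMSEQ_iff by blast
    from lim(2)[of n, rule_format, OF e]
    obtain U where U: "open U" "0 \<in> U" "\<forall>s\<in>U. norm ((\<pi> s o\<^sub>L y n) - y n) \<le> e/3"
      by (elim exE conjE)
    have "norm ((\<pi> s o\<^sub>L z) - z) \<le> e" if "s \<in> U" for s
    proof -
      have "(\<pi> s o\<^sub>L z) - z = ((y n - z) + ((\<pi> s o\<^sub>L y n) - y n)) - (\<pi> s o\<^sub>L (y n - z))"
        by (simp add: compose_diff_right)
      also have "norm \<dots> \<le> (e/3 + e/3) + e/3"
        using n bspec[OF U(3) that] norm_rep_compose[of s "y n - z"]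
          norm_triangle_ineq4[of "(y n - z) + ((\<pi> s o\<^sub>L y n) - y n)" "\<pi> s o\<^sub>L (y n - z)"]
          norm_triangle_ineq[of "y n - z" "(\<pi> s o\<^sub>L y n) - y n"]
        by linarith
      finally show ?thesis by simp
    qed
    with U show "\<exists>U. open U \<and> 0 \<in> U \<and> (\<forall>s\<in>U. norm ((\<pi> s o\<^sub>L z) - z) \<le> e)" by blast
  qed
qed

lemma A_rep_continuous:
  assumes "x \<in> \<A>"
  shows "continuous_on UNIV (\<lambda>s. \<pi> s o\<^sub>L x)"
  unfolding continuous_on_def
proof (intro ballI tendstoI)
  fix t and e :: real assume "0 < e"
  then have e: "0 < e/2" by simp
  from A_rep_near_zero[OF assms, rule_format, OF e]
  obtain U where U: "open U" "0 \<in> U" "\<forall>s\<in>U. norm ((\<pi> s o\<^sub>L x) - x) \<le> e/2"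
    by (elim exE conjE)
  have "open ((\<lambda>s. s - t) -` U)" using U(1) by (intro open_vimage continuous_intros)
  moreover have "t \<in> (\<lambda>s. s - t) -` U" using U(2) by simp
  moreover have "dist (\<pi> s o\<^sub>L x) (\<pi> t o\<^sub>L x) < e" if "s \<in> (\<lambda>s. s - t) -` U" for s
  proof -
    have "(\<pi> s o\<^sub>L x) - (\<pi> t o\<^sub>L x) = \<pi> t o\<^sub>L ((\<pi> (s - t) o\<^sub>L x) - x)"
      using rep_add[of t "s - t"] by (simp add: compose_diff_right flip: compose_assoc)
    then have "norm ((\<pi> s o\<^sub>L x) - (\<pi> t o\<^sub>L x)) \<le> e/2"
      using bspec[OF U(3), of "s - t"] that by (simp add: norm_rep_compose)
    then show ?thesis using \<open>0 < e\<close> by (simp add: dist_norm)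
  qed
  ultimately show "\<forall>\<^sub>F s in at t within UNIV. dist (\<pi> s o\<^sub>L x) (\<pi> t o\<^sub>L x) < e"
    unfolding eventually_at_topological by blast
qed

text \<open>The product is the weak integral of f against
  \<open>\<lambda>s. \<pi> s o\<^sub>L x\<close>, which is norm continuous with values in the
  algebra.\<close>

lemma A_pi1_compose:
  assumes f: "integrable m f" and x: "x \<in> \<A>"
  shows "pi1 m \<pi> f o\<^sub>L x \<in> \<A>"
proof (rule op_integral_mem[OF f op_subspace_A closed_A])
  show "continuous_on UNIV (\<lambda>s. \<pi> s o\<^sub>L x)" by (rule A_rep_continuous[OF x])
  show "norm (\<pi> s o\<^sub>L x) \<le> norm x" for s by (simp add: norm_rep_compose)
  show "\<pi> s o\<^sub>L x \<in> \<A>" for s by (rule A_rep[OF x])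
  show "cinner ((pi1 m \<pi> f o\<^sub>L x) \<xi>) \<eta> = (\<integral>t. f t * cinner ((\<pi> t o\<^sub>L x) \<xi>) \<eta> \<partial>m)" for \<xi> \<eta>
    by (simp add: cinner_pi1[OF f])
qed

text \<open>Left multiplication by the adjoint preserves the algebra. This is what allows operators
  such as a' a - a - a' + 1 to be applied to its elements.\<close>

lemma A_adjoint_compose:
  assumes f: "integrable m f" and x: "x \<in> \<A>" and T: "is_adj T (pi1 m \<pi> f)"
  shows "T o\<^sub>L x \<in> \<A>"
proof (rule op_integral_mem)
  obtain T' where T': "is_adj T' (pi1 m \<pi> f)"
    "\<And>\<xi> \<eta>. cinner (T' \<xi>) \<eta> = (\<integral>s. cnj (f s) * cinner (\<pi> (- s) \<xi>) \<eta> \<partial>m)"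
    using pi1_adjoint[OF f] by metis
  show "continuous_on UNIV (\<lambda>s. \<pi> (- s) o\<^sub>L x)"
    by (rule continuous_on_compose2[OF A_rep_continuous[OF x]]) (auto intro: continuous_intros)
  show "norm (\<pi> (- s) o\<^sub>L x) \<le> norm x" for s by (simp add: norm_rep_compose)
  show "\<pi> (- s) o\<^sub>L x \<in> \<A>" for s by (rule A_rep[OF x])
  show "cinner ((T o\<^sub>L x) \<xi>) \<eta> = (\<integral>t. cnj (f t) * cinner ((\<pi> (- t) o\<^sub>L x) \<xi>) \<eta> \<partial>m)" for \<xi> \<eta>
    using is_adj_unique[OF T T'(1)] by (simp add: T'(2))
  show "integrable m (\<lambda>t. cnj (f t))" using f by simp
qed (rule op_subspace_A closed_A)+

lemma A_compose:
  assumes "x \<in> \<A>" "y \<in> \<A>" shows "x o\<^sub>L y \<in> \<A>"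
  using assms(1)
proof (induct rule: A_induct)
  case (pi1 f)
  then show ?case using assms(2) by (rule A_pi1_compose)
next
  case (lim u v)
  then show ?case using closed_sequentially[OF closed_A, of "\<lambda>n. u n o\<^sub>L y"]
    by (simp add: tendsto_compose)
qed

end

section \<open>The spectrum consists of the approximate eigencharacters\<close>

lemma dual_groupD:
  assumes "\<sigma> \<in> dual_group"
  shows "continuous_on UNIV \<sigma>" "cmod (\<sigma> s) = 1" "\<sigma> (s + t) = \<sigma> s * \<sigma> t"
    "\<sigma> 0 = 1" "\<sigma> (- s) = cnj (\<sigma> s)" "cnj (\<sigma> s) * \<sigma> s = 1" "inverse (\<sigma> s) = cnj (\<sigma> s)"
proof -
  show 1: "continuous_on UNIV \<sigma>" "cmod (\<sigma> s) = 1" "\<sigma> (s + t) = \<sigma> s * \<sigma> t" for s t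
    using assms by (auto simp: dual_group_def)
  have "\<sigma> 0 * \<sigma> 0 = \<sigma> 0 * 1" using 1(3)[of 0 0] by simp
  moreover have "\<sigma> 0 \<noteq> 0" using 1(2)[of 0] by auto
  ultimately show 0: "\<sigma> 0 = 1" by (simp only: mult_cancel_left simp_thms)
  show 2: "cnj (\<sigma> s) * \<sigma> s = 1" for s
    using 1(2)[of s] complex_norm_square[of "\<sigma> s"] by (simp add: mult.commute)
  have "\<sigma> s \<noteq> 0" using 1(2)[of s] by auto
  moreover have "\<sigma> (- s) * \<sigma> s = 1" using 1(3)[of "- s" s] 0 by simp
  ultimately show "\<sigma> (- s) = cnj (\<sigma> s)" using 2[of s] mult_right_cancel by metis
  show "inverse (\<sigma> s) = cnj (\<sigma> s)"
    using 2[of s] \<open>\<sigma> s \<noteq> 0\<close> by (simp add: field_simps)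
qed

context urep
begin

definition approx_spectrum :: "('g \<Rightarrow> complex) set" where
  "approx_spectrum = {\<sigma> \<in> dual_group. \<forall>K e. compact K \<longrightarrow> 0 < e \<longrightarrow>
     (\<exists>\<eta>. norm \<eta> = 1 \<and> (\<forall>s\<in>K. norm (\<pi> s \<eta> - \<sigma> s *\<^sub>C \<eta>) \<le> e))}"

lemma approx_spectrum_dual: "\<sigma> \<in> approx_spectrum \<Longrightarrow> \<sigma> \<in> dual_group"
  by (simp add: approx_spectrum_def)

lemma approx_spectrumE:
  assumes "\<sigma> \<in> approx_spectrum" "compact K" "0 < e"
  obtains \<eta> where "norm \<eta> = 1" "\<And>s. s \<in> K \<Longrightarrow> norm (\<pi> s \<eta> - \<sigma> s *\<^sub>C \<eta>) \<le> e"
proof -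
  from assms(1)[unfolded approx_spectrum_def mem_Collect_eq, THEN conjunct2, rule_format, OF assms(2,3)]
  obtain \<eta> where "norm \<eta> = 1" "\<forall>s\<in>K. norm (\<pi> s \<eta> - \<sigma> s *\<^sub>C \<eta>) \<le> e" by (elim exE conjE)
  then show thesis by (intro that[of \<eta>]) auto
qed

end

text \<open>A bounded-below operator is inverted by the contraction \<open>x \<mapsto> x - t (b x - e)\<close>; running the
  iteration inside \<open>A\<close> solves \<open>b x = e\<close> there without adjoining a unit.\<close>

lemma solve_coercive_equation:
  fixes b e :: "'h::complex_hilbert \<Rightarrow>\<^sub>L 'h"
  assumes A: "op_subspace A" "closed A" "\<And>x. x \<in> A \<Longrightarrow> b o\<^sub>L x \<in> A" and e: "e \<in> A"
    and "0 < d" and low: "\<And>\<xi>. d * (norm \<xi>)\<^sup>2 \<le> Re (cinner (b \<xi>) \<xi>)"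
  obtains x where "x \<in> A" "b o\<^sub>L x = e"
proof -
  \<comment> \<open>The estimate below is |S \<xi>|^2 \<le> (1 - 2 t d + t^2 M) |\<xi>|^2, and t = d
    / M minimises the bracket, with value 1 - d t. The summand 1 keeps M positive.\<close>
  define M where "M = (norm b)\<^sup>2 + 1"
  have "1 \<le> M" by (simp add: M_def)
  define t where "t = d / M"
  have "0 < t" using \<open>0 < d\<close> \<open>1 \<le> M\<close> by (simp add: t_def)
  \<comment> \<open>The maximum secures q \<ge> 0; on the zero space 1 - d t can be
    negative.\<close>
  define q where "q = sqrt (max 0 (1 - d * t))"
  have "0 \<le> q" "q < 1" using \<open>0 < d\<close> \<open>0 < t\<close> by (auto simp: q_def)
  define S where "S = id_blinfun - t *\<^sub>R b"
  have "norm S \<le> q"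
  proof (rule norm_blinfun_bound[OF \<open>0 \<le> q\<close>])
    fix \<xi>
    have "(norm (S \<xi>))\<^sup>2 = (norm \<xi>)\<^sup>2 - 2 * t * Re (cinner (b \<xi>) \<xi>) + t\<^sup>2 * (norm (b \<xi>))\<^sup>2"
      by (simp add: S_def blinfun.diff_left blinfun.scaleR_left norm_diff_sq cinner_scaleR_right
          cinner_commute[of \<xi> "b \<xi>"] power_mult_distrib)
    also have "\<dots> \<le> (norm \<xi>)\<^sup>2 - 2 * t * (d * (norm \<xi>)\<^sup>2) + t\<^sup>2 * (M * (norm \<xi>)\<^sup>2)"
    proof (intro add_mono diff_left_mono mult_left_mono low)
      have "(norm (b \<xi>))\<^sup>2 \<le> (norm b * norm \<xi>)\<^sup>2" by (intro power_mono norm_blinfun norm_ge_zero)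
      also have "\<dots> \<le> M * (norm \<xi>)\<^sup>2" by (simp add: M_def power_mult_distrib mult_right_mono)
      finally show "(norm (b \<xi>))\<^sup>2 \<le> M * (norm \<xi>)\<^sup>2" .
    qed (use \<open>0 < t\<close> in auto)
    also have "t\<^sup>2 * (M * (norm \<xi>)\<^sup>2) = t * (d * (norm \<xi>)\<^sup>2)"
      using \<open>1 \<le> M\<close> by (simp add: t_def power2_eq_square)
    also have "(norm \<xi>)\<^sup>2 - 2 * t * (d * (norm \<xi>)\<^sup>2) + t * (d * (norm \<xi>)\<^sup>2) = (1 - d * t) * (norm \<xi>)\<^sup>2"
      by (simp add: algebra_simps)
    also have "\<dots> \<le> (q * norm \<xi>)\<^sup>2"
      by (simp add: q_def power_mult_distrib mult_right_mono)
    finally show "norm (S \<xi>) \<le> q * norm \<xi>"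
      using \<open>0 \<le> q\<close> by (intro power2_le_imp_le[of "norm (S \<xi>)"]) auto
  qed
  define f where "f x = (S o\<^sub>L x) + t *\<^sub>R e" for x
  have scaleR: "r *\<^sub>R x \<in> A" if "x \<in> A" for x r
  proof -
    have "r *\<^sub>R x = scaleC_op (of_real r) x"
      by (rule blinfun_eqI) (simp add: scaleC_op.rep_eq blinfun.scaleR_left scaleC_of_real)
    then show ?thesis using A(1) that by (simp add: op_subspace_def)
  qed
  have "\<exists>!x\<in>A. f x = x"
  proof (rule Banach_fix)
    show "complete A" using A(2) by (simp add: complete_eq_closed)
    show "A \<noteq> {}" using e by blast
    show "f ` A \<subseteq> A"
    proof (rule image_subsetI)
      fix x assume x: "x \<in> A"
      have "f x = x + ((- t) *\<^sub>R (b o\<^sub>L x) + t *\<^sub>R e)"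
        by (simp add: f_def S_def compose_diff_left compose_scaleR_left)
      then show "f x \<in> A" using A(1) scaleR[OF A(3)[OF x], of "- t"] scaleR[OF e] x
        by (simp only: op_subspace_def)
    qed
    show "dist (f x) (f y) \<le> q * dist x y" if "x \<in> A" "y \<in> A" for x y
    proof -
      have "f x - f y = S o\<^sub>L (x - y)" by (simp add: f_def compose_diff_right)
      then show ?thesis
        unfolding dist_norm using norm_blinfun_compose[of S "x - y"] mult_right_mono[OF \<open>norm S \<le> q\<close>, of "norm (x - y)"]
        by simp
    qed
  qed (use \<open>0 \<le> q\<close> \<open>q < 1\<close> in auto)
  then obtain x where x: "x \<in> A" "f x = x" by blast
  have "t *\<^sub>R (b o\<^sub>L x) = t *\<^sub>R e"
    using x(2) by (auto simp: f_def S_def compose_diff_left compose_scaleR_left algebra_simps)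
  then show thesis using that x(1) \<open>0 < t\<close> by simp
qed

lemma commutes_adjoint:
  assumes "commutes S T" "is_adj S' S" "is_adj T' T"
  shows "commutes S' T'"
proof (rule commutesI, rule cinner_ext)
  fix \<xi> \<eta>
  have "cinner (S' (T' \<xi>)) \<eta> = cinner \<xi> (T (S \<eta>))"
    using is_adjD[OF is_adj_sym[OF assms(2)]] is_adjD[OF is_adj_sym[OF assms(3)]] by simp
  also have "\<dots> = cinner \<xi> (S (T \<eta>))" using commutesD[OF assms(1)] by simp
  also have "\<dots> = cinner (T' (S' \<xi>)) \<eta>"
    using is_adjD[OF is_adj_sym[OF assms(2)]] is_adjD[OF is_adj_sym[OF assms(3)]] by simp
  finally show "cinner (S' (T' \<xi>)) \<eta> = cinner (T' (S' \<xi>)) \<eta>" .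
qed

section \<open>From characters of the algebra to approximate eigenvectors\<close>

context haar_rep
begin

text \<open>f is the conjugate of \<sigma> on a compact set of positive measure, normalised. The
  operator \<open>pi1 m \<pi> f\<close> then has value 1 under a character belonging to \<sigma> and
  stands in for a unit.\<close>

lemma unit_transform_exists:
  assumes \<sigma>: "\<sigma> \<in> dual_group"
  obtains f where "integrable m f" "L1_transform m f \<sigma> = 1"
proof -
  obtain C where C: "compact C" "0 < emeasure m C" by (rule compact_positive_measure)
  define c where "c = measure m C"
  have "emeasure m C = ennreal c"
    unfolding c_def using compact_finite[OF C(1)] by (intro emeasure_eq_ennreal_measure) auto
  then have "0 < c" using C(2) by (simp add: ennreal_less_zero_iff)
  define f where "f t = indicator C t *\<^sub>R (cnj (\<sigma> t) / of_real c)" for t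
  have ind: "integrable m (\<lambda>t. indicat_real C t / c)"
    using compact_sets[OF C(1)] compact_finite[OF C(1)] by (intro integrable_divide integrable_real_indicator)
  have "integrable m f"
  proof (rule norm_integral_le(1)[OF _ ind])
    have "(\<lambda>t. cnj (\<sigma> t) / of_real c) \<in> borel_measurable m"
      unfolding borel_measurable_m
      by (intro borel_measurable_continuous_onI continuous_intros dual_groupD(1)[OF \<sigma>]) (use \<open>0 < c\<close> in auto)
    then show "f \<in> borel_measurable m"
      unfolding f_def using compact_sets[OF C(1)]
      by (intro borel_measurable_scaleR borel_measurable_indicator)
    show "cmod (f t) \<le> indicat_real C t / c" for t
      using \<open>0 < c\<close> by (simp add: f_def norm_divide dual_groupD(2)[OF \<sigma>])
  qed
  moreover have "L1_transform m f \<sigma> = 1"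
  proof -
    have "f t * \<sigma> t = of_real (indicat_real C t / c)" for t
      using dual_groupD(6)[OF \<sigma>, of t] by (simp add: f_def split: split_indicator)
    then have "L1_transform m f \<sigma> = of_real (\<integral>t. indicat_real C t / c \<partial>m)"
      by (simp only: L1_transform_def integral_complex_of_real)
    also have "(\<integral>t. indicat_real C t / c \<partial>m) = 1"
      using \<open>0 < c\<close> compact_sets[OF C(1)] by (simp add: c_def)
    finally show ?thesis by simp
  qed
  ultimately show thesis by (rule that)
qed

lemma transform_integrable:
  assumes "\<sigma> \<in> dual_group" "integrable m f"
  shows "integrable m (\<lambda>t. f t * \<sigma> t)"
proof (rule norm_integral_le(1)[OF _ integrable_norm[OF assms(2)]])
  have "\<sigma> \<in> borel_measurable m"
    unfolding borel_measurable_m by (rule borel_measurable_continuous_onI[OF dual_groupD(1)[OF assms(1)]])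
  then show "(\<lambda>t. f t * \<sigma> t) \<in> borel_measurable m"
    using borel_measurable_integrable[OF assms(2)] by measurable
qed (simp add: norm_mult dual_groupD(2)[OF assms(1)])

lemma L1_transform_translate:
  assumes \<sigma>: "\<sigma> \<in> dual_group" and f: "integrable m f"
  shows "L1_transform m (\<lambda>t. f (t - s)) \<sigma> = \<sigma> s * L1_transform m f \<sigma>"
proof -
  have "f (t - s) * \<sigma> t = \<sigma> s * (f (t - s) * \<sigma> (t - s))" for t
    using dual_groupD(3)[OF \<sigma>, of s "t - s"] by simp
  then have "L1_transform m (\<lambda>t. f (t - s)) \<sigma> = (\<integral>t. \<sigma> s * (f (t - s) * \<sigma> (t - s)) \<partial>m)"
    unfolding L1_transform_def by (intro Bochner_Integration.integral_cong refl)
  also have "\<dots> = \<sigma> s * (\<integral>t. f (t - s) * \<sigma> (t - s) \<partial>m)" by (rule integral_mult_right_zero)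
  also have "(\<integral>t. f (t - s) * \<sigma> (t - s) \<partial>m) = L1_transform m f \<sigma>"
    unfolding L1_transform_def
    by (rule integral_translate[OF borel_measurable_integrable[OF transform_integrable[OF \<sigma> f]]])
  finally show ?thesis .
qed

text \<open>Write a for \<open>pi1 m \<pi> f\<close>. If no such vector exists, the operator b whose
  form is the sum of all |D s \<xi>|^2 and |E \<xi>|^2 is bounded below by d^2, so b x = a is
  solvable in the algebra; but \<phi> vanishes on every b x and equals 1 at a. The clause that a
  almost fixes the vector later upgrades finite sets to compact ones.\<close>

lemma approx_eigenvector_from_character:
  assumes \<sigma>: "\<sigma> \<in> dual_group" and \<phi>: "is_character \<A> \<phi>"
    and \<phi>_pi1: "\<And>f. integrable m f \<Longrightarrow> \<phi> (pi1 m \<pi> f) = L1_transform m f \<sigma>"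
    and f: "integrable m f" "L1_transform m f \<sigma> = 1" and "finite F" "0 < d"
  obtains \<eta> where "norm \<eta> = 1" "norm (pi1 m \<pi> f \<eta> - \<eta>) \<le> d"
    "\<And>s. s \<in> F \<Longrightarrow> norm (\<pi> s \<eta> - \<sigma> s *\<^sub>C \<eta>) \<le> d"
proof (rule ccontr)
  assume contra: "\<not> thesis"
  let ?a = "pi1 m \<pi> f"
  have add: "\<phi> (x + y) = \<phi> x + \<phi> y" and mult: "\<phi> (x o\<^sub>L y) = \<phi> x * \<phi> y"
    and scale: "\<phi> (scaleC_op c x) = c * \<phi> x" if "x \<in> \<A>" "y \<in> \<A>" for x y c
    using \<phi> that unfolding is_character_def by blast+
  have zero_mem: "0 \<in> \<A>" using op_subspace_A by (simp add: op_subspace_def)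
  then have zero: "\<phi> 0 = 0" using add[of 0 0] by simp
  have diff: "\<phi> (x - y) = \<phi> x - \<phi> y" if "x \<in> \<A>" "y \<in> \<A>" for x y
    using add[OF A_diff[OF that] that(2)] by simp
  have a: "?a \<in> \<A>" by (rule pi1_mem[OF f(1)])
  have \<phi>a: "\<phi> ?a = 1" using \<phi>_pi1[OF f(1)] f(2) by simp
  have a_rep: "commutes (\<pi> s) ?a" for s
    by (rule pi1_commutes[OF f(1) rep_adj rep_commutes])
  \<comment> \<open>As \<phi> a = 1, a factor a may be inserted and moved past \<pi> s. Then \<pi> s
    acts on a, where the transform of a translate gives \<sigma> s.\<close>
  have \<phi>_rep: "\<phi> (\<pi> s o\<^sub>L x) = \<sigma> s * \<phi> x" if x: "x \<in> \<A>" for s x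
  proof -
    have "\<phi> (\<pi> s o\<^sub>L x) = \<phi> (?a o\<^sub>L (\<pi> s o\<^sub>L x))"
      using mult[OF a A_rep[OF x]] \<phi>a by simp
    also have "?a o\<^sub>L (\<pi> s o\<^sub>L x) = (\<pi> s o\<^sub>L ?a) o\<^sub>L x"
      using a_rep[of s] by (simp add: commutes_def flip: compose_assoc)
    also have "\<phi> \<dots> = \<phi> (\<pi> s o\<^sub>L ?a) * \<phi> x" by (rule mult[OF A_rep[OF a] x])
    also have "\<phi> (\<pi> s o\<^sub>L ?a) = \<sigma> s"
      using \<phi>_pi1[OF integrable_translate[OF f(1)]] L1_transform_translate[OF \<sigma> f(1)] f(2)
      by (simp add: rep_pi1[OF f(1)])
    finally show ?thesis .
  qed
  obtain a' where a': "a' \<in> BH" "is_adj a' ?a" by (rule pi1_adjoint[OF f(1)])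
  have aa': "commutes a' ?a"
  proof (rule pi1_commutes[OF f(1) is_adj_sym[OF a'(2)]])
    show "commutes a' (\<pi> t)" for t
      using commutes_adjoint[OF commutes_sym[OF a_rep[of "- t"]] a'(2) rep_adj[of "- t"]] by simp
  qed
  have a'_mem: "a' o\<^sub>L x \<in> \<A>" if "x \<in> \<A>" for x by (rule A_adjoint_compose[OF f(1) that a'(2)])
  define D where "D s = \<pi> s - scaleC_op (\<sigma> s) id_blinfun" for s
  define D' where "D' s = \<pi> (- s) - scaleC_op (cnj (\<sigma> s)) id_blinfun" for s
  have D_adj: "is_adj (D' s) (D s)" for s
    unfolding D_def D'_def by (intro is_adj_diff rep_adj is_adj_scaleC is_adj_id)
  have D_mem: "D s o\<^sub>L x \<in> \<A>" "D' s o\<^sub>L x \<in> \<A>" "\<phi> (D s o\<^sub>L x) = 0" "\<phi> (D' s o\<^sub>L x) = 0"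
    if x: "x \<in> \<A>" for s x
  proof -
    have eq: "D s o\<^sub>L x = (\<pi> s o\<^sub>L x) - scaleC_op (\<sigma> s) x"
      "D' s o\<^sub>L x = (\<pi> (- s) o\<^sub>L x) - scaleC_op (cnj (\<sigma> s)) x"
      unfolding D_def D'_def by (rule blinfun_eqI, simp add: blinfun.diff_left scaleC_op.rep_eq)+
    show "D s o\<^sub>L x \<in> \<A>" "D' s o\<^sub>L x \<in> \<A>"
      unfolding eq by (intro A_diff A_rep A_scaleC x)+
    show "\<phi> (D s o\<^sub>L x) = 0" "\<phi> (D' s o\<^sub>L x) = 0"
      unfolding eq by (simp_all add: diff[OF A_rep[OF x] A_scaleC[OF x]] \<phi>_rep[OF x] scale[OF x x] dual_groupD(5)[OF \<sigma>])
  qed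
  define E where "E = ?a - id_blinfun"
  define E' where "E' = a' - id_blinfun"
  have E_adj: "is_adj E' E" unfolding E_def E'_def by (intro is_adj_diff a'(2) is_adj_id)
  have E_mem: "E o\<^sub>L x \<in> \<A>" "\<phi> (E o\<^sub>L x) = 0" "E' o\<^sub>L x \<in> \<A>" if x: "x \<in> \<A>" for x
    using A_diff[OF A_compose[OF a x] x] A_diff[OF a'_mem[OF x] x] diff[OF A_compose[OF a x] x] mult[OF a x] \<phi>a
    by (simp_all add: E_def E'_def compose_diff_left)
  \<comment> \<open>\<phi> is evaluated inside the algebra only, and a' is not known to belong to
    it. Inserting a gives (a' a) y, a product of two elements of the algebra.\<close>
  have E'_zero: "\<phi> (E' o\<^sub>L y) = 0" if y: "y \<in> \<A>" "\<phi> y = 0" for y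
  proof -
    have "\<phi> (a' o\<^sub>L y) = \<phi> (?a o\<^sub>L (a' o\<^sub>L y))" using mult[OF a a'_mem[OF y(1)]] \<phi>a by simp
    also have "?a o\<^sub>L (a' o\<^sub>L y) = (a' o\<^sub>L ?a) o\<^sub>L y"
      using aa' by (simp add: commutes_def flip: compose_assoc)
    also have "\<phi> \<dots> = 0" using mult[OF a'_mem[OF a] y(1)] y(2) by simp
    finally show ?thesis using diff[OF a'_mem[OF y(1)] y(1)] y(2) by (simp add: E'_def compose_diff_left)
  qed
  define b where "b = (\<Sum>s\<in>F. D' s o\<^sub>L D s) + (E' o\<^sub>L E)"
  have b_x: "b o\<^sub>L x = (\<Sum>s\<in>F. D' s o\<^sub>L (D s o\<^sub>L x)) + (E' o\<^sub>L (E o\<^sub>L x))" for x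
    by (rule blinfun_eqI) (simp add: b_def blinfun.add_left blinfun.sum_left)
  have sum_mem: "(\<Sum>s\<in>F'. D' s o\<^sub>L (D s o\<^sub>L x)) \<in> \<A> \<and> \<phi> (\<Sum>s\<in>F'. D' s o\<^sub>L (D s o\<^sub>L x)) = 0"
    if x: "x \<in> \<A>" and "finite F'" for x F'
    using \<open>finite F'\<close>
  proof (induct F' rule: finite_induct)
    case empty
    then show ?case by (simp add: zero zero_mem)
  next
    case (insert s F')
    then show ?case
      using D_mem[OF D_mem(1)[OF x]] add[OF D_mem(2)[OF D_mem(1)[OF x]], of "\<Sum>s\<in>F'. D' s o\<^sub>L (D s o\<^sub>L x)"]
      by (simp add: A_add)
  qed
  have b_mem: "b o\<^sub>L x \<in> \<A>" and \<phi>_b: "\<phi> (b o\<^sub>L x) = 0" if x: "x \<in> \<A>" for x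
    using sum_mem[OF x \<open>finite F\<close>] E_mem(3)[OF E_mem(1)[OF x]] E'_zero[OF E_mem(1,2)[OF x]]
    by (simp_all add: b_x A_add add)
  have b_form: "Re (cinner (b \<xi>) \<xi>) = (\<Sum>s\<in>F. (norm (D s \<xi>))\<^sup>2) + (norm (E \<xi>))\<^sup>2" for \<xi>
    by (simp add: b_def blinfun.add_left blinfun.sum_left cinner_add_left cinner_sum_left
        is_adjD[OF is_adj_sym[OF D_adj]] is_adjD[OF is_adj_sym[OF E_adj]] cinner_self)
  have low: "d\<^sup>2 * (norm \<xi>)\<^sup>2 \<le> Re (cinner (b \<xi>) \<xi>)" for \<xi>
  proof (cases "\<xi> = 0")
    case False
    define \<eta> where "\<eta> = (1 / norm \<xi>) *\<^sub>R \<xi>"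
    have \<eta>: "norm \<eta> = 1" "\<xi> = norm \<xi> *\<^sub>R \<eta>" using False by (simp_all add: \<eta>_def)
    have D_app: "D s \<eta> = \<pi> s \<eta> - \<sigma> s *\<^sub>C \<eta>" and E_app: "E \<eta> = ?a \<eta> - \<eta>" for s
      by (simp_all add: D_def E_def blinfun.diff_left scaleC_op.rep_eq)
    have nonneg: "0 \<le> (\<Sum>s\<in>F. (norm (D s \<eta>))\<^sup>2)" by (simp add: sum_nonneg)
    have "\<not> (norm (E \<eta>) \<le> d \<and> (\<forall>s\<in>F. norm (D s \<eta>) \<le> d))"
      using contra that[OF \<eta>(1)] unfolding D_app E_app by blast
    then consider "d < norm (E \<eta>)" | s where "s \<in> F" "d < norm (D s \<eta>)" by (meson not_le)
    then have "d\<^sup>2 \<le> (\<Sum>s\<in>F. (norm (D s \<eta>))\<^sup>2) + (norm (E \<eta>))\<^sup>2"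
    proof cases
      case 1
      then have "d\<^sup>2 \<le> (norm (E \<eta>))\<^sup>2" using \<open>0 < d\<close> by (intro power_mono) auto
      then show ?thesis using nonneg by linarith
    next
      case (2 s)
      then have "d\<^sup>2 \<le> (norm (D s \<eta>))\<^sup>2" using \<open>0 < d\<close> by (intro power_mono) auto
      also have "\<dots> \<le> (\<Sum>s\<in>F. (norm (D s \<eta>))\<^sup>2)"
        using 2(1) \<open>finite F\<close> by (intro member_le_sum[of s F "\<lambda>s. (norm (D s \<eta>))\<^sup>2"]) auto
      finally show ?thesis using zero_le_power2[of "norm (E \<eta>)"] by linarith
    qed
    then have "d\<^sup>2 \<le> Re (cinner (b \<eta>) \<eta>)" by (simp add: b_form)
    moreover have "Re (cinner (b \<xi>) \<xi>) = (norm \<xi>)\<^sup>2 * Re (cinner (b \<eta>) \<eta>)"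
      by (subst (1 2) \<eta>(2)) (simp add: blinfun.scaleR_right cinner_scaleR_left cinner_scaleR_right power2_eq_square)
    ultimately show ?thesis using mult_right_mono[of "d\<^sup>2" _ "(norm \<xi>)\<^sup>2"] by (simp add: mult.commute)
  qed simp
  obtain x where x: "x \<in> \<A>" "b o\<^sub>L x = ?a"
    by (rule solve_coercive_equation[OF op_subspace_A closed_A b_mem a _ low]) (use \<open>0 < d\<close> in auto)
  then show False using \<phi>_b[OF x(1)] \<phi>a by simp
qed

text \<open>The character supplies a vector for a finite F only. As that vector is almost fixed by a
  and \<open>\<lambda>s. \<pi> s o\<^sub>L ?a\<close> is norm continuous, a suitable finite subset
  of K controls all of K.\<close>

lemma E_pi_subset_approx_spectrum: "E_pi m \<pi> \<subseteq> approx_spectrum"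
proof
  fix \<sigma> assume "\<sigma> \<in> E_pi m \<pi>"
  then obtain \<phi> where \<sigma>: "\<sigma> \<in> dual_group" and \<phi>: "is_character \<A> \<phi>"
    "\<And>f. integrable m f \<Longrightarrow> \<phi> (pi1 m \<pi> f) = L1_transform m f \<sigma>"
    unfolding E_pi_def by blast
  obtain f where f: "integrable m f" "L1_transform m f \<sigma> = 1" by (rule unit_transform_exists[OF \<sigma>])
  let ?a = "pi1 m \<pi> f"
  have "\<exists>\<eta>. norm \<eta> = 1 \<and> (\<forall>s\<in>K. norm (\<pi> s \<eta> - \<sigma> s *\<^sub>C \<eta>) \<le> e)" if K: "compact K" and "0 < e" for K e
  proof -
    \<comment> \<open>One fifth for each of the five terms in \<open>eq\<close>.\<close>
    define d where "d = e / 5"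
    have "0 < d" using \<open>0 < e\<close> by (simp add: d_def)
    let ?V = "\<lambda>s. {t. norm ((\<pi> t o\<^sub>L ?a) - (\<pi> s o\<^sub>L ?a)) < d} \<inter> {t. cmod (\<sigma> s - \<sigma> t) < d}"
    have "open (?V s)" for s
      by (intro open_Int open_Collect_less continuous_intros A_rep_continuous pi1_mem f dual_groupD(1)[OF \<sigma>])
    moreover have "K \<subseteq> (\<Union>s\<in>K. ?V s)" using \<open>0 < d\<close> by auto
    ultimately obtain F where F: "F \<subseteq> K" "finite F" "K \<subseteq> (\<Union>s\<in>F. ?V s)"
      using compactE_image[OF K, of K ?V] by blast
    obtain \<eta> where \<eta>: "norm \<eta> = 1" "norm (?a \<eta> - \<eta>) \<le> d" "\<And>s. s \<in> F \<Longrightarrow> norm (\<pi> s \<eta> - \<sigma> s *\<^sub>C \<eta>) \<le> d"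
      by (rule approx_eigenvector_from_character[OF \<sigma> \<phi> f F(2) \<open>0 < d\<close>]) (assumption, rule that)
    have "norm (\<pi> t \<eta> - \<sigma> t *\<^sub>C \<eta>) \<le> e" if "t \<in> K" for t
    proof -
      obtain s where s: "s \<in> F" "norm ((\<pi> t o\<^sub>L ?a) - (\<pi> s o\<^sub>L ?a)) < d" "cmod (\<sigma> s - \<sigma> t) < d"
        using F(3) \<open>t \<in> K\<close> by blast
      have eq: "\<pi> t \<eta> - \<sigma> t *\<^sub>C \<eta> = \<pi> t (\<eta> - ?a \<eta>) + (((\<pi> t o\<^sub>L ?a) - (\<pi> s o\<^sub>L ?a)) \<eta>
          + (\<pi> s (?a \<eta> - \<eta>) + ((\<pi> s \<eta> - \<sigma> s *\<^sub>C \<eta>) + (\<sigma> s - \<sigma> t) *\<^sub>C \<eta>)))"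
        by (simp add: blinfun.diff_left blinfun.diff_right scaleC_diff_left)
      have "norm (\<pi> t (\<eta> - ?a \<eta>)) \<le> d" "norm (\<pi> s (?a \<eta> - \<eta>)) \<le> d"
        using \<eta>(2) by (simp_all add: norm_minus_commute)
      moreover have "norm (((\<pi> t o\<^sub>L ?a) - (\<pi> s o\<^sub>L ?a)) \<eta>) \<le> d"
        using norm_blinfun[of "(\<pi> t o\<^sub>L ?a) - (\<pi> s o\<^sub>L ?a)" \<eta>] s(2) \<eta>(1) by simp
      moreover have "norm ((\<sigma> s - \<sigma> t) *\<^sub>C \<eta>) \<le> d"
        using s(3) \<eta>(1) by (simp add: norm_scaleC)
      ultimately have "norm (\<pi> t \<eta> - \<sigma> t *\<^sub>C \<eta>) \<le> d + (d + (d + (d + d)))"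
        unfolding eq by (intro norm_triangle_mono \<eta>(3)[OF s(1)])
      then show ?thesis by (simp add: d_def)
    qed
    then show ?thesis by (intro exI[of _ \<eta>] conjI ballI \<eta>(1))
  qed
  with \<sigma> show "\<sigma> \<in> approx_spectrum" by (simp add: approx_spectrum_def)
qed

subsection \<open>Approximate eigencharacters are characters of the algebra\<close>

definition near_eigen :: "('g \<Rightarrow> complex) \<Rightarrow> 'g set \<Rightarrow> real \<Rightarrow> 'h \<Rightarrow> bool" where
  "near_eigen \<sigma> K d \<eta> \<longleftrightarrow> norm \<eta> = 1 \<and> (\<forall>s\<in>K. norm (\<pi> s \<eta> - \<sigma> s *\<^sub>C \<eta>) \<le> d)"

text \<open>\<kappa> is the limit of x along the near eigenvectors of \<sigma> as K grows and d
  shrinks. Quantifying over all of them lets two operators be compared on a common vector.\<close>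

definition eigenvalue_at :: "('g \<Rightarrow> complex) \<Rightarrow> ('h \<Rightarrow>\<^sub>L 'h) \<Rightarrow> complex \<Rightarrow> bool" where
  "eigenvalue_at \<sigma> x \<kappa> \<longleftrightarrow> (\<forall>e>0. \<exists>K d. compact K \<and> 0 < d \<and>
     (\<forall>\<eta>. near_eigen \<sigma> K d \<eta> \<longrightarrow> norm (x \<eta> - \<kappa> *\<^sub>C \<eta>) \<le> e))"

lemma eigenvalue_atE:
  assumes "eigenvalue_at \<sigma> x \<kappa>" "0 < e"
  obtains K d where "compact K" "0 < d" "\<And>\<eta>. near_eigen \<sigma> K d \<eta> \<Longrightarrow> norm (x \<eta> - \<kappa> *\<^sub>C \<eta>) \<le> e"
proof -
  from assms(1)[unfolded eigenvalue_at_def, rule_format, OF assms(2)]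
  obtain K d where K: "compact K" "0 < d"
    "\<forall>\<eta>. near_eigen \<sigma> K d \<eta> \<longrightarrow> norm (x \<eta> - \<kappa> *\<^sub>C \<eta>) \<le> e" by (elim exE conjE)
  show thesis by (rule that[OF K(1,2) K(3)[rule_format]])
qed

lemma near_eigen_mono: "near_eigen \<sigma> (K \<union> L) (min c d) \<eta> \<Longrightarrow> near_eigen \<sigma> K c \<eta> \<and> near_eigen \<sigma> L d \<eta>"
  unfolding near_eigen_def by (auto intro: order_trans)

lemma eigenvalue_at_pair:
  assumes "eigenvalue_at \<sigma> x \<kappa>" "eigenvalue_at \<sigma> y \<nu>" "0 < e" "0 < e'"
  obtains K d where "compact K" "0 < d"
    "\<And>\<eta>. near_eigen \<sigma> K d \<eta> \<Longrightarrow> norm (x \<eta> - \<kappa> *\<^sub>C \<eta>) \<le> e \<and> norm (y \<eta> - \<nu> *\<^sub>C \<eta>) \<le> e'"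
proof -
  obtain K c where K: "compact K" "0 < c" "\<And>\<eta>. near_eigen \<sigma> K c \<eta> \<Longrightarrow> norm (x \<eta> - \<kappa> *\<^sub>C \<eta>) \<le> e"
    by (rule eigenvalue_atE[OF assms(1,3)]) (rule that)
  obtain L d where L: "compact L" "0 < d" "\<And>\<eta>. near_eigen \<sigma> L d \<eta> \<Longrightarrow> norm (y \<eta> - \<nu> *\<^sub>C \<eta>) \<le> e'"
    by (rule eigenvalue_atE[OF assms(2,4)]) (rule that)
  show thesis
  proof (rule that[of "K \<union> L" "min c d"])
    show "compact (K \<union> L)" using K(1) L(1) by (rule compact_Un)
    show "0 < min c d" using K(2) L(2) by simp
    fix \<eta> assume "near_eigen \<sigma> (K \<union> L) (min c d) \<eta>"
    note near_eigen_mono[OF this]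
    then show "norm (x \<eta> - \<kappa> *\<^sub>C \<eta>) \<le> e \<and> norm (y \<eta> - \<nu> *\<^sub>C \<eta>) \<le> e'"
      by (intro conjI K(3) L(3)) (erule conjunct1, erule conjunct2)
  qed
qed

text \<open>A common near eigenvector exists because \<sigma> lies in the approximate spectrum. The
  bound yields uniqueness of \<kappa> and the Cauchy property under limits.\<close>

lemma eigenvalue_at_dist:
  assumes \<sigma>: "\<sigma> \<in> approx_spectrum" and "eigenvalue_at \<sigma> x \<kappa>" "eigenvalue_at \<sigma> y \<nu>"
  shows "cmod (\<kappa> - \<nu>) \<le> norm (x - y)"
proof (rule field_le_epsilon)
  fix e :: real assume "0 < e"
  then have e: "0 < e/2" by simp
  obtain K d where K: "compact K" "0 < d"
    "\<And>\<eta>. near_eigen \<sigma> K d \<eta> \<Longrightarrow> norm (x \<eta> - \<kappa> *\<^sub>C \<eta>) \<le> e/2 \<and> norm (y \<eta> - \<nu> *\<^sub>C \<eta>) \<le> e/2"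
    by (rule eigenvalue_at_pair[OF assms(2,3) e e]) (rule that)
  obtain \<eta> where \<eta>: "norm \<eta> = 1" "\<And>s. s \<in> K \<Longrightarrow> norm (\<pi> s \<eta> - \<sigma> s *\<^sub>C \<eta>) \<le> d"
    by (rule approx_spectrumE[OF \<sigma> K(1,2)]) (rule that)
  then have n: "norm (x \<eta> - \<kappa> *\<^sub>C \<eta>) \<le> e/2" "norm (y \<eta> - \<nu> *\<^sub>C \<eta>) \<le> e/2"
    using K(3)[of \<eta>] by (simp_all add: near_eigen_def)
  have "cmod (\<kappa> - \<nu>) = norm ((\<kappa> - \<nu>) *\<^sub>C \<eta>)" by (simp add: norm_scaleC \<eta>(1))
  also have "(\<kappa> - \<nu>) *\<^sub>C \<eta> = ((x - y) \<eta> + (y \<eta> - \<nu> *\<^sub>C \<eta>)) - (x \<eta> - \<kappa> *\<^sub>C \<eta>)"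
    by (simp add: blinfun.diff_left scaleC_diff_left)
  also have "norm \<dots> \<le> norm (x - y) + e"
    using n norm_blinfun[of "x - y" \<eta>] \<eta>(1) norm_triangle_ineq4[of "(x - y) \<eta> + (y \<eta> - \<nu> *\<^sub>C \<eta>)" "x \<eta> - \<kappa> *\<^sub>C \<eta>"]
      norm_triangle_ineq[of "(x - y) \<eta>" "y \<eta> - \<nu> *\<^sub>C \<eta>"] by simp
  finally show "cmod (\<kappa> - \<nu>) \<le> norm (x - y) + e" .
qed

lemma eigenvalue_at_unique:
  "\<sigma> \<in> approx_spectrum \<Longrightarrow> eigenvalue_at \<sigma> x \<kappa> \<Longrightarrow> eigenvalue_at \<sigma> x \<nu> \<Longrightarrow> \<kappa> = \<nu>"
  using eigenvalue_at_dist[of \<sigma> x \<kappa> x \<nu>] by simp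

lemma eigenvalue_at_add:
  assumes "eigenvalue_at \<sigma> x \<kappa>" "eigenvalue_at \<sigma> y \<nu>"
  shows "eigenvalue_at \<sigma> (x + y) (\<kappa> + \<nu>)"
  unfolding eigenvalue_at_def
proof (intro allI impI)
  fix e :: real assume "0 < e"
  then have e: "0 < e/2" by simp
  obtain K d where K: "compact K" "0 < d"
    "\<And>\<eta>. near_eigen \<sigma> K d \<eta> \<Longrightarrow> norm (x \<eta> - \<kappa> *\<^sub>C \<eta>) \<le> e/2 \<and> norm (y \<eta> - \<nu> *\<^sub>C \<eta>) \<le> e/2"
    by (rule eigenvalue_at_pair[OF assms e e]) (rule that)
  have near: "norm ((x + y) \<eta> - (\<kappa> + \<nu>) *\<^sub>C \<eta>) \<le> e" if "near_eigen \<sigma> K d \<eta>" for \<eta>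
    using K(3)[OF that] norm_triangle_ineq[of "x \<eta> - \<kappa> *\<^sub>C \<eta>" "y \<eta> - \<nu> *\<^sub>C \<eta>"]
    by (simp add: blinfun.add_left scaleC_add_left add_diff_add)
  show "\<exists>K d. compact K \<and> 0 < d \<and> (\<forall>\<eta>. near_eigen \<sigma> K d \<eta> \<longrightarrow> norm ((x + y) \<eta> - (\<kappa> + \<nu>) *\<^sub>C \<eta>) \<le> e)"
      by (intro exI[of _ K] exI[of _ d] conjI allI impI K(1) \<open>0 < d\<close> near)
qed

text \<open>x (y \<eta>) is compared with \<nu> (x \<eta>), where complex linearity of x lets \<nu>
  be pulled out. The added 1 in c and c' avoids zero denominators.\<close>

lemma eigenvalue_at_compose:
  assumes "x \<in> BH" "eigenvalue_at \<sigma> x \<kappa>" "eigenvalue_at \<sigma> y \<nu>"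
  shows "eigenvalue_at \<sigma> (x o\<^sub>L y) (\<kappa> * \<nu>)"
  unfolding eigenvalue_at_def
proof (intro allI impI)
  fix e :: real assume "0 < e"
  define c where "c = e / (2 * (cmod \<nu> + 1))"
  define c' where "c' = e / (2 * (norm x + 1))"
  have pos: "0 < cmod \<nu> + 1" "0 < norm x + 1" by (simp_all add: add_nonneg_pos)
  have c: "0 < c" "0 < c'" using \<open>0 < e\<close> pos by (simp_all only: c_def c'_def zero_less_divide_iff zero_less_mult_iff) auto
  obtain K d where K: "compact K" "0 < d"
    "\<And>\<eta>. near_eigen \<sigma> K d \<eta> \<Longrightarrow> norm (x \<eta> - \<kappa> *\<^sub>C \<eta>) \<le> c \<and> norm (y \<eta> - \<nu> *\<^sub>C \<eta>) \<le> c'"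
    by (rule eigenvalue_at_pair[OF assms(2,3) c]) (rule that)
  have near: "norm ((x o\<^sub>L y) \<eta> - (\<kappa> * \<nu>) *\<^sub>C \<eta>) \<le> e" if "near_eigen \<sigma> K d \<eta>" for \<eta>
  proof -
    have "(x o\<^sub>L y) \<eta> - (\<kappa> * \<nu>) *\<^sub>C \<eta> = x (y \<eta> - \<nu> *\<^sub>C \<eta>) + \<nu> *\<^sub>C (x \<eta> - \<kappa> *\<^sub>C \<eta>)"
      by (simp add: blinfun.diff_right BH_D[OF assms(1)] scaleC_diff_right scaleC_scaleC mult.commute)
    also have "norm \<dots> \<le> (norm x + 1) * c' + (cmod \<nu> + 1) * c"
    proof (intro norm_triangle_mono)
      show "norm (x (y \<eta> - \<nu> *\<^sub>C \<eta>)) \<le> (norm x + 1) * c'"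
        by (rule order_trans[OF norm_blinfun mult_mono]) (use K(3)[OF that] pos in auto)
      show "norm (\<nu> *\<^sub>C (x \<eta> - \<kappa> *\<^sub>C \<eta>)) \<le> (cmod \<nu> + 1) * c"
        unfolding norm_scaleC by (rule mult_mono) (use K(3)[OF that] pos in auto)
    qed
    also have "\<dots> = e"
    proof -
      have "z * (e / (2 * z)) = e/2" if "0 < z" for z :: real using that by simp
      from this[OF pos(1)] this[OF pos(2)] show ?thesis unfolding c_def c'_def by linarith
    qed
    finally show ?thesis .
  qed
  show "\<exists>K d. compact K \<and> 0 < d \<and> (\<forall>\<eta>. near_eigen \<sigma> K d \<eta> \<longrightarrow> norm ((x o\<^sub>L y) \<eta> - (\<kappa> * \<nu>) *\<^sub>C \<eta>) \<le> e)"
      by (intro exI[of _ K] exI[of _ d] conjI allI impI K(1) \<open>0 < d\<close> near)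
qed

lemma eigenvalue_at_scalar: "eigenvalue_at \<sigma> (scaleC_op c id_blinfun) c"
  unfolding eigenvalue_at_def
  by (intro allI impI exI[of _ "{}"] exI[of _ 1]) (simp add: scaleC_op.rep_eq)

lemma eigenvalue_at_scaleC:
  assumes "eigenvalue_at \<sigma> x \<kappa>"
  shows "eigenvalue_at \<sigma> (scaleC_op c x) (c * \<kappa>)"
proof -
  have "scaleC_op c id_blinfun o\<^sub>L x = scaleC_op c x" by (rule blinfun_eqI) (simp add: scaleC_op.rep_eq)
  then show ?thesis
    using eigenvalue_at_compose[OF BH_scaleC[OF BH_id] eigenvalue_at_scalar assms, of c] by simp
qed

text \<open>On K the bound d for near eigenvectors applies and costs e/2 in total; off K the trivial
  bound 2 is paid with a tail of f of mass e/4.\<close>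

lemma eigenvalue_at_pi1:
  assumes \<sigma>: "\<sigma> \<in> dual_group" and f: "integrable m f"
  shows "eigenvalue_at \<sigma> (pi1 m \<pi> f) (L1_transform m f \<sigma>)"
  unfolding eigenvalue_at_def
proof (intro allI impI)
  fix e :: real assume "0 < e"
  then have "0 < e/4" by simp
  then obtain K where K: "compact K" "(\<integral>t. cmod (f t) * indicator (- K) t \<partial>m) \<le> e/4"
    using L1_tail[OF f] by blast
  define N where "N = (\<integral>t. cmod (f t) \<partial>m)"
  have "0 \<le> N" by (simp add: N_def)
  define d where "d = e / (2 * (N + 1))"
  have "0 < d" using \<open>0 < e\<close> \<open>0 \<le> N\<close> by (simp add: d_def)
  have meas: "- K \<in> sets m"
    using compact_sets[OF K(1)] unfolding sets_m by (rule borel_comp)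
  have tail: "integrable m (\<lambda>t. cmod (f t) * indicator (- K) t)"
    using integrable_real_mult_indicator[OF meas integrable_norm[OF f]] .
  have near: "norm (pi1 m \<pi> f \<eta> - L1_transform m f \<sigma> *\<^sub>C \<eta>) \<le> e" if \<eta>: "near_eigen \<sigma> K d \<eta>" for \<eta>
  proof (rule norm_le_if_cinner_le)
    fix \<zeta>
    let ?g = "\<lambda>s. f s * cinner (\<pi> s \<eta>) \<zeta> - (f s * \<sigma> s) * cinner \<eta> \<zeta>"
    have i: "integrable m ?g"
      by (intro Bochner_Integration.integrable_diff rep_integrable f integrable_mult_left transform_integrable[OF \<sigma>])
    have "cinner (pi1 m \<pi> f \<eta> - L1_transform m f \<sigma> *\<^sub>C \<eta>) \<zeta> = (\<integral>s. ?g s \<partial>m)"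
      unfolding L1_transform_def
      by (subst Bochner_Integration.integral_diff)
        (auto simp: cinner_simps cinner_pi1[OF f] intro: rep_integrable[OF f] integrable_mult_left[OF transform_integrable[OF \<sigma> f]])
    also have "cmod \<dots> \<le> (\<integral>s. (cmod (f s) * d + (cmod (f s) * indicator (- K) s) * 2) * norm \<zeta> \<partial>m)"
    proof (rule norm_integral_le(2)[OF borel_measurable_integrable[OF i]])
      show "integrable m (\<lambda>s. (cmod (f s) * d + (cmod (f s) * indicator (- K) s) * 2) * norm \<zeta>)"
        by (intro integrable_mult_left Bochner_Integration.integrable_add integrable_norm f tail)
      fix s
      have "?g s = f s * cinner (\<pi> s \<eta> - \<sigma> s *\<^sub>C \<eta>) \<zeta>"
        by (simp add: cinner_simps right_diff_distrib)
      then have "cmod (?g s) \<le> cmod (f s) * (norm (\<pi> s \<eta> - \<sigma> s *\<^sub>C \<eta>) * norm \<zeta>)"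
        using mult_left_mono[OF cmod_cinner_le norm_ge_zero] by (simp add: norm_mult)
      also have "\<dots> \<le> cmod (f s) * ((d + indicator (- K) s * 2) * norm \<zeta>)"
      proof (intro mult_left_mono mult_right_mono)
        show "norm (\<pi> s \<eta> - \<sigma> s *\<^sub>C \<eta>) \<le> d + indicat_real (- K) s * 2"
        proof (cases "s \<in> K")
          case True
          then show ?thesis using \<eta> by (simp add: near_eigen_def)
        next
          case False
          have "norm (\<pi> s \<eta> - \<sigma> s *\<^sub>C \<eta>) \<le> 2"
            using \<eta> norm_triangle_ineq4[of "\<pi> s \<eta>" "\<sigma> s *\<^sub>C \<eta>"]
            by (simp add: near_eigen_def norm_scaleC dual_groupD(2)[OF \<sigma>])
          then show ?thesis using False \<open>0 < d\<close> by simp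
        qed
      qed auto
      finally show "cmod (?g s) \<le> (cmod (f s) * d + (cmod (f s) * indicator (- K) s) * 2) * norm \<zeta>"
        by (simp add: algebra_simps)
    qed
    also have "\<dots> = (N * d + (\<integral>s. cmod (f s) * indicator (- K) s \<partial>m) * 2) * norm \<zeta>"
      unfolding integral_mult_left_zero N_def
      by (subst Bochner_Integration.integral_add) (auto simp: f tail)
    also have "\<dots> \<le> e * norm \<zeta>"
    proof (rule mult_right_mono)
      have "N * d \<le> (N + 1) * d" using \<open>0 < d\<close> by (intro mult_right_mono) auto
      also have "\<dots> = e/2"
      proof -
        have "z * (e / (2 * z)) = e/2" if "0 < z" for z :: real using that by simp
        from this[of "N + 1"] show ?thesis using \<open>0 \<le> N\<close> unfolding d_def by linarith
      qed
      finally show "N * d + (\<integral>s. cmod (f s) * indicator (- K) s \<partial>m) * 2 \<le> e" using K(2) by linarith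
    qed simp
    finally show "cmod (cinner (pi1 m \<pi> f \<eta> - L1_transform m f \<sigma> *\<^sub>C \<eta>) \<zeta>) \<le> e * norm \<zeta>" .
  qed (use \<open>0 < e\<close> in simp)
  show "\<exists>K d. compact K \<and> 0 < d \<and>
      (\<forall>\<eta>. near_eigen \<sigma> K d \<eta> \<longrightarrow> norm (pi1 m \<pi> f \<eta> - L1_transform m f \<sigma> *\<^sub>C \<eta>) \<le> e)"
      by (intro exI[of _ K] exI[of _ d] conjI allI impI K(1) \<open>0 < d\<close> near)
qed

text \<open>By density: along a convergent sequence of operators the values are Cauchy, and their
  limit is the value at the limit operator.\<close>

lemma eigenvalue_at_exists:
  assumes \<sigma>: "\<sigma> \<in> approx_spectrum" and "x \<in> \<A>"
  shows "\<exists>\<kappa>. eigenvalue_at \<sigma> x \<kappa>"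
  using assms(2)
proof (induct rule: A_induct)
  case (pi1 f)
  then show ?case using eigenvalue_at_pi1[OF approx_spectrum_dual[OF \<sigma>]] by blast
next
  case (lim y z)
  then obtain \<kappa> where \<kappa>: "\<And>n. eigenvalue_at \<sigma> (y n) (\<kappa> n)" by metis
  have "Cauchy \<kappa>"
  proof (rule CauchyI)
    fix e :: real assume "0 < e"
    then obtain M where M: "\<And>p q. M \<le> p \<Longrightarrow> M \<le> q \<Longrightarrow> norm (y p - y q) < e"
      using CauchyD[OF LIMSEQ_imp_Cauchy[OF lim(3)]] by blast
    have "norm (\<kappa> p - \<kappa> q) < e" if "M \<le> p" "M \<le> q" for p q
      by (rule le_less_trans[OF eigenvalue_at_dist[OF \<sigma> \<kappa> \<kappa>] M[OF that]])
    then show "\<exists>M. \<forall>p\<ge>M. \<forall>q\<ge>M. norm (\<kappa> p - \<kappa> q) < e" by blast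
  qed
  then obtain l where l: "\<kappa> \<longlonglongrightarrow> l" using Cauchy_convergent convergent_def by blast
  have "eigenvalue_at \<sigma> z l"
    unfolding eigenvalue_at_def
  proof (intro allI impI)
    fix e :: real assume "0 < e"
    then have e: "0 < e/3" by simp
    have "\<forall>\<^sub>F n in sequentially. dist (y n) z < e/3 \<and> dist (\<kappa> n) l < e/3"
      using tendstoD[OF lim(3) e] tendstoD[OF l e] by (rule eventually_conj)
    then obtain n where n: "dist (y n) z < e/3 \<and> dist (\<kappa> n) l < e/3"
      using eventually_happens'[OF sequentially_bot] by blast
    obtain K d where K: "compact K" "0 < d" "\<And>\<eta>. near_eigen \<sigma> K d \<eta> \<Longrightarrow> norm (y n \<eta> - \<kappa> n *\<^sub>C \<eta>) \<le> e/3"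
      by (rule eigenvalue_atE[OF \<kappa>[of n] e]) (rule that)
    have near: "norm (z \<eta> - l *\<^sub>C \<eta>) \<le> e" if \<eta>: "near_eigen \<sigma> K d \<eta>" for \<eta>
    proof -
      have "norm \<eta> = 1" using \<eta> by (simp add: near_eigen_def)
      have eq: "z \<eta> - l *\<^sub>C \<eta> = (z - y n) \<eta> + ((y n \<eta> - \<kappa> n *\<^sub>C \<eta>) + (\<kappa> n - l) *\<^sub>C \<eta>)"
        by (simp add: blinfun.diff_left scaleC_diff_left)
      have "norm ((z - y n) \<eta>) \<le> e/3"
        using norm_blinfun[of "z - y n" \<eta>] n \<open>norm \<eta> = 1\<close> by (simp add: dist_norm norm_minus_commute)
      moreover have "norm ((\<kappa> n - l) *\<^sub>C \<eta>) \<le> e/3"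
        using n \<open>norm \<eta> = 1\<close> by (simp add: norm_scaleC dist_norm)
      ultimately have "norm (z \<eta> - l *\<^sub>C \<eta>) \<le> e/3 + (e/3 + e/3)"
        unfolding eq by (intro norm_triangle_mono K(3)[OF \<eta>])
      then show ?thesis by simp
    qed
    show "\<exists>K d. compact K \<and> 0 < d \<and> (\<forall>\<eta>. near_eigen \<sigma> K d \<eta> \<longrightarrow> norm (z \<eta> - l *\<^sub>C \<eta>) \<le> e)"
      by (intro exI[of _ K] exI[of _ d] conjI allI impI K(1) \<open>0 < d\<close> near)
  qed
  then show ?case by blast
qed

text \<open>For the remaining inclusion, the limiting value \<kappa> of x along near eigenvectors
  defines the character; it is non-zero because some \<open>pi1 m \<pi> f\<close> has value
  1.\<close>

theorem E_pi_eq_approx_spectrum: "E_pi m \<pi> = approx_spectrum"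
proof (rule antisym[OF E_pi_subset_approx_spectrum], rule subsetI)
  fix \<sigma> assume \<sigma>: "\<sigma> \<in> approx_spectrum"
  note dual = approx_spectrum_dual[OF \<sigma>]
  define \<phi> where "\<phi> x = (THE \<kappa>. eigenvalue_at \<sigma> x \<kappa>)" for x
  have \<phi>_eq: "\<phi> x = \<kappa>" if "eigenvalue_at \<sigma> x \<kappa>" for x \<kappa>
    unfolding \<phi>_def using that by (rule the_equality) (rule eigenvalue_at_unique[OF \<sigma> _ that])
  have \<phi>: "eigenvalue_at \<sigma> x (\<phi> x)" if "x \<in> \<A>" for x
    using eigenvalue_at_exists[OF \<sigma> that] \<phi>_eq by auto
  have \<phi>_pi1: "\<phi> (pi1 m \<pi> f) = L1_transform m f \<sigma>" if "integrable m f" for f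
    by (rule \<phi>_eq[OF eigenvalue_at_pi1[OF dual that]])
  obtain f where f: "integrable m f" "L1_transform m f \<sigma> = 1" by (rule unit_transform_exists[OF dual])
  have "is_character \<A> \<phi>"
    unfolding is_character_def
  proof (intro conjI ballI allI)
    fix x y c assume x: "x \<in> \<A>"
    show "\<phi> (scaleC_op c x) = c * \<phi> x" by (rule \<phi>_eq[OF eigenvalue_at_scaleC[OF \<phi>[OF x]]])
    assume y: "y \<in> \<A>"
    show "\<phi> (x + y) = \<phi> x + \<phi> y" by (rule \<phi>_eq[OF eigenvalue_at_add[OF \<phi>[OF x] \<phi>[OF y]]])
    show "\<phi> (x o\<^sub>L y) = \<phi> x * \<phi> y"
      by (rule \<phi>_eq[OF eigenvalue_at_compose[OF A_BH[OF x] \<phi>[OF x] \<phi>[OF y]]])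
  next
    show "\<exists>x\<in>\<A>. \<phi> x \<noteq> 0" using pi1_mem[OF f(1)] \<phi>_pi1[OF f(1)] f(2) by (intro bexI[of _ "pi1 m \<pi> f"]) auto
  qed
  then show "\<sigma> \<in> E_pi m \<pi>" unfolding E_pi_def using dual \<phi>_pi1 by blast
qed

end

section \<open>Orthogonal decomposition into approximate eigenspaces\<close>

context urep
begin

section \<open>Invariant subspaces, commutant and bicommutant\<close>

definition invariant :: "'h set \<Rightarrow> bool" where
  "invariant W \<longleftrightarrow> closed W \<and> csubspace W \<and> (\<forall>s. \<forall>\<xi>\<in>W. \<pi> s \<xi> \<in> W)"

definition nontrivial :: "'h set \<Rightarrow> bool" where
  "nontrivial W \<longleftrightarrow> (\<exists>\<xi>\<in>W. \<xi> \<noteq> 0)"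

lemma invariantD:
  assumes "invariant W"
  shows "closed W" "csubspace W" "\<xi> \<in> W \<Longrightarrow> \<pi> s \<xi> \<in> W"
  using assms by (auto simp: invariant_def)

lemma nontrivial_unit:
  assumes "nontrivial W" "csubspace W"
  obtains \<eta> where "\<eta> \<in> W" "norm \<eta> = 1"
proof -
  obtain \<xi> where "\<xi> \<in> W" "\<xi> \<noteq> 0" using assms(1) by (auto simp: nontrivial_def)
  then show thesis using csubspaceD(5)[OF assms(2), of \<xi> "1 / norm \<xi>"]
    by (intro that[of "(1 / norm \<xi>) *\<^sub>R \<xi>"]) auto
qed

text \<open>An adjoint is required so that S can be moved across weak integrals and the set is
  closed under adjoints; complex linearity follows by \<open>is_adj_BH\<close>.\<close>

definition rep_commutant :: "('h \<Rightarrow>\<^sub>L 'h) set" where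
  "rep_commutant = {S. (\<exists>S'. is_adj S' S) \<and> (\<forall>t. commutes S (\<pi> t))}"

definition rep_bicommutant :: "('h \<Rightarrow>\<^sub>L 'h) set" where
  "rep_bicommutant = {T \<in> BH. \<forall>S\<in>rep_commutant. commutes S T}"

lemma rep_commutant_rep: "\<pi> s \<in> rep_commutant"
  using rep_adj rep_commutes by (auto simp: rep_commutant_def)

lemma rep_commutant_adjoint:
  assumes "S \<in> rep_commutant" "is_adj S' S"
  shows "S' \<in> rep_commutant"
proof -
  have "commutes S' (\<pi> t)" for t
    using commutes_adjoint[OF _ assms(2) rep_adj, of "- t"] assms(1) by (simp add: rep_commutant_def)
  then show ?thesis using is_adj_sym[OF assms(2)] by (auto simp: rep_commutant_def)
qed

lemma bicommutantD: "T \<in> rep_bicommutant \<Longrightarrow> T \<in> BH" "T \<in> rep_bicommutant \<Longrightarrow> S \<in> rep_commutant \<Longrightarrow> commutes S T"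
  by (auto simp: rep_bicommutant_def)

lemma commutes_scaleC_id: "S \<in> BH \<Longrightarrow> commutes S (scaleC_op c id_blinfun)"
  by (rule commutesI) (simp add: scaleC_op.rep_eq BH_D)

lemma is_adj_BH:
  assumes "is_adj S' S" shows "S \<in> BH"
  unfolding BH_def mem_Collect_eq
proof (intro allI)
  fix c x show "S (c *\<^sub>C x) = c *\<^sub>C S x"
    by (rule cinner_ext) (simp add: is_adjD[OF assms] cinner_scaleC_left)
qed

lemma rep_commutant_BH: "S \<in> rep_commutant \<Longrightarrow> S \<in> BH"
  using is_adj_BH by (auto simp: rep_commutant_def)

lemma bicommutant_rep: "\<pi> s \<in> rep_bicommutant"
  using rep_BH by (auto simp: rep_bicommutant_def rep_commutant_def)

lemma bicommutant_id: "id_blinfun \<in> rep_bicommutant"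
  by (simp add: rep_bicommutant_def commutes_id)

lemma bicommutant_add: "S \<in> rep_bicommutant \<Longrightarrow> T \<in> rep_bicommutant \<Longrightarrow> S + T \<in> rep_bicommutant"
  by (simp add: rep_bicommutant_def commutes_add BH_add)

lemma bicommutant_diff: "S \<in> rep_bicommutant \<Longrightarrow> T \<in> rep_bicommutant \<Longrightarrow> S - T \<in> rep_bicommutant"
  by (simp add: rep_bicommutant_def commutes_diff BH_diff)

lemma bicommutant_compose: "S \<in> rep_bicommutant \<Longrightarrow> T \<in> rep_bicommutant \<Longrightarrow> S o\<^sub>L T \<in> rep_bicommutant"
  by (simp add: rep_bicommutant_def commutes_compose BH_compose)

lemma bicommutant_scaleR: "S \<in> rep_bicommutant \<Longrightarrow> r *\<^sub>R S \<in> rep_bicommutant"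
  by (simp add: rep_bicommutant_def commutes_scaleR BH_scaleR)

lemma bicommutant_scaleC:
  assumes "S \<in> rep_bicommutant" shows "scaleC_op c S \<in> rep_bicommutant"
proof -
  have "scaleC_op c S = scaleC_op c id_blinfun o\<^sub>L S" by (rule blinfun_eqI) (simp add: scaleC_op.rep_eq)
  moreover have "scaleC_op c id_blinfun \<in> rep_bicommutant"
    by (auto simp: rep_bicommutant_def BH_scaleC intro: commutes_scaleC_id rep_commutant_BH)
  ultimately show ?thesis using bicommutant_compose assms by simp
qed

lemma bicommutant_sum: "(\<And>i. i \<in> F \<Longrightarrow> f i \<in> rep_bicommutant) \<Longrightarrow> (\<Sum>i\<in>F. f i) \<in> rep_bicommutant"
proof (induction F rule: infinite_finite_induct)
  case (insert i F)
  then show ?case by (simp add: bicommutant_add)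
qed (use bicommutant_scaleR[OF bicommutant_id, of 0] in simp_all)

text \<open>The orthogonal projection onto W commutes with \<pi> because \<open>\<pi> (- t)\<close>
  also preserves W. Its use is that operators of the bicommutant then leave every invariant subspace
  invariant.\<close>

lemma invariant_projection:
  assumes W: "invariant W"
  obtains P where "P \<in> rep_commutant" "\<And>\<xi>. P \<xi> \<in> W" "\<And>\<xi>. \<xi> \<in> W \<Longrightarrow> P \<xi> = \<xi>"
proof -
  have "\<exists>p. p \<in> W \<and> (\<forall>w\<in>W. cinner (\<xi> - p) w = 0)" for \<xi>
    using orthogonal_projection_exists[OF invariantD(1,2)[OF W], of \<xi>] by metis
  then obtain p where p: "\<And>\<xi>. p \<xi> \<in> W" "\<And>\<xi> w. w \<in> W \<Longrightarrow> cinner (\<xi> - p \<xi>) w = 0" by metis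
  note sub = csubspaceD[OF invariantD(2)[OF W]]
  \<comment> \<open>The projection is the only point of W with this orthogonality; additivity,
    homogeneity and commutation with \<pi> are all instances.\<close>
  have unique: "p \<xi> = q" if "q \<in> W" "\<And>w. w \<in> W \<Longrightarrow> cinner (\<xi> - q) w = 0" for \<xi> q
  proof -
    have w: "p \<xi> - q \<in> W" by (rule sub(4)[OF p(1) that(1)])
    have "cinner (p \<xi> - q) (p \<xi> - q) = cinner (\<xi> - q) (p \<xi> - q) - cinner (\<xi> - p \<xi>) (p \<xi> - q)"
      by (simp add: cinner_diff_left)
    also have "\<dots> = 0" using p(2)[OF w] that(2)[OF w] by simp
    finally show ?thesis by (simp add: cinner_self)
  qed
  have p_add: "p (x + y) = p x + p y" for x y
  proof (rule unique[OF sub(2)[OF p(1) p(1)]])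
    fix w assume "w \<in> W"
    then have "cinner (x - p x) w + cinner (y - p y) w = 0" using p(2) by simp
    then show "cinner (x + y - (p x + p y)) w = 0" unfolding add_diff_add cinner_add_left .
  qed
  have p_scale: "p (c *\<^sub>C x) = c *\<^sub>C p x" for c x
  proof (rule unique[OF sub(3)[OF p(1)]])
    fix w assume "w \<in> W"
    then have "c * cinner (x - p x) w = 0" using p(2) by simp
    then show "cinner (c *\<^sub>C x - c *\<^sub>C p x) w = 0"
      unfolding scaleC_diff_right[symmetric] cinner_scaleC_left .
  qed
  have orth: "cinner \<xi> (p \<eta>) = cinner (p \<xi>) (p \<eta>)" for \<xi> \<eta>
    using p(2)[OF p(1), of \<xi> \<eta>] by (simp add: cinner_diff_left)
  have p_norm: "norm (p \<xi>) \<le> norm \<xi>" for \<xi>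
  proof -
    have "norm (p \<xi>) * norm (p \<xi>) \<le> norm \<xi> * norm (p \<xi>)"
      using cmod_cinner_le[of \<xi> "p \<xi>"] by (simp add: orth cinner_self norm_power power2_eq_square norm_mult)
    then show ?thesis by (cases "p \<xi> = 0") auto
  qed
  obtain P where P: "P \<in> BH" "\<And>\<xi> \<eta>. cinner (blinfun_apply P \<xi>) \<eta> = cinner (p \<xi>) \<eta>"
  proof (rule sesquilinear_form_operator[of "\<lambda>\<xi> \<eta>. cinner (p \<xi>) \<eta>" 1])
    show "cmod (cinner (p x) y) \<le> 1 * norm x * norm y" for x y
      using cmod_cinner_le[of "p x" y] mult_right_mono[OF p_norm[of x] norm_ge_zero[of y]] by simp
  qed (simp_all add: p_add p_scale cinner_simps)
  have Pp: "P \<xi> = p \<xi>" for \<xi> by (rule cinner_ext) (rule P(2))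
  have "is_adj P P"
    unfolding is_adj_def Pp
  proof (intro allI)
    fix x y
    have "cinner (p x) y = cnj (cinner y (p x))" by (rule cinner_commute)
    also have "\<dots> = cnj (cinner (p y) (p x))" by (simp only: orth[of y x])
    also have "\<dots> = cinner (p x) (p y)" by (rule cinner_commute[symmetric])
    finally show "cinner (p x) y = cinner x (p y)" by (simp only: orth[of x y])
  qed
  moreover have "commutes P (\<pi> t)" for t
  proof (rule commutesI)
    fix \<xi>
    show "P (\<pi> t \<xi>) = \<pi> t (P \<xi>)"
      unfolding Pp
    proof (rule unique[OF invariantD(3)[OF W p(1)]])
      fix w assume "w \<in> W"
      then have "\<pi> (- t) w \<in> W" by (rule invariantD(3)[OF W])
      then have "cinner (\<xi> - p \<xi>) (\<pi> (- t) w) = 0" by (rule p(2))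
      then show "cinner (\<pi> t \<xi> - \<pi> t (p \<xi>)) w = 0" by (simp add: cinner_rep[symmetric] blinfun.diff_right)
    qed
  qed
  ultimately have "P \<in> rep_commutant" by (auto simp: rep_commutant_def)
  moreover have "P \<xi> \<in> W" for \<xi> by (simp add: Pp p(1))
  moreover have "P \<xi> = \<xi>" if "\<xi> \<in> W" for \<xi> unfolding Pp by (rule unique[OF that]) simp
  ultimately show thesis by (rule that)
qed

lemma bicommutant_invariant:
  assumes W: "invariant W" and T: "T \<in> rep_bicommutant" and "\<xi> \<in> W"
  shows "T \<xi> \<in> W"
proof -
  obtain P where P: "P \<in> rep_commutant" "\<And>\<xi>. P \<xi> \<in> W" "\<And>\<xi>. \<xi> \<in> W \<Longrightarrow> P \<xi> = \<xi>"
    by (rule invariant_projection[OF W]) (rule that)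
  have "T \<xi> = P (T \<xi>)" using commutesD[OF bicommutantD(2)[OF T P(1)], of \<xi>] P(3)[OF assms(3)] by simp
  then show ?thesis using P(2)[of "T \<xi>"] by simp
qed

text \<open>With \<open>C = |B|\<close>, the subspace \<open>W'\<close> is the kernel of the positive part of \<open>B\<close> in \<open>W\<close>; it
  contains \<open>(C - B) \<xi>\<^sub>0\<close>, which is non-zero because \<open>B\<close> is not positive on \<open>W\<close>.\<close>

lemma spectral_split:
  assumes W: "invariant W" and B: "B \<in> rep_bicommutant" "is_adj B B"
    and \<xi>0: "\<xi>0 \<in> W" "Re (cinner (B \<xi>0) \<xi>0) < 0"
  obtains W' where "invariant W'" "W' \<subseteq> W" "nontrivial W'" "\<And>\<xi>. \<xi> \<in> W' \<Longrightarrow> Re (cinner (B \<xi>) \<xi>) \<le> 0"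
proof -
  obtain C where C: "C \<in> BH" "is_adj C C" "C o\<^sub>L C = B o\<^sub>L B"
    "\<And>x. 0 \<le> Re (cinner (C x) x)" "\<And>S. commutes S B \<Longrightarrow> commutes S C"
    by (rule selfadjoint_absolute_value[OF bicommutantD(1)[OF B(1)] B(2)]) (rule that)
  have "C \<in> rep_bicommutant"
    using C(1) C(5)[OF bicommutantD(2)[OF B(1)]] by (simp add: rep_bicommutant_def)
  have CB: "commutes B C" by (rule C(5)) (simp add: commutes_def)
  define W' where "W' = {\<xi> \<in> W. C \<xi> = - B \<xi>}"
  have "closed W'"
  proof -
    have "closed {\<xi>. C \<xi> = - B \<xi>}" by (intro closed_Collect_eq continuous_intros)
    then show ?thesis using invariantD(1)[OF W] unfolding W'_def Collect_conj_eq by (simp add: closed_Int)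
  qed
  moreover have "csubspace W'"
    using csubspaceD[OF invariantD(2)[OF W]] BH_D[OF C(1)] BH_D[OF bicommutantD(1)[OF B(1)]]
    unfolding csubspace_def W'_def by (simp add: blinfun.add_right scaleC_minus_right)
  moreover have "\<pi> s \<xi> \<in> W'" if "\<xi> \<in> W'" for s \<xi>
  proof -
    have \<xi>: "\<xi> \<in> W" "C \<xi> = - B \<xi>" using that by (simp_all add: W'_def)
    have "C (\<pi> s \<xi>) = \<pi> s (C \<xi>)"
      by (rule commutesD[OF bicommutantD(2)[OF \<open>C \<in> rep_bicommutant\<close> rep_commutant_rep], symmetric])
    also have "\<dots> = - \<pi> s (B \<xi>)" by (simp only: \<xi>(2) blinfun.minus_right)
    also have "\<dots> = - B (\<pi> s \<xi>)"
      by (simp only: commutesD[OF bicommutantD(2)[OF B(1) rep_commutant_rep]])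
    finally show ?thesis using invariantD(3)[OF W \<xi>(1)] by (simp add: W'_def)
  qed
  ultimately have "invariant W'" by (simp add: invariant_def)
  moreover have "W' \<subseteq> W" by (auto simp: W'_def)
  moreover have "nontrivial W'"
  proof -
    let ?\<zeta> = "C \<xi>0 - B \<xi>0"
    have "?\<zeta> \<in> W"
      using bicommutant_invariant[OF W \<open>C \<in> rep_bicommutant\<close> \<xi>0(1)] bicommutant_invariant[OF W B(1) \<xi>0(1)]
      by (rule csubspaceD(4)[OF invariantD(2)[OF W]])
    \<comment> \<open>C commutes with B and C^2 = B^2, so C (C - B) = B^2 - B C = - B (C -
      B).\<close>
    moreover have "C ?\<zeta> = - B ?\<zeta>"
    proof -
      have "C (C \<xi>0) = B (B \<xi>0)" using C(3) by (metis blinfun_apply_blinfun_compose)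
      then show ?thesis using commutesD[OF CB, of \<xi>0] by (simp add: blinfun.diff_right)
    qed
    moreover have "?\<zeta> \<noteq> 0" using C(4)[of \<xi>0] \<xi>0(2) by auto
    ultimately show ?thesis by (auto simp: nontrivial_def W'_def)
  qed
  moreover have "Re (cinner (B \<xi>) \<xi>) \<le> 0" if "\<xi> \<in> W'" for \<xi>
  proof -
    have "B \<xi> = - C \<xi>" using that by (simp add: W'_def)
    then show ?thesis using C(4)[of \<xi>] by (simp add: cinner_minus_left)
  qed
  ultimately show thesis by (rule that)
qed

text \<open>l is the bottom of the numerical range of T on W, so S = T - l is non-negative there,
  and \<open>spectral_split\<close> for S - e selects a subspace where the form of S is at most e
  |\<xi>|^2. The two form bounds are then converted into a norm bound.\<close>

lemma near_scalar_subspace: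
  assumes W: "invariant W" "nontrivial W" and T: "T \<in> rep_bicommutant" "is_adj T T" and "0 < e"
  obtains l W' where "invariant W'" "W' \<subseteq> W" "nontrivial W'" "\<And>\<xi>. \<xi> \<in> W' \<Longrightarrow> norm (T \<xi> - l *\<^sub>R \<xi>) \<le> e * norm \<xi>"
proof -
  define X where "X = {\<eta> \<in> W. norm \<eta> = 1}"
  define q where "q \<eta> = Re (cinner (T \<eta>) \<eta>)" for \<eta>
  have "X \<noteq> {}" using nontrivial_unit[OF W(2) invariantD(2)[OF W(1)]] by (auto simp: X_def)
  have bdd: "bdd_below (q ` X)"
  proof (rule bdd_belowI2[of _ "- norm T"])
    fix \<eta> assume "\<eta> \<in> X"
    then have "\<bar>q \<eta>\<bar> \<le> norm T"
      using order_trans[OF abs_Re_le_cmod cmod_cinner_blinfun_le, of T \<eta> \<eta>] by (simp add: X_def q_def)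
    then show "- norm T \<le> q \<eta>" by linarith
  qed
  define l where "l = (INF \<eta>\<in>X. q \<eta>)"
  have "l < l + e" using \<open>0 < e\<close> by simp
  then obtain \<xi>0 where \<xi>0: "\<xi>0 \<in> X" "q \<xi>0 < l + e"
    using cINF_less_iff[OF \<open>X \<noteq> {}\<close> bdd, of "l + e"] by (auto simp: l_def)
  have low: "l * (norm \<xi>)\<^sup>2 \<le> q \<xi>" if "\<xi> \<in> W" for \<xi>
  proof (cases "\<xi> = 0")
    case False
    let ?\<eta> = "(1 / norm \<xi>) *\<^sub>R \<xi>"
    have "?\<eta> \<in> X" using that False csubspaceD(5)[OF invariantD(2)[OF W(1)]] by (simp add: X_def)
    then have "l \<le> q ?\<eta>" unfolding l_def by (rule cINF_lower[OF bdd])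
    also have "q ?\<eta> = q \<xi> / (norm \<xi>)\<^sup>2"
      by (simp add: q_def blinfun.scaleR_right cinner_scaleR_left cinner_scaleR_right power2_eq_square)
    finally show ?thesis using False by (simp add: field_simps)
  qed (simp add: q_def)
  define S where "S = T - l *\<^sub>R id_blinfun"
  have S_adj: "is_adj S S" unfolding S_def by (intro is_adj_diff T is_adj_scaleR is_adj_id)
  have S_bi: "S \<in> rep_bicommutant" unfolding S_def by (intro bicommutant_diff T bicommutant_scaleR bicommutant_id)
  have S_form: "Re (cinner (S \<xi>) \<xi>) = q \<xi> - l * (norm \<xi>)\<^sup>2" for \<xi>
    by (simp add: S_def blinfun.diff_left blinfun.scaleR_left cinner_simps q_def cinner_self)
  define B where "B = S - e *\<^sub>R id_blinfun"
  have B: "B \<in> rep_bicommutant" "is_adj B B"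
    unfolding B_def by (intro bicommutant_diff S_bi bicommutant_scaleR bicommutant_id is_adj_diff S_adj is_adj_scaleR is_adj_id)+
  have B_form: "Re (cinner (B \<xi>) \<xi>) = Re (cinner (S \<xi>) \<xi>) - e * (norm \<xi>)\<^sup>2" for \<xi>
    by (simp add: B_def blinfun.diff_left blinfun.scaleR_left cinner_simps cinner_self)
  have "Re (cinner (B \<xi>0) \<xi>0) < 0" using \<xi>0 by (simp add: B_form S_form X_def)
  then obtain W' where W': "invariant W'" "W' \<subseteq> W" "nontrivial W'"
    "\<And>\<xi>. \<xi> \<in> W' \<Longrightarrow> Re (cinner (B \<xi>) \<xi>) \<le> 0"
    using spectral_split[OF W(1) B, of \<xi>0] \<xi>0(1) unfolding X_def by blast
  have "norm (T \<xi> - l *\<^sub>R \<xi>) \<le> e * norm \<xi>" if \<xi>: "\<xi> \<in> W'" for \<xi>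
  proof -
    let ?\<zeta> = "S \<xi>"
    have \<zeta>: "?\<zeta> \<in> W'" by (rule bicommutant_invariant[OF W'(1) S_bi \<xi>])
    have v: "?\<zeta> - e *\<^sub>R \<xi> \<in> W"
      using \<xi> \<zeta> W'(2) by (auto intro: csubspaceD[OF invariantD(2)[OF W(1)]])
    have "cinner (S ?\<zeta>) \<xi> = cinner ?\<zeta> ?\<zeta>" by (rule is_adjD[OF S_adj])
    then have cross: "Re (cinner (S ?\<zeta>) \<xi>) = (norm ?\<zeta>)\<^sup>2" "Re (cinner ?\<zeta> ?\<zeta>) = (norm ?\<zeta>)\<^sup>2"
      by (simp_all add: cinner_self)
    \<comment> \<open>Non-negativity of S at \<zeta> - e \<xi>, with \<zeta> = S \<xi>, combined
      with the upper bounds at \<zeta> and at \<xi>, gives e |\<zeta>|^2 \<le> e^3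
      |\<xi>|^2.\<close>
    have "0 \<le> Re (cinner (S (?\<zeta> - e *\<^sub>R \<xi>)) (?\<zeta> - e *\<^sub>R \<xi>))"
      using low[OF v] by (simp add: S_form)
    also have "\<dots> = Re (cinner (S ?\<zeta>) ?\<zeta>) - 2 * (e * (norm ?\<zeta>)\<^sup>2) + e\<^sup>2 * Re (cinner (S \<xi>) \<xi>)"
      using cross by (simp add: blinfun.diff_right blinfun.scaleR_right cinner_diff_left cinner_diff_right
          cinner_scaleR_left cinner_scaleR_right power2_eq_square[of e] algebra_simps)
    also have "\<dots> \<le> e * (norm ?\<zeta>)\<^sup>2 - 2 * (e * (norm ?\<zeta>)\<^sup>2) + e\<^sup>2 * (e * (norm \<xi>)\<^sup>2)"
      using W'(4)[OF \<zeta>] W'(4)[OF \<xi>] unfolding B_form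
      by (intro add_mono diff_right_mono mult_left_mono) auto
    finally have "e * (norm ?\<zeta>)\<^sup>2 \<le> e * (e * norm \<xi>)\<^sup>2" by (simp add: power2_eq_square algebra_simps)
    then have "(norm ?\<zeta>)\<^sup>2 \<le> (e * norm \<xi>)\<^sup>2" using \<open>0 < e\<close> by simp
    then have "norm ?\<zeta> \<le> e * norm \<xi>" by (rule power2_le_imp_le) (use \<open>0 < e\<close> in simp)
    then show ?thesis by (simp add: S_def blinfun.diff_left blinfun.scaleR_left)
  qed
  then show thesis by (rule that[OF W'(1-3)])
qed

text \<open>The real part \<open>T1\<close> and the imaginary part \<open>T2\<close> of \<pi> s are
  self-adjoint elements of the bicommutant; W is cut for one and then for the other, each with error
  e/2.\<close>

lemma near_scalar_subspace_rep:
  assumes W: "invariant W" "nontrivial W" and "0 < e"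
  obtains c W' where "invariant W'" "W' \<subseteq> W" "nontrivial W'" "\<And>\<xi>. \<xi> \<in> W' \<Longrightarrow> norm (\<pi> s \<xi> - c *\<^sub>C \<xi>) \<le> e * norm \<xi>"
proof -
  define T1 where "T1 = scaleC_op (1/2) (\<pi> s + \<pi> (- s))"
  define T2 where "T2 = scaleC_op (- \<i> / 2) (\<pi> s - \<pi> (- s))"
  have bi: "T1 \<in> rep_bicommutant" "T2 \<in> rep_bicommutant"
    unfolding T1_def T2_def
    by (intro bicommutant_scaleC bicommutant_add bicommutant_diff bicommutant_rep)+
  have "is_adj (scaleC_op (cnj (1/2)) (\<pi> (- s) + \<pi> (- (- s)))) T1"
    unfolding T1_def by (intro is_adj_scaleC is_adj_add rep_adj)
  then have adj1: "is_adj T1 T1" by (simp add: T1_def add.commute)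
  have "is_adj (scaleC_op (cnj (- \<i> / 2)) (\<pi> (- s) - \<pi> (- (- s)))) T2"
    unfolding T2_def by (intro is_adj_scaleC is_adj_diff rep_adj)
  moreover have "scaleC_op (cnj (- \<i> / 2)) (\<pi> (- s) - \<pi> (- (- s))) = T2"
    by (rule blinfun_eqI)
      (simp add: T2_def scaleC_op.rep_eq blinfun.diff_left scaleC_diff_right scaleC_minus_left)
  ultimately have adj2: "is_adj T2 T2" by simp
  have rep_eq: "\<pi> s \<xi> = T1 \<xi> + \<i> *\<^sub>C T2 \<xi>" for \<xi>
  proof -
    have "T1 \<xi> + \<i> *\<^sub>C T2 \<xi> = (1/2) *\<^sub>C \<pi> s \<xi> + (1/2) *\<^sub>C \<pi> s \<xi>"
      by (simp add: T1_def T2_def scaleC_op.rep_eq blinfun.diff_left blinfun.add_left scaleC_diff_right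
          scaleC_add_right scaleC_scaleC)
    also have "\<dots> = \<pi> s \<xi>" by (simp flip: scaleC_add_left)
    finally show ?thesis by simp
  qed
  have e: "0 < e/2" using \<open>0 < e\<close> by simp
  obtain l1 W1 where W1: "invariant W1" "W1 \<subseteq> W" "nontrivial W1"
    "\<And>\<xi>. \<xi> \<in> W1 \<Longrightarrow> norm (T1 \<xi> - l1 *\<^sub>R \<xi>) \<le> e/2 * norm \<xi>"
    by (rule near_scalar_subspace[OF W bi(1) adj1 e]) (rule that)
  obtain l2 W2 where W2: "invariant W2" "W2 \<subseteq> W1" "nontrivial W2"
    "\<And>\<xi>. \<xi> \<in> W2 \<Longrightarrow> norm (T2 \<xi> - l2 *\<^sub>R \<xi>) \<le> e/2 * norm \<xi>"
    by (rule near_scalar_subspace[OF W1(1,3) bi(2) adj2 e]) (rule that)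
  have "norm (\<pi> s \<xi> - (of_real l1 + \<i> * of_real l2) *\<^sub>C \<xi>) \<le> e * norm \<xi>" if \<xi>: "\<xi> \<in> W2" for \<xi>
  proof -
    have "\<pi> s \<xi> - (of_real l1 + \<i> * of_real l2) *\<^sub>C \<xi> = (T1 \<xi> - l1 *\<^sub>R \<xi>) + \<i> *\<^sub>C (T2 \<xi> - l2 *\<^sub>R \<xi>)"
      by (simp add: rep_eq scaleC_add_left scaleC_diff_right scaleC_of_real flip: scaleC_scaleC)
    also have "norm \<dots> \<le> e/2 * norm \<xi> + e/2 * norm \<xi>"
      using W1(4)[OF subsetD[OF W2(2) \<xi>]] W2(4)[OF \<xi>]
      by (intro norm_triangle_mono) (auto simp: norm_scaleC)
    finally show ?thesis by simp
  qed
  then show thesis by (rule that[OF W2(1) order_trans[OF W2(2) W1(2)] W2(3)])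
qed

lemma near_scalar_subspace_finite:
  assumes "finite F" and W: "invariant W" "nontrivial W" and "0 < e"
  shows "\<exists>c W'. invariant W' \<and> W' \<subseteq> W \<and> nontrivial W' \<and>
    (\<forall>s\<in>F. \<forall>\<xi>\<in>W'. norm (\<pi> s \<xi> - c s *\<^sub>C \<xi>) \<le> e * norm \<xi>)"
  using assms(1)
proof (induct F rule: finite_induct)
  case empty
  show ?case by (intro exI[of _ "\<lambda>_. 0"] exI[of _ W]) (simp add: W)
next
  case (insert s F)
  then obtain c W' where W': "invariant W'" "W' \<subseteq> W" "nontrivial W'"
    "\<forall>s\<in>F. \<forall>\<xi>\<in>W'. norm (\<pi> s \<xi> - c s *\<^sub>C \<xi>) \<le> e * norm \<xi>" by (elim exE conjE)
  obtain d W'' where W'': "invariant W''" "W'' \<subseteq> W'" "nontrivial W''"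
    "\<And>\<xi>. \<xi> \<in> W'' \<Longrightarrow> norm (\<pi> s \<xi> - d *\<^sub>C \<xi>) \<le> e * norm \<xi>"
    by (rule near_scalar_subspace_rep[OF W'(1,3) \<open>0 < e\<close>, of s]) (rule that)
  have "\<forall>t\<in>insert s F. \<forall>\<xi>\<in>W''. norm (\<pi> t \<xi> - (c(s := d)) t *\<^sub>C \<xi>) \<le> e * norm \<xi>"
  proof (intro ballI)
    fix t \<xi> assume t: "t \<in> insert s F" and \<xi>: "\<xi> \<in> W''"
    show "norm (\<pi> t \<xi> - (c(s := d)) t *\<^sub>C \<xi>) \<le> e * norm \<xi>"
    proof (cases "t = s")
      case False
      then show ?thesis using t bspec[OF bspec[OF W'(4)], of t \<xi>] subsetD[OF W''(2) \<xi>] by simp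
    qed (simp add: W''(4)[OF \<xi>])
  qed
  then show ?case using W''(1,3) order_trans[OF W''(2) W'(2)]
    by (intro exI[of _ "c(s := d)"] exI[of _ W''] conjI)
qed

text \<open>Compactness of the product of discs turns the approximate joint eigenvalues for finite subsets
  of the group into a single function on the group.\<close>

lemma joint_approximate_eigenvalue:
  assumes W: "invariant W" "nontrivial W"
  obtains c where "\<And>F e. finite F \<Longrightarrow> 0 < e \<Longrightarrow> \<exists>\<eta>\<in>W. norm \<eta> = 1 \<and> (\<forall>s\<in>F. norm (\<pi> s \<eta> - c s *\<^sub>C \<eta>) \<le> e)"
proof -
  define near where "near F n c \<longleftrightarrow> (\<exists>\<eta>\<in>W. norm \<eta> = 1 \<and> (\<forall>s\<in>F. norm (\<pi> s \<eta> - c s *\<^sub>C \<eta>) \<le> 1 / real (Suc n)))"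
    for F n and c :: "'g \<Rightarrow> complex"
  \<comment> \<open>Functions on the whole group with values of modulus at most 2, compact by
    Tychonoff's theorem. Radius 2 suffices, since an approximate eigenvalue has modulus at most 1 +
    1 / Suc n.\<close>
  define S where "S = (PiE UNIV (\<lambda>_. cball 0 2) :: ('g \<Rightarrow> complex) set)"
  define X where "X p = {c \<in> S. near (fst p) (snd p) c}" for p
  define I where "I = {p :: 'g set \<times> nat. finite (fst p)}"
  have S_comp: "compact S"
    unfolding S_def compactin_euclidean_iff[symmetric] euclidean_product_topology[symmetric] compactin_PiE
    by simp
  have X_ne: "X (F, n) \<noteq> {}" if F: "finite F" for F n
  proof -
    have pos: "0 < 1 / real (Suc n)" by simp
    from near_scalar_subspace_finite[OF F W pos]
    obtain c W' where W': "invariant W'" "W' \<subseteq> W" "nontrivial W'"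
      "\<forall>s\<in>F. \<forall>\<xi>\<in>W'. norm (\<pi> s \<xi> - c s *\<^sub>C \<xi>) \<le> 1 / real (Suc n) * norm \<xi>"
      by (elim exE conjE)
    obtain \<eta> where \<eta>: "\<eta> \<in> W'" "norm \<eta> = 1"
      by (rule nontrivial_unit[OF W'(3) invariantD(2)[OF W'(1)]])
    \<comment> \<open>Outside F the value is immaterial; 0 keeps c' in the product of discs.\<close>
    define c' where "c' s = (if s \<in> F then c s else 0)" for s
    have *: "norm (\<pi> s \<eta> - c s *\<^sub>C \<eta>) \<le> 1 / real (Suc n)" if "s \<in> F" for s
      using bspec[OF bspec[OF W'(4) that] \<eta>(1)] \<eta>(2) by simp
    have "cmod (c s) \<le> 2" if "s \<in> F" for s
    proof -
      have "norm (c s *\<^sub>C \<eta>) \<le> norm (\<pi> s \<eta>) + norm (\<pi> s \<eta> - c s *\<^sub>C \<eta>)"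
        using norm_triangle_ineq4[of "\<pi> s \<eta>" "\<pi> s \<eta> - c s *\<^sub>C \<eta>"] by simp
      then have "cmod (c s) \<le> 1 + norm (\<pi> s \<eta> - c s *\<^sub>C \<eta>)"
        unfolding norm_scaleC norm_rep \<eta>(2) by simp
      moreover have "1 / real (Suc n) \<le> 1" by simp
      ultimately show ?thesis using *[OF that] by linarith
    qed
    then have "c' \<in> S" by (auto simp: S_def c'_def)
    moreover have "near F n c'"
      unfolding near_def using \<eta> * W'(2) by (intro bexI[of _ \<eta>]) (auto simp: c'_def)
    ultimately show ?thesis by (auto simp: X_def)
  qed
  have mono: "X (G, N) \<subseteq> X (F, n)" if "F \<subseteq> G" "n \<le> N" for F G n N
  proof
    fix c assume c: "c \<in> X (G, N)"
    have "1 / real (Suc N) \<le> 1 / real (Suc n)" using that(2) by (simp add: field_simps)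
    then show "c \<in> X (F, n)"
      using c that(1) unfolding X_def near_def by (auto intro: order_trans)
  qed
  \<comment> \<open>The sets \<open>X p\<close> are not known to be closed, so the finite
    intersection property is applied to their closures. A nearby member of \<open>X (F, n)\<close>
    is recovered afterwards at the price of e/2.\<close>
  have "S \<inter> (\<Inter>p\<in>I. closure (X p)) \<noteq> {}"
  proof (rule compact_imp_fip_image[OF S_comp closed_closure])
    fix J assume J: "finite J" "J \<subseteq> I"
    define G where "G = (\<Union>p\<in>J. fst p)"
    define N where "N = Max (insert 0 (snd ` J))"
    have "finite G" using J unfolding G_def I_def by auto
    then obtain c where c: "c \<in> X (G, N)" using X_ne by blast
    have "c \<in> closure (X p)" if "p \<in> J" for p
    proof -
      have "snd p \<le> N" "fst p \<subseteq> G" using that J(1) by (auto simp: N_def G_def)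
      then have "c \<in> X (fst p, snd p)" using mono c by blast
      then show ?thesis using closure_subset by (metis prod.collapse subsetD)
    qed
    moreover have "c \<in> S" using c by (simp add: X_def)
    ultimately show "S \<inter> (\<Inter>p\<in>J. closure (X p)) \<noteq> {}" by blast
  qed
  then obtain c where c: "\<And>p. p \<in> I \<Longrightarrow> c \<in> closure (X p)" by blast
  have "\<exists>\<eta>\<in>W. norm \<eta> = 1 \<and> (\<forall>s\<in>F. norm (\<pi> s \<eta> - c s *\<^sub>C \<eta>) \<le> e)" if F: "finite F" and "0 < e" for F e
  proof -
    have "0 < e/2" using \<open>0 < e\<close> by simp
    then obtain n where n: "1 / real (Suc n) < e/2" using nat_approx_posE by blast
    define U where "U = (\<Inter>s\<in>F. {c' :: 'g \<Rightarrow> complex. cmod (c' s - c s) < e/2})"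
    have "open U" unfolding U_def
      by (intro open_INT F ballI open_Collect_less continuous_intros continuous_on_product_coordinates)
    moreover have "c \<in> U" using \<open>0 < e/2\<close> by (simp add: U_def)
    moreover have "c \<in> closure (X (F, n))" using F by (intro c) (simp add: I_def)
    ultimately have "U \<inter> X (F, n) \<noteq> {}"
      using open_Int_closure_eq_empty[of U "X (F, n)"] by blast
    then obtain c' where c': "c' \<in> U" "near F n c'" by (auto simp: X_def)
    then obtain \<eta> where \<eta>: "\<eta> \<in> W" "norm \<eta> = 1" "\<forall>s\<in>F. norm (\<pi> s \<eta> - c' s *\<^sub>C \<eta>) \<le> 1 / real (Suc n)"
      unfolding near_def by (elim bexE conjE)
    have "norm (\<pi> s \<eta> - c s *\<^sub>C \<eta>) \<le> e" if "s \<in> F" for s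
    proof -
      have "norm (\<pi> s \<eta> - c s *\<^sub>C \<eta>) \<le> norm (\<pi> s \<eta> - c' s *\<^sub>C \<eta>) + norm ((c' s - c s) *\<^sub>C \<eta>)"
        using norm_triangle_ineq[of "\<pi> s \<eta> - c' s *\<^sub>C \<eta>" "(c' s - c s) *\<^sub>C \<eta>"] by (simp add: scaleC_diff_left)
      moreover have "cmod (c' s - c s) < e/2" using c'(1) that by (simp add: U_def)
      ultimately show ?thesis using bspec[OF \<eta>(3) that] n \<eta>(2) by (simp add: norm_scaleC)
    qed
    with \<eta>(1,2) show ?thesis by (intro bexI[of _ \<eta>] conjI ballI)
  qed
  then show thesis by (rule that)
qed

end

section \<open>Norm-continuous subrepresentations and approximate eigenspaces\<close>

context haar_rep
begin

lemma pi1_bicommutant: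
  assumes f: "integrable m f"
  shows "pi1 m \<pi> f \<in> rep_bicommutant"
proof -
  have "commutes S (pi1 m \<pi> f)" if S: "S \<in> rep_commutant" for S
  proof -
    obtain S' where "is_adj S' S" using S by (auto simp: rep_commutant_def)
    then show ?thesis using S by (intro pi1_commutes[OF f]) (auto simp: rep_commutant_def)
  qed
  then show ?thesis using pi1_BH[OF f] by (simp add: rep_bicommutant_def)
qed

lemma adjoint_bicommutant:
  assumes T: "T \<in> rep_bicommutant" and T': "is_adj T' T"
  shows "T' \<in> rep_bicommutant"
proof -
  have "commutes S T'" if S: "S \<in> rep_commutant" for S
  proof -
    obtain S' where S': "is_adj S' S" using S by (auto simp: rep_commutant_def)
    have "commutes S' T" by (rule bicommutantD(2)[OF T rep_commutant_adjoint[OF S S']])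
    then show ?thesis by (rule commutes_adjoint[OF _ is_adj_sym[OF S'] T'])
  qed
  then show ?thesis using is_adj_BH[OF is_adj_sym[OF T']] by (simp add: rep_bicommutant_def)
qed

text \<open>f is the indicator of a set D of positive measure on which \<pi> t \<xi> stays within
  |\<xi>|/2 of \<xi>, so averaging over D cannot cancel \<xi>.\<close>

lemma smoothing_nonzero:
  assumes "\<xi> \<noteq> 0"
  obtains f where "integrable m f" "pi1 m \<pi> f \<xi> \<noteq> 0"
proof -
  define V where "V = {s. norm (\<pi> s \<xi> - \<xi>) < norm \<xi> / 2}"
  have "open V" unfolding V_def
    by (intro open_Collect_less continuous_intros rep_continuous)
  moreover have "0 \<in> V" using assms by (simp add: V_def rep_zero)
  ultimately obtain D where D: "D \<in> sets borel" "D \<subseteq> V" "0 < emeasure m D" "emeasure m D < \<infinity>"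
    by (rule small_set_positive_measure)
  define c where "c = measure m D"
  have "emeasure m D = ennreal c"
    unfolding c_def using D(4) by (intro emeasure_eq_ennreal_measure) auto
  then have "0 < c" using D(3) by (simp add: ennreal_less_zero_iff)
  have Dm: "D \<in> sets m" using D(1) by (simp add: sets_m)
  define f where "f t = complex_of_real (indicat_real D t)" for t
  have ind: "integrable m (indicat_real D)" using Dm D(4) by (intro integrable_real_indicator)
  then have f: "integrable m f" unfolding f_def by (rule integrable_of_real)
  have int_f: "(\<integral>t. f t \<partial>m) = of_real c"
    using Dm by (simp add: f_def integral_complex_of_real c_def)
  have "norm (pi1 m \<pi> f \<xi> - of_real c *\<^sub>C \<xi>) \<le> c * (norm \<xi> / 2)"
  proof (rule norm_le_if_cinner_le)
    fix \<zeta>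
    let ?g = "\<lambda>t. f t * cinner (\<pi> t \<xi>) \<zeta> - f t * cinner \<xi> \<zeta>"
    have i: "integrable m ?g"
      by (intro Bochner_Integration.integrable_diff rep_integrable f integrable_mult_left)
    have "cinner (pi1 m \<pi> f \<xi> - of_real c *\<^sub>C \<xi>) \<zeta> = (\<integral>t. ?g t \<partial>m)"
      using int_f f
      by (subst Bochner_Integration.integral_diff) (auto simp: cinner_simps cinner_pi1[OF f] intro: rep_integrable[OF f])
    also have "cmod \<dots> \<le> (\<integral>t. indicat_real D t * (norm \<xi> / 2 * norm \<zeta>) \<partial>m)"
    proof (rule norm_integral_le(2)[OF borel_measurable_integrable[OF i]])
      show "integrable m (\<lambda>t. indicat_real D t * (norm \<xi> / 2 * norm \<zeta>))"
        by (rule integrable_mult_left) (use ind in simp)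
      fix t
      show "cmod (?g t) \<le> indicat_real D t * (norm \<xi> / 2 * norm \<zeta>)"
      proof (cases "t \<in> D")
        case True
        have "cmod (cinner (\<pi> t \<xi> - \<xi>) \<zeta>) \<le> norm \<xi> / 2 * norm \<zeta>"
          by (rule order_trans[OF cmod_cinner_le mult_right_mono]) (use True D(2) in \<open>auto simp: V_def\<close>)
        then show ?thesis using True by (simp add: f_def cinner_diff_left)
      qed (simp add: f_def)
    qed
    also have "\<dots> = c * (norm \<xi> / 2) * norm \<zeta>"
      using Dm unfolding integral_mult_left_zero by (simp add: c_def)
    finally show "cmod (cinner (pi1 m \<pi> f \<xi> - of_real c *\<^sub>C \<xi>) \<zeta>) \<le> c * (norm \<xi> / 2) * norm \<zeta>" .
  qed (use \<open>0 < c\<close> in simp)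
  moreover have "norm (of_real c *\<^sub>C \<xi>) = c * norm \<xi>" using \<open>0 < c\<close> by (simp add: norm_scaleC)
  moreover have "0 < c * norm \<xi>" using \<open>0 < c\<close> assms by simp
  ultimately have "pi1 m \<pi> f \<xi> \<noteq> 0" by auto
  then show thesis by (rule that[OF f])
qed

definition norm_continuous_on :: "'h set \<Rightarrow> bool" where
  "norm_continuous_on W \<longleftrightarrow> (\<forall>e>0. \<exists>U. open U \<and> 0 \<in> U \<and> (\<forall>s\<in>U. \<forall>\<xi>\<in>W. norm (\<pi> s \<xi> - \<xi>) \<le> e * norm \<xi>))"

lemma norm_continuous_onE:
  assumes "norm_continuous_on W" "0 < e"
  obtains U where "open U" "0 \<in> U" "\<And>s \<xi>. s \<in> U \<Longrightarrow> \<xi> \<in> W \<Longrightarrow> norm (\<pi> s \<xi> - \<xi>) \<le> e * norm \<xi>"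
proof -
  from assms(1)[unfolded norm_continuous_on_def, rule_format, OF assms(2)]
  obtain U where U: "open U" "0 \<in> U" "\<forall>s\<in>U. \<forall>\<xi>\<in>W. norm (\<pi> s \<xi> - \<xi>) \<le> e * norm \<xi>" by (elim exE conjE)
  show thesis by (rule that[OF U(1,2) U(3)[rule_format]])
qed

text \<open>On W0 the operator a = \<open>pi1 m \<pi> f\<close> is bounded below by r. As a commutes
  with \<pi>, r |\<pi> s \<xi> - \<xi>| \<le> |(\<pi> s a - a) \<xi>| for \<xi> in W0, and the
  operator on the right is small in norm for s near 0.\<close>

lemma norm_continuous_subspace:
  assumes W: "invariant W" "nontrivial W"
  obtains W0 where "invariant W0" "W0 \<subseteq> W" "nontrivial W0" "norm_continuous_on W0"
proof -
  obtain \<xi>0 where \<xi>0: "\<xi>0 \<in> W" "\<xi>0 \<noteq> 0" using W(2) by (auto simp: nontrivial_def)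
  obtain f where f: "integrable m f" "pi1 m \<pi> f \<xi>0 \<noteq> 0" by (rule smoothing_nonzero[OF \<xi>0(2)])
  let ?a = "pi1 m \<pi> f"
  obtain a' where a': "is_adj a' ?a" using pi1_adjoint[OF f(1)] by metis
  define T where "T = a' o\<^sub>L ?a"
  have T: "T \<in> rep_bicommutant" "is_adj T T"
    unfolding T_def
    by (intro bicommutant_compose adjoint_bicommutant[OF _ a'] pi1_bicommutant f(1) is_adj_compose a' is_adj_sym[OF a'])+
  have T_form: "cinner (T \<xi>) \<xi> = of_real ((norm (?a \<xi>))\<^sup>2)" for \<xi>
    by (simp only: T_def blinfun_apply_blinfun_compose is_adjD[OF is_adj_sym[OF a']] cinner_self)
  \<comment> \<open>Half of |a \<xi>0|^2 / |\<xi>0|^2, so that the form of B = d - a' a is negative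
    at \<xi>0.\<close>
  define d where "d = ((norm (?a \<xi>0)) / (norm \<xi>0))\<^sup>2 / 2"
  have "0 < d" using f(2) \<xi>0(2) by (simp add: d_def)
  define B where "B = d *\<^sub>R id_blinfun - T"
  have B: "B \<in> rep_bicommutant" "is_adj B B"
    unfolding B_def by (intro bicommutant_diff bicommutant_scaleR bicommutant_id T is_adj_diff is_adj_scaleR is_adj_id)+
  have B_form: "Re (cinner (B \<xi>) \<xi>) = d * (norm \<xi>)\<^sup>2 - (norm (?a \<xi>))\<^sup>2" for \<xi>
    by (simp add: B_def blinfun.diff_left blinfun.scaleR_left cinner_diff_left cinner_scaleR_left cinner_self T_form)
  have "Re (cinner (B \<xi>0) \<xi>0) < 0"
    using f(2) \<xi>0(2) by (simp add: B_form d_def power_divide)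
  then obtain W0 where W0: "invariant W0" "W0 \<subseteq> W" "nontrivial W0" "\<And>\<xi>. \<xi> \<in> W0 \<Longrightarrow> Re (cinner (B \<xi>) \<xi>) \<le> 0"
    by (rule spectral_split[OF W(1) B \<xi>0(1)]) (rule that)
  define r where "r = sqrt d"
  have "0 < r" using \<open>0 < d\<close> by (simp add: r_def)
  have low: "r * norm \<xi> \<le> norm (?a \<xi>)" if "\<xi> \<in> W0" for \<xi>
  proof (rule power2_le_imp_le)
    show "(r * norm \<xi>)\<^sup>2 \<le> (norm (?a \<xi>))\<^sup>2"
      using W0(4)[OF that] \<open>0 < d\<close> by (simp add: B_form r_def power_mult_distrib)
  qed simp
  have "norm_continuous_on W0"
    unfolding norm_continuous_on_def
  proof (intro allI impI)
    fix e :: real assume "0 < e"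
    then have "0 < e * r" using \<open>0 < r\<close> by simp
    from A_rep_near_zero[OF pi1_mem[OF f(1)], rule_format, OF this]
    obtain U where U: "open U" "0 \<in> U" "\<forall>s\<in>U. norm ((\<pi> s o\<^sub>L ?a) - ?a) \<le> e * r" by (elim exE conjE)
    have "norm (\<pi> s \<xi> - \<xi>) \<le> e * norm \<xi>" if s: "s \<in> U" and \<xi>: "\<xi> \<in> W0" for s \<xi>
    proof -
      let ?v = "\<pi> s \<xi> - \<xi>"
      have "?v \<in> W0" by (rule csubspaceD(4)[OF invariantD(2)[OF W0(1)] invariantD(3)[OF W0(1) \<xi>] \<xi>])
      then have "r * norm ?v \<le> norm (?a ?v)" by (rule low)
      also have "?a ?v = ((\<pi> s o\<^sub>L ?a) - ?a) \<xi>"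
        using commutesD[OF bicommutantD(2)[OF pi1_bicommutant[OF f(1)] rep_commutant_rep], of s \<xi>]
        by (simp add: blinfun.diff_left blinfun.diff_right)
      also have "norm \<dots> \<le> (e * r) * norm \<xi>"
        by (rule order_trans[OF norm_blinfun mult_right_mono[OF bspec[OF U(3) s] norm_ge_zero]])
      finally have "r * norm ?v \<le> r * (e * norm \<xi>)" by (simp add: mult_ac)
      then show ?thesis using \<open>0 < r\<close> by simp
    qed
    with U(1,2) show "\<exists>U. open U \<and> 0 \<in> U \<and> (\<forall>s\<in>U. \<forall>\<xi>\<in>W0. norm (\<pi> s \<xi> - \<xi>) \<le> e * norm \<xi>)"
      by (intro exI[of _ U] conjI ballI)
  qed
  then show thesis by (rule that[OF W0(1-3)])
qed

text \<open>Each law for c involves finitely many group elements and is tested on one vector \<eta>.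
  Continuity needs the uniformity in \<open>norm_continuous_on\<close>, since \<eta> depends on the
  points compared.\<close>

lemma approximate_eigenvalue_character:
  assumes W: "norm_continuous_on W"
    and c: "\<And>F e. finite F \<Longrightarrow> 0 < e \<Longrightarrow> \<exists>\<eta>\<in>W. norm \<eta> = 1 \<and> (\<forall>s\<in>F. norm (\<pi> s \<eta> - c s *\<^sub>C \<eta>) \<le> e)"
  shows "c \<in> dual_group"
proof -
  have approx: "\<exists>\<eta>\<in>W. norm \<eta> = 1 \<and> norm (\<pi> s \<eta> - c s *\<^sub>C \<eta>) \<le> e \<and> norm (\<pi> t \<eta> - c t *\<^sub>C \<eta>) \<le> e
      \<and> norm (\<pi> u \<eta> - c u *\<^sub>C \<eta>) \<le> e" if "0 < e" for s t u e
    using c[of "{s,t,u}" e] that by simp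
  have unit: "cmod (c s) = 1" for s
  proof -
    have "\<bar>cmod (c s) - 1\<bar> \<le> 0 + e" if e: "0 < e" for e
    proof -
      obtain \<eta> where \<eta>: "norm \<eta> = 1" "norm (\<pi> s \<eta> - c s *\<^sub>C \<eta>) \<le> e"
        using approx[OF e, of s s s] by (elim bexE conjE)
      then show ?thesis
        using norm_triangle_ineq3[of "\<pi> s \<eta>" "c s *\<^sub>C \<eta>"] by (simp add: norm_scaleC)
    qed
    then have "\<bar>cmod (c s) - 1\<bar> \<le> 0" by (rule field_le_epsilon)
    then show ?thesis by simp
  qed
  moreover have "c (s + t) = c s * c t" for s t
  proof -
    have "cmod (c (s + t) - c s * c t) \<le> 0 + e" if e: "0 < e" for e
    proof -
      have "0 < e/3" using e by simp
      from approx[OF this, of s t "s + t"]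
      obtain \<eta> where \<eta>: "norm \<eta> = 1" "norm (\<pi> s \<eta> - c s *\<^sub>C \<eta>) \<le> e/3"
        "norm (\<pi> t \<eta> - c t *\<^sub>C \<eta>) \<le> e/3" "norm (\<pi> (s + t) \<eta> - c (s + t) *\<^sub>C \<eta>) \<le> e/3"
        by (elim bexE conjE)
      have "(c (s + t) - c s * c t) *\<^sub>C \<eta> = \<pi> s (\<pi> t \<eta> - c t *\<^sub>C \<eta>)
          + (c t *\<^sub>C (\<pi> s \<eta> - c s *\<^sub>C \<eta>) - (\<pi> (s + t) \<eta> - c (s + t) *\<^sub>C \<eta>))"
        by (simp add: blinfun.diff_right BH_D[OF rep_BH] rep_add_apply scaleC_diff_left scaleC_diff_right
            scaleC_scaleC mult.commute)
      also have "norm \<dots> \<le> e/3 + (e/3 + e/3)"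
        using \<eta> unit[of t]
        by (intro norm_triangle_mono order_trans[OF norm_triangle_ineq4 add_mono]) (simp_all add: norm_scaleC)
      finally show ?thesis by (simp add: norm_scaleC \<eta>(1))
    qed
    then have "cmod (c (s + t) - c s * c t) \<le> 0" by (rule field_le_epsilon)
    then show ?thesis by simp
  qed
  moreover have "continuous_on UNIV c"
    unfolding continuous_on_def
  proof (intro ballI tendstoI)
    fix t and e :: real assume "0 < e"
    then have e: "0 < e/4" by simp
    obtain U where U: "open U" "0 \<in> U" "\<And>s \<xi>. s \<in> U \<Longrightarrow> \<xi> \<in> W \<Longrightarrow> norm (\<pi> s \<xi> - \<xi>) \<le> e/4 * norm \<xi>"
      by (rule norm_continuous_onE[OF W e]) (rule that)
    have "open ((\<lambda>s. s - t) -` U)" using U(1) by (intro open_vimage continuous_intros)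
    moreover have "t \<in> (\<lambda>s. s - t) -` U" using U(2) by simp
    moreover have "dist (c s) (c t) < e" if s: "s \<in> (\<lambda>s. s - t) -` U" for s
    proof -
      obtain \<eta> where \<eta>: "\<eta> \<in> W" "norm \<eta> = 1" "norm (\<pi> s \<eta> - c s *\<^sub>C \<eta>) \<le> e/4" "norm (\<pi> t \<eta> - c t *\<^sub>C \<eta>) \<le> e/4"
        using approx[OF e, of s t t] by (elim bexE conjE)
      have "\<pi> s \<eta> - \<pi> t \<eta> = \<pi> t (\<pi> (s - t) \<eta> - \<eta>)"
        using rep_add_apply[of t "s - t" \<eta>] by (simp add: blinfun.diff_right)
      then have st: "norm (\<pi> s \<eta> - \<pi> t \<eta>) \<le> e/4" using U(3)[of "s - t" \<eta>] s \<eta>(1,2) by simp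
      have "(c s - c t) *\<^sub>C \<eta> = (\<pi> s \<eta> - \<pi> t \<eta>) + ((\<pi> t \<eta> - c t *\<^sub>C \<eta>) - (\<pi> s \<eta> - c s *\<^sub>C \<eta>))"
        by (simp add: scaleC_diff_left)
      also have "norm \<dots> \<le> e/4 + (e/4 + e/4)"
        using st \<eta> by (intro norm_triangle_mono order_trans[OF norm_triangle_ineq4 add_mono])
      finally show ?thesis using \<open>0 < e\<close> by (simp add: norm_scaleC \<eta>(2) dist_norm)
    qed
    ultimately show "\<forall>\<^sub>F s in at t within UNIV. dist (c s) (c t) < e"
      unfolding eventually_at_topological by blast
  qed
  ultimately show ?thesis by (simp add: dual_group_def)
qed

text \<open>F does not depend on \<xi>: norm continuity on W lets one finite set control all vectors
  of W on all of K.\<close>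

lemma uniform_on_compact:
  assumes W: "norm_continuous_on W" and \<sigma>: "continuous_on UNIV \<sigma>" and K: "compact K" and "0 < e"
  obtains F where "finite F" "\<And>\<xi> t. \<xi> \<in> W \<Longrightarrow> \<forall>s\<in>F. norm (\<pi> s \<xi> - \<sigma> s *\<^sub>C \<xi>) \<le> e/3 * norm \<xi> \<Longrightarrow>
    t \<in> K \<Longrightarrow> norm (\<pi> t \<xi> - \<sigma> t *\<^sub>C \<xi>) \<le> e * norm \<xi>"
proof -
  have e: "0 < e/3" using \<open>0 < e\<close> by simp
  obtain U where U: "open U" "0 \<in> U" "\<And>s \<xi>. s \<in> U \<Longrightarrow> \<xi> \<in> W \<Longrightarrow> norm (\<pi> s \<xi> - \<xi>) \<le> e/3 * norm \<xi>"
    by (rule norm_continuous_onE[OF W e]) (rule that)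
  let ?V = "\<lambda>s. (\<lambda>t. t - s) -` U \<inter> {t. cmod (\<sigma> s - \<sigma> t) < e/3}"
  have "open (?V s)" for s
    by (intro open_Int open_vimage[OF U(1)] open_Collect_less continuous_intros \<sigma>)
  moreover have "K \<subseteq> (\<Union>s\<in>K. ?V s)" using e U(2) by auto
  ultimately obtain F where F: "F \<subseteq> K" "finite F" "K \<subseteq> (\<Union>s\<in>F. ?V s)"
    using compactE_image[OF K, of K ?V] by blast
  have "norm (\<pi> t \<xi> - \<sigma> t *\<^sub>C \<xi>) \<le> e * norm \<xi>"
    if \<xi>: "\<xi> \<in> W" and near: "\<forall>s\<in>F. norm (\<pi> s \<xi> - \<sigma> s *\<^sub>C \<xi>) \<le> e/3 * norm \<xi>" and t: "t \<in> K" for \<xi> t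
  proof -
    obtain s where s: "s \<in> F" "t - s \<in> U" "cmod (\<sigma> s - \<sigma> t) < e/3" using F(3) t by blast
    have "\<pi> t \<xi> - \<sigma> t *\<^sub>C \<xi> = \<pi> s (\<pi> (t - s) \<xi> - \<xi>) + ((\<pi> s \<xi> - \<sigma> s *\<^sub>C \<xi>) + (\<sigma> s - \<sigma> t) *\<^sub>C \<xi>)"
      using rep_add_apply[of s "t - s" \<xi>] by (simp add: blinfun.diff_right scaleC_diff_left)
    also have "norm \<dots> \<le> e/3 * norm \<xi> + (e/3 * norm \<xi> + e/3 * norm \<xi>)"
    proof (intro norm_triangle_mono bspec[OF near s(1)])
      show "norm (\<pi> s (\<pi> (t - s) \<xi> - \<xi>)) \<le> e/3 * norm \<xi>" using U(3)[OF s(2) \<xi>] by simp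
      show "norm ((\<sigma> s - \<sigma> t) *\<^sub>C \<xi>) \<le> e/3 * norm \<xi>"
        unfolding norm_scaleC using s(3) by (intro mult_right_mono) auto
    qed
    finally show ?thesis by simp
  qed
  then show thesis by (rule that[OF F(2)])
qed

text \<open>Inside W0 there are \<sigma> and, for a finite F, a good vector \<eta>. The sum of all
  \<open>D' s o\<^sub>L D s\<close> minus (e/3)^2 has negative form at \<eta>, so
  \<open>spectral_split\<close> replaces the vector by a subspace on which all deviations on F are
  at most e/3; \<open>uniform_on_compact\<close> extends this to K.\<close>

lemma approximate_eigenspace:
  assumes W: "invariant W" "nontrivial W" and K: "compact K" and "0 < e"
  obtains \<sigma> W' where "\<sigma> \<in> approx_spectrum" "invariant W'" "W' \<subseteq> W" "nontrivial W'"
    "\<And>s \<xi>. s \<in> K \<Longrightarrow> \<xi> \<in> W' \<Longrightarrow> norm (\<pi> s \<xi> - \<sigma> s *\<^sub>C \<xi>) \<le> e * norm \<xi>"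
proof -
  obtain W0 where W0: "invariant W0" "W0 \<subseteq> W" "nontrivial W0" "norm_continuous_on W0"
    by (rule norm_continuous_subspace[OF W])
  obtain \<sigma> where \<sigma>: "\<And>F e. finite F \<Longrightarrow> 0 < e \<Longrightarrow>
      \<exists>\<eta>\<in>W0. norm \<eta> = 1 \<and> (\<forall>s\<in>F. norm (\<pi> s \<eta> - \<sigma> s *\<^sub>C \<eta>) \<le> e)"
    by (rule joint_approximate_eigenvalue[OF W0(1,3)]) (rule that)
  have dual: "\<sigma> \<in> dual_group" by (rule approximate_eigenvalue_character[OF W0(4) \<sigma>])
  have "\<sigma> \<in> approx_spectrum"
  proof -
    have "\<exists>\<eta>. norm \<eta> = 1 \<and> (\<forall>s\<in>L. norm (\<pi> s \<eta> - \<sigma> s *\<^sub>C \<eta>) \<le> d)" if L: "compact L" and d: "0 < d" for L d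
    proof -
      obtain F where F: "finite F" "\<And>\<xi> t. \<xi> \<in> W0 \<Longrightarrow> \<forall>s\<in>F. norm (\<pi> s \<xi> - \<sigma> s *\<^sub>C \<xi>) \<le> d/3 * norm \<xi> \<Longrightarrow>
          t \<in> L \<Longrightarrow> norm (\<pi> t \<xi> - \<sigma> t *\<^sub>C \<xi>) \<le> d * norm \<xi>"
        by (rule uniform_on_compact[OF W0(4) dual_groupD(1)[OF dual] L d]) (rule that)
      have "0 < d/3" using d by simp
      from \<sigma>[OF F(1) this] obtain \<eta> where \<eta>: "\<eta> \<in> W0" "norm \<eta> = 1"
        "\<forall>s\<in>F. norm (\<pi> s \<eta> - \<sigma> s *\<^sub>C \<eta>) \<le> d/3" by (elim bexE conjE)
      have "norm (\<pi> t \<eta> - \<sigma> t *\<^sub>C \<eta>) \<le> d" if "t \<in> L" for t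
        using F(2)[OF \<eta>(1) _ that] \<eta>(3) by (simp add: \<eta>(2))
      with \<eta>(2) show ?thesis by (intro exI[of _ \<eta>] conjI ballI)
    qed
    with dual show ?thesis by (simp add: approx_spectrum_def)
  qed
  obtain F where F: "finite F" "\<And>\<xi> t. \<xi> \<in> W0 \<Longrightarrow> \<forall>s\<in>F. norm (\<pi> s \<xi> - \<sigma> s *\<^sub>C \<xi>) \<le> e/3 * norm \<xi> \<Longrightarrow>
      t \<in> K \<Longrightarrow> norm (\<pi> t \<xi> - \<sigma> t *\<^sub>C \<xi>) \<le> e * norm \<xi>"
    by (rule uniform_on_compact[OF W0(4) dual_groupD(1)[OF dual] K \<open>0 < e\<close>]) (rule that)
  define D where "D s = \<pi> s - scaleC_op (\<sigma> s) id_blinfun" for s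
  define D' where "D' s = \<pi> (- s) - scaleC_op (cnj (\<sigma> s)) id_blinfun" for s
  have D_adj: "is_adj (D' s) (D s)" for s
    unfolding D_def D'_def by (intro is_adj_diff rep_adj is_adj_scaleC is_adj_id)
  have D_app: "D s \<xi> = \<pi> s \<xi> - \<sigma> s *\<^sub>C \<xi>" for s \<xi>
    by (simp add: D_def blinfun.diff_left scaleC_op.rep_eq)
  define r where "r = (e/3)\<^sup>2"
  define B where "B = (\<Sum>s\<in>F. D' s o\<^sub>L D s) - r *\<^sub>R id_blinfun"
  have B_bi: "B \<in> rep_bicommutant"
    unfolding B_def D_def D'_def
    by (intro bicommutant_diff bicommutant_sum bicommutant_compose bicommutant_rep bicommutant_scaleC
        bicommutant_scaleR bicommutant_id)
  have B_cinner: "cinner (B x) y = (\<Sum>s\<in>F. cinner (D s x) (D s y)) - of_real r * cinner x y" for x y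
    by (simp add: B_def blinfun.diff_left blinfun.sum_left blinfun.scaleR_left cinner_diff_left
        cinner_sum_left cinner_scaleR_left is_adjD[OF is_adj_sym[OF D_adj]])
  have "is_adj B B"
    unfolding is_adj_def
  proof (intro allI)
    fix x y
    have "cinner x (B y) = cnj (cinner (B y) x)" by (rule cinner_commute)
    also have "\<dots> = cinner (B x) y" by (simp add: B_cinner flip: cinner_commute)
    finally show "cinner (B x) y = cinner x (B y)" by simp
  qed
  have B_form: "Re (cinner (B \<xi>) \<xi>) = (\<Sum>s\<in>F. (norm (D s \<xi>))\<^sup>2) - r * (norm \<xi>)\<^sup>2" for \<xi>
    by (simp add: B_cinner cinner_self)
  \<comment> \<open>With n = card F this means (n + 1) q = e/3, hence n q^2 < (e/3)^2, also for
    empty F.\<close>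
  define q where "q = e / (3 * (real (card F) + 1))"
  have "0 < q" using \<open>0 < e\<close> by (simp add: q_def add_nonneg_pos)
  from \<sigma>[OF F(1) this] obtain \<eta> where \<eta>: "\<eta> \<in> W0" "norm \<eta> = 1"
    "\<forall>s\<in>F. norm (\<pi> s \<eta> - \<sigma> s *\<^sub>C \<eta>) \<le> q" by (elim bexE conjE)
  have "(\<Sum>s\<in>F. (norm (D s \<eta>))\<^sup>2) \<le> (\<Sum>s\<in>F. q\<^sup>2)"
    using \<eta>(3) \<open>0 < q\<close> by (intro sum_mono power_mono) (auto simp: D_app)
  also have "\<dots> = real (card F) * q\<^sup>2" by simp
  also have "\<dots> < r"
  proof -
    define n where "n = real (card F)"
    have "0 \<le> n" by (simp add: n_def)
    have "e / 3 = (n + 1) * q" unfolding q_def n_def[symmetric] using \<open>0 \<le> n\<close> by (simp add: field_simps)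
    then have "r = (n + 1)\<^sup>2 * q\<^sup>2" by (simp add: r_def power_mult_distrib)
    moreover have "n < (n + 1)\<^sup>2" using \<open>0 \<le> n\<close> by (simp add: power2_eq_square algebra_simps add_pos_nonneg)
    ultimately show ?thesis unfolding n_def[symmetric] using \<open>0 < q\<close> by simp
  qed
  finally have "Re (cinner (B \<eta>) \<eta>) < 0" by (simp add: B_form \<eta>(2))
  then obtain W' where W': "invariant W'" "W' \<subseteq> W0" "nontrivial W'" "\<And>\<xi>. \<xi> \<in> W' \<Longrightarrow> Re (cinner (B \<xi>) \<xi>) \<le> 0"
    by (rule spectral_split[OF W0(1) B_bi \<open>is_adj B B\<close> \<eta>(1)]) (rule that)
  have "norm (\<pi> t \<xi> - \<sigma> t *\<^sub>C \<xi>) \<le> e * norm \<xi>" if t: "t \<in> K" and \<xi>: "\<xi> \<in> W'" for t \<xi>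
  proof (rule F(2)[OF subsetD[OF W'(2) \<xi>] _ t], rule ballI)
    fix s assume s: "s \<in> F"
    have "(norm (D s \<xi>))\<^sup>2 \<le> (\<Sum>s\<in>F. (norm (D s \<xi>))\<^sup>2)"
      using s F(1) by (intro member_le_sum[of s F "\<lambda>s. (norm (D s \<xi>))\<^sup>2"]) auto
    also have "\<dots> \<le> (e/3 * norm \<xi>)\<^sup>2" using W'(4)[OF \<xi>] unfolding B_form r_def power_mult_distrib by linarith
    finally have "norm (D s \<xi>) \<le> e/3 * norm \<xi>" by (rule power2_le_imp_le) (use \<open>0 < e\<close> in simp)
    then show "norm (\<pi> s \<xi> - \<sigma> s *\<^sub>C \<xi>) \<le> e/3 * norm \<xi>" by (simp only: D_app)
  qed
  then show thesis by (rule that[OF \<open>\<sigma> \<in> approx_spectrum\<close> W'(1) order_trans[OF W'(2) W0(2)] W'(3)])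
qed

end

section \<open>Orthogonal families and finite expansions\<close>

lemma pythagoras_sum:
  fixes v :: "'a \<Rightarrow> 'h::complex_hilbert"
  assumes "finite X" "\<And>a b. a \<in> X \<Longrightarrow> b \<in> X \<Longrightarrow> a \<noteq> b \<Longrightarrow> cinner (v a) (v b) = 0"
  shows "(norm (\<Sum>a\<in>X. v a))\<^sup>2 = (\<Sum>a\<in>X. (norm (v a))\<^sup>2)"
  using assms
proof (induct X rule: finite_induct)
  case (insert a X)
  have "cinner (v a) (\<Sum>b\<in>X. v b) = (\<Sum>b\<in>X. cinner (v a) (v b))" by (rule cinner_sum_right)
  also have "\<dots> = 0" using insert(2,4) by (intro sum.neutral) auto
  finally have "(norm (v a + (\<Sum>b\<in>X. v b)))\<^sup>2 = (norm (v a))\<^sup>2 + (norm (\<Sum>b\<in>X. v b))\<^sup>2"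
    by (simp add: norm_add_sq)
  then show ?case using insert by simp
qed simp

context haar_rep
begin

definition eigenspace_for :: "'g set \<Rightarrow> real \<Rightarrow> 'h set \<Rightarrow> ('g \<Rightarrow> complex) \<Rightarrow> bool" where
  "eigenspace_for K e W \<sigma> \<longleftrightarrow> invariant W \<and> nontrivial W \<and> \<sigma> \<in> approx_spectrum \<and>
     (\<forall>s\<in>K. \<forall>\<xi>\<in>W. norm (\<pi> s \<xi> - \<sigma> s *\<^sub>C \<xi>) \<le> e * norm \<xi>)"

definition orthogonal_sets :: "'h set \<Rightarrow> 'h set \<Rightarrow> bool" where
  "orthogonal_sets V W \<longleftrightarrow> (\<forall>\<xi>\<in>V. \<forall>\<eta>\<in>W. cinner \<xi> \<eta> = 0)"

lemma orthogonal_sets_sym: "orthogonal_sets V W \<Longrightarrow> orthogonal_sets W V"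
  unfolding orthogonal_sets_def by (metis cinner_commute complex_cnj_zero)

text \<open>The orthogonal complement of a maximal family is invariant; were it non-trivial,
  \<open>approximate_eigenspace\<close> would supply a further member. Pairs record which character
  belongs to which subspace, and different members may carry the same character.\<close>

lemma orthogonal_family_exists:
  assumes K: "compact K" "0 < e"
  obtains M where "\<And>W \<sigma>. (W, \<sigma>) \<in> M \<Longrightarrow> eigenspace_for K e W \<sigma>"
    "\<And>p q. p \<in> M \<Longrightarrow> q \<in> M \<Longrightarrow> p \<noteq> q \<Longrightarrow> orthogonal_sets (fst p) (fst q)"
    "\<forall>\<xi>. (\<forall>p\<in>M. \<forall>\<eta>\<in>fst p. cinner \<xi> \<eta> = 0) \<longrightarrow> \<xi> = 0"
proof -
  define fam where "fam = {M. (\<forall>p\<in>M. eigenspace_for K e (fst p) (snd p)) \<and>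
    (\<forall>p\<in>M. \<forall>q\<in>M. p \<noteq> q \<longrightarrow> orthogonal_sets (fst p) (fst q))}"
  have "\<exists>M\<in>fam. \<forall>X\<in>fam. M \<subseteq> X \<longrightarrow> X = M"
  proof (rule subset_Zorn')
    fix C assume "subset.chain fam C"
    then have C: "C \<subseteq> fam" "\<And>X Y. X \<in> C \<Longrightarrow> Y \<in> C \<Longrightarrow> X \<subseteq> Y \<or> Y \<subseteq> X"
      by (auto simp: subset.chain_def)
    show "\<Union>C \<in> fam"
      unfolding fam_def mem_Collect_eq
    proof (intro conjI ballI impI)
      fix p assume "p \<in> \<Union>C"
      then obtain X where "p \<in> X" "X \<in> fam" using C(1) by blast
      then show "eigenspace_for K e (fst p) (snd p)" by (simp add: fam_def)
    next
      fix p q assume pq: "p \<in> \<Union>C" "q \<in> \<Union>C" "p \<noteq> q"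
      then obtain X Y where XY: "p \<in> X" "X \<in> C" "q \<in> Y" "Y \<in> C" by blast
      from C(2)[OF XY(2,4)] have "\<exists>Z\<in>C. p \<in> Z \<and> q \<in> Z"
      proof
        assume "X \<subseteq> Y" then show ?thesis using XY by (intro bexI[of _ Y]) auto
      next
        assume "Y \<subseteq> X" then show ?thesis using XY by (intro bexI[of _ X]) auto
      qed
      then obtain Z where Z: "Z \<in> C" "p \<in> Z" "q \<in> Z" by (elim bexE conjE)
      have "Z \<in> fam" using C(1) Z(1) by (rule subsetD)
      then show "orthogonal_sets (fst p) (fst q)" using Z(2,3) pq(3) by (simp add: fam_def)
    qed
  qed
  then obtain M where M: "M \<in> fam" "\<forall>X\<in>fam. M \<subseteq> X \<longrightarrow> X = M" by (elim bexE)
  have M1: "eigenspace_for K e (fst p) (snd p)" if "p \<in> M" for p using M(1) that by (simp add: fam_def)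
  have M2: "orthogonal_sets (fst p) (fst q)" if "p \<in> M" "q \<in> M" "p \<noteq> q" for p q
    using M(1) that by (simp add: fam_def)
  define V where "V = {\<xi>. \<forall>p\<in>M. \<forall>\<eta>\<in>fst p. cinner \<xi> \<eta> = 0}"
  have "invariant V"
    unfolding invariant_def
  proof (intro conjI allI ballI)
    have "V = (\<Inter>p\<in>M. \<Inter>\<eta>\<in>fst p. {\<xi>. cinner \<xi> \<eta> = 0})" by (auto simp: V_def)
    moreover have "closed {\<xi>. cinner \<xi> \<eta> = 0}" for \<eta> :: 'h
      by (intro closed_Collect_eq continuous_on_cinner continuous_intros)
    ultimately show "closed V" by (simp add: closed_INT)
    show "csubspace V" by (simp add: csubspace_def V_def cinner_simps)
    fix s \<xi> assume \<xi>: "\<xi> \<in> V"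
    have "cinner (\<pi> s \<xi>) \<eta> = 0" if p: "p \<in> M" "\<eta> \<in> fst p" for p \<eta>
    proof -
      have "\<pi> (- s) \<eta> \<in> fst p"
        using M1[OF p(1)] p(2) unfolding eigenspace_for_def by (auto intro: invariantD(3))
      then show ?thesis using \<xi> p(1) by (simp add: cinner_rep V_def)
    qed
    then show "\<pi> s \<xi> \<in> V" by (simp add: V_def)
  qed
  have "\<not> nontrivial V"
  proof
    assume "nontrivial V"
    obtain \<sigma> W' where W': "\<sigma> \<in> approx_spectrum" "invariant W'" "W' \<subseteq> V" "nontrivial W'"
      "\<And>s \<xi>. s \<in> K \<Longrightarrow> \<xi> \<in> W' \<Longrightarrow> norm (\<pi> s \<xi> - \<sigma> s *\<^sub>C \<xi>) \<le> e * norm \<xi>"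
      by (rule approximate_eigenspace[OF \<open>invariant V\<close> \<open>nontrivial V\<close> K]) (rule that)
    have orth: "orthogonal_sets W' (fst p)" if "p \<in> M" for p
      using W'(3) that unfolding orthogonal_sets_def V_def by blast
    have "eigenspace_for K e W' \<sigma>" using W' by (simp add: eigenspace_for_def)
    then have "insert (W', \<sigma>) M \<in> fam"
      using M1 M2 orth orthogonal_sets_sym[OF orth] unfolding fam_def by auto
    \<comment> \<open>By maximality the new pair is already a member, so W' would be orthogonal to
      itself.\<close>
    then have "insert (W', \<sigma>) M = M" using M(2) by (simp only: subset_insertI)
    then have "(W', \<sigma>) \<in> M" by blast
    from orth[OF this] have "orthogonal_sets W' W'" by simp
    moreover obtain \<xi> where "\<xi> \<in> W'" "\<xi> \<noteq> 0" using W'(4) by (auto simp: nontrivial_def)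
    ultimately have "cinner \<xi> \<xi> = 0" by (simp add: orthogonal_sets_def)
    then show False using \<open>\<xi> \<noteq> 0\<close> by (simp add: cinner_self)
  qed
  then have trivial: "\<forall>\<xi>. (\<forall>p\<in>M. \<forall>\<eta>\<in>fst p. cinner \<xi> \<eta> = 0) \<longrightarrow> \<xi> = 0"
    by (auto simp: nontrivial_def V_def)
  have "eigenspace_for K e W \<sigma>" if "(W, \<sigma>) \<in> M" for W \<sigma> using M1[OF that] by simp
  from that[OF this M2 trivial] show thesis .
qed

text \<open>The closure of the finite sums is the whole space, since the residual of the projection
  onto it is orthogonal to every member. The components vanish off X, so that several expansions can
  share a larger index set.\<close>

lemma finite_sums_dense:
  fixes M :: "('h set \<times> 'i) set"
  assumes sub: "\<And>p. p \<in> M \<Longrightarrow> csubspace (fst p)"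
    and total: "\<forall>\<xi>. (\<forall>p\<in>M. \<forall>\<eta>\<in>fst p. cinner \<xi> \<eta> = 0) \<longrightarrow> \<xi> = 0" and "0 < e"
  shows "\<exists>X v. finite X \<and> X \<subseteq> M \<and> (\<forall>p\<in>M. v p \<in> fst p) \<and> (\<forall>p. p \<notin> X \<longrightarrow> v p = 0)
    \<and> norm (\<xi> - (\<Sum>p\<in>X. v p)) < e"
proof -
  define rep_of where "rep_of X v \<zeta> \<longleftrightarrow> finite X \<and> X \<subseteq> M \<and> (\<forall>p\<in>M. v p \<in> fst p) \<and> (\<forall>p. p \<notin> X \<longrightarrow> v p = 0)
     \<and> \<zeta> = (\<Sum>p\<in>X. v p)" for X v and \<zeta> :: 'h
  define V where "V = {\<zeta>. \<exists>X v. rep_of X v \<zeta>}"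
  have "csubspace V"
    unfolding csubspace_def
  proof (intro conjI ballI allI)
    have "rep_of {} (\<lambda>_. 0) 0" using csubspaceD(1)[OF sub] by (simp add: rep_of_def)
    then show "0 \<in> V" by (auto simp: V_def)
  next
    fix x y assume "x \<in> V" "y \<in> V"
    then obtain X v Y w where x: "rep_of X v x" and y: "rep_of Y w y" by (auto simp: V_def)
    have fin: "finite (X \<union> Y)" using x y by (simp add: rep_of_def)
    have "x = (\<Sum>p\<in>X \<union> Y. v p)" "y = (\<Sum>p\<in>X \<union> Y. w p)"
      using x y fin by (auto simp: rep_of_def intro!: sum.mono_neutral_left)
    then have "rep_of (X \<union> Y) (\<lambda>p. v p + w p) (x + y)"
      using x y csubspaceD(2)[OF sub] by (auto simp: rep_of_def sum.distrib)
    then show "x + y \<in> V" unfolding V_def by blast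
  next
    fix c x assume "x \<in> V"
    then obtain X v where "rep_of X v x" by (auto simp: V_def)
    then have "rep_of X (\<lambda>p. c *\<^sub>C v p) (c *\<^sub>C x)"
      using csubspaceD(3)[OF sub] by (auto simp: rep_of_def scaleC_sum_right)
    then show "c *\<^sub>C x \<in> V" unfolding V_def by blast
  qed
  obtain p where p: "p \<in> closure V" "\<And>w. w \<in> closure V \<Longrightarrow> cinner (\<xi> - p) w = 0"
    by (rule orthogonal_projection_exists[OF closed_closure csubspace_closure[OF \<open>csubspace V\<close>], of \<xi>]) (rule that)
  have "\<xi> - p = 0"
  proof (rule total[rule_format])
    fix q \<eta> assume q: "q \<in> M" "\<eta> \<in> fst q"
    have "rep_of {q} (\<lambda>p. if p = q then \<eta> else 0) \<eta>"
      using q csubspaceD(1)[OF sub] by (simp add: rep_of_def)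
    then have "\<eta> \<in> V" unfolding V_def by blast
    then show "cinner (\<xi> - p) \<eta> = 0" using p(2) closure_subset by blast
  qed
  then have "\<xi> \<in> closure V" using p(1) by simp
  then obtain \<zeta> where \<zeta>: "\<zeta> \<in> V" "dist \<zeta> \<xi> < e" using \<open>0 < e\<close> closure_approachable by blast
  then obtain X v where "rep_of X v \<zeta>" by (auto simp: V_def)
  then show ?thesis
    using \<zeta>(2) unfolding rep_of_def dist_norm norm_minus_commute[of \<zeta>] by (intro exI[of _ X] exI[of _ v]) auto
qed

text \<open>Orthogonality makes the errors of the components add in squares, so the total error does
  not grow with the number of summands. It also makes the norm of the twisted sum independent of t,
  which gives the bound on all of G. A common X for all j allows a single coefficient matrix to be
  formed.\<close>

theorem approximate_eigenvector_expansion: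
  fixes \<xi> :: "nat \<Rightarrow> 'h"
  assumes K: "compact K" and e: "0 < e" "e \<le> 1"
  obtains X :: "('h set \<times> ('g \<Rightarrow> complex)) set" and v where
    "finite X" "\<And>p. p \<in> X \<Longrightarrow> snd p \<in> approx_spectrum"
    "\<And>j t. j < n \<Longrightarrow> t \<in> K \<Longrightarrow> norm (\<pi> t (\<xi> j) - (\<Sum>p\<in>X. snd p t *\<^sub>C v j p)) \<le> e * (norm (\<xi> j) + 2)"
    "\<And>j t. j < n \<Longrightarrow> norm (\<Sum>p\<in>X. snd p t *\<^sub>C v j p) \<le> norm (\<xi> j) + 1"
proof -
  obtain M where M: "\<And>W \<sigma>. (W, \<sigma>) \<in> M \<Longrightarrow> eigenspace_for K e W \<sigma>"
    "\<And>p q. p \<in> M \<Longrightarrow> q \<in> M \<Longrightarrow> p \<noteq> q \<Longrightarrow> orthogonal_sets (fst p) (fst q)"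
    "\<forall>\<xi>. (\<forall>p\<in>M. \<forall>\<eta>\<in>fst p. cinner \<xi> \<eta> = 0) \<longrightarrow> \<xi> = 0"
    by (rule orthogonal_family_exists[OF K e(1)]) (rule that)
  have M1: "eigenspace_for K e (fst p) (snd p)" if "p \<in> M" for p using M(1)[of "fst p" "snd p"] that by simp
  have sub: "csubspace (fst p)" if "p \<in> M" for p
    using M1[OF that] by (auto simp: eigenspace_for_def dest: invariantD(2))
  have "\<exists>X v. finite X \<and> X \<subseteq> M \<and> (\<forall>p\<in>M. v p \<in> fst p) \<and> (\<forall>p. p \<notin> X \<longrightarrow> v p = 0)
    \<and> norm (\<xi> j - (\<Sum>p\<in>X. v p)) < e" for j
    by (rule finite_sums_dense[OF sub M(3) e(1)]) assumption+
  then obtain Y v where Y: "\<And>j. finite (Y j)" "\<And>j. Y j \<subseteq> M" "\<And>j p. p \<in> M \<Longrightarrow> v j p \<in> fst p"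
    "\<And>j p. p \<notin> Y j \<Longrightarrow> v j p = 0" "\<And>j. norm (\<xi> j - (\<Sum>p\<in>Y j. v j p)) < e" by metis
  define X where "X = (\<Union>j<n. Y j)"
  have X: "finite X" "X \<subseteq> M" using Y(1,2) by (auto simp: X_def)
  have sum_Y: "(\<Sum>p\<in>X. v j p) = (\<Sum>p\<in>Y j. v j p)" if "j < n" for j
    using that X(1) Y(4) by (intro sum.mono_neutral_right) (auto simp: X_def)
  have close: "norm (\<xi> j - (\<Sum>p\<in>X. v j p)) \<le> e" if "j < n" for j
    using Y(5)[of j] sum_Y[OF that] by simp
  have dual: "snd p \<in> dual_group" if "p \<in> M" for p
    using M1[OF that] approx_spectrum_dual by (auto simp: eigenspace_for_def)
  have orth: "cinner x y = 0" if "p \<in> X" "q \<in> X" "p \<noteq> q" "x \<in> fst p" "y \<in> fst q" for p q x y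
    using M(2)[of p q] that X(2) unfolding orthogonal_sets_def by blast
  have vmem: "v j p \<in> fst p" if "p \<in> X" for p j
    by (rule Y(3)[OF subsetD[OF X(2) that]])
  have norm_sum: "norm (\<Sum>p\<in>X. snd p t *\<^sub>C v j p) = norm (\<Sum>p\<in>X. v j p)" for j t
  proof -
    have "(norm (\<Sum>p\<in>X. snd p t *\<^sub>C v j p))\<^sup>2 = (\<Sum>p\<in>X. (norm (snd p t *\<^sub>C v j p))\<^sup>2)"
    proof (rule pythagoras_sum[OF X(1)])
      fix p q assume pq: "p \<in> X" "q \<in> X" "p \<noteq> q"
      have "cinner (v j p) (v j q) = 0" by (rule orth[OF pq vmem[OF pq(1)] vmem[OF pq(2)]])
      then show "cinner (snd p t *\<^sub>C v j p) (snd q t *\<^sub>C v j q) = 0" by (simp add: cinner_simps)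
    qed
    also have "\<dots> = (\<Sum>p\<in>X. (norm (v j p))\<^sup>2)"
      using dual_groupD(2)[OF dual[OF subsetD[OF X(2)]]] by (intro sum.cong refl) (simp add: norm_scaleC)
    also have "\<dots> = (norm (\<Sum>p\<in>X. v j p))\<^sup>2"
      by (rule pythagoras_sum[OF X(1), symmetric]) (rule orth[OF _ _ _ vmem vmem])
    finally show ?thesis by simp
  qed
  have sum_le: "norm (\<Sum>p\<in>X. v j p) \<le> norm (\<xi> j) + e" if "j < n" for j
    using close[OF that] norm_triangle_sub[of "\<Sum>p\<in>X. v j p" "\<xi> j"] by (simp add: norm_minus_commute)
  have eig: "norm (\<pi> t (\<Sum>p\<in>X. v j p) - (\<Sum>p\<in>X. snd p t *\<^sub>C v j p)) \<le> e * norm (\<Sum>p\<in>X. v j p)"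
    if t: "t \<in> K" for t j
  proof (rule power2_le_imp_le)
    \<comment> \<open>Invariance keeps each deviation in its own subspace, so Pythagoras applies to
      the deviations as well.\<close>
    have mem: "v j p \<in> fst p" "\<pi> t (v j p) - snd p t *\<^sub>C v j p \<in> fst p" if "p \<in> X" for p
    proof -
      have p: "p \<in> M" using that X(2) by blast
      show 1: "v j p \<in> fst p" by (rule vmem[OF that])
      show "\<pi> t (v j p) - snd p t *\<^sub>C v j p \<in> fst p"
        using M1[OF p] 1 unfolding eigenspace_for_def
        by (auto intro!: csubspaceD(4)[OF sub[OF p]] csubspaceD(3)[OF sub[OF p]] invariantD(3))
    qed
    have "(norm (\<pi> t (\<Sum>p\<in>X. v j p) - (\<Sum>p\<in>X. snd p t *\<^sub>C v j p)))\<^sup>2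
        = (norm (\<Sum>p\<in>X. \<pi> t (v j p) - snd p t *\<^sub>C v j p))\<^sup>2"
      by (simp add: blinfun.sum_right sum_subtractf)
    also have "\<dots> = (\<Sum>p\<in>X. (norm (\<pi> t (v j p) - snd p t *\<^sub>C v j p))\<^sup>2)"
      by (rule pythagoras_sum[OF X(1)]) (rule orth[OF _ _ _ mem(2) mem(2)])
    also have "\<dots> \<le> (\<Sum>p\<in>X. e\<^sup>2 * (norm (v j p))\<^sup>2)"
    proof (rule sum_mono)
      fix p assume p: "p \<in> X"
      then have "norm (\<pi> t (v j p) - snd p t *\<^sub>C v j p) \<le> e * norm (v j p)"
        using M1[of p] X(2) mem(1)[OF p] t unfolding eigenspace_for_def by blast
      then have "(norm (\<pi> t (v j p) - snd p t *\<^sub>C v j p))\<^sup>2 \<le> (e * norm (v j p))\<^sup>2"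
        by (rule power_mono) simp
      then show "(norm (\<pi> t (v j p) - snd p t *\<^sub>C v j p))\<^sup>2 \<le> e\<^sup>2 * (norm (v j p))\<^sup>2"
        by (simp only: power_mult_distrib)
    qed
    also have "\<dots> = e\<^sup>2 * (norm (\<Sum>p\<in>X. v j p))\<^sup>2"
      by (subst pythagoras_sum[OF X(1)]) (auto simp: sum_distrib_left intro: orth[OF _ _ _ mem(1) mem(1)])
    finally show "(norm (\<pi> t (\<Sum>p\<in>X. v j p) - (\<Sum>p\<in>X. snd p t *\<^sub>C v j p)))\<^sup>2 \<le> (e * norm (\<Sum>p\<in>X. v j p))\<^sup>2"
      by (simp only: power_mult_distrib)
  qed (use e in simp)
  show thesis
  proof (rule that[of X v])
    show "snd p \<in> approx_spectrum" if "p \<in> X" for p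
      using M1[of p] that X(2) by (auto simp: eigenspace_for_def)
    fix j t assume j: "j < n"
    show "norm (\<Sum>p\<in>X. snd p t *\<^sub>C v j p) \<le> norm (\<xi> j) + 1"
      using sum_le[OF j] e(2) by (simp add: norm_sum)
    assume t: "t \<in> K"
    have "\<pi> t (\<xi> j) - (\<Sum>p\<in>X. snd p t *\<^sub>C v j p)
      = \<pi> t (\<xi> j - (\<Sum>p\<in>X. v j p)) + (\<pi> t (\<Sum>p\<in>X. v j p) - (\<Sum>p\<in>X. snd p t *\<^sub>C v j p))"
      by (simp add: blinfun.diff_right)
    also have "norm \<dots> \<le> e + e * (norm (\<xi> j) + 1)"
    proof (rule norm_triangle_mono)
      show "norm (\<pi> t (\<xi> j - (\<Sum>p\<in>X. v j p))) \<le> e" using close[OF j] by simp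
      have "e * norm (\<Sum>p\<in>X. v j p) \<le> e * (norm (\<xi> j) + 1)"
        using sum_le[OF j] e by (intro mult_left_mono) auto
      with eig[OF t, of j] show "norm (\<pi> t (\<Sum>p\<in>X. v j p) - (\<Sum>p\<in>X. snd p t *\<^sub>C v j p)) \<le> e * (norm (\<xi> j) + 1)"
        by linarith
    qed
    also have "\<dots> = e * (norm (\<xi> j) + 2)" by (simp add: algebra_simps)
    finally show "norm (\<pi> t (\<xi> j) - (\<Sum>p\<in>X. snd p t *\<^sub>C v j p)) \<le> e * (norm (\<xi> j) + 2)" .
  qed (rule X(1))
qed

end

section \<open>Schur multipliers\<close>

text \<open>The conjugate falls on the second index here, but on the first in
  \<open>positive_definite_on\<close>; matrices are transposed when passing between the two.\<close>

definition psd_on :: "'i set \<Rightarrow> ('i \<Rightarrow> 'i \<Rightarrow> complex) \<Rightarrow> bool" where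
  "psd_on S N \<longleftrightarrow> (\<forall>c. (\<Sum>a\<in>S. \<Sum>b\<in>S. N a b * (c a * cnj (c b))) \<in> \<real>\<^sub>\<ge>\<^sub>0)"

lemma psd_onD: "psd_on S N \<Longrightarrow> (\<Sum>a\<in>S. \<Sum>b\<in>S. N a b * (c a * cnj (c b))) \<in> \<real>\<^sub>\<ge>\<^sub>0"
  by (simp add: psd_on_def)

lemma psd_on_subset:
  assumes N: "psd_on S N" and "finite S" "T \<subseteq> S"
  shows "psd_on T N"
  unfolding psd_on_def
proof
  fix c :: "'a \<Rightarrow> complex"
  let ?c = "\<lambda>a. if a \<in> T then c a else 0"
  have "(\<Sum>a\<in>S. \<Sum>b\<in>S. N a b * (?c a * cnj (?c b))) = (\<Sum>a\<in>T. \<Sum>b\<in>S. N a b * (?c a * cnj (?c b)))"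
    using assms(2,3) by (intro sum.mono_neutral_right) auto
  also have "\<dots> = (\<Sum>a\<in>T. \<Sum>b\<in>T. N a b * (?c a * cnj (?c b)))"
    using assms(2,3) by (intro sum.cong refl sum.mono_neutral_right) auto
  also have "\<dots> = (\<Sum>a\<in>T. \<Sum>b\<in>T. N a b * (c a * cnj (c b)))"
    by (intro sum.cong refl) simp
  finally show "(\<Sum>a\<in>T. \<Sum>b\<in>T. N a b * (c a * cnj (c b))) \<in> \<real>\<^sub>\<ge>\<^sub>0"
    using psd_onD[OF N, of ?c] by simp
qed

lemma psd_on_pair:
  assumes "psd_on S N" "finite S" "a \<in> S" "b \<in> S" "a \<noteq> b"
  shows "N a a * (p * cnj p) + N a b * (p * cnj q) + (N b a * (q * cnj p) + N b b * (q * cnj q)) \<in> \<real>\<^sub>\<ge>\<^sub>0"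
proof -
  have "psd_on {a, b} N" by (rule psd_on_subset[OF assms(1,2)]) (use assms in auto)
  from psd_onD[OF this, of "\<lambda>z. if z = a then p else q"] assms(5) show ?thesis by simp
qed

lemma psd_on_diagonal:
  assumes "psd_on S N" "finite S" "a \<in> S"
  shows "N a a \<in> \<real>\<^sub>\<ge>\<^sub>0"
proof -
  have "psd_on {a} N" by (rule psd_on_subset[OF assms(1,2)]) (use assms in auto)
  from psd_onD[OF this, of "\<lambda>_. 1"] show ?thesis by simp
qed

text \<open>Values of the form are real; the coefficients (1, 1) and (1, \<i>) give the two real
  equations needed.\<close>

lemma psd_on_hermitian:
  assumes N: "psd_on S N" "finite S" "a \<in> S" "b \<in> S"
  shows "N b a = cnj (N a b)"
proof (cases "a = b")
  case True
  then show ?thesis using psd_on_diagonal[OF N(1-3)] by (auto simp: complex_nonneg_Reals_iff complex_eq_iff)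
next
  case False
  have "Im (N a a) = 0" "Im (N b b) = 0"
    using psd_on_diagonal[OF N(1-3)] psd_on_diagonal[OF N(1,2,4)] by (auto simp: complex_nonneg_Reals_iff)
  then show ?thesis
    using psd_on_pair[OF N False, of 1 1] psd_on_pair[OF N False, of 1 \<i>]
    by (auto simp: complex_nonneg_Reals_iff complex_eq_iff)
qed

text \<open>Induction on the index set by Schur complements: splitting off one index writes \<open>N\<close> as a
  rank-one matrix plus a positive matrix on the remaining indices.\<close>

theorem schur_product_sum_nonneg:
  assumes "finite S" "psd_on S m" "psd_on S N"
  shows "(\<Sum>a\<in>S. \<Sum>b\<in>S. m a b * N a b) \<in> \<real>\<^sub>\<ge>\<^sub>0"
  using assms
proof (induct S arbitrary: N rule: finite_induct)
  case (insert x S)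
  note N = \<open>psd_on (insert x S) N\<close>
  have fin: "finite (insert x S)" using insert(1) by simp
  have mS: "psd_on S m" by (rule psd_on_subset[OF insert(4) fin]) auto
  define d where "d = Re (N x x)"
  have d: "N x x = of_real d" "0 \<le> d"
    using psd_on_diagonal[OF N fin, of x] by (auto simp: d_def complex_nonneg_Reals_iff complex_eq_iff)
  have herm: "N x b = cnj (N b x)" if "b \<in> insert x S" for b
    by (rule psd_on_hermitian[OF N fin that]) simp
  show ?case
  proof (cases "d = 0")
    case True
    have zero: "N b x = 0 \<and> N x b = 0" if b: "b \<in> S" for b
    proof -
      have "b \<noteq> x" using b insert(2) by auto
      \<comment> \<open>With coefficient 1 at b and -t N b x at x, the form is N b b - 2 t |N b
        x|^2; a non-zero N b x is refuted by large t.\<close>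
      have bd: "2 * t * (cmod (N b x))\<^sup>2 \<le> Re (N b b)" for t :: real
        using psd_on_pair[OF N fin _ _ \<open>b \<noteq> x\<close>, of 1 "- of_real t * N b x"] b herm[of b] d(1) True
        by (simp add: complex_nonneg_Reals_iff cmod_power2 power2_eq_square[of "Re _"] power2_eq_square[of "Im _"] algebra_simps)
      have "N b x = 0"
      proof (rule ccontr)
        assume "N b x \<noteq> 0"
        then have "0 < (cmod (N b x))\<^sup>2" by simp
        then show False
          using bd[of "(Re (N b b) + 1) / (2 * (cmod (N b x))\<^sup>2)"] by (simp add: field_simps)
      qed
      then show ?thesis using herm[of b] b by simp
    qed
    have "(\<Sum>a\<in>insert x S. \<Sum>b\<in>insert x S. m a b * N a b) = (\<Sum>a\<in>S. \<Sum>b\<in>S. m a b * N a b)"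
      using insert(1,2) zero d(1) True by (simp add: sum.neutral)
    also have "\<dots> \<in> \<real>\<^sub>\<ge>\<^sub>0"
      by (rule insert(3)[OF mS psd_on_subset[OF N fin]]) auto
    finally show ?thesis .
  next
    case False
    then have "0 < d" using d(2) by simp
    \<comment> \<open>The Schur complement of the entry at x; it vanishes in the row and column of
      x.\<close>
    define N' where "N' a b = N a b - N a x * N x b / of_real d" for a b
    have "psd_on S N'"
      unfolding psd_on_def
    proof
      fix c :: "'a \<Rightarrow> complex"
      define u where "u = (\<Sum>a\<in>S. N a x * c a)"
      have u_cnj: "cnj u = (\<Sum>b\<in>S. N x b * cnj (c b))"
        unfolding u_def cnj_sum using herm by (intro sum.cong refl) simp
      \<comment> \<open>This value at x minimises the form of N among the extensions of c, and the
        minimum is the form of N'.\<close>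
      define g where "g = c(x := - u / of_real d)"
      have g: "g x = - u / of_real d" "\<And>a. a \<in> S \<Longrightarrow> g a = c a" using insert(2) by (auto simp: g_def)
      have 1: "(\<Sum>b\<in>S. N x b * (g x * cnj (g b))) = g x * cnj u"
        unfolding u_cnj sum_distrib_left using g(2) by (intro sum.cong refl) simp
      have 2: "(\<Sum>a\<in>S. N a x * (g a * cnj (g x))) = u * cnj (g x)"
        unfolding u_def sum_distrib_right using g(2) by (intro sum.cong refl) simp
      have 3: "(\<Sum>a\<in>S. \<Sum>b\<in>S. N a b * (g a * cnj (g b))) = (\<Sum>a\<in>S. \<Sum>b\<in>S. N a b * (c a * cnj (c b)))"
        using g(2) by (intro sum.cong refl) simp
      have "(\<Sum>a\<in>insert x S. \<Sum>b\<in>insert x S. N a b * (g a * cnj (g b)))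
          = N x x * (g x * cnj (g x)) + g x * cnj u + (u * cnj (g x) + (\<Sum>a\<in>S. \<Sum>b\<in>S. N a b * (c a * cnj (c b))))"
        unfolding sum.insert[OF insert(1,2)] sum.distrib 1 2 3 by (simp only: ac_simps)
      also have "\<dots> = (\<Sum>a\<in>S. \<Sum>b\<in>S. N a b * (c a * cnj (c b))) - u * cnj u / of_real d"
        using \<open>0 < d\<close> by (simp add: g(1) d(1) field_simps)
      also have "u * cnj u / of_real d = (\<Sum>a\<in>S. \<Sum>b\<in>S. (N a x * N x b / of_real d) * (c a * cnj (c b)))"
        unfolding u_cnj unfolding u_def sum_product sum_divide_distrib
        by (intro sum.cong refl) simp
      also have "(\<Sum>a\<in>S. \<Sum>b\<in>S. N a b * (c a * cnj (c b))) - \<dots> = (\<Sum>a\<in>S. \<Sum>b\<in>S. N' a b * (c a * cnj (c b)))"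
        by (simp add: N'_def left_diff_distrib sum_subtractf)
      finally show "(\<Sum>a\<in>S. \<Sum>b\<in>S. N' a b * (c a * cnj (c b))) \<in> \<real>\<^sub>\<ge>\<^sub>0"
        using psd_onD[OF N, of g] by simp
    qed
    then have "(\<Sum>a\<in>S. \<Sum>b\<in>S. m a b * N' a b) \<in> \<real>\<^sub>\<ge>\<^sub>0" by (rule insert(3)[OF mS])
    moreover have "(\<Sum>a\<in>insert x S. \<Sum>b\<in>insert x S. m a b * N' a b) = (\<Sum>a\<in>S. \<Sum>b\<in>S. m a b * N' a b)"
      using insert(1,2) \<open>0 < d\<close> by (simp add: N'_def d(1))
    ultimately have 1: "(\<Sum>a\<in>insert x S. \<Sum>b\<in>insert x S. m a b * N' a b) \<in> \<real>\<^sub>\<ge>\<^sub>0" by simp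
    \<comment> \<open>The rank-one remainder is non-negative by positivity of m, tested on the
      coefficients N a x.\<close>
    have "(\<Sum>a\<in>insert x S. \<Sum>b\<in>insert x S. m a b * N a b) =
        (\<Sum>a\<in>insert x S. \<Sum>b\<in>insert x S. m a b * N' a b + of_real (1 / d) * (m a b * (N a x * cnj (N b x))))"
    proof (intro sum.cong refl)
      fix a b assume "a \<in> insert x S" "b \<in> insert x S"
      then show "m a b * N a b = m a b * N' a b + of_real (1 / d) * (m a b * (N a x * cnj (N b x)))"
        using herm[of b] by (simp add: N'_def algebra_simps)
    qed
    also have "\<dots> = (\<Sum>a\<in>insert x S. \<Sum>b\<in>insert x S. m a b * N' a b)
        + of_real (1 / d) * (\<Sum>a\<in>insert x S. \<Sum>b\<in>insert x S. m a b * (N a x * cnj (N b x)))"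
      by (simp only: sum.distrib sum_distrib_left)
    also have "\<dots> \<in> \<real>\<^sub>\<ge>\<^sub>0"
      using \<open>0 < d\<close>
      by (intro nonneg_Reals_add_I 1 nonneg_Reals_mult_I psd_onD[OF insert(4)]) simp
    finally show ?thesis .
  qed
qed simp

text \<open>Closedness of the non-negative reals, for an error linear in e with a constant
  independent of e. Both analytic implications end with it.\<close>

lemma nonneg_Reals_approx:
  assumes "\<And>e. 0 < e \<Longrightarrow> e \<le> 1 \<Longrightarrow> \<exists>r\<in>\<real>\<^sub>\<ge>\<^sub>0. cmod (q - r) \<le> C * e"
  shows "q \<in> \<real>\<^sub>\<ge>\<^sub>0"
proof -
  have "\<exists>r\<in>\<real>\<^sub>\<ge>\<^sub>0. dist r q < e" if "0 < e" for e
  proof -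
    define d where "d = min 1 (e / (2 * (\<bar>C\<bar> + 1)))"
    have "0 < d" "d \<le> 1" using \<open>0 < e\<close> by (auto simp: d_def)
    from assms[OF this] obtain r where r: "r \<in> \<real>\<^sub>\<ge>\<^sub>0" "cmod (q - r) \<le> C * d" by blast
    have "C * d \<le> (\<bar>C\<bar> + 1) * (e / (2 * (\<bar>C\<bar> + 1)))"
      using \<open>0 < d\<close> \<open>0 < e\<close> by (intro mult_mono) (auto simp: d_def)
    also have "\<dots> = e / 2"
    proof -
      have "z * (e / (2 * z)) = e / 2" if "0 < z" for z :: real using that by simp
      from this[of "\<bar>C\<bar> + 1"] show ?thesis by simp
    qed
    also have "\<dots> < e" using \<open>0 < e\<close> by simp
    finally show ?thesis using r by (intro bexI[of _ r]) (auto simp: dist_norm norm_minus_commute)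
  qed
  then have "q \<in> closure \<real>\<^sub>\<ge>\<^sub>0" unfolding closure_approachable by blast
  then show ?thesis using closed_nonneg_Reals_complex by simp
qed

lemma completely_positive_imp_positive:
  fixes \<Phi> :: "('h::complex_hilbert \<Rightarrow>\<^sub>L 'h) \<Rightarrow> ('h \<Rightarrow>\<^sub>L 'h)"
  assumes "completely_positive_map \<Phi>"
  shows "positive_map \<Phi>"
  unfolding positive_map_def
proof (intro allI impI)
  fix x :: "'h \<Rightarrow>\<^sub>L 'h" assume x: "positive_op x"
  have "positive_op_matrix 1 (\<lambda>_ _. x)"
    using x by (simp add: positive_op_matrix_def positive_op_def)
  then have y: "positive_op_matrix 1 (\<lambda>_ _. \<Phi> x)"
    using assms unfolding completely_positive_map_def by blast
  have "cinner (\<Phi> x \<xi>) \<xi> \<in> \<real>\<^sub>\<ge>\<^sub>0" for \<xi>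
    using y[unfolded positive_op_matrix_def, THEN conjunct2, THEN spec, of "\<lambda>_. \<xi>"] by simp
  moreover have "\<Phi> x \<in> BH" using y by (simp add: positive_op_matrix_def)
  ultimately show "positive_op (\<Phi> x)" by (simp add: positive_op_def)
qed

lemma bounded_borel_continuous:
  assumes "continuous_on UNIV f" "\<And>s. cmod (f s) \<le> b"
  shows "f \<in> bounded_borel"
  by (rule bounded_borelI[OF borel_measurable_continuous_onI[OF assms(1)] assms(2)])

lemma dual_group_ratio_bounded_borel:
  assumes "\<sigma> \<in> dual_group" "\<tau> \<in> dual_group"
  shows "(\<lambda>s. \<sigma> s * inverse (\<tau> s)) \<in> bounded_borel"
  unfolding dual_groupD(7)[OF assms(2)]
  by (rule bounded_borel_continuous[of _ 1])
    (intro continuous_intros dual_groupD(1)[OF assms(1)] dual_groupD(1)[OF assms(2)],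
      simp add: norm_mult dual_groupD(2)[OF assms(1)] dual_groupD(2)[OF assms(2)])

section \<open>The conjugation map\<close>

context urep
begin

lemma rep_minus_form_continuous: "continuous_on UNIV (\<lambda>s. cinner (x (\<pi> (- s) \<xi>)) (\<pi> (- s) \<eta>))"
  for x :: "'h \<Rightarrow>\<^sub>L 'h"
  by (intro continuous_on_cinner rep_minus_continuous blinfun.continuous_on continuous_on_const)

text \<open>The adjoint of \<pi> s is \<open>\<pi> (- s)\<close>, so the form of the image is a
  scalar integral in which \<open>\<pi> (- s)\<close> acts on both vectors.\<close>

lemma Gamma_rep:
  assumes \<mu>: "\<mu> \<in> M_space" and x: "x \<in> BH"
  shows Gamma_rep_BH: "Gamma_rep \<pi> \<mu> x \<in> BH"
    and cinner_Gamma_rep: "cinner (Gamma_rep \<pi> \<mu> x \<xi>) \<eta> = cm_integral \<mu> (\<lambda>s. cinner (x (\<pi> (- s) \<xi>)) (\<pi> (- s) \<eta>))"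
proof -
  let ?F = "\<lambda>s. (\<pi> s o\<^sub>L x) o\<^sub>L \<pi> (- s)"
  have eq: "Gamma_rep \<pi> \<mu> x = weak_star_integral (cm_integral \<mu>) ?F"
    by (simp add: Gamma_rep_def op_adj_rep)
  have form: "cinner (?F s \<xi>) \<eta> = cinner (x (\<pi> (- s) \<xi>)) (\<pi> (- s) \<eta>)" for s \<xi> \<eta>
    by (simp add: cinner_rep[of s])
  have BH: "?F s \<in> BH" for s by (intro BH_compose rep_BH x)
  have meas: "(\<lambda>s. cinner (?F s \<xi>) \<eta>) \<in> borel_measurable borel" for \<xi> \<eta>
    unfolding form by (rule borel_measurable_continuous_onI[OF rep_minus_form_continuous])
  have bound: "norm (?F s) \<le> norm x" for s
  proof (rule norm_blinfun_bound)
    show "norm (?F s \<xi>) \<le> norm x * norm \<xi>" for \<xi>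
      using norm_blinfun[of x "\<pi> (- s) \<xi>"] by simp
  qed simp
  show "Gamma_rep \<pi> \<mu> x \<in> BH"
    unfolding eq by (rule cm_weak_integral(1)[OF \<mu> BH meas bound])
  show "cinner (Gamma_rep \<pi> \<mu> x \<xi>) \<eta> = cm_integral \<mu> (\<lambda>s. cinner (x (\<pi> (- s) \<xi>)) (\<pi> (- s) \<eta>))"
    unfolding eq cm_weak_integral(2)[OF \<mu> BH meas bound] form ..
qed

text \<open>Unitarity gives <\<pi> s \<xi>, \<pi> s \<eta>> = <\<xi>, \<eta>>, while the two
  approximations turn the left side into \<sigma> s times the conjugate of \<tau> s times <\<xi>,
  \<eta>>.\<close>

lemma near_orthogonality:
  assumes "cmod (\<tau> s) = 1" "norm (\<pi> s \<xi> - \<sigma> s *\<^sub>C \<xi>) \<le> d" "norm (\<pi> s \<eta> - \<tau> s *\<^sub>C \<eta>) \<le> d"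
    "norm \<xi> = 1" "norm \<eta> = 1"
  shows "cmod (\<sigma> s - \<tau> s) * cmod (cinner \<xi> \<eta>) \<le> 2 * d"
proof -
  have "cinner (\<pi> s \<xi>) (\<pi> s \<eta>) = cinner \<xi> \<eta>" by (simp add: cinner_rep)
  moreover have "\<tau> s * cnj (\<tau> s) = 1" using assms(1) complex_norm_square[of "\<tau> s"] by simp
  \<comment> \<open>The last two brackets are zero. They are carried along so that the identity is a
    pure expansion; unitarity and |\<tau> s| = 1 are substituted afterwards.\<close>
  ultimately have "(\<sigma> s - \<tau> s) * cinner \<xi> \<eta> = \<tau> s * cinner (\<pi> s \<xi>) (\<tau> s *\<^sub>C \<eta> - \<pi> s \<eta>) - cinner (\<pi> s \<xi> - \<sigma> s *\<^sub>C \<xi>) \<eta> + (\<tau> s * cinner (\<pi> s \<xi>) (\<pi> s \<eta>) - \<tau> s * cinner \<xi> \<eta>)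
      + (cinner (\<pi> s \<xi>) \<eta> - (\<tau> s * cnj (\<tau> s)) * cinner (\<pi> s \<xi>) \<eta>)"
    by (simp add: cinner_simps algebra_simps)
  then have "(\<sigma> s - \<tau> s) * cinner \<xi> \<eta> = \<tau> s * cinner (\<pi> s \<xi>) (\<tau> s *\<^sub>C \<eta> - \<pi> s \<eta>) - cinner (\<pi> s \<xi> - \<sigma> s *\<^sub>C \<xi>) \<eta>"
    using \<open>\<tau> s * cnj (\<tau> s) = 1\<close> \<open>cinner (\<pi> s \<xi>) (\<pi> s \<eta>) = cinner \<xi> \<eta>\<close> by simp
  then have "cmod (\<sigma> s - \<tau> s) * cmod (cinner \<xi> \<eta>)
      \<le> cmod (cinner (\<pi> s \<xi>) (\<tau> s *\<^sub>C \<eta> - \<pi> s \<eta>)) + cmod (cinner (\<pi> s \<xi> - \<sigma> s *\<^sub>C \<xi>) \<eta>)"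
    using norm_triangle_ineq4[of "\<tau> s * cinner (\<pi> s \<xi>) (\<tau> s *\<^sub>C \<eta> - \<pi> s \<eta>)" "cinner (\<pi> s \<xi> - \<sigma> s *\<^sub>C \<xi>) \<eta>"]
      assms(1) norm_mult[of "\<sigma> s - \<tau> s" "cinner \<xi> \<eta>"] by (simp add: norm_mult)
  also have "\<dots> \<le> d + d"
    using cmod_cinner_le[of "\<pi> s \<xi>" "\<tau> s *\<^sub>C \<eta> - \<pi> s \<eta>"] cmod_cinner_le[of "\<pi> s \<xi> - \<sigma> s *\<^sub>C \<xi>" \<eta>] assms
    by (intro add_mono) (auto simp: norm_minus_commute)
  finally show ?thesis by simp
qed

text \<open>The operator sending \<xi> to <\<xi>, \<zeta>> \<zeta>, given by its form.\<close>

lemma rank_one_operator: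
  obtains T :: "'h \<Rightarrow>\<^sub>L 'h" where "positive_op T" "\<And>\<xi> \<eta>. cinner (T \<xi>) \<eta> = cinner \<xi> \<zeta> * cinner \<zeta> \<eta>"
proof -
  obtain T :: "'h \<Rightarrow>\<^sub>L 'h" where T: "T \<in> BH" "\<And>\<xi> \<eta>. cinner (T \<xi>) \<eta> = cinner \<xi> \<zeta> * cinner \<zeta> \<eta>"
  proof (rule sesquilinear_form_operator[of "\<lambda>\<xi> \<eta>. cinner \<xi> \<zeta> * cinner \<zeta> \<eta>" "norm \<zeta> * norm \<zeta>"])
    show "cmod (cinner x \<zeta> * cinner \<zeta> y) \<le> norm \<zeta> * norm \<zeta> * norm x * norm y" for x y
      using mult_mono[OF cmod_cinner_le[of x \<zeta>] cmod_cinner_le[of \<zeta> y]] by (simp add: norm_mult mult_ac)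
  qed (simp_all add: cinner_simps algebra_simps)
  have "cinner (T \<xi>) \<xi> \<in> \<real>\<^sub>\<ge>\<^sub>0" for \<xi>
  proof -
    have "cinner (T \<xi>) \<xi> = of_real ((cmod (cinner \<xi> \<zeta>))\<^sup>2)"
      unfolding T(2) complex_norm_square by (simp flip: cinner_commute)
    then show ?thesis by simp
  qed
  then show thesis using that T by (auto simp: positive_op_def)
qed

text \<open>Distinct characters differ at some point. Adding one such point per pair to K and
  scaling the error by the least separation \<rho> makes \<open>near_orthogonality\<close>
  effective.\<close>

lemma quasi_orthonormal_eigenvectors:
  assumes S: "finite S" "S \<subseteq> approx_spectrum" and K: "compact K" and e: "0 < e"
  obtains \<eta> where "\<And>\<sigma>. \<sigma> \<in> S \<Longrightarrow> norm (\<eta> \<sigma>) = 1"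
    "\<And>\<sigma> s. \<sigma> \<in> S \<Longrightarrow> s \<in> K \<Longrightarrow> norm (\<pi> s (\<eta> \<sigma>) - \<sigma> s *\<^sub>C \<eta> \<sigma>) \<le> e"
    "\<And>\<sigma> \<tau>. \<sigma> \<in> S \<Longrightarrow> \<tau> \<in> S \<Longrightarrow> \<sigma> \<noteq> \<tau> \<Longrightarrow> cmod (cinner (\<eta> \<sigma>) (\<eta> \<tau>)) \<le> e"
proof -
  define P where "P = {p \<in> S \<times> S. fst p \<noteq> snd p}"
  have "finite P" using S(1) by (simp add: P_def)
  have "\<exists>s. fst p s \<noteq> snd p s" if "p \<in> P" for p using that by (auto simp: P_def)
  then obtain g where g: "\<And>p. p \<in> P \<Longrightarrow> fst p (g p) \<noteq> snd p (g p)" by metis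
  \<comment> \<open>The inserted 1 keeps the minimum meaningful when S has at most one
    element.\<close>
  define \<rho> where "\<rho> = Min (insert 1 ((\<lambda>p. cmod (fst p (g p) - snd p (g p))) ` P))"
  have "0 < \<rho>" using \<open>finite P\<close> g by (auto simp: \<rho>_def)
  have \<rho>: "\<rho> \<le> cmod (fst p (g p) - snd p (g p))" if "p \<in> P" for p
    using \<open>finite P\<close> that by (simp add: \<rho>_def)
  define d where "d = min e (e * \<rho> / 2)"
  have "0 < d" using e \<open>0 < \<rho>\<close> by (simp add: d_def)
  have K': "compact (K \<union> g ` P)"
    by (rule compact_Un[OF K finite_imp_compact[OF finite_imageI[OF \<open>finite P\<close>]]])
  have "\<exists>v. norm v = 1 \<and> (\<forall>s\<in>K \<union> g ` P. norm (\<pi> s v - \<sigma> s *\<^sub>C v) \<le> d)" if "\<sigma> \<in> S" for \<sigma>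
    using subsetD[OF S(2) that, unfolded approx_spectrum_def mem_Collect_eq, THEN conjunct2, rule_format, OF K' \<open>0 < d\<close>] .
  then obtain \<eta> where \<eta>: "\<And>\<sigma>. \<sigma> \<in> S \<Longrightarrow> norm (\<eta> \<sigma>) = 1"
    "\<And>\<sigma>. \<sigma> \<in> S \<Longrightarrow> \<forall>s\<in>K \<union> g ` P. norm (\<pi> s (\<eta> \<sigma>) - \<sigma> s *\<^sub>C \<eta> \<sigma>) \<le> d" by metis
  show thesis
  proof (rule that[OF \<eta>(1)])
    show "norm (\<pi> s (\<eta> \<sigma>) - \<sigma> s *\<^sub>C \<eta> \<sigma>) \<le> e" if "\<sigma> \<in> S" "s \<in> K" for \<sigma> s
      using bspec[OF \<eta>(2)[OF that(1)], of s] that(2) by (simp add: d_def)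
    fix \<sigma> \<tau> assume \<sigma>\<tau>: "\<sigma> \<in> S" "\<tau> \<in> S" "\<sigma> \<noteq> \<tau>"
    then have p: "(\<sigma>, \<tau>) \<in> P" by (simp add: P_def)
    let ?s = "g (\<sigma>, \<tau>)"
    have s: "?s \<in> K \<union> g ` P" using p by blast
    have "cmod (\<tau> ?s) = 1"
      using subsetD[OF S(2) \<sigma>\<tau>(2)] approx_spectrum_dual dual_groupD(2) by blast
    from near_orthogonality[where s = ?s and \<sigma> = \<sigma> and \<tau> = \<tau>, OF this bspec[OF \<eta>(2)[OF \<sigma>\<tau>(1)] s] bspec[OF \<eta>(2)[OF \<sigma>\<tau>(2)] s] \<eta>(1)[OF \<sigma>\<tau>(1)] \<eta>(1)[OF \<sigma>\<tau>(2)]]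
    have "cmod (\<sigma> ?s - \<tau> ?s) * cmod (cinner (\<eta> \<sigma>) (\<eta> \<tau>)) \<le> 2 * d" .
    moreover have "\<rho> * cmod (cinner (\<eta> \<sigma>) (\<eta> \<tau>)) \<le> cmod (\<sigma> ?s - \<tau> ?s) * cmod (cinner (\<eta> \<sigma>) (\<eta> \<tau>))"
      using \<rho>[OF p] by (intro mult_right_mono) auto
    moreover have "2 * d \<le> \<rho> * e" by (simp add: d_def mult.commute)
    ultimately have "\<rho> * cmod (cinner (\<eta> \<sigma>) (\<eta> \<tau>)) \<le> \<rho> * e" by linarith
    then show "cmod (cinner (\<eta> \<sigma>) (\<eta> \<tau>)) \<le> e" using \<open>0 < \<rho>\<close> by simp
  qed
qed

text \<open>The quadratic form is the integral of |w|^2 against \<mu>. For z s = <\<pi> s \<zeta>,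
  \<theta>>, the integral of |z|^2 is the form at \<theta> of the image of the positive rank-one
  operator of \<zeta>, hence non-negative; and z is close to w on K.\<close>

lemma positive_imp_positive_definite:
  assumes \<mu>: "\<mu> \<in> M_space" and pos: "positive_map (Gamma_rep \<pi> \<mu>)"
  shows "positive_definite_on approx_spectrum (\<lambda>\<sigma> \<tau>. measure_transform \<mu> (\<lambda>s. \<sigma> s * inverse (\<tau> s)))"
  unfolding positive_definite_on_def
proof (intro allI impI)
  fix n and x :: "nat \<Rightarrow> 'g \<Rightarrow> complex" and c :: "nat \<Rightarrow> complex"
  assume "\<forall>i<n. x i \<in> approx_spectrum"
  then have x: "x i \<in> approx_spectrum" "x i \<in> dual_group" if "i < n" for i
    using that approx_spectrum_dual by auto
  let ?q = "\<Sum>i<n. \<Sum>j<n. measure_transform \<mu> (\<lambda>s. x i s * inverse (x j s)) * c j * cnj (c i)"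
  define S where "S = x ` {..<n}"
  have S: "finite S" "S \<subseteq> approx_spectrum" "card S \<le> n"
    using x card_image_le[of "{..<n}" x] by (auto simp: S_def)
  define w where "w s = (\<Sum>i<n. cnj (c i) * x i s)" for s
  define N where "N = real n"
  have "0 \<le> N" by (simp add: N_def)
  define C where "C = (\<Sum>i<n. cmod (c i))"
  have "0 \<le> C" by (simp add: C_def sum_nonneg)
  have w_bb: "w \<in> bounded_borel"
    unfolding w_def
    by (intro bounded_borel_sum bounded_borel_mult bounded_borel_const bounded_borel_continuous[of _ 1])
      (simp_all add: dual_groupD(1,2)[OF x(2)])
  have w_cont: "continuous_on UNIV w"
    unfolding w_def by (intro continuous_intros dual_groupD(1)) (simp add: x(2))
  have w_le: "cmod (w s) \<le> C" for s
    unfolding w_def C_def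
    by (rule sum_norm_le) (simp add: norm_mult dual_groupD(2)[OF x(2)])
  have q_eq: "?q = cm_integral \<mu> (\<lambda>s. w s * cnj (w s))"
  proof -
    have bb: "(\<lambda>s. (c j * cnj (c i)) * (x i s * inverse (x j s))) \<in> bounded_borel" if "i < n" "j < n" for i j
      by (intro bounded_borel_mult[OF bounded_borel_const] dual_group_ratio_bounded_borel x(2) that)
    have "w s * cnj (w s) = (\<Sum>i<n. \<Sum>j<n. (c j * cnj (c i)) * (x i s * inverse (x j s)))" for s
      unfolding w_def cnj_sum sum_product
      by (intro sum.cong refl) (simp add: dual_groupD(7)[OF x(2)])
    then have "cm_integral \<mu> (\<lambda>s. w s * cnj (w s))
        = cm_integral \<mu> (\<lambda>s. \<Sum>i<n. \<Sum>j<n. (c j * cnj (c i)) * (x i s * inverse (x j s)))"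
      by (simp only:)
    also have "\<dots> = (\<Sum>i<n. cm_integral \<mu> (\<lambda>s. \<Sum>j<n. (c j * cnj (c i)) * (x i s * inverse (x j s))))"
      by (rule cm_integral_sum[OF \<mu>]) (intro bounded_borel_sum bb, simp_all)
    also have "\<dots> = (\<Sum>i<n. \<Sum>j<n. cm_integral \<mu> (\<lambda>s. (c j * cnj (c i)) * (x i s * inverse (x j s))))"
      by (intro sum.cong refl cm_integral_sum[OF \<mu>] bb) simp_all
    finally have "cm_integral \<mu> (\<lambda>s. w s * cnj (w s))
        = (\<Sum>i<n. \<Sum>j<n. cm_integral \<mu> (\<lambda>s. (c j * cnj (c i)) * (x i s * inverse (x j s))))" .
    then show ?thesis by (simp add: cm_integral_cmult[OF \<mu>] measure_transform_def mult_ac)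
  qed
  obtain V where V: "0 \<le> V"
    "\<And>e. 0 < e \<Longrightarrow> \<exists>K. compact K \<and> (\<forall>f a b. f \<in> borel_measurable borel \<longrightarrow> 0 \<le> a \<longrightarrow>
       (\<forall>s\<in>K. cmod (f s) \<le> a) \<longrightarrow> (\<forall>s. cmod (f s) \<le> b) \<longrightarrow> cmod (cm_integral \<mu> f) \<le> V * a + e * b)"
    by (rule cm_integral_tight_bound[OF \<mu>]) (rule that)
  \<comment> \<open>L bounds |z| + |w|, and its square bounds |z|^2 + |w|^2.\<close>
  define L where "L = C * N + C"
  have "0 \<le> L" using \<open>0 \<le> C\<close> \<open>0 \<le> N\<close> by (simp add: L_def)
  show "?q \<in> \<real>\<^sub>\<ge>\<^sub>0"
  proof (rule nonneg_Reals_approx)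
    fix e :: real assume e: "0 < e" "e \<le> 1"
    obtain K where K: "compact K" "\<And>f a b. f \<in> borel_measurable borel \<Longrightarrow> 0 \<le> a \<Longrightarrow>
       \<forall>s\<in>K. cmod (f s) \<le> a \<Longrightarrow> \<forall>s. cmod (f s) \<le> b \<Longrightarrow> cmod (cm_integral \<mu> f) \<le> V * a + e * b"
      using V(2)[OF e(1)] by metis
    obtain \<eta> where \<eta>: "\<And>\<sigma>. \<sigma> \<in> S \<Longrightarrow> norm (\<eta> \<sigma>) = 1"
      "\<And>\<sigma> s. \<sigma> \<in> S \<Longrightarrow> s \<in> K \<Longrightarrow> norm (\<pi> s (\<eta> \<sigma>) - \<sigma> s *\<^sub>C \<eta> \<sigma>) \<le> e"
      "\<And>\<sigma> \<tau>. \<sigma> \<in> S \<Longrightarrow> \<tau> \<in> S \<Longrightarrow> \<sigma> \<noteq> \<tau> \<Longrightarrow> cmod (cinner (\<eta> \<sigma>) (\<eta> \<tau>)) \<le> e"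
      by (rule quasi_orthonormal_eigenvectors[OF S(1,2) K(1) e(1)]) (rule that)
    have xS: "x i \<in> S" if "i < n" for i using that by (simp add: S_def)
    define \<zeta> where "\<zeta> = (\<Sum>i<n. cnj (c i) *\<^sub>C \<eta> (x i))"
    \<comment> \<open>The sum runs over the set S, not over the indices: each character counts once,
      so <\<eta> (x i), \<theta>> is near 1 even if some x i coincide.\<close>
    define \<theta> where "\<theta> = (\<Sum>\<sigma>\<in>S. \<eta> \<sigma>)"
    have "norm \<theta> \<le> (\<Sum>\<sigma>\<in>S. 1)" unfolding \<theta>_def by (rule sum_norm_le) (simp add: \<eta>(1))
    then have \<theta>_le: "norm \<theta> \<le> N" using S(3) by (simp add: N_def)
    have \<zeta>_le: "norm \<zeta> \<le> C"
      unfolding \<zeta>_def C_def by (rule sum_norm_le) (simp add: norm_scaleC \<eta>(1) xS)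
    have \<theta>_near: "cmod (cinner (\<eta> (x i)) \<theta> - 1) \<le> N * e" if i: "i < n" for i
    proof -
      have "cinner (\<eta> (x i)) \<theta> = cinner (\<eta> (x i)) (\<eta> (x i)) + (\<Sum>\<sigma>\<in>S - {x i}. cinner (\<eta> (x i)) (\<eta> \<sigma>))"
        unfolding \<theta>_def cinner_sum_right by (rule sum.remove[OF S(1) xS[OF i]])
      then have "cmod (cinner (\<eta> (x i)) \<theta> - 1) = cmod (\<Sum>\<sigma>\<in>S - {x i}. cinner (\<eta> (x i)) (\<eta> \<sigma>))"
        by (simp add: cinner_self \<eta>(1)[OF xS[OF i]])
      also have "\<dots> \<le> (\<Sum>\<sigma>\<in>S - {x i}. e)"
        by (rule sum_norm_le) (use \<eta>(3)[OF xS[OF i]] in auto)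
      also have "\<dots> = real (card (S - {x i})) * e" by simp
      also have "\<dots> \<le> N * e"
        using card_Diff1_le[of S "x i"] S(3) e(1) unfolding N_def by (intro mult_right_mono) auto
      finally show ?thesis .
    qed
    obtain T :: "'h \<Rightarrow>\<^sub>L 'h" where T: "positive_op T" "\<And>\<xi> \<eta>. cinner (T \<xi>) \<eta> = cinner \<xi> \<zeta> * cinner \<zeta> \<eta>"
      by (rule rank_one_operator[of \<zeta>]) (rule that)
    have TBH: "T \<in> BH" using T(1) by (simp add: positive_op_def)
    define z where "z s = cinner (\<pi> s \<zeta>) \<theta>" for s
    let ?r = "cinner (Gamma_rep \<pi> \<mu> T \<theta>) \<theta>"
    have "?r \<in> \<real>\<^sub>\<ge>\<^sub>0" using pos T(1) unfolding positive_map_def positive_op_def by blast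
    have r_eq: "?r = cm_integral \<mu> (\<lambda>s. z s * cnj (z s))"
    proof -
      have "cinner (T (\<pi> (- s) \<theta>)) (\<pi> (- s) \<theta>) = z s * cnj (z s)" for s
        unfolding T(2) z_def cinner_rep[of s] cinner_commute[of "\<pi> (- s) \<theta>" \<zeta>] by (rule mult.commute)
      then show ?thesis by (simp add: cinner_Gamma_rep[OF \<mu> TBH])
    qed
    have z_le: "cmod (z s) \<le> C * N" for s
      unfolding z_def
      by (rule order_trans[OF cmod_cinner_le mult_mono]) (use \<zeta>_le \<theta>_le \<open>0 \<le> C\<close> in auto)
    have z_cont: "continuous_on UNIV z" unfolding z_def by (rule rep_coefficient_continuous)
    have near: "cmod (z s - w s) \<le> 2 * N * C * e" if s: "s \<in> K" for s
    proof -
      have "z s - w s = (\<Sum>i<n. cnj (c i) * (cinner (\<pi> s (\<eta> (x i)) - x i s *\<^sub>C \<eta> (x i)) \<theta> + x i s * (cinner (\<eta> (x i)) \<theta> - 1)))"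
        by (simp add: z_def w_def \<zeta>_def blinfun.sum_right BH_D[OF rep_BH] cinner_sum_left cinner_simps
            sum_subtractf[symmetric] algebra_simps)
      also have "cmod \<dots> \<le> (\<Sum>i<n. cmod (c i) * (2 * N * e))"
      proof (rule sum_norm_le)
        fix i assume "i \<in> {..<n}"
        then have i: "i < n" by simp
        have "cmod (cinner (\<pi> s (\<eta> (x i)) - x i s *\<^sub>C \<eta> (x i)) \<theta>) \<le> e * N"
          by (rule order_trans[OF cmod_cinner_le mult_mono]) (use \<eta>(2)[OF xS[OF i] s] \<theta>_le e in auto)
        moreover have "cmod (x i s * (cinner (\<eta> (x i)) \<theta> - 1)) \<le> N * e"
          using \<theta>_near[OF i] by (simp add: norm_mult dual_groupD(2)[OF x(2)[OF i]])
        ultimately have "cmod (cinner (\<pi> s (\<eta> (x i)) - x i s *\<^sub>C \<eta> (x i)) \<theta> + x i s * (cinner (\<eta> (x i)) \<theta> - 1)) \<le> e * N + N * e"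
          by (rule norm_triangle_mono)
        then show "cmod (cnj (c i) * (cinner (\<pi> s (\<eta> (x i)) - x i s *\<^sub>C \<eta> (x i)) \<theta> + x i s * (cinner (\<eta> (x i)) \<theta> - 1)))
            \<le> cmod (c i) * (2 * N * e)"
          unfolding norm_mult[of "cnj (c i)"] complex_mod_cnj by (intro mult_left_mono) (auto simp: mult_ac)
      qed
      also have "\<dots> = 2 * N * C * e" by (simp add: C_def sum_distrib_left sum_distrib_right mult_ac)
      finally show ?thesis .
    qed
    let ?h = "\<lambda>s. z s * cnj (z s) - w s * cnj (w s)"
    have h_eq: "?h s = (z s - w s) * cnj (z s) + w s * cnj (z s - w s)" for s by (simp add: algebra_simps)
    have "cmod (cm_integral \<mu> ?h) \<le> V * (2 * N * C * e * L) + e * (L * L)"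
    proof (rule K(2))
      show "?h \<in> borel_measurable borel"
        by (intro borel_measurable_continuous_onI continuous_intros z_cont w_cont)
      show "0 \<le> 2 * N * C * e * L" using \<open>0 \<le> N\<close> \<open>0 \<le> C\<close> \<open>0 \<le> L\<close> e by simp
      show "\<forall>s\<in>K. cmod (?h s) \<le> 2 * N * C * e * L"
      proof
        fix s assume s: "s \<in> K"
        have "cmod (?h s) \<le> cmod (z s - w s) * cmod (z s) + cmod (w s) * cmod (z s - w s)"
          unfolding h_eq using norm_triangle_ineq[of "(z s - w s) * cnj (z s)" "w s * cnj (z s - w s)"]
          by (simp only: norm_mult complex_mod_cnj)
        also have "\<dots> = cmod (z s - w s) * (cmod (z s) + cmod (w s))" by (simp add: algebra_simps)
        also have "\<dots> \<le> 2 * N * C * e * L"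
          using near[OF s] z_le[of s] w_le[of s] \<open>0 \<le> N\<close> \<open>0 \<le> C\<close> e unfolding L_def
          by (intro mult_mono add_mono) auto
        finally show "cmod (?h s) \<le> 2 * N * C * e * L" .
      qed
      show "\<forall>s. cmod (?h s) \<le> L * L"
      proof
        fix s
        have "cmod (?h s) \<le> cmod (z s) * cmod (z s) + cmod (w s) * cmod (w s)"
          using norm_triangle_ineq4[of "z s * cnj (z s)" "w s * cnj (w s)"] by (simp only: norm_mult complex_mod_cnj)
        also have "\<dots> \<le> (C * N) * (C * N) + C * C"
          using z_le[of s] w_le[of s] \<open>0 \<le> N\<close> \<open>0 \<le> C\<close> by (intro add_mono mult_mono) auto
        also have "\<dots> \<le> L * L"
          using \<open>0 \<le> N\<close> \<open>0 \<le> C\<close> by (simp add: L_def algebra_simps)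
        finally show "cmod (?h s) \<le> L * L" .
      qed
    qed
    also have "cm_integral \<mu> ?h = ?r - ?q"
      unfolding r_eq q_eq
      by (rule cm_integral_diff[OF \<mu>])
        (rule bounded_borel_continuous, intro continuous_intros z_cont w_cont,
          simp only: norm_mult complex_mod_cnj, rule mult_mono[OF z_le z_le] mult_mono[OF w_le w_le],
          use \<open>0 \<le> N\<close> \<open>0 \<le> C\<close> in auto)+
    finally have "cmod (?q - ?r) \<le> (V * (2 * N * C * L) + L * L) * e"
      by (simp add: norm_minus_commute algebra_simps)
    with \<open>?r \<in> \<real>\<^sub>\<ge>\<^sub>0\<close> show "\<exists>r\<in>\<real>\<^sub>\<ge>\<^sub>0. cmod (?q - r) \<le> (V * (2 * N * C * L) + L * L) * e" by blast
  qed
qed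

end

section \<open>Positive definiteness implies complete positivity\<close>

context haar_rep
begin

text \<open>F is the integrand of the amplified form and G its value at the expansions. They differ
  by a multiple of e on K and by a bounded amount elsewhere, so their integrals differ by an error
  linear in e. The Schur factors of the integral of G are m, positive because x is, and u, positive
  by hypothesis.\<close>

lemma positive_definite_imp_completely_positive:
  assumes \<mu>: "\<mu> \<in> M_space"
    and pd: "positive_definite_on approx_spectrum (\<lambda>\<sigma> \<tau>. measure_transform \<mu> (\<lambda>s. \<sigma> s * inverse (\<tau> s)))"
  shows "completely_positive_map (Gamma_rep \<pi> \<mu>)"
  unfolding completely_positive_map_def
proof (intro allI impI)
  fix n and x :: "nat \<Rightarrow> nat \<Rightarrow> ('h \<Rightarrow>\<^sub>L 'h)"
  assume x: "positive_op_matrix n x"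
  have x_BH: "x i j \<in> BH" if "i < n" "j < n" for i j
    using x that by (simp add: positive_op_matrix_def)
  have x_pos: "(\<Sum>i<n. \<Sum>j<n. cinner (x i j (\<xi> j)) (\<xi> i)) \<in> \<real>\<^sub>\<ge>\<^sub>0" for \<xi>
    using x by (simp add: positive_op_matrix_def)
  obtain V where V: "0 \<le> V"
    "\<And>e. 0 < e \<Longrightarrow> \<exists>K. compact K \<and> (\<forall>f a b. f \<in> borel_measurable borel \<longrightarrow> 0 \<le> a \<longrightarrow>
       (\<forall>s\<in>K. cmod (f s) \<le> a) \<longrightarrow> (\<forall>s. cmod (f s) \<le> b) \<longrightarrow> cmod (cm_integral \<mu> f) \<le> V * a + e * b)"
    by (rule cm_integral_tight_bound[OF \<mu>]) (rule that)
  have "(\<Sum>i<n. \<Sum>j<n. cinner (Gamma_rep \<pi> \<mu> (x i j) (\<xi> j)) (\<xi> i)) \<in> \<real>\<^sub>\<ge>\<^sub>0" for \<xi> :: "nat \<Rightarrow> 'h"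
  proof -
    define F where "F s = (\<Sum>i<n. \<Sum>j<n. cinner (x i j (\<pi> (- s) (\<xi> j))) (\<pi> (- s) (\<xi> i)))" for s
    \<comment> \<open>The summand 2 lets R dominate both |\<xi> j| + 2 in the error and |\<xi> j| +
      1 in the norm of the expansion.\<close>
    define R where "R = (\<Sum>j<n. norm (\<xi> j)) + 2"
    define L where "L = (\<Sum>i<n. \<Sum>j<n. norm (x i j))"
    have "0 \<le> L" by (simp add: L_def sum_nonneg)
    have R: "norm (\<xi> j) + 2 \<le> R" if "j < n" for j
      using member_le_sum[of j "{..<n}" "\<lambda>j. norm (\<xi> j)"] that by (simp add: R_def)
    have "0 \<le> R" by (simp add: R_def sum_nonneg)
    have coeff_bb: "(\<lambda>s. cinner (x i j (\<pi> (- s) (\<xi> j))) (\<pi> (- s) (\<xi> i))) \<in> bounded_borel" for i j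
    proof (rule bounded_borel_continuous[OF rep_minus_form_continuous])
      show "cmod (cinner (x i j (\<pi> (- s) (\<xi> j))) (\<pi> (- s) (\<xi> i))) \<le> norm (x i j) * (norm (\<xi> j) * norm (\<xi> i))" for s
        using cmod_cinner_blinfun_le[of "x i j" "\<pi> (- s) (\<xi> j)" "\<pi> (- s) (\<xi> i)"] by simp
    qed
    have F_bb: "F \<in> bounded_borel" unfolding F_def by (intro bounded_borel_sum coeff_bb)
    have q_eq: "(\<Sum>i<n. \<Sum>j<n. cinner (Gamma_rep \<pi> \<mu> (x i j) (\<xi> j)) (\<xi> i)) = cm_integral \<mu> F"
    proof -
      have "cm_integral \<mu> F = (\<Sum>i<n. cm_integral \<mu> (\<lambda>s. \<Sum>j<n. cinner (x i j (\<pi> (- s) (\<xi> j))) (\<pi> (- s) (\<xi> i))))"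
        unfolding F_def by (rule cm_integral_sum[OF \<mu>]) (intro bounded_borel_sum coeff_bb)
      also have "\<dots> = (\<Sum>i<n. \<Sum>j<n. cm_integral \<mu> (\<lambda>s. cinner (x i j (\<pi> (- s) (\<xi> j))) (\<pi> (- s) (\<xi> i))))"
        by (intro sum.cong refl cm_integral_sum[OF \<mu>] coeff_bb)
      also have "\<dots> = (\<Sum>i<n. \<Sum>j<n. cinner (Gamma_rep \<pi> \<mu> (x i j) (\<xi> j)) (\<xi> i))"
        by (intro sum.cong refl) (simp add: cinner_Gamma_rep[OF \<mu> x_BH])
      finally show ?thesis by simp
    qed
    show ?thesis
      unfolding q_eq
    proof (rule nonneg_Reals_approx)
      fix e :: real assume e: "0 < e" "e \<le> 1"
      from V(2)[OF e(1)] obtain K where K: "compact K" "\<forall>f a b. f \<in> borel_measurable borel \<longrightarrow> 0 \<le> a \<longrightarrow>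
         (\<forall>s\<in>K. cmod (f s) \<le> a) \<longrightarrow> (\<forall>s. cmod (f s) \<le> b) \<longrightarrow> cmod (cm_integral \<mu> f) \<le> V * a + e * b"
        by (elim exE conjE)
      \<comment> \<open>The integrand at s involves \<open>\<pi> (- s)\<close>, so the expansion
        must be accurate on -K.\<close>
      have K': "compact (uminus ` K)"
        by (rule compact_continuous_image[OF _ K(1)]) (intro continuous_intros)
      obtain X :: "('h set \<times> ('g \<Rightarrow> complex)) set" and v where X: "finite X" "\<And>p. p \<in> X \<Longrightarrow> snd p \<in> approx_spectrum"
        "\<And>j t. j < n \<Longrightarrow> t \<in> uminus ` K \<Longrightarrow> norm (\<pi> t (\<xi> j) - (\<Sum>p\<in>X. snd p t *\<^sub>C v j p)) \<le> e * (norm (\<xi> j) + 2)"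
        "\<And>j t. j < n \<Longrightarrow> norm (\<Sum>p\<in>X. snd p t *\<^sub>C v j p) \<le> norm (\<xi> j) + 1"
        by (rule approximate_eigenvector_expansion[OF K' e, of n \<xi>]) (rule that)
      have dual: "snd p \<in> dual_group" if "p \<in> X" for p using X(2)[OF that] by (rule approx_spectrum_dual)
      define w where "w j t = (\<Sum>p\<in>X. snd p t *\<^sub>C v j p)" for j t
      define G where "G s = (\<Sum>i<n. \<Sum>j<n. cinner (x i j (w j (- s))) (w i (- s)))" for s
      define m where "m p q = (\<Sum>i<n. \<Sum>j<n. cinner (x i j (v j p)) (v i q))" for p q
      \<comment> \<open>At -s the character of p contributes its inverse at s, so the character of q
        stands in the numerator. This also absorbs the transposition between \<open>psd_on\<close>
        and \<open>positive_definite_on\<close>.\<close>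
      define u where "u p q = measure_transform \<mu> (\<lambda>s. snd q s * inverse (snd p s))" for p q :: "'h set \<times> ('g \<Rightarrow> complex)"
      have expand: "(\<Sum>i<n. \<Sum>j<n. cinner (x i j (\<Sum>p\<in>X. c p *\<^sub>C v j p)) (\<Sum>q\<in>X. d q *\<^sub>C v i q))
          = (\<Sum>p\<in>X. \<Sum>q\<in>X. m p q * (c p * cnj (d q)))" for c d
      proof -
        have "cinner (x i j (\<Sum>p\<in>X. c p *\<^sub>C v j p)) (\<Sum>q\<in>X. d q *\<^sub>C v i q)
            = (\<Sum>p\<in>X. \<Sum>q\<in>X. cinner (x i j (v j p)) (v i q) * (c p * cnj (d q)))" if "i < n" "j < n" for i j
          unfolding blinfun.sum_right cinner_sum_left
          by (intro sum.cong refl) (simp add: BH_D[OF x_BH[OF that]] cinner_scaleC_left cinner_sum_right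
              cinner_scaleC_right sum_distrib_left mult_ac)
        then have "(\<Sum>i<n. \<Sum>j<n. cinner (x i j (\<Sum>p\<in>X. c p *\<^sub>C v j p)) (\<Sum>q\<in>X. d q *\<^sub>C v i q))
            = (\<Sum>i<n. \<Sum>j<n. \<Sum>p\<in>X. \<Sum>q\<in>X. cinner (x i j (v j p)) (v i q) * (c p * cnj (d q)))"
          by (intro sum.cong refl) simp
        also have "\<dots> = (\<Sum>i<n. \<Sum>p\<in>X. \<Sum>j<n. \<Sum>q\<in>X. cinner (x i j (v j p)) (v i q) * (c p * cnj (d q)))"
          by (intro sum.cong refl sum.swap)
        also have "\<dots> = (\<Sum>p\<in>X. \<Sum>i<n. \<Sum>j<n. \<Sum>q\<in>X. cinner (x i j (v j p)) (v i q) * (c p * cnj (d q)))"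
          by (rule sum.swap)
        also have "\<dots> = (\<Sum>p\<in>X. \<Sum>i<n. \<Sum>q\<in>X. \<Sum>j<n. cinner (x i j (v j p)) (v i q) * (c p * cnj (d q)))"
          by (intro sum.cong refl sum.swap)
        also have "\<dots> = (\<Sum>p\<in>X. \<Sum>q\<in>X. \<Sum>i<n. \<Sum>j<n. cinner (x i j (v j p)) (v i q) * (c p * cnj (d q)))"
          by (intro sum.cong refl sum.swap)
        also have "\<dots> = (\<Sum>p\<in>X. \<Sum>q\<in>X. m p q * (c p * cnj (d q)))"
          unfolding m_def sum_distrib_right ..
        finally show ?thesis .
      qed
      have "psd_on X m"
        unfolding psd_on_def
      proof
        fix c :: "'h set \<times> ('g \<Rightarrow> complex) \<Rightarrow> complex"
        show "(\<Sum>p\<in>X. \<Sum>q\<in>X. m p q * (c p * cnj (c q))) \<in> \<real>\<^sub>\<ge>\<^sub>0"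
          using x_pos[of "\<lambda>j. \<Sum>p\<in>X. c p *\<^sub>C v j p"] unfolding expand .
      qed
      moreover have "psd_on X u"
        unfolding psd_on_def
      proof
        fix c :: "'h set \<times> ('g \<Rightarrow> complex) \<Rightarrow> complex"
        \<comment> \<open>\<open>positive_definite_on\<close> speaks of finite sequences, which may
          repeat points; this matters because different members of X can share a character.\<close>
        obtain h where h: "bij_betw h {..<card X} X"
          using ex_bij_betw_nat_finite[OF X(1)] by (auto simp: lessThan_atLeast0)
        have "snd (h i) \<in> approx_spectrum" if "i < card X" for i
          using X(2) bij_betwE[OF h] that by blast
        then have "(\<Sum>i<card X. \<Sum>j<card X. measure_transform \<mu> (\<lambda>s. snd (h i) s * inverse (snd (h j) s)) * c (h j) * cnj (c (h i))) \<in> \<real>\<^sub>\<ge>\<^sub>0"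
          using pd[unfolded positive_definite_on_def, rule_format, of "card X" "\<lambda>i. snd (h i)" "\<lambda>i. c (h i)"] by simp
        also have "(\<Sum>i<card X. \<Sum>j<card X. measure_transform \<mu> (\<lambda>s. snd (h i) s * inverse (snd (h j) s)) * c (h j) * cnj (c (h i)))
            = (\<Sum>i<card X. \<Sum>j<card X. u (h j) (h i) * (c (h j) * cnj (c (h i))))"
          by (simp add: u_def mult.assoc)
        also have "\<dots> = (\<Sum>i<card X. \<Sum>p\<in>X. u p (h i) * (c p * cnj (c (h i))))"
          by (intro sum.cong refl sum.reindex_bij_betw[OF h, where g = "\<lambda>p. u p (h i) * (c p * cnj (c (h i)))" for i])
        also have "\<dots> = (\<Sum>q\<in>X. \<Sum>p\<in>X. u p q * (c p * cnj (c q)))"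
          by (rule sum.reindex_bij_betw[OF h, where g = "\<lambda>q. \<Sum>p\<in>X. u p q * (c p * cnj (c q))"])
        also have "\<dots> = (\<Sum>p\<in>X. \<Sum>q\<in>X. u p q * (c p * cnj (c q)))" by (rule sum.swap)
        finally show "(\<Sum>p\<in>X. \<Sum>q\<in>X. u p q * (c p * cnj (c q))) \<in> \<real>\<^sub>\<ge>\<^sub>0" .
      qed
      ultimately have "(\<Sum>p\<in>X. \<Sum>q\<in>X. m p q * u p q) \<in> \<real>\<^sub>\<ge>\<^sub>0"
        by (rule schur_product_sum_nonneg[OF X(1)])
      have bb: "(\<lambda>s. m p q * (snd q s * inverse (snd p s))) \<in> bounded_borel" if "p \<in> X" "q \<in> X" for p q
        by (intro bounded_borel_mult[OF bounded_borel_const] dual_group_ratio_bounded_borel dual that)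
      have G_eq: "G s = (\<Sum>p\<in>X. \<Sum>q\<in>X. m p q * (snd q s * inverse (snd p s)))" for s
        unfolding G_def w_def expand
        by (intro sum.cong refl) (simp add: dual_groupD(5)[OF dual] dual_groupD(7)[OF dual] mult.commute)
      have G_bb: "G \<in> bounded_borel" unfolding G_eq[abs_def] by (intro bounded_borel_sum bb)
      have "cm_integral \<mu> G = (\<Sum>p\<in>X. cm_integral \<mu> (\<lambda>s. \<Sum>q\<in>X. m p q * (snd q s * inverse (snd p s))))"
        unfolding G_eq[abs_def] by (rule cm_integral_sum[OF \<mu>]) (intro bounded_borel_sum bb)
      also have "\<dots> = (\<Sum>p\<in>X. \<Sum>q\<in>X. cm_integral \<mu> (\<lambda>s. m p q * (snd q s * inverse (snd p s))))"
        by (intro sum.cong refl cm_integral_sum[OF \<mu>] bb)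
      also have "\<dots> = (\<Sum>p\<in>X. \<Sum>q\<in>X. m p q * u p q)"
        by (simp add: cm_integral_cmult[OF \<mu>] u_def measure_transform_def)
      finally have G_pos: "cm_integral \<mu> G \<in> \<real>\<^sub>\<ge>\<^sub>0"
        using \<open>(\<Sum>p\<in>X. \<Sum>q\<in>X. m p q * u p q) \<in> \<real>\<^sub>\<ge>\<^sub>0\<close> by simp
      have diff_le: "cmod (F s - G s) \<le> L * (2 * (d * R))"
        if d: "\<And>j. j < n \<Longrightarrow> norm (\<pi> (- s) (\<xi> j) - w j (- s)) \<le> d" "0 \<le> d" for s d
      proof -
        have w_R: "norm (w j (- s)) \<le> R" and \<xi>_R: "norm (\<xi> j) \<le> R" if "j < n" for j
          using X(4)[OF that, of "- s"] R[OF that] by (simp_all add: w_def)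
        have "F s - G s = (\<Sum>i<n. \<Sum>j<n. cinner (x i j (\<pi> (- s) (\<xi> j) - w j (- s))) (\<pi> (- s) (\<xi> i))
            + cinner (x i j (w j (- s))) (\<pi> (- s) (\<xi> i) - w i (- s)))"
          by (simp add: F_def G_def blinfun.diff_right cinner_diff_left cinner_diff_right sum_subtractf[symmetric])
        also have "cmod \<dots> \<le> (\<Sum>i<n. \<Sum>j<n. norm (x i j) * (2 * (d * R)))"
        proof (intro sum_norm_le)
          fix i j assume "i \<in> {..<n}" "j \<in> {..<n}"
          then have ij: "i < n" "j < n" by simp_all
          have "cmod (cinner (x i j (\<pi> (- s) (\<xi> j) - w j (- s))) (\<pi> (- s) (\<xi> i))) \<le> norm (x i j) * (d * R)"
            using d ij \<xi>_R \<open>0 \<le> R\<close>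
            by (intro order_trans[OF cmod_cinner_blinfun_le mult_left_mono[OF mult_mono]]) auto
          moreover have "cmod (cinner (x i j (w j (- s))) (\<pi> (- s) (\<xi> i) - w i (- s))) \<le> norm (x i j) * (R * d)"
            using d ij w_R \<open>0 \<le> R\<close>
            by (intro order_trans[OF cmod_cinner_blinfun_le mult_left_mono[OF mult_mono]]) auto
          ultimately have "cmod (cinner (x i j (\<pi> (- s) (\<xi> j) - w j (- s))) (\<pi> (- s) (\<xi> i))
              + cinner (x i j (w j (- s))) (\<pi> (- s) (\<xi> i) - w i (- s))) \<le> norm (x i j) * (d * R) + norm (x i j) * (R * d)"
            by (rule norm_triangle_mono)
          then show "cmod (cinner (x i j (\<pi> (- s) (\<xi> j) - w j (- s))) (\<pi> (- s) (\<xi> i))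
              + cinner (x i j (w j (- s))) (\<pi> (- s) (\<xi> i) - w i (- s))) \<le> norm (x i j) * (2 * (d * R))"
            by (simp add: mult_ac)
        qed
        also have "\<dots> = L * (2 * (d * R))" by (simp add: L_def sum_distrib_right)
        finally show ?thesis .
      qed
      \<comment> \<open>On K each vector is off by at most e R; elsewhere by at most 2 R, from the
        norms alone.\<close>
      have "cmod (cm_integral \<mu> (\<lambda>s. F s - G s)) \<le> V * (L * (2 * ((e * R) * R))) + e * (L * (2 * ((2 * R) * R)))"
      proof (rule K(2)[rule_format])
        show "(\<lambda>s. F s - G s) \<in> borel_measurable borel"
          using bounded_borel_diff[OF F_bb G_bb] by (simp add: bounded_borel_def)
        show "0 \<le> L * (2 * ((e * R) * R))" using \<open>0 \<le> L\<close> \<open>0 \<le> R\<close> e by simp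
        show "cmod (F s - G s) \<le> L * (2 * ((e * R) * R))" if s: "s \<in> K" for s
        proof (rule diff_le)
          fix j assume j: "j < n"
          have "norm (\<pi> (- s) (\<xi> j) - w j (- s)) \<le> e * (norm (\<xi> j) + 2)"
            unfolding w_def by (rule X(3)[OF j]) (use s in simp)
          also have "\<dots> \<le> e * R" using R[OF j] e(1) by (intro mult_left_mono) auto
          finally show "norm (\<pi> (- s) (\<xi> j) - w j (- s)) \<le> e * R" .
        qed (use e \<open>0 \<le> R\<close> in simp)
        show "cmod (F s - G s) \<le> L * (2 * ((2 * R) * R))" for s
        proof (rule diff_le)
          fix j assume j: "j < n"
          have "norm (\<pi> (- s) (\<xi> j) - w j (- s)) \<le> norm (\<xi> j) + norm (w j (- s))"
            using norm_triangle_ineq4[of "\<pi> (- s) (\<xi> j)" "w j (- s)"] by simp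
          also have "\<dots> \<le> 2 * R" using X(4)[OF j, of "- s"] R[OF j] by (simp add: w_def)
          finally show "norm (\<pi> (- s) (\<xi> j) - w j (- s)) \<le> 2 * R" .
        qed (use \<open>0 \<le> R\<close> in simp)
      qed
      also have "cm_integral \<mu> (\<lambda>s. F s - G s) = cm_integral \<mu> F - cm_integral \<mu> G"
        by (rule cm_integral_diff[OF \<mu> F_bb G_bb])
      finally have "cmod (cm_integral \<mu> F - cm_integral \<mu> G) \<le> (V * (L * (2 * R * R)) + L * (2 * (2 * R * R))) * e"
        by (simp add: algebra_simps)
      with G_pos show "\<exists>r\<in>\<real>\<^sub>\<ge>\<^sub>0. cmod (cm_integral \<mu> F - r) \<le> (V * (L * (2 * R * R)) + L * (2 * (2 * R * R))) * e"
        by (rule bexI[rotated])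
    qed
  qed
  moreover have "Gamma_rep \<pi> \<mu> (x i j) \<in> BH" if "i < n" "j < n" for i j
    by (rule Gamma_rep_BH[OF \<mu> x_BH[OF that]])
  ultimately show "positive_op_matrix n (\<lambda>i j. Gamma_rep \<pi> \<mu> (x i j))"
    by (simp add: positive_op_matrix_def)
qed

end

theorem corollary4p3:
  fixes haar :: "'g::{topological_ab_group_add, t2_space} measure"
    and \<pi> :: "'g \<Rightarrow> ('h::complex_hilbert \<Rightarrow>\<^sub>L 'h)"
    and \<mu> :: "'g set \<Rightarrow> complex"
  assumes "locally_compact_space (euclidean :: 'g topology)"
    and "haar_measure haar"
    and "unitary_rep \<pi>"
    and "\<mu> \<in> M_space"
  shows "(positive_map (Gamma_rep \<pi> \<mu>) \<longleftrightarrow> completely_positive_map (Gamma_rep \<pi> \<mu>)) \<and>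
         (completely_positive_map (Gamma_rep \<pi> \<mu>) \<longleftrightarrow>
            positive_definite_on (E_pi haar \<pi>) (\<lambda>\<sigma> \<tau>. measure_transform \<mu> (\<lambda>s. \<sigma> s * inverse (\<tau> s))))"
proof -
  interpret haar_rep haar \<pi>
    using assms(2,3) by (simp add: haar_rep_def haar_def urep_def)
  show ?thesis
    unfolding E_pi_eq_approx_spectrum
    using positive_imp_positive_definite[OF assms(4)] positive_definite_imp_completely_positive[OF assms(4)]
      completely_positive_imp_positive by blast
qed

end
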